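(* Let $Z(t)$, $t\ge0$, be a symmetric stable process with index $\alpha\in(1,2)$ on a filtered probability space $(\Omega,\mathcal{F},(\mathcal{F}_t),P)$, let $x_n\in\mathbb{R}$ and let $a_n:\mathbb{R}\to\mathbb{R}$ be measurable functions, $n\ge0$. Assume that 1) $\lim_{n\to\infty}x_n=x_0$; 2) $\sup_{n\ge0}\sup_x|a_n(x)|<\infty$; 3) $a_n\to a_0$ as $n\to\infty$ in measure $\mu$, where $\mu(dx)=(1+|x|)^{-(\alpha+1)}\,dx$. Then for any $n\ge0$ the equation $$\xi_n(t)=x_n+\int_0^t a_n(\xi_n(s))\,ds+Z(t),\qquad t\ge0,$$ has a unique strong solution $\xi_n$, and for any $T>0$ $$\sup_{t\in[0,T]}|\xi_n(t)-\xi_0(t)|\to0\quad\text{in probability as } n\to\infty.$$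
   Context: A symmetric stable process with index $\alpha$ is a càdlàg process $Z$ with $Z(0)=0$ and stationary independent increments such that, for some $c>0$, $E\exp\{i\lambda Z(t)\}=\exp\{-ct|\lambda|^\alpha\}$ for all $\lambda\in\mathbb{R}$, $t\ge0$; it is $(\mathcal{F}_t)$-adapted and its increments $Z(t+s)-Z(t)$ are independent of $\mathcal{F}_t$. A solution of an equation $\xi(t)=x+\int_0^t a(\xi(s))\,ds+Z(t)$, $t\ge0$, is an $(\mathcal{F}_t)$-adapted process $\xi$ such that almost surely $\int_0^T|a(\xi(s))|\,ds<\infty$ for all $T>0$ and the equation holds for all $t\ge0$. A solution is strong if it is adapted to the completed filtration generated by $Z$. Uniqueness is understood pathwise: any two solutions on the same filtered probability space with the same $Z$ and the same initial value coincide for all $t\ge0$ almost surely. Convergence in measure $\mu$ means $\mu(\{x:|a_n(x)-a_0(x)|>\varepsilon\})\to0$ for every $\varepsilon>0$. *)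

theory Defs
  imports "HOL-Probability.Probability"
begin

text \<open>
  Time is the half-line \<open>{0..}\<close> inside \<open>real\<close>. Values of processes and filtrations at negative
  times are unconstrained and never used; hence the \<open>max 0 t\<close> below.
\<close>

definition filtered_prob_space :: "'w measure \<Rightarrow> (real \<Rightarrow> 'w measure) \<Rightarrow> bool" where
  "filtered_prob_space M F \<longleftrightarrow>
     prob_space M \<and> filtration (space M) (\<lambda>t. F (max 0 t)) \<and> (\<forall>t\<ge>0. subalgebra M (F t))"

definition adapted :: "(real \<Rightarrow> 'w measure) \<Rightarrow> (real \<Rightarrow> 'w \<Rightarrow> real) \<Rightarrow> bool" where
  "adapted F X \<longleftrightarrow> (\<forall>t\<ge>0. X t \<in> borel_measurable (F t))"

definition cadlag :: "(real \<Rightarrow> real) \<Rightarrow> bool" where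
  "cadlag f \<longleftrightarrow>
     (\<forall>t\<ge>0. (f \<longlongrightarrow> f t) (at_right t)) \<and> (\<forall>t>0. \<exists>l. (f \<longlongrightarrow> l) (at_left t))"

definition stationary_increments :: "'w measure \<Rightarrow> (real \<Rightarrow> 'w \<Rightarrow> real) \<Rightarrow> bool" where
  "stationary_increments M Z \<longleftrightarrow>
     (\<forall>t\<ge>0. \<forall>s\<ge>0. distr M borel (\<lambda>\<omega>. Z (t + s) \<omega> - Z t \<omega>) = distr M borel (\<lambda>\<omega>. Z s \<omega> - Z 0 \<omega>))"

definition independent_increments :: "'w measure \<Rightarrow> (real \<Rightarrow> 'w \<Rightarrow> real) \<Rightarrow> bool" where
  "independent_increments M Z \<longleftrightarrow>
     (\<forall>(k::nat) (t::nat \<Rightarrow> real). 0 \<le> t 0 \<and> mono t \<longrightarrow>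
        prob_space.indep_vars M (\<lambda>_. borel) (\<lambda>i \<omega>. Z (t (Suc i)) \<omega> - Z (t i) \<omega>) {..<k})"

definition symmetric_stable_process ::
  "'w measure \<Rightarrow> (real \<Rightarrow> 'w measure) \<Rightarrow> real \<Rightarrow> (real \<Rightarrow> 'w \<Rightarrow> real) \<Rightarrow> bool" where
  "symmetric_stable_process M F \<alpha> Z \<longleftrightarrow>
     adapted F Z \<and>
     (\<forall>\<omega>\<in>space M. Z 0 \<omega> = 0 \<and> cadlag (\<lambda>t. Z t \<omega>)) \<and>
     stationary_increments M Z \<and>
     independent_increments M Z \<and>
     (\<exists>c>0. \<forall>t\<ge>0. \<forall>\<theta>.
        char (distr M borel (Z t)) \<theta> = exp (complex_of_real (- (c * t * \<bar>\<theta>\<bar> powr \<alpha>)))) \<and>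
     (\<forall>t\<ge>0. \<forall>s\<ge>0. prob_space.indep_set M
        (sets (vimage_algebra (space M) (\<lambda>\<omega>. Z (t + s) \<omega> - Z t \<omega>) borel)) (sets (F t)))"

text \<open>
  Completion is by all subsets of \<open>M\<close>-null sets, not only by the null sets of the
  \<open>\<sigma>\<close>-algebra generated up to time \<open>t\<close>.
\<close>

definition completed_natural_filtration ::
  "'w measure \<Rightarrow> (real \<Rightarrow> 'w \<Rightarrow> real) \<Rightarrow> real \<Rightarrow> 'w measure" where
  "completed_natural_filtration M Z t =
     sigma (space M)
       ((\<Union>s\<in>{0..t}. sets (vimage_algebra (space M) (Z s) borel)) \<union> null_sets (completion M))"

definition solution ::
  "'w measure \<Rightarrow> (real \<Rightarrow> 'w measure) \<Rightarrow> (real \<Rightarrow> 'w \<Rightarrow> real) \<Rightarrow> (real \<Rightarrow> real) \<Rightarrow> real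
     \<Rightarrow> (real \<Rightarrow> 'w \<Rightarrow> real) \<Rightarrow> bool" where
  "solution M F Z a x \<xi> \<longleftrightarrow>
     adapted F \<xi> \<and>
     (AE \<omega> in M.
        (\<forall>T>0. set_integrable lborel {0..T} (\<lambda>s. a (\<xi> s \<omega>))) \<and>
        (\<forall>t\<ge>0. \<xi> t \<omega> = x + (LBINT s:{0..t}. a (\<xi> s \<omega>)) + Z t \<omega>))"

definition strong_solution ::
  "'w measure \<Rightarrow> (real \<Rightarrow> 'w measure) \<Rightarrow> (real \<Rightarrow> 'w \<Rightarrow> real) \<Rightarrow> (real \<Rightarrow> real) \<Rightarrow> real
     \<Rightarrow> (real \<Rightarrow> 'w \<Rightarrow> real) \<Rightarrow> bool" where
  "strong_solution M F Z a x \<xi> \<longleftrightarrow>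
     solution M F Z a x \<xi> \<and> adapted (completed_natural_filtration M Z) \<xi>"

definition pathwise_unique ::
  "'w measure \<Rightarrow> (real \<Rightarrow> 'w measure) \<Rightarrow> (real \<Rightarrow> 'w \<Rightarrow> real) \<Rightarrow> (real \<Rightarrow> real) \<Rightarrow> real \<Rightarrow> bool" where
  "pathwise_unique M F Z a x \<longleftrightarrow>
     (\<forall>\<xi> \<eta>. solution M F Z a x \<xi> \<and> solution M F Z a x \<eta> \<longrightarrow>
        (AE \<omega> in M. \<forall>t\<ge>0. \<xi> t \<omega> = \<eta> t \<omega>))"

text \<open>
  Measurability is demanded because \<^const>\<open>emeasure\<close> is \<open>0\<close> on non-measurable sets.
\<close>

definition converges_in_measure ::
  "'b measure \<Rightarrow> (nat \<Rightarrow> 'b \<Rightarrow> real) \<Rightarrow> ('b \<Rightarrow> real) \<Rightarrow> bool" where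
  "converges_in_measure N f g \<longleftrightarrow>
     (\<forall>n. f n \<in> borel_measurable N) \<and> g \<in> borel_measurable N \<and>
     (\<forall>\<epsilon>>0. (\<lambda>n. emeasure N {x \<in> space N. \<bar>f n x - g x\<bar> > \<epsilon>}) \<longlonglongrightarrow> 0)"

definition weight_measure :: "real \<Rightarrow> real measure" where
  "weight_measure \<alpha> = density lborel (\<lambda>x. ennreal ((1 + \<bar>x\<bar>) powr (- (\<alpha> + 1))))"

text \<open>
  Solutions have cadlag paths only almost surely, so the supremum over \<open>{0..T}\<close> is a random
  variable only with respect to the completion of \<open>M\<close>. The real-valued supremum is the true one
  whenever the path is bounded on \<open>{0..T}\<close>, that is, outside a null set.
\<close>

definition uniformly_converges_in_probability ::
  "'w measure \<Rightarrow> real \<Rightarrow> (nat \<Rightarrow> real \<Rightarrow> 'w \<Rightarrow> real) \<Rightarrow> (real \<Rightarrow> 'w \<Rightarrow> real) \<Rightarrow> bool" where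
  "uniformly_converges_in_probability M T X Y \<longleftrightarrow>
     converges_in_measure (completion M) (\<lambda>n \<omega>. SUP t\<in>{0..T}. \<bar>X n t \<omega> - Y t \<omega>\<bar>) (\<lambda>_. 0)"

end

theory Submission
  imports Defs
begin

text \<open>
  A bounded drift must be shown to perturb the stable noise \<open>Z\<close> only slightly, however irregular the
  drift is. The argument works at one independent exponential time of a large rate \<open>l\<close>: \<open>Q\<close> denotes
  the product of this time's law with \<open>M\<close>, and all processes are random variables under \<open>Q\<close>.

  \<^item> The smoothing of the noise enters through one kernel. Since \<open>\<alpha> > 1\<close>, the resolvent density
    of \<open>Z\<close> has an integrable derivative, and the \<open>L1\<close> norm of that derivative tends to \<open>0\<close> as
    \<open>l\<close> grows (\<open>stable_resolvent_kernel\<close>). Let \<open>k\<close> be minus this derivative, so that the Fourier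
    transform of \<open>k\<close> is \<open>\<i> \<theta> / (l + c \<bar>\<theta>\<bar>\<^sup>\<alpha>)\<close>, let \<open>kappa\<close> be its norm, and write \<open>D f\<close> for the
    correlation \<open>\<integral> k(w) f(\<cdot> + w) dw\<close>. The rate is chosen so large that \<open>B * kappa \<le> 1 / 2\<close>, where \<open>B\<close>
    bounds all drifts.

  \<^item> Let \<open>\<xi> = x + \<integral>\<beta> + Z\<close>, where \<open>\<beta>\<close> is any adapted process bounded by \<open>B\<close>. Duhamel's formula for
    the characters of \<open>\<xi>\<close>, integrated over the exponential time, is the identity
    \<open>E f(\<xi>) = E f(x + Z) + E (\<beta> * D f(\<xi>))\<close> for characters \<open>f\<close>; as signed measures are determined by
    their Fourier transforms, it holds for every bounded Borel \<open>f\<close> (\<open>path_resolvent_identity\<close>).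

  \<^item> Iterating the identity has two consequences. The law of \<open>\<xi>\<close> under \<open>Q\<close> has a density bounded by
    \<open>2 * l * kappa\<close> (\<open>krylov\<close>). And if \<open>\<beta>\<close> is close to \<open>a(\<xi>)\<close> in \<open>L1(Q)\<close>, then the law of \<open>\<xi>\<close> is
    almost determined by \<open>a\<close> and \<open>x\<close> (\<open>law_comparison\<close>).

  \<^item> Closeness of laws becomes closeness of paths through the maximum. The noise cancels in \<open>\<xi> - \<eta>\<close>,
    so \<open>max \<xi> \<eta>\<close> is again a drifted path, with the drift of whichever path is on top, and it solves
    the equation about as well as \<open>\<xi>\<close> and \<open>\<eta>\<close> do. Hence all three have nearly the same law, and as
    \<open>\<bar>\<xi> - \<eta>\<bar> = 2 * max \<xi> \<eta> - \<xi> - \<eta>\<close>, the expectation of \<open>\<bar>\<xi> - \<eta>\<bar>\<close> is small. The resulting inequality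
    \<open>flow_distance\<close> bounds it by \<open>\<bar>x - y\<bar>\<close> and by the errors \<open>E \<bar>\<beta> - a(\<xi>)\<bar>\<close> and \<open>E \<bar>\<gamma> - a(\<eta>)\<bar>\<close>.

  The theorem is read off from \<open>flow_distance\<close>. Two solutions have no error, so they agree
  (\<open>pathwise_uniqueness\<close>). Approximate solutions exist: Picard iterates for Lipschitz drifts, and
  Lipschitz averages of \<open>a\<close> in general, the occupation density bound making the change of drift
  small. By \<open>flow_distance\<close> they form a Cauchy sequence, whose limit is a solution
  (\<open>strong_existence\<close>). Everything may be done inside the filtration generated by \<open>Z\<close>, so this
  solution is strong. Finally \<open>\<xi> n\<close> solves the equation with drift \<open>a 0\<close> up to the error
  \<open>E \<bar>a n - a 0\<bar>(\<xi> n)\<close>, which convergence in the weighted measure and the occupation density bound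
  force to \<open>0\<close> (\<open>solutions_converge\<close>). Convergence is uniform in time because the difference of
  two paths is Lipschitz in time: if it is large once, it is large for a while.
\<close>

section \<open>Fourier inversion for an integrable transform\<close>

lemma integral_iexp_gaussian:
  fixes n s :: real
  assumes n: "n > 0"
  shows "(LINT v|lborel. iexp (s * v) * complex_of_real (exp (- ((v / n)\<^sup>2 / 2))))
    = complex_of_real (n * sqrt (2 * pi) * exp (- ((n * s)\<^sup>2 / 2)))"
proof -
  have ch: "(LINT z|lborel. std_normal_density z *\<^sub>R iexp (n * s * z)) = complex_of_real (exp (- ((n * s)\<^sup>2) / 2))"
  proof -
    have "char std_normal_distribution (n * s) = (LINT z|lborel. std_normal_density z *\<^sub>R iexp (n * s * z))"
      unfolding char_def by (subst integral_density) auto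
    then show ?thesis by (simp add: char_std_normal_distribution)
  qed
  have "(LINT v|lborel. iexp (s * v) * complex_of_real (exp (- ((v / n)\<^sup>2 / 2))))
     = n *\<^sub>R (LINT z|lborel. iexp (s * (n * z)) * complex_of_real (exp (- (z\<^sup>2 / 2))))"
    using n by (subst lborel_integral_real_affine[where c=n and t=0]) auto
  also have "\<dots> = n *\<^sub>R (LINT z|lborel. sqrt (2 * pi) *\<^sub>R (std_normal_density z *\<^sub>R iexp (n * s * z)))"
    by (intro arg_cong[where f="\<lambda>x. n *\<^sub>R x"] Bochner_Integration.integral_cong refl)
       (simp add: std_normal_density_def scaleR_conv_of_real ac_simps)
  also have "\<dots> = n *\<^sub>R (sqrt (2 * pi) *\<^sub>R complex_of_real (exp (- ((n * s)\<^sup>2) / 2)))"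
    by (simp only: integral_scaleR_right ch)
  finally show ?thesis by (simp add: scaleR_conv_of_real)
qed

text \<open>
  Damp \<open>Q\<close> by a wide Gaussian. Fubini turns the damped integral into an average of \<open>g\<close> over a
  narrow Gaussian around \<open>\<tau>\<close>, and both sides converge when the width of the damping grows.
\<close>

lemma fourier_inversion:
  fixes g Q :: "real \<Rightarrow> complex"
  assumes cont: "continuous_on UNIV g" and bd: "\<And>\<theta>. norm (g \<theta>) \<le> C" and gi: "integrable lborel g"
    and Q: "\<And>v. Q v = (LINT \<theta>|lborel. iexp (- (\<theta> * v)) * g \<theta>) / (2 * pi)" and Qi: "integrable lborel Q"
  shows "(LINT v|lborel. Q v * iexp (\<tau> * v)) = g \<tau>"
proof -
  \<comment> \<open>damping factors, increasing to \<open>1\<close>\<close>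
  define w where "w m v = exp (- ((v / real (Suc m))\<^sup>2 / 2))" for m :: nat and v :: real
  have [measurable]: "g \<in> borel_measurable borel" "Q \<in> borel_measurable borel"
    using gi Qi by auto
  have wm[measurable]: "w m \<in> borel_measurable borel" for m unfolding w_def by measurable
  have w1: "\<bar>w m v\<bar> \<le> 1" for m v by (simp add: w_def)
  have wi: "integrable lborel (w m)" for m
  proof -
    have "integrable lborel (\<lambda>v. sqrt (2 * pi) * std_normal_density (0 + (1 / real (Suc m)) * v))"
      by (intro integrable_mult_right lborel_integrable_real_affine) (auto intro: integrable_normal_density)
    also have "(\<lambda>v. sqrt (2 * pi) * std_normal_density (0 + (1 / real (Suc m)) * v)) = w m"
      by (auto simp: std_normal_density_def w_def fun_eq_iff)
    finally show ?thesis .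
  qed
  have lim1: "(\<lambda>m. LINT v|lborel. Q v * iexp (\<tau> * v) * complex_of_real (w m v))
      \<longlonglongrightarrow> (LINT v|lborel. Q v * iexp (\<tau> * v) * complex_of_real 1)"
  proof (rule integral_dominated_convergence[where w="\<lambda>v. norm (Q v)"])
    show "AE v in lborel. (\<lambda>m. Q v * iexp (\<tau> * v) * complex_of_real (w m v))
        \<longlonglongrightarrow> Q v * iexp (\<tau> * v) * complex_of_real 1"
    proof (intro AE_I2 tendsto_mult tendsto_const tendsto_of_real)
      fix v :: real
      have "(\<lambda>m. v / real (Suc m)) \<longlonglongrightarrow> 0"
        using LIMSEQ_Suc[OF lim_const_over_n[of v]] by simp
      then have "(\<lambda>m. exp (- ((v / real (Suc m))\<^sup>2 / 2))) \<longlonglongrightarrow> exp (- (0\<^sup>2 / 2))"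
        by (intro tendsto_intros) auto
      then show "(\<lambda>m. w m v) \<longlonglongrightarrow> 1" by (simp add: w_def)
    qed
    show "AE v in lborel. norm (Q v * iexp (\<tau> * v) * complex_of_real (w m v)) \<le> norm (Q v)" for m
      using w1 by (auto simp: norm_mult intro!: mult_left_le)
  qed (use Qi in auto)
  have eq: "(LINT v|lborel. Q v * iexp (\<tau> * v) * complex_of_real (w m v))
      = (LINT z|lborel. std_normal_density z *\<^sub>R g (\<tau> + (1 / real (Suc m)) * z))" for m
  proof -
    let ?f = "\<lambda>v \<theta>. (g \<theta> * iexp ((\<tau> - \<theta>) * v) * complex_of_real (w m v)) / (2 * pi)"
    have int: "integrable (lborel \<Otimes>\<^sub>M lborel) (\<lambda>(v, \<theta>). ?f v \<theta>)"
    proof (rule Bochner_Integration.integrable_bound)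
      show "integrable (lborel \<Otimes>\<^sub>M lborel) (\<lambda>(v, \<theta>). w m v * norm (g \<theta>))"
        by (rule lborel_pair.Fubini_integrable)
           (use wi gi in \<open>auto simp: abs_mult intro!: integrable_mult_left integrable_mult_right integrable_abs\<close>)
      show "AE x in lborel \<Otimes>\<^sub>M lborel. norm (case x of (v, \<theta>) \<Rightarrow> ?f v \<theta>) \<le> norm (case x of (v, \<theta>) \<Rightarrow> w m v * norm (g \<theta>))"
      proof (intro AE_I2, clarify)
        fix v \<theta> :: real
        have "norm (?f v \<theta>) = (norm (g \<theta>) * \<bar>w m v\<bar>) / (2 * pi)"
          by (simp add: norm_mult norm_divide)
        also have "\<dots> \<le> (norm (g \<theta>) * \<bar>w m v\<bar>) / 1"
          using pi_gt3 by (intro divide_left_mono) auto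
        finally show "norm (?f v \<theta>) \<le> norm (w m v * norm (g \<theta>))"
          by (simp add: abs_mult mult.commute)
      qed
    qed (simp add: w_def)
    have "(LINT v|lborel. Q v * iexp (\<tau> * v) * complex_of_real (w m v)) = (LINT v|lborel. LINT \<theta>|lborel. ?f v \<theta>)"
    proof (intro Bochner_Integration.integral_cong refl)
      fix v
      have "(LINT \<theta>|lborel. ?f v \<theta>) = (LINT \<theta>|lborel. (iexp (- (\<theta> * v)) * g \<theta>) * (iexp (\<tau> * v) * complex_of_real (w m v) / (2 * pi)))"
        by (intro Bochner_Integration.integral_cong refl)
           (auto simp: algebra_simps exp_diff exp_minus field_simps)
      also have "\<dots> = (LINT \<theta>|lborel. iexp (- (\<theta> * v)) * g \<theta>) * (iexp (\<tau> * v) * complex_of_real (w m v) / (2 * pi))"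
        by (rule integral_mult_left_zero)
      finally have e: "(LINT \<theta>|lborel. ?f v \<theta>) = (LINT \<theta>|lborel. iexp (- (\<theta> * v)) * g \<theta>) * (iexp (\<tau> * v) * complex_of_real (w m v) / (2 * pi))" .
      show "Q v * iexp (\<tau> * v) * complex_of_real (w m v) = (LINT \<theta>|lborel. ?f v \<theta>)"
        unfolding e Q by (simp only: times_divide_eq_left times_divide_eq_right mult.assoc)
    qed
    also have "\<dots> = (LINT \<theta>|lborel. LINT v|lborel. ?f v \<theta>)"
      by (rule lborel_pair.Fubini_integral[symmetric, OF int])
    also have "\<dots> = (LINT \<theta>|lborel. g \<theta> * complex_of_real (real (Suc m) * sqrt (2 * pi) * exp (- ((real (Suc m) * (\<tau> - \<theta>))\<^sup>2 / 2))) / (2 * pi))"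
    proof (intro Bochner_Integration.integral_cong refl)
      fix \<theta>
      have "(LINT v|lborel. ?f v \<theta>) = (LINT v|lborel. (g \<theta> / (2 * pi)) * (iexp ((\<tau> - \<theta>) * v) * complex_of_real (exp (- ((v / real (Suc m))\<^sup>2 / 2)))))"
        by (intro Bochner_Integration.integral_cong refl) (auto simp: w_def)
      also have "\<dots> = (g \<theta> / (2 * pi)) * (LINT v|lborel. iexp ((\<tau> - \<theta>) * v) * complex_of_real (exp (- ((v / real (Suc m))\<^sup>2 / 2))))"
        by (rule integral_mult_right_zero)
      finally show "(LINT v|lborel. ?f v \<theta>) = g \<theta> * complex_of_real (real (Suc m) * sqrt (2 * pi) * exp (- ((real (Suc m) * (\<tau> - \<theta>))\<^sup>2 / 2))) / (2 * pi)"
        by (subst (asm) integral_iexp_gaussian) auto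
    qed
    also have "\<dots> = (1 / real (Suc m)) *\<^sub>R (LINT z|lborel. g (\<tau> + (1 / real (Suc m)) * z) * complex_of_real (real (Suc m) * sqrt (2 * pi) * exp (- (z\<^sup>2 / 2))) / (2 * pi))"
      by (subst lborel_integral_real_affine[where c="1 / real (Suc m)" and t=\<tau>])
         (auto intro!: Bochner_Integration.integral_cong simp: power2_eq_square algebra_simps simp del: of_nat_Suc)
    also have "\<dots> = (LINT z|lborel. (1 / real (Suc m)) *\<^sub>R (g (\<tau> + (1 / real (Suc m)) * z) * complex_of_real (real (Suc m) * sqrt (2 * pi) * exp (- (z\<^sup>2 / 2))) / (2 * pi)))"
      by (rule integral_scaleR_right[symmetric])
    also have "\<dots> = (LINT z|lborel. std_normal_density z *\<^sub>R g (\<tau> + (1 / real (Suc m)) * z))"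
    proof (intro Bochner_Integration.integral_cong refl)
      fix z
      have "sqrt (2 * pi) / (2 * pi) = 1 / sqrt (2 * pi)"
        using real_sqrt_mult_self[of "2*pi"] by (simp add: field_simps)
      then have *: "complex_of_real (sqrt (2 * pi)) / (2 * pi) = complex_of_real (1 / sqrt (2 * pi))"
        by (metis of_real_divide of_real_mult of_real_numeral)
      have "(1 / real (Suc m)) *\<^sub>R (g (\<tau> + (1 / real (Suc m)) * z) * complex_of_real (real (Suc m) * sqrt (2 * pi) * exp (- (z\<^sup>2 / 2))) / (2 * pi))
         = (complex_of_real (sqrt (2 * pi)) / (2 * pi)) * (complex_of_real (exp (- (z\<^sup>2 / 2))) * g (\<tau> + (1 / real (Suc m)) * z))"
        by (simp add: scaleR_conv_of_real del: of_nat_Suc)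
      also have "\<dots> = std_normal_density z *\<^sub>R g (\<tau> + (1 / real (Suc m)) * z)"
        unfolding * by (simp add: std_normal_density_def scaleR_conv_of_real)
      finally show "(1 / real (Suc m)) *\<^sub>R (g (\<tau> + (1 / real (Suc m)) * z) * complex_of_real (real (Suc m) * sqrt (2 * pi) * exp (- (z\<^sup>2 / 2))) / (2 * pi)) = std_normal_density z *\<^sub>R g (\<tau> + (1 / real (Suc m)) * z)" .
    qed
    finally show ?thesis .
  qed
  have lim2: "(\<lambda>m. LINT z|lborel. std_normal_density z *\<^sub>R g (\<tau> + (1 / real (Suc m)) * z))
      \<longlonglongrightarrow> (LINT z|lborel. std_normal_density z *\<^sub>R g \<tau>)"
  proof (rule integral_dominated_convergence[where w="\<lambda>z. std_normal_density z * C"])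
    show "AE z in lborel. (\<lambda>m. std_normal_density z *\<^sub>R g (\<tau> + (1 / real (Suc m)) * z)) \<longlonglongrightarrow> std_normal_density z *\<^sub>R g \<tau>"
    proof (intro AE_I2 tendsto_scaleR tendsto_const)
      fix z :: real
      have "(\<lambda>m. z / real (Suc m)) \<longlonglongrightarrow> 0"
        using LIMSEQ_Suc[OF lim_const_over_n[of z]] by simp
      then have "(\<lambda>m. \<tau> + (1 / real (Suc m)) * z) \<longlonglongrightarrow> \<tau> + 0"
        by (intro tendsto_intros) (simp add: field_simps)
      then show "(\<lambda>m. g (\<tau> + (1 / real (Suc m)) * z)) \<longlonglongrightarrow> g \<tau>"
        using isCont_tendsto_compose[of "\<tau> + 0" g] cont by (simp add: continuous_on_eq_continuous_at)
    qed
    show "AE z in lborel. norm (std_normal_density z *\<^sub>R g (\<tau> + (1 / real (Suc m)) * z)) \<le> std_normal_density z * C" for m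
      using bd by (auto intro!: mult_left_mono)
    show "integrable lborel (\<lambda>z. std_normal_density z * C)"
      by (intro integrable_mult_left) (auto intro: integrable_normal_density)
  qed auto
  have "(LINT z|lborel. std_normal_density z *\<^sub>R g \<tau>) = (LINT z|lborel. std_normal_density z) *\<^sub>R g \<tau>"
    by (rule integral_scaleR_left) (auto intro: integrable_normal_density)
  also have "\<dots> = g \<tau>" by (simp add: integral_normal_density)
  finally show ?thesis
    using LIMSEQ_unique[OF lim1[unfolded eq] lim2] by simp
qed

section \<open>The derivative of the stable density\<close>

lemma set_integrable_exp_decay:
  fixes d :: real
  assumes "d > 0"
  shows "set_integrable lborel {0<..} (\<lambda>u. exp (- (d * u)))"
proof -
  interpret prob_space "density lborel (exponential_density d)"
    by (rule prob_space_exponential_density[OF assms])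
  have "integrable (density lborel (exponential_density d)) (\<lambda>_. 1::real)" by simp
  then have "integrable lborel (\<lambda>x. exponential_density d x)"
    using assms by (subst (asm) integrable_density) (auto simp: exponential_density_nonneg)
  then have "integrable lborel (\<lambda>x. (1 / d) * exponential_density d x)" by simp
  then have "integrable lborel (\<lambda>x. indicator {0<..} x *\<^sub>R ((1 / d) * exponential_density d x))"
    by (intro integrable_mult_indicator) auto
  also have "(\<lambda>x. indicator {0<..} x *\<^sub>R ((1 / d) * exponential_density d x))
      = (\<lambda>x. indicator {0<..} x *\<^sub>R exp (- (d * x)))"
    using assms by (auto simp: fun_eq_iff exponential_density_def split: split_indicator)
  finally show ?thesis by (simp add: set_integrable_def)
qed

text \<open>
  Up to constants \<open>\<theta>\<^sup>\<alpha>\<close> dominates \<open>\<theta>\<close>, and half of the exponential decay pays for the power of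
  \<open>\<theta>\<close>. The range of exponents covers all powers in the second derivative of \<open>\<theta> exp (- c \<theta>\<^sup>\<alpha>)\<close>.
\<close>

lemma powr_exp_decay:
  fixes c \<alpha> :: real
  assumes c: "c > 0" and \<alpha>: "\<alpha> \<ge> 1"
  obtains K where "K \<ge> 0"
    "\<And>\<theta> s. 0 < \<theta> \<Longrightarrow> 0 \<le> s \<Longrightarrow> s \<le> 4 \<Longrightarrow> \<theta> powr s * exp (- (c * \<theta> powr \<alpha>)) \<le> K * exp (- (c / 2 * \<theta>))"
proof
  \<comment> \<open>chosen so that \<open>1 + \<theta>\<close> is at most \<open>m\<close> times the fourth root of a lower bound of \<open>exp (c \<theta> / 2)\<close>\<close>
  define m where "m = 1 + 8 / c"
  have m: "m \<ge> 1" using c by (simp add: m_def)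
  show "0 \<le> m ^ 4 * exp c" using m by simp
  fix \<theta> s :: real assume \<theta>: "0 < \<theta>" and s: "0 \<le> s" "s \<le> 4"
  have "\<theta> \<le> 1 + \<theta> powr \<alpha>"
  proof (cases "\<theta> \<le> 1")
    case False
    then have "\<theta> powr 1 \<le> \<theta> powr \<alpha>" using \<alpha> by (intro powr_mono) auto
    then show ?thesis using \<theta> by simp
  qed (simp add: add_increasing2)
  then have "c * \<theta> \<le> c * (1 + \<theta> powr \<alpha>)" using c by (intro mult_left_mono) auto
  then have 1: "exp (- (c * \<theta> powr \<alpha>)) \<le> exp (c - c * \<theta>)"
    by (simp add: algebra_simps)
  have "\<theta> powr s \<le> (1 + \<theta>) powr s" using \<theta> s by (intro powr_mono2) auto
  also have "\<dots> \<le> (1 + \<theta>) powr 4" using \<theta> s by (intro powr_mono) auto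
  also have "\<dots> = (1 + \<theta>) ^ 4" using \<theta> by (simp add: powr_numeral)
  also have "\<dots> \<le> (m * (1 + (c * \<theta> / 2) / real 4)) ^ 4"
  proof (rule power_mono)
    have "m * (1 + (c * \<theta> / 2) / real 4) = 1 + \<theta> + (8 / c + c * \<theta> / 8)"
      using c by (simp add: m_def field_simps)
    moreover have "0 \<le> 8 / c + c * \<theta> / 8" using c \<theta> by (intro add_nonneg_nonneg) auto
    ultimately show "1 + \<theta> \<le> m * (1 + (c * \<theta> / 2) / real 4)" by linarith
  qed (use \<theta> in auto)
  also have "\<dots> = m ^ 4 * (1 + (c * \<theta> / 2) / real 4) ^ 4" by (rule power_mult_distrib)
  also have "\<dots> \<le> m ^ 4 * exp (c * \<theta> / 2)"
  proof (intro mult_left_mono exp_ge_one_plus_x_over_n_power_n)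
    have "0 < c * \<theta>" using c \<theta> by (rule mult_pos_pos)
    then show "- real 4 \<le> c * \<theta> / 2" by linarith
  qed (use m in auto)
  finally have 2: "\<theta> powr s \<le> m ^ 4 * exp (c * \<theta> / 2)" .
  have "\<theta> powr s * exp (- (c * \<theta> powr \<alpha>)) \<le> (m ^ 4 * exp (c * \<theta> / 2)) * exp (c - c * \<theta>)"
    using m by (intro mult_mono 1 2) auto
  also have "\<dots> = m ^ 4 * exp c * exp (- (c / 2 * \<theta>))"
    by (simp add: exp_add[symmetric] exp_diff exp_minus field_simps flip: exp_double)
  finally show "\<theta> powr s * exp (- (c * \<theta> powr \<alpha>)) \<le> m ^ 4 * exp c * exp (- (c / 2 * \<theta>))" .
qed

lemma integral_fold_half_line:
  fixes f :: "real \<Rightarrow> 'a::{banach, second_countable_topology}"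
  assumes f: "integrable lborel f"
  shows "(LINT \<theta>|lborel. f \<theta>) = (LINT \<theta>:{0<..}|lborel. f \<theta> + f (- \<theta>))"
proof -
  have fm: "integrable lborel (\<lambda>\<theta>. f (- \<theta>))"
    using lborel_integrable_real_affine[OF f, of "-1" 0] by simp
  have "(LINT \<theta>|lborel. f \<theta>) = (LINT \<theta>|lborel. indicator {0<..} \<theta> *\<^sub>R f \<theta> + indicator {..<0} \<theta> *\<^sub>R f \<theta>)"
  proof (rule integral_cong_AE)
    show "AE x in lborel. f x = indicator {0<..} x *\<^sub>R f x + indicator {..<0} x *\<^sub>R f x"
      using AE_lborel_singleton[of 0] by eventually_elim (auto split: split_indicator)
  qed (use f in auto)
  also have "\<dots> = (LINT \<theta>|lborel. indicator {0<..} \<theta> *\<^sub>R f \<theta>) + (LINT \<theta>|lborel. indicator {..<0} \<theta> *\<^sub>R f \<theta>)"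
    by (intro Bochner_Integration.integral_add integrable_mult_indicator f) auto
  also have "(LINT \<theta>|lborel. indicator {..<0} \<theta> *\<^sub>R f \<theta>) = (LINT \<theta>|lborel. indicator {0<..} \<theta> *\<^sub>R f (- \<theta>))"
    by (subst lborel_integral_real_affine[where c="-1" and t=0])
       (auto intro!: Bochner_Integration.integral_cong split: split_indicator)
  also have "(LINT \<theta>|lborel. indicator {0<..} \<theta> *\<^sub>R f \<theta>) + (LINT \<theta>|lborel. indicator {0<..} \<theta> *\<^sub>R f (- \<theta>))
      = (LINT \<theta>|lborel. indicator {0<..} \<theta> *\<^sub>R f \<theta> + indicator {0<..} \<theta> *\<^sub>R f (- \<theta>))"
    by (intro Bochner_Integration.integral_add[symmetric] integrable_mult_indicator f fm) auto
  finally show ?thesis by (simp add: set_lebesgue_integral_def scaleR_right_distrib)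
qed

text \<open>
  Two integrations by parts move two factors \<open>v\<close> onto \<open>g \<theta> = \<theta> exp (- c \<theta>\<^sup>\<alpha>)\<close>. The boundary terms
  at \<open>0\<close> vanish as \<open>g\<close> and the sine do, and \<open>g''\<close> is integrable because near \<open>0\<close> it is of order
  \<open>\<theta> powr (\<alpha> - 1)\<close>. One antiderivative \<open>F\<close> performs both integrations at once.
\<close>

lemma stable_derivative_decay:
  fixes c \<alpha> :: real
  assumes c: "c > 0" and \<alpha>: "1 < \<alpha>" "\<alpha> < 2"
  obtains C where "\<And>v. v\<^sup>2 * \<bar>LINT \<theta>:{0<..}|lborel. \<theta> * exp (- (c * \<theta> powr \<alpha>)) * sin (\<theta> * v)\<bar> \<le> C"
proof -
  obtain K where K: "K \<ge> 0" and
    Kb: "\<And>\<theta> s. 0 < \<theta> \<Longrightarrow> 0 \<le> s \<Longrightarrow> s \<le> 4 \<Longrightarrow> \<theta> powr s * exp (- (c * \<theta> powr \<alpha>)) \<le> K * exp (- (c / 2 * \<theta>))"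
    using powr_exp_decay[of c \<alpha>] assms by auto
  define E where "E \<theta> = exp (- (c * \<theta> powr \<alpha>))" for \<theta>
  define g where "g \<theta> = \<theta> * E \<theta>" for \<theta>
  define g1 where "g1 \<theta> = E \<theta> - c * \<alpha> * (\<theta> powr \<alpha> * E \<theta>)" for \<theta>
  define g2 where "g2 \<theta> = - (c * \<alpha> * (1 + \<alpha>)) * (\<theta> powr (\<alpha> - 1) * E \<theta>) + c\<^sup>2 * \<alpha>\<^sup>2 * (\<theta> powr (2 * \<alpha> - 1) * E \<theta>)" for \<theta>
  have Em[measurable]: "E \<in> borel_measurable borel" unfolding E_def by measurable
  have Eb: "\<theta> powr s * E \<theta> \<le> K * exp (- (c / 2 * \<theta>))" if "0 < \<theta>" "0 \<le> s" "s \<le> 4" for \<theta> s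
    using Kb[OF that] by (simp add: E_def)
  have E0: "E \<theta> \<ge> 0" for \<theta> by (simp add: E_def)
  have dE: "(E has_real_derivative - (c * \<alpha>) * \<theta> powr (\<alpha> - 1) * E \<theta>) (at \<theta>)" if "\<theta> > 0" for \<theta>
    unfolding E_def using that by (auto intro!: derivative_eq_intros)
  have p1: "\<theta> * \<theta> powr (\<alpha> - 1) = \<theta> powr \<alpha>" if "\<theta> > 0" for \<theta>
    using that powr_add[of \<theta> 1 "\<alpha> - 1"] by simp
  have dg: "(g has_real_derivative g1 \<theta>) (at \<theta>)" if "\<theta> > 0" for \<theta>
    unfolding g_def g1_def using that p1[OF that]
    by (auto intro!: derivative_eq_intros dE simp: algebra_simps)
  have p2: "\<theta> powr \<alpha> * \<theta> powr (\<alpha> - 1) = \<theta> powr (2 * \<alpha> - 1)" if "\<theta> > 0" for \<theta>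
    using powr_add[of \<theta> "\<alpha>" "\<alpha> - 1"] by simp
  have dg1: "(g1 has_real_derivative g2 \<theta>) (at \<theta>)" if "\<theta> > 0" for \<theta>
    unfolding g1_def g2_def using that
    by (auto intro!: derivative_eq_intros dE simp: algebra_simps power2_eq_square)
      (use p2[OF that] in \<open>simp add: algebra_simps\<close>)
  have gb: "\<bar>g \<theta>\<bar> \<le> K * exp (- (c / 2 * \<theta>))" if "\<theta> > 0" for \<theta>
    using Eb[OF that, of 1] that E0[of \<theta>] by (simp add: g_def)
  define C1 where "C1 = 1 + c * \<alpha>"
  have g1b: "\<bar>g1 \<theta>\<bar> \<le> C1 * (K * exp (- (c / 2 * \<theta>)))" if "\<theta> > 0" for \<theta>
  proof -
    have "\<bar>g1 \<theta>\<bar> \<le> \<theta> powr 0 * E \<theta> + c * \<alpha> * (\<theta> powr \<alpha> * E \<theta>)"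
      using that c \<alpha> E0[of \<theta>] by (simp add: g1_def abs_if)
    also have "\<dots> \<le> K * exp (- (c / 2 * \<theta>)) + c * \<alpha> * (K * exp (- (c / 2 * \<theta>)))"
      using c \<alpha> by (intro add_mono mult_left_mono Eb[OF that]) auto
    finally show ?thesis by (simp add: C1_def algebra_simps)
  qed
  define C2 where "C2 = c * \<alpha> * (1 + \<alpha>) + c\<^sup>2 * \<alpha>\<^sup>2"
  have g2b: "\<bar>g2 \<theta>\<bar> \<le> C2 * (K * exp (- (c / 2 * \<theta>)))" if "\<theta> > 0" for \<theta>
  proof -
    have "\<bar>g2 \<theta>\<bar> \<le> \<bar>- (c * \<alpha> * (1 + \<alpha>)) * (\<theta> powr (\<alpha> - 1) * E \<theta>)\<bar> + \<bar>c\<^sup>2 * \<alpha>\<^sup>2 * (\<theta> powr (2 * \<alpha> - 1) * E \<theta>)\<bar>"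
      unfolding g2_def by (rule abs_triangle_ineq)
    also have "\<dots> = c * \<alpha> * (1 + \<alpha>) * (\<theta> powr (\<alpha> - 1) * E \<theta>) + c\<^sup>2 * \<alpha>\<^sup>2 * (\<theta> powr (2 * \<alpha> - 1) * E \<theta>)"
      using that c \<alpha> E0[of \<theta>] by (simp add: abs_mult)
    also have "\<dots> \<le> c * \<alpha> * (1 + \<alpha>) * (K * exp (- (c / 2 * \<theta>))) + c\<^sup>2 * \<alpha>\<^sup>2 * (K * exp (- (c / 2 * \<theta>)))"
      using c \<alpha> by (intro add_mono mult_left_mono Eb[OF that]) auto
    finally show ?thesis by (simp add: C2_def algebra_simps)
  qed
  have expi: "set_integrable lborel {0<..} (\<lambda>\<theta>. exp (- (c / 2 * \<theta>)))"
    by (rule set_integrable_exp_decay) (use c in simp)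
  have C2: "C2 \<ge> 0" using c \<alpha> by (simp add: C2_def)
  define D where "D = C2 * K * (LINT \<theta>:{0<..}|lborel. exp (- (c / 2 * \<theta>)))"
  have dec: "((\<lambda>\<theta>. L * exp (- (c / 2 * \<theta>))) \<longlongrightarrow> 0) at_top" for L
  proof -
    have "LIM \<theta> at_top. - (c / 2 * \<theta>) :> at_bot"
      using filterlim_tendsto_pos_mult_at_top[OF tendsto_const[of "c / 2"] _ filterlim_ident] c by (simp add: filterlim_uminus_at_bot)
    then have "((\<lambda>\<theta>. exp (- (c / 2 * \<theta>))) \<longlongrightarrow> 0) at_top"
      by (rule filterlim_compose[OF exp_at_bot])
    then show ?thesis by (rule tendsto_mult_right_zero)
  qed
  show ?thesis
  proof (rule that)
    fix v :: real
    \<comment> \<open>integrating the derivative of \<open>F\<close> over the half line gives \<open>0\<close> and relates the transforms of \<open>g\<close> and \<open>g2\<close>\<close>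
    define F where "F \<theta> = - v * (g \<theta> * cos (\<theta> * v)) + g1 \<theta> * sin (\<theta> * v)" for \<theta>
    have dF: "(F has_real_derivative (v\<^sup>2 * (g \<theta> * sin (\<theta> * v)) + g2 \<theta> * sin (\<theta> * v))) (at \<theta>)" if "\<theta> > 0" for \<theta>
      unfolding F_def using that
      by (auto intro!: derivative_eq_intros dg dg1 simp: algebra_simps power2_eq_square)
    have ig: "set_integrable lborel {0<..} (\<lambda>\<theta>. g \<theta> * sin (\<theta> * v))"
    proof (rule set_integrable_bound)
      show "set_integrable lborel {0<..} (\<lambda>\<theta>. K * exp (- (c / 2 * \<theta>)))" using expi by simp
      show "AE x in lborel. x \<in> {0<..} \<longrightarrow> norm (g x * sin (x * v)) \<le> norm (K * exp (- (c / 2 * x)))"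
      proof (intro AE_I2 impI)
        fix x :: real assume "x \<in> {0<..}"
        then have "\<bar>g x\<bar> * \<bar>sin (x * v)\<bar> \<le> (K * exp (- (c / 2 * x))) * 1"
          using gb[of x] K by (intro mult_mono) auto
        then show "norm (g x * sin (x * v)) \<le> norm (K * exp (- (c / 2 * x)))"
          using K by (simp add: abs_mult)
      qed
    qed (simp add: g_def set_borel_measurable_def)
    have b2: "\<bar>g2 x * sin (x * v)\<bar> \<le> C2 * K * exp (- (c / 2 * x))" if "x > 0" for x
    proof -
      have "\<bar>g2 x\<bar> * \<bar>sin (x * v)\<bar> \<le> (C2 * (K * exp (- (c / 2 * x)))) * 1"
        using g2b[OF that] K C2 by (intro mult_mono) auto
      then show ?thesis by (simp add: abs_mult mult.assoc)
    qed
    have ig2: "set_integrable lborel {0<..} (\<lambda>\<theta>. g2 \<theta> * sin (\<theta> * v))"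
    proof (rule set_integrable_bound)
      show "set_integrable lborel {0<..} (\<lambda>\<theta>. C2 * K * exp (- (c / 2 * \<theta>)))" using expi by simp
      show "AE x in lborel. x \<in> {0<..} \<longrightarrow> norm (g2 x * sin (x * v)) \<le> norm (C2 * K * exp (- (c / 2 * x)))"
        using b2 by (auto intro: order_trans[OF _ abs_ge_self])
    qed (simp add: g2_def set_borel_measurable_def)
    have "(LBINT \<theta>=ereal 0..\<infinity>. v\<^sup>2 * (g \<theta> * sin (\<theta> * v)) + g2 \<theta> * sin (\<theta> * v)) = 0 - 0"
    proof (rule interval_integral_FTC_integrable)
      show "(F has_vector_derivative v\<^sup>2 * (g x * sin (x * v)) + g2 x * sin (x * v)) (at x)"
        if "ereal 0 < ereal x" for x
        using dF[of x] that by (simp add: has_real_derivative_iff_has_vector_derivative)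
      show "isCont (\<lambda>\<theta>. v\<^sup>2 * (g \<theta> * sin (\<theta> * v)) + g2 \<theta> * sin (\<theta> * v)) x"
        if "ereal 0 < ereal x" for x
        using that unfolding g_def g2_def E_def by (auto intro!: continuous_intros)
      show "set_integrable lborel (einterval (ereal 0) \<infinity>) (\<lambda>\<theta>. v\<^sup>2 * (g \<theta> * sin (\<theta> * v)) + g2 \<theta> * sin (\<theta> * v))"
        using ig ig2 by (simp add: greaterThan_def einterval_def)
      have "(F \<longlongrightarrow> - v * ((0 * exp (- (c * 0 powr \<alpha>))) * cos (0 * v))
          + (exp (- (c * 0 powr \<alpha>)) - c * \<alpha> * (0 powr \<alpha> * exp (- (c * 0 powr \<alpha>)))) * sin (0 * v)) (at_right 0)"
        unfolding F_def g_def g1_def E_def using \<alpha>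
        by (intro tendsto_intros tendsto_powr') (auto simp: eventually_at_filter)
      then have "(F \<longlongrightarrow> 0) (at_right 0)" by simp
      then show "((F \<circ> real_of_ereal) \<longlongrightarrow> 0) (at_right (ereal 0))"
        by (simp only: ereal_tendsto_simps)
      have "(F \<longlongrightarrow> 0) at_top"
      proof (rule Lim_null_comparison)
        show "((\<lambda>\<theta>. (\<bar>v\<bar> * K + C1 * K) * exp (- (c / 2 * \<theta>))) \<longlongrightarrow> 0) at_top" by (rule dec)
        show "\<forall>\<^sub>F \<theta> in at_top. norm (F \<theta>) \<le> (\<bar>v\<bar> * K + C1 * K) * exp (- (c / 2 * \<theta>))"
          using eventually_gt_at_top[of 0]
        proof eventually_elim
          case (elim \<theta>)
          have "\<bar>F \<theta>\<bar> \<le> \<bar>v\<bar> * (\<bar>g \<theta>\<bar> * \<bar>cos (\<theta> * v)\<bar>) + \<bar>g1 \<theta>\<bar> * \<bar>sin (\<theta> * v)\<bar>"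
            unfolding F_def by (rule order_trans[OF abs_triangle_ineq]) (simp add: abs_mult)
          also have "\<dots> \<le> \<bar>v\<bar> * (K * exp (- (c / 2 * \<theta>)) * 1) + (C1 * (K * exp (- (c / 2 * \<theta>)))) * 1"
            using gb[OF elim] g1b[OF elim] by (intro add_mono mult_left_mono mult_mono order_trans[OF abs_ge_zero g1b[OF elim]] order_trans[OF abs_ge_zero gb[OF elim]]) auto
          finally show ?case by (simp add: algebra_simps)
        qed
      qed
      then show "((F \<circ> real_of_ereal) \<longlongrightarrow> 0) (at_left \<infinity>)"
        by (simp only: ereal_tendsto_simps)
    qed auto
    then have "(LINT \<theta>:{0<..}|lborel. v\<^sup>2 * (g \<theta> * sin (\<theta> * v)) + g2 \<theta> * sin (\<theta> * v)) = 0"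
      by (simp add: interval_lebesgue_integral_def einterval_def greaterThan_def)
    then have "v\<^sup>2 * (LINT \<theta>:{0<..}|lborel. g \<theta> * sin (\<theta> * v)) = - (LINT \<theta>:{0<..}|lborel. g2 \<theta> * sin (\<theta> * v))"
      using ig ig2 by (subst (asm) set_integral_add) auto
    then have "v\<^sup>2 * \<bar>LINT \<theta>:{0<..}|lborel. g \<theta> * sin (\<theta> * v)\<bar> = \<bar>LINT \<theta>:{0<..}|lborel. g2 \<theta> * sin (\<theta> * v)\<bar>"
      by (metis abs_minus_cancel abs_mult abs_power2)
    also have "\<dots> \<le> (LINT \<theta>:{0<..}|lborel. C2 * K * exp (- (c / 2 * \<theta>)))"
      unfolding set_lebesgue_integral_def
    proof (rule integral_abs_bound_integral)
      show "integrable lborel (\<lambda>x. indicat_real {0<..} x *\<^sub>R (g2 x * sin (x * v)))"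
        using ig2 by (simp add: set_integrable_def)
      show "integrable lborel (\<lambda>x. indicat_real {0<..} x *\<^sub>R (C2 * K * exp (- (c / 2 * x))))"
        using set_integrable_mult_right[OF expi, of "C2 * K"] by (simp add: set_integrable_def)
      show "\<bar>indicat_real {0<..} x *\<^sub>R (g2 x * sin (x * v))\<bar> \<le> indicat_real {0<..} x *\<^sub>R (C2 * K * exp (- (c / 2 * x)))" for x
        using b2[of x] by (auto split: split_indicator)
    qed
    also have "\<dots> = D" by (simp add: D_def)
    finally show "v\<^sup>2 * \<bar>LINT \<theta>:{0<..}|lborel. \<theta> * exp (- (c * \<theta> powr \<alpha>)) * sin (\<theta> * v)\<bar> \<le> D"
      by (simp add: g_def E_def)
  qed
qed

lemma set_integral_exp_decay:
  fixes d :: real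
  assumes d: "d > 0"
  shows "(LINT u:{0<..}|lborel. exp (- (d * u))) = 1 / d"
proof -
  interpret prob_space "density lborel (exponential_density d)"
    by (rule prob_space_exponential_density[OF d])
  have "1 = (LINT x|density lborel (exponential_density d). (1::real))"
    using prob_space by simp
  also have "\<dots> = (LINT x|lborel. exponential_density d x * 1)"
    using d by (subst integral_density) (auto simp: exponential_density_nonneg)
  also have "\<dots> = (LINT x|lborel. d * (indicator {0<..} x *\<^sub>R exp (- (d * x))))"
  proof (rule integral_cong_AE)
    show "AE x in lborel. exponential_density d x * 1 = d * (indicator {0<..} x *\<^sub>R exp (- (d * x)))"
      using AE_lborel_singleton[of 0]
      by eventually_elim (auto simp: exponential_density_def mult.commute split: split_indicator)
  qed auto
  also have "\<dots> = d * (LINT u:{0<..}|lborel. exp (- (d * u)))"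
    by (simp add: set_lebesgue_integral_def)
  finally show ?thesis using d by (simp add: field_simps)
qed

lemma integrable_exp_abs_decay:
  fixes d :: real
  assumes d: "d > 0"
  shows "integrable lborel (\<lambda>u. exp (- (d * \<bar>u\<bar>)))"
proof -
  have 1: "integrable lborel (\<lambda>u. indicator {0<..} u *\<^sub>R exp (- (d * u)))"
    using set_integrable_exp_decay[OF d] by (simp add: set_integrable_def)
  have 2: "integrable lborel (\<lambda>u. indicator {0<..} (0 + (-1) * u) *\<^sub>R exp (- (d * (0 + (-1) * u))))"
    by (rule lborel_integrable_real_affine[OF 1]) simp
  have "AE u in lborel. indicator {0<..} u *\<^sub>R exp (- (d * u)) + indicator {0<..} (0 + (-1) * u) *\<^sub>R exp (- (d * (0 + (-1) * u))) = exp (- (d * \<bar>u\<bar>))"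
    using AE_lborel_singleton[of 0] by eventually_elim (auto split: split_indicator)
  from integrable_cong_AE_imp[OF Bochner_Integration.integrable_add[OF 1 2] _ this]
  show ?thesis by simp
qed

text \<open>
  The function \<open>q\<close> is minus the derivative of the density of \<open>Z 1\<close>. It is defined by Fourier
  inversion; the odd transform reduces to a sine integral, and this is bounded and decays like
  \<open>1 / v\<^sup>2\<close>, so \<open>q\<close> is integrable and the inversion theorem applies.
\<close>

lemma stable_derivative_density:
  fixes c \<alpha> :: real
  assumes c: "c > 0" and \<alpha>: "1 < \<alpha>" "\<alpha> < 2"
  obtains q :: "real \<Rightarrow> real" where "integrable lborel q"
    "\<And>\<tau>. (LINT v|lborel. complex_of_real (q v) * iexp (\<tau> * v)) = \<i> * \<tau> * exp (- (c * \<bar>\<tau>\<bar> powr \<alpha>))"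
proof -
  obtain K where K: "K \<ge> 0" and
    Kb: "\<And>\<theta> s. 0 < \<theta> \<Longrightarrow> 0 \<le> s \<Longrightarrow> s \<le> 4 \<Longrightarrow> \<theta> powr s * exp (- (c * \<theta> powr \<alpha>)) \<le> K * exp (- (c / 2 * \<theta>))"
    using powr_exp_decay[of c \<alpha>] assms by auto
  obtain C where C: "\<And>v. v\<^sup>2 * \<bar>LINT \<theta>:{0<..}|lborel. \<theta> * exp (- (c * \<theta> powr \<alpha>)) * sin (\<theta> * v)\<bar> \<le> C"
    using stable_derivative_decay[OF assms] by blast
  define g where "g \<theta> = \<i> * complex_of_real (\<theta> * exp (- (c * \<bar>\<theta>\<bar> powr \<alpha>)))" for \<theta>
  have ng: "norm (g \<theta>) = \<bar>\<theta>\<bar> * exp (- (c * \<bar>\<theta>\<bar> powr \<alpha>))" for \<theta>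
    by (simp add: g_def norm_mult)
  have gb: "norm (g \<theta>) \<le> K * exp (- (c / 2 * \<bar>\<theta>\<bar>))" for \<theta>
    using Kb[of "\<bar>\<theta>\<bar>" 1] K by (cases "\<theta> = 0") (auto simp: ng)
  have gm[measurable]: "g \<in> borel_measurable borel" unfolding g_def by measurable
  have gi: "integrable lborel g"
  proof (rule Bochner_Integration.integrable_bound)
    show "integrable lborel (\<lambda>\<theta>. K * exp (- (c / 2 * \<bar>\<theta>\<bar>)))"
      using integrable_exp_abs_decay[of "c / 2"] c by simp
    show "AE x in lborel. norm (g x) \<le> norm (K * exp (- (c / 2 * \<bar>x\<bar>)))"
      using gb K by (auto intro!: order_trans[OF gb])
  qed simp
  define q where "q v = (LINT \<theta>:{0<..}|lborel. \<theta> * exp (- (c * \<theta> powr \<alpha>)) * sin (\<theta> * v)) / pi" for v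
  have Q: "complex_of_real (q v) = (LINT \<theta>|lborel. iexp (- (\<theta> * v)) * g \<theta>) / (2 * pi)" for v
  proof -
    have "integrable lborel (\<lambda>\<theta>. iexp (- (\<theta> * v)) * g \<theta>)"
      by (rule Bochner_Integration.integrable_bound[OF gi]) (auto simp: norm_mult)
    then have "(LINT \<theta>|lborel. iexp (- (\<theta> * v)) * g \<theta>) = (LINT \<theta>:{0<..}|lborel. iexp (- (\<theta> * v)) * g \<theta> + iexp (- (- \<theta> * v)) * g (- \<theta>))"
      by (rule integral_fold_half_line)
    also have "\<dots> = (LINT \<theta>:{0<..}|lborel. 2 * complex_of_real (\<theta> * exp (- (c * \<theta> powr \<alpha>)) * sin (\<theta> * v)))"
    proof (rule set_lebesgue_integral_cong; (intro allI impI)?)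
      fix \<theta> :: real assume "\<theta> \<in> {0<..}"
      then show "iexp (- (\<theta> * v)) * g \<theta> + iexp (- (- \<theta> * v)) * g (- \<theta>) = 2 * complex_of_real (\<theta> * exp (- (c * \<theta> powr \<alpha>)) * sin (\<theta> * v))"
        by (simp only: g_def cis_conv_exp[symmetric]) (simp add: complex_eq_iff)
    qed simp
    also have "\<dots> = complex_of_real (2 * pi * q v)"
    proof -
      have "(\<lambda>\<theta>. indicat_real {0<..} \<theta> *\<^sub>R (2 * complex_of_real (\<theta> * exp (- (c * \<theta> powr \<alpha>)) * sin (\<theta> * v))))
          = (\<lambda>\<theta>. complex_of_real (2 * (indicat_real {0<..} \<theta> *\<^sub>R (\<theta> * exp (- (c * \<theta> powr \<alpha>)) * sin (\<theta> * v)))))"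
        by (auto simp: fun_eq_iff split: split_indicator)
      then show ?thesis
        unfolding q_def set_lebesgue_integral_def
        by (simp only: integral_complex_of_real integral_mult_right_zero) simp
    qed
    finally show ?thesis by simp
  qed
  define C0 where "C0 = (LINT \<theta>|lborel. norm (g \<theta>)) / (2 * pi)"
  have q0: "\<bar>q v\<bar> \<le> C0" for v
  proof -
    have "\<bar>q v\<bar> = norm (complex_of_real (q v))" by simp
    also have "\<dots> = norm (LINT \<theta>|lborel. iexp (- (\<theta> * v)) * g \<theta>) / (2 * pi)" unfolding Q by (simp add: norm_divide)
    also have "\<dots> \<le> (LINT \<theta>|lborel. norm (iexp (- (\<theta> * v)) * g \<theta>)) / (2 * pi)"
      by (intro divide_right_mono integral_norm_bound) auto
    finally show ?thesis by (simp add: C0_def norm_mult)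
  qed
  have q2: "v\<^sup>2 * \<bar>q v\<bar> \<le> C / pi" for v
    using C[of v] by (simp add: q_def abs_mult divide_right_mono)
  have qb: "\<bar>q v\<bar> \<le> (C0 + C / pi) * inverse (1 + v\<^sup>2)" for v
  proof -
    have "\<bar>q v\<bar> * (1 + v\<^sup>2) \<le> C0 + C / pi" using q0[of v] q2[of v] by (simp add: algebra_simps)
    moreover have "1 + v\<^sup>2 > 0" by (simp add: add_pos_nonneg)
    ultimately show ?thesis
      unfolding divide_inverse[symmetric] by (subst pos_le_divide_eq) auto
  qed
  have qm[measurable]: "q \<in> borel_measurable borel"
    unfolding q_def set_lebesgue_integral_def by measurable
  have qi: "integrable lborel q"
  proof (rule Bochner_Integration.integrable_bound)
    show "integrable lborel (\<lambda>v. (C0 + C / pi) * inverse (1 + v\<^sup>2))"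
      using integrable_inverse_1_plus_square by (simp add: set_integrable_def einterval_def)
    show "AE x in lborel. norm (q x) \<le> norm ((C0 + C / pi) * inverse (1 + x\<^sup>2))"
      by (auto intro!: AE_I2 order_trans[OF qb] abs_ge_self)
  qed simp
  show ?thesis
  proof (rule that[OF qi])
    fix \<tau> :: real
    have "(LINT v|lborel. complex_of_real (q v) * iexp (\<tau> * v)) = g \<tau>"
    proof (rule fourier_inversion[where C=K])
      have "continuous_on UNIV (\<lambda>\<theta>. \<bar>\<theta>\<bar> powr \<alpha>)"
        using \<alpha> by (intro continuous_on_powr') (auto intro!: continuous_intros)
      then show "continuous_on UNIV g" unfolding g_def
        by (intro continuous_on_mult continuous_on_const continuous_on_of_real continuous_on_exp
            continuous_on_minus continuous_on_id)
      show "norm (g \<theta>) \<le> K" for \<theta>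
      proof (rule order_trans[OF gb])
        have "exp (- (c / 2 * \<bar>\<theta>\<bar>)) \<le> 1" using c by simp
        then show "K * exp (- (c / 2 * \<bar>\<theta>\<bar>)) \<le> K" using K by (rule mult_left_le)
      qed
      show "integrable lborel (\<lambda>v. complex_of_real (q v))" using qi by simp
    qed (use gi Q in auto)
    then show "(LINT v|lborel. complex_of_real (q v) * iexp (\<tau> * v)) = \<i> * \<tau> * exp (- (c * \<bar>\<tau>\<bar> powr \<alpha>))"
      by (simp add: g_def mult.assoc flip: exp_of_real)
  qed
qed

section \<open>The derivative of the resolvent density\<close>

text \<open>
  The factor \<open>u powr (- r)\<close> arises because the derivative of the density of \<open>Z u\<close> has \<open>L1\<close> norm
  proportional to it; integrability at \<open>0\<close> is what \<open>r < 1\<close> provides.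
\<close>

lemma powr_exp_integral_tendsto_0:
  fixes r :: real
  assumes r: "0 < r" "r < 1"
  defines "h \<equiv> (\<lambda>m u. indicator {0<..} u * (exp (- (real (Suc m) * u)) * u powr (- r)))"
  shows "\<And>m. integrable lborel (h m)" "(\<lambda>m. LINT u|lborel. h m u) \<longlonglongrightarrow> 0"
proof -
  have hm[measurable]: "h m \<in> borel_measurable borel" for m unfolding h_def by measurable
  have h0: "integrable lborel (h 0)"
  proof (rule integrableI_nonneg)
    have "(\<integral>\<^sup>+ x. ennreal (h 0 x) \<partial>lborel) = (\<integral>\<^sup>+ t. ennreal (indicator {0..} t * t powr ((1 - r) - 1) / exp t) \<partial>lborel)"
      by (intro nn_integral_cong) (auto simp: h_def exp_minus field_simps split: split_indicator)
    also have "\<dots> = ennreal (Gamma (1 - r))" using Gamma_conv_nn_integral_real[of "1 - r"] r by simp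
    finally show "(\<integral>\<^sup>+ x. ennreal (h 0 x) \<partial>lborel) < \<infinity>" by simp
  qed (auto simp: h_def)
  have hle: "norm (h m u) \<le> h 0 u" for m u
    by (auto simp: h_def mult_right_mono split: split_indicator)
  show "integrable lborel (h m)" for m
    by (rule Bochner_Integration.integrable_bound[OF h0]) (auto intro!: AE_I2 order_trans[OF hle[unfolded real_norm_def]] abs_ge_self)
  have "(\<lambda>m. LINT u|lborel. h m u) \<longlonglongrightarrow> (LINT u::real|lborel. (0::real))"
  proof (rule integral_dominated_convergence[where w="h 0"])
    show "AE u in lborel. (\<lambda>m. h m u) \<longlonglongrightarrow> 0"
    proof (rule AE_I2)
      fix u :: real
      show "(\<lambda>m. h m u) \<longlonglongrightarrow> 0"
      proof (cases "u > 0")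
        case True
        have "(\<lambda>m. exp (- u) ^ m) \<longlonglongrightarrow> 0" using True by (intro LIMSEQ_realpow_zero) auto
        then have "(\<lambda>m. exp (- u) ^ Suc m * u powr (- r)) \<longlonglongrightarrow> 0"
          by (intro tendsto_mult_left_zero) (rule LIMSEQ_Suc)
        moreover have "exp (- u) ^ Suc m * u powr (- r) = h m u" for m
          using True by (simp only: h_def exp_of_nat_mult[symmetric]) simp
        ultimately show ?thesis by simp
      qed (simp add: h_def)
    qed
    show "AE x in lborel. norm (h m x) \<le> h 0 x" for m using hle by simp
  qed (use h0 in auto)
  then show "(\<lambda>m. LINT u|lborel. h m u) \<longlonglongrightarrow> 0" by simp
qed

text \<open>
  By self-similarity, minus the derivative of the density of \<open>Z u\<close> is
  \<open>u powr (- 2 / \<alpha>) * q (u powr (- 1 / \<alpha>) * w)\<close>, with \<open>L1\<close> norm \<open>u powr (- 1 / \<alpha>)\<close> times that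
  of \<open>q\<close>. The Laplace transform of this in \<open>u\<close> converges since \<open>1 / \<alpha> < 1\<close> and is the desired
  kernel; its norm is small when the rate \<open>l\<close> is large.
\<close>

lemma stable_resolvent_kernel:
  fixes c \<alpha> \<epsilon> :: real
  assumes c: "c > 0" and \<alpha>: "1 < \<alpha>" "\<alpha> < 2" and \<epsilon>: "\<epsilon> > 0"
  obtains l :: real and k :: "real \<Rightarrow> real" where "l > 0" "integrable lborel k"
    "(LINT w|lborel. \<bar>k w\<bar>) \<le> \<epsilon>"
    "\<And>\<theta>. (LINT w|lborel. complex_of_real (k w) * iexp (\<theta> * w)) = \<i> * \<theta> / complex_of_real (l + c * \<bar>\<theta>\<bar> powr \<alpha>)"
proof -
  obtain q :: "real \<Rightarrow> real" where qi: "integrable lborel q" and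
    q: "\<And>\<tau>. (LINT v|lborel. complex_of_real (q v) * iexp (\<tau> * v)) = \<i> * \<tau> * exp (- (c * \<bar>\<tau>\<bar> powr \<alpha>))"
    using stable_derivative_density[OF c \<alpha>] by blast
  define r where "r = 1 / \<alpha>"
  have r: "0 < r" "r < 1" "r * \<alpha> = 1" using \<alpha> by (auto simp: r_def field_simps)
  define L1 where "L1 = (LINT v|lborel. \<bar>q v\<bar>)"
  define h where "h m u = indicator {0<..} u * (exp (- (real (Suc m) * u)) * u powr (- r))" for m u
  have hi: "integrable lborel (h m)" for m
    unfolding h_def using powr_exp_integral_tendsto_0(1)[of r] r by simp
  have "(\<lambda>m. LINT u|lborel. h m u) \<longlonglongrightarrow> 0"
    unfolding h_def using powr_exp_integral_tendsto_0(2)[of r] r by simp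
  then have "(\<lambda>m. (LINT u|lborel. h m u) * L1) \<longlonglongrightarrow> 0"
    by (rule tendsto_mult_left_zero)
  then have "eventually (\<lambda>m. (LINT u|lborel. h m u) * L1 < \<epsilon>) sequentially"
    using \<epsilon> by (rule order_tendstoD)
  then obtain m where m: "(LINT u|lborel. h m u) * L1 < \<epsilon>"
    by (auto simp: eventually_sequentially)
  define l where "l = real (Suc m)"
  have l: "l > 0" by (simp add: l_def)
  have [measurable]: "q \<in> borel_measurable borel" using qi by auto
  \<comment> \<open>minus the derivative of the density of \<open>Z u\<close>, discounted at rate \<open>l\<close>\<close>
  define G where "G u w = indicator {0<..} u * (exp (- (l * u)) * u powr (- 2 * r)) * q (u powr (- r) * w)" for u w :: real
  have Gm[measurable]: "(\<lambda>(u, w). G u w) \<in> borel_measurable (lborel \<Otimes>\<^sub>M lborel)"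
    unfolding G_def by measurable
  have Gs: "integrable lborel (\<lambda>w. G u w)" for u
  proof (cases "u > 0")
    case True
    then show ?thesis
      using lborel_integrable_real_affine[OF qi, of "u powr (- r)" 0] by (simp add: G_def)
  qed (simp add: G_def)
  have Gn: "(LINT w|lborel. norm (G u w)) = h m u * L1" for u
  proof (cases "u > 0")
    case True
    have "(LINT w|lborel. norm (G u w)) = exp (- (l * u)) * u powr (- 2 * r) * (LINT w|lborel. \<bar>q (u powr (- r) * w)\<bar>)"
      using True by (simp add: G_def abs_mult)
    also have "L1 = u powr (- r) * (LINT w|lborel. \<bar>q (u powr (- r) * w)\<bar>)"
      unfolding L1_def using True
      by (subst lborel_integral_real_affine[where c="u powr (- r)" and t=0]) auto
    then have "(LINT w|lborel. \<bar>q (u powr (- r) * w)\<bar>) = u powr r * L1"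
      using True by (simp add: powr_minus field_simps)
    also have "exp (- (l * u)) * u powr (- 2 * r) * (u powr r * L1) = h m u * L1"
      using True by (simp add: h_def l_def powr_add[symmetric])
    finally show ?thesis .
  qed (simp add: G_def h_def)
  have Gi: "integrable (lborel \<Otimes>\<^sub>M lborel) (\<lambda>(u, w). G u w)"
  proof (rule lborel_pair.Fubini_integrable)
    show "integrable lborel (\<lambda>x. LINT y|lborel. norm (case (x, y) of (u, w) \<Rightarrow> G u w))"
      by (simp add: Gn[unfolded real_norm_def] hi)
    show "AE x in lborel. integrable lborel (\<lambda>y. case (x, y) of (u, w) \<Rightarrow> G u w)"
      using Gs by simp
  qed simp
  define k where "k w = (LINT u|lborel. G u w)" for w
  show ?thesis
  proof (rule that[OF l])
    show ki: "integrable lborel k"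
      unfolding k_def by (rule lborel_pair.integrable_snd[OF Gi])
    have Gi': "integrable (lborel \<Otimes>\<^sub>M lborel) (\<lambda>(u, w). norm (G u w))"
      using integrable_norm[OF Gi] by (simp add: case_prod_beta')
    have "(LINT w|lborel. \<bar>k w\<bar>) \<le> (LINT w|lborel. LINT u|lborel. norm (G u w))"
    proof (rule integral_mono)
      show "integrable lborel (\<lambda>w. LINT u|lborel. norm (G u w))"
        by (rule lborel_pair.integrable_snd[OF Gi'])
      show "\<bar>k w\<bar> \<le> (LINT u|lborel. norm (G u w))" for w
        unfolding k_def using integral_norm_bound[of lborel "\<lambda>u. G u w"] by simp
    qed (use ki in simp)
    also have "\<dots> = (LINT u|lborel. LINT w|lborel. norm (G u w))"
      by (rule lborel_pair.Fubini_integral[OF Gi'])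
    also have "\<dots> = (LINT u|lborel. h m u) * L1" unfolding Gn by simp
    finally show "(LINT w|lborel. \<bar>k w\<bar>) \<le> \<epsilon>" using m by simp
    fix \<theta> :: real
    define \<psi> where "\<psi> = c * \<bar>\<theta>\<bar> powr \<alpha>"
    have \<psi>: "\<psi> \<ge> 0" using c by (simp add: \<psi>_def)
    have Gi2: "integrable (lborel \<Otimes>\<^sub>M lborel) (\<lambda>(u, w). complex_of_real (G u w) * iexp (\<theta> * w))"
      by (rule Bochner_Integration.integrable_bound[OF Gi]) (auto simp: norm_mult)
    have "(LINT w|lborel. complex_of_real (k w) * iexp (\<theta> * w))
        = (LINT w|lborel. LINT u|lborel. complex_of_real (G u w) * iexp (\<theta> * w))"
      by (simp add: k_def)
    also have "\<dots> = (LINT u|lborel. LINT w|lborel. complex_of_real (G u w) * iexp (\<theta> * w))"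
      by (rule lborel_pair.Fubini_integral[OF Gi2])
    also have "\<dots> = (LINT u|lborel. \<i> * \<theta> * complex_of_real (indicator {0<..} u *\<^sub>R exp (- ((l + \<psi>) * u))))"
    proof (intro Bochner_Integration.integral_cong refl)
      fix u :: real
      show "(LINT w|lborel. complex_of_real (G u w) * iexp (\<theta> * w)) = \<i> * \<theta> * complex_of_real (indicator {0<..} u *\<^sub>R exp (- ((l + \<psi>) * u)))"
      proof (cases "u > 0")
        case True
        let ?s = "u powr r"
        have s: "?s \<noteq> 0" "u powr (- r) * ?s = 1" using True by (auto simp: powr_minus)
        have "(LINT w|lborel. complex_of_real (G u w) * iexp (\<theta> * w))
          = ?s *\<^sub>R (LINT v|lborel. complex_of_real (G u (?s * v)) * iexp (\<theta> * (?s * v)))"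
          using True by (subst lborel_integral_real_affine[where c="?s" and t=0]) auto
        also have "(LINT v|lborel. complex_of_real (G u (?s * v)) * iexp (\<theta> * (?s * v)))
          = (LINT v|lborel. complex_of_real (exp (- (l * u)) * u powr (- 2 * r)) * (complex_of_real (q v) * iexp ((\<theta> * ?s) * v)))"
        proof (intro Bochner_Integration.integral_cong refl)
          fix v :: real
          have e: "u powr (- r) * (?s * v) = v" using s(2) by (metis mult.assoc mult_1)
          then have "G u (?s * v) = exp (- (l * u)) * u powr (- 2 * r) * q v"
            using True unfolding G_def e by simp
          then show "complex_of_real (G u (?s * v)) * iexp (\<theta> * (?s * v)) = complex_of_real (exp (- (l * u)) * u powr (- 2 * r)) * (complex_of_real (q v) * iexp ((\<theta> * ?s) * v))"
            by (simp add: mult.assoc)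
        qed
        also have "\<dots> = complex_of_real (exp (- (l * u)) * u powr (- 2 * r)) * (\<i> * complex_of_real (\<theta> * ?s) * exp (- (c * \<bar>\<theta> * ?s\<bar> powr \<alpha>)))"
          by (simp only: integral_mult_right_zero q)
        also have "c * \<bar>\<theta> * ?s\<bar> powr \<alpha> = \<psi> * u"
          using True r(3) by (simp add: \<psi>_def abs_mult powr_mult powr_powr)
        also have "?s *\<^sub>R (complex_of_real (exp (- (l * u)) * u powr (- 2 * r)) * (\<i> * complex_of_real (\<theta> * ?s) * exp (- (\<psi> * u))))
           = \<i> * \<theta> * complex_of_real ((?s * ?s * u powr (- 2 * r)) * (exp (- (l * u)) * exp (- (\<psi> * u))))"
          by (simp add: scaleR_conv_of_real mult.assoc mult.left_commute)
        also have "?s * ?s * u powr (- 2 * r) = 1"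
          using True by (simp add: powr_add[symmetric])
        also have "exp (- (l * u)) * exp (- (\<psi> * u)) = exp (- ((l + \<psi>) * u))"
          by (simp add: exp_add[symmetric] algebra_simps)
        finally show ?thesis using True by simp
      qed (simp add: G_def)
    qed
    also have "\<dots> = \<i> * \<theta> * complex_of_real (1 / (l + \<psi>))"
      using set_integral_exp_decay[of "l + \<psi>"] l \<psi>
      by (simp only: integral_mult_right_zero integral_complex_of_real set_lebesgue_integral_def)
    finally show "(LINT w|lborel. complex_of_real (k w) * iexp (\<theta> * w)) = \<i> * \<theta> / complex_of_real (l + c * \<bar>\<theta>\<bar> powr \<alpha>)"
      by (simp add: \<psi>_def)
  qed
qed

section \<open>Signed measures are determined by their characters\<close>

text \<open>
  The positive and negative parts of \<open>h\<close> have the same mass (the case \<open>\<theta> = 0\<close>). Normalised, they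
  give two laws of \<open>X\<close> with the same characteristic function, which agree by Levy's uniqueness theorem.
\<close>

lemma zero_char_imp_zero_integral:
  fixes N :: "'b measure" and X h :: "'b \<Rightarrow> real" and f :: "real \<Rightarrow> real"
  assumes X[measurable]: "X \<in> borel_measurable N" and h: "integrable N h"
    and ch: "\<And>\<theta>. (LINT z|N. complex_of_real (h z) * iexp (\<theta> * X z)) = 0"
    and f[measurable]: "f \<in> borel_measurable borel" and fb: "\<And>y. \<bar>f y\<bar> \<le> C"
  shows "(LINT z|N. h z * f (X z)) = 0"
proof -
  have [measurable]: "h \<in> borel_measurable N" using h by simp
  define hp where "hp z = max 0 (h z)" for z
  define hn where "hn z = max 0 (- h z)" for z
  have [measurable]: "hp \<in> borel_measurable N" "hn \<in> borel_measurable N" unfolding hp_def hn_def by measurable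
  have hpi: "integrable N hp" and hni: "integrable N hn"
    unfolding hp_def hn_def using h by auto
  have hpn: "hp z \<ge> 0" "hn z \<ge> 0" "h z = hp z - hn z" for z by (auto simp: hp_def hn_def)
  have eI: "integrable N (\<lambda>z. complex_of_real (u z) * iexp (\<theta> * X z))" if "integrable N u" for \<theta> and u :: "'b \<Rightarrow> real"
    by (rule Bochner_Integration.integrable_bound[OF that]) (use that in \<open>auto simp: norm_mult\<close>)
  have fI: "integrable N (\<lambda>z. u z * f (X z))" if u: "integrable N u" for u :: "'b \<Rightarrow> real"
  proof (rule Bochner_Integration.integrable_bound[OF integrable_mult_left[OF u]])
    show "AE x in N. norm (u x * f (X x)) \<le> norm (u x * C)"
      using fb by (auto intro!: AE_I2 mult_left_mono order_trans[OF fb] abs_ge_self simp: abs_mult)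
  qed (use u in auto)
  have che: "(LINT z|N. complex_of_real (hp z) * iexp (\<theta> * X z)) = (LINT z|N. complex_of_real (hn z) * iexp (\<theta> * X z))" for \<theta>
  proof -
    have "(LINT z|N. complex_of_real (hp z) * iexp (\<theta> * X z)) - (LINT z|N. complex_of_real (hn z) * iexp (\<theta> * X z))
       = (LINT z|N. complex_of_real (hp z) * iexp (\<theta> * X z) - complex_of_real (hn z) * iexp (\<theta> * X z))"
      by (rule Bochner_Integration.integral_diff[symmetric]) (intro eI hpi hni)+
    also have "\<dots> = (LINT z|N. complex_of_real (h z) * iexp (\<theta> * X z))"
      by (simp add: hpn(3) left_diff_distrib)
    finally show ?thesis using ch by simp
  qed
  define m where "m = (LINT z|N. hp z)"
  have m2: "(LINT z|N. hn z) = m"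
  proof -
    have "complex_of_real (LINT z|N. hn z) = complex_of_real m"
      using che[of 0] by (simp add: m_def)
    then show ?thesis by (simp only: of_real_eq_iff)
  qed
  have m0: "m \<ge> 0" unfolding m_def by (intro integral_nonneg_AE) (simp add: hpn)
  show ?thesis
  proof (cases "m = 0")
    case True
    have "AE z in N. hp z = 0" using True hpi by (subst integral_nonneg_eq_0_iff_AE[symmetric]) (auto simp: m_def hpn)
    moreover have "AE z in N. hn z = 0" using True m2 hni by (subst integral_nonneg_eq_0_iff_AE[symmetric]) (auto simp: hpn)
    ultimately have "AE z in N. h z * f (X z) = 0" by eventually_elim (simp add: hpn(3))
    then show ?thesis by (rule integral_eq_zero_AE)
  next
    case False
    then have m: "m > 0" using m0 by simp
    let ?D = "\<lambda>u. distr (density N (\<lambda>z. ennreal (u z / m))) borel X"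
    have rd: "real_distribution (?D u)" if u: "integrable N u" "(LINT z|N. u z) = m" "\<And>z. u z \<ge> 0" for u
    proof -
      have [measurable]: "u \<in> borel_measurable N" using u by simp
      have "emeasure (density N (\<lambda>z. ennreal (u z / m))) (space N) = (\<integral>\<^sup>+ z. ennreal (u z / m) \<partial>N)"
        by (subst emeasure_density) (auto intro!: nn_integral_cong)
      also have "\<dots> = ennreal (LINT z|N. u z / m)"
        using u m by (intro nn_integral_eq_integral) auto
      also have "\<dots> = 1" using u m by simp
      finally have "prob_space (density N (\<lambda>z. ennreal (u z / m)))" by (intro prob_spaceI) simp
      then have "prob_space (?D u)" by (rule prob_space.prob_space_distr) simp
      then show ?thesis by (simp add: real_distribution_def real_distribution_axioms_def)
    qed
    have intg: "(LINT y|?D u. \<phi> y) = (LINT z|N. (u z / m) *\<^sub>R \<phi> (X z))"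
      if u: "integrable N u" "\<And>z. u z \<ge> 0" and [measurable]: "\<phi> \<in> borel_measurable borel"
      for u and \<phi> :: "real \<Rightarrow> 'c::{banach, second_countable_topology}"
    proof -
      have [measurable]: "u \<in> borel_measurable N" using u by simp
      show ?thesis using u m by (subst integral_distr) (auto intro!: integral_density)
    qed
    have "char (?D hp) = char (?D hn)"
    proof
      fix \<theta>
      have chv: "char (?D u) \<theta> = (LINT z|N. complex_of_real (u z) * iexp (\<theta> * X z)) / m" if u: "integrable N u" "\<And>z. u z \<ge> 0" for u
        unfolding char_def by (subst intg[OF u]) (auto simp: scaleR_conv_of_real)
      show "char (?D hp) \<theta> = char (?D hn) \<theta>"
        by (simp only: chv[OF hpi hpn(1)] chv[OF hni hpn(2)] che)
    qed
    then have "?D hp = ?D hn"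
      by (intro Levy_uniqueness rd hpi hni hpn m2) (simp_all add: m_def)
    then have "(LINT y|?D hp. f y) = (LINT y|?D hn. f y)" by simp
    then have "(LINT z|N. hp z * f (X z)) = (LINT z|N. hn z * f (X z))"
      using m by (simp add: intg[OF hpi hpn(1) f] intg[OF hni hpn(2) f])
    then show ?thesis
      by (simp add: hpn(3) left_diff_distrib Bochner_Integration.integral_diff[OF fI[OF hpi] fI[OF hni]])
  qed
qed

text \<open>
  A finite sum is one integral over the product with a counting measure.
\<close>

lemma zero_sum_char_imp_zero_sum_integral:
  fixes N :: "'b measure" and X h :: "nat \<Rightarrow> 'b \<Rightarrow> real" and f :: "real \<Rightarrow> real"
  assumes "sigma_finite_measure N" and X: "\<And>i. i < n \<Longrightarrow> X i \<in> borel_measurable N"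
    and h: "\<And>i. i < n \<Longrightarrow> integrable N (h i)"
    and ch: "\<And>\<theta>. (\<Sum>i<n. LINT z|N. complex_of_real (h i z) * iexp (\<theta> * X i z)) = 0"
    and f[measurable]: "f \<in> borel_measurable borel" and fb: "\<And>y. \<bar>f y\<bar> \<le> C"
  shows "(\<Sum>i<n. LINT z|N. h i z * f (X i z)) = 0"
proof -
  interpret N: sigma_finite_measure N by fact
  interpret I: finite_measure "count_space {..<n}" by (rule finite_measure_count_space) simp
  interpret P: pair_sigma_finite "count_space {..<n}" N ..
  let ?P = "count_space {..<n} \<Otimes>\<^sub>M N"
  have meas: "(\<lambda>(i, z). u i z) \<in> borel_measurable ?P" if "\<And>i. i < n \<Longrightarrow> u i \<in> borel_measurable N"
    for u :: "nat \<Rightarrow> 'b \<Rightarrow> 'c::topological_space"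
    by (rule measurable_pair_measure_countable1) (use that in auto)
  have int: "integrable ?P (\<lambda>(i, z). u i z)" if u: "\<And>i. i < n \<Longrightarrow> integrable N (u i)"
    for u :: "nat \<Rightarrow> 'b \<Rightarrow> 'c::{banach, second_countable_topology}"
  proof (rule P.Fubini_integrable)
    show "(\<lambda>(i, z). u i z) \<in> borel_measurable ?P" by (rule meas) (use u in auto)
    show "integrable (count_space {..<n}) (\<lambda>x. LINT y|N. norm (case (x, y) of (i, z) \<Rightarrow> u i z))"
      by (rule integrable_count_space) simp
    show "AE x in count_space {..<n}. integrable N (\<lambda>y. case (x, y) of (i, z) \<Rightarrow> u i z)"
      using u by (intro AE_I2) auto
  qed
  have sum: "(LINT p|?P. (case p of (i, z) \<Rightarrow> u i z)) = (\<Sum>i<n. LINT z|N. u i z)" if u: "\<And>i. i < n \<Longrightarrow> integrable N (u i)"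
    for u :: "nat \<Rightarrow> 'b \<Rightarrow> 'c::{banach, second_countable_topology}"
    using P.integral_fst[OF int[OF u]] by (simp add: lebesgue_integral_count_space_finite)
  have "(LINT p|?P. (case p of (i, z) \<Rightarrow> h i z) * f (case p of (i, z) \<Rightarrow> X i z)) = 0"
  proof (rule zero_char_imp_zero_integral[OF meas int _ f fb])
    show "(LINT z|?P. complex_of_real (case z of (i, z) \<Rightarrow> h i z) * iexp (\<theta> * (case z of (i, z) \<Rightarrow> X i z))) = 0" for \<theta>
    proof -
      have I: "integrable N (\<lambda>z. complex_of_real (h i z) * iexp (\<theta> * X i z))" if "i < n" for i
        by (rule Bochner_Integration.integrable_bound[OF h[OF that]]) (use h[OF that] X[OF that] in \<open>auto simp: norm_mult\<close>)
      show ?thesis using sum[of "\<lambda>i z. complex_of_real (h i z) * iexp (\<theta> * X i z)", OF I] ch[of \<theta>] by (simp add: case_prod_beta')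
    qed
  qed (use X h in auto)
  moreover have I: "integrable N (\<lambda>z. h i z * f (X i z))" if "i < n" for i
  proof (rule Bochner_Integration.integrable_bound[OF integrable_mult_left[OF h[OF that]]])
    show "(\<lambda>z. h i z * f (X i z)) \<in> borel_measurable N" using X[OF that] h[OF that] by simp
    show "AE x in N. norm (h i x * f (X i x)) \<le> norm (h i x * C)"
      by (auto intro!: AE_I2 mult_left_mono order_trans[OF fb] abs_ge_self simp: abs_mult)
  qed
  from sum[of "\<lambda>i z. h i z * f (X i z)", OF I] have "(LINT p|?P. (case p of (i, z) \<Rightarrow> h i z * f (X i z))) = (\<Sum>i<n. LINT z|N. h i z * f (X i z))" by simp
  ultimately show ?thesis by (simp add: case_prod_beta')
qed

text \<open>
  All three terms are transported to \<open>Q \<Otimes>\<^sub>M N\<close>. As \<open>N\<close> may be infinite, the weight \<open>g\<close> of total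
  mass \<open>1\<close> is needed to write an expectation under \<open>Q\<close> as an integral over the product.
\<close>

lemma signed_char_uniqueness:
  fixes Q :: "'a measure" and N :: "'b measure" and X Y :: "'a \<Rightarrow> real" and W h g :: "'b \<Rightarrow> real" and f :: "real \<Rightarrow> real"
  assumes "prob_space Q" and "sigma_finite_measure N"
    and X[measurable]: "X \<in> borel_measurable Q" and Y[measurable]: "Y \<in> borel_measurable Q"
    and W[measurable]: "W \<in> borel_measurable N"
    and h: "integrable N h" and g: "integrable N g" "(LINT z|N. g z) = 1"
    and ch: "\<And>\<theta>. (LINT z|Q. iexp (\<theta> * X z)) = (LINT z|Q. iexp (\<theta> * Y z)) + (LINT z|N. complex_of_real (h z) * iexp (\<theta> * W z))"
    and f[measurable]: "f \<in> borel_measurable borel" and fb: "\<And>y. \<bar>f y\<bar> \<le> C"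
  shows "(LINT z|Q. f (X z)) = (LINT z|Q. f (Y z)) + (LINT z|N. h z * f (W z))"
proof -
  interpret Q: prob_space Q by fact
  interpret N: sigma_finite_measure N by fact
  interpret P: pair_sigma_finite Q N ..
  have [measurable]: "h \<in> borel_measurable N" "g \<in> borel_measurable N" using h g by auto
  let ?P = "Q \<Otimes>\<^sub>M N"
  have int: "integrable ?P (\<lambda>(x, y). v y *\<^sub>R u x)" 
    and val: "(LINT p|?P. (case p of (x, y) \<Rightarrow> v y *\<^sub>R u x)) = (LINT y|N. v y) *\<^sub>R (LINT x|Q. u x)"
    if v: "integrable N v" and u: "integrable Q u"
    for v :: "'b \<Rightarrow> real" and u :: "'a \<Rightarrow> 'c::{banach, second_countable_topology}"
  proof -
    have [measurable]: "v \<in> borel_measurable N" "u \<in> borel_measurable Q" using u v by auto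
    show *: "integrable ?P (\<lambda>(x, y). v y *\<^sub>R u x)"
    proof (rule P.Fubini_integrable)
      show "integrable Q (\<lambda>x. LINT y|N. norm (case (x, y) of (x, y) \<Rightarrow> v y *\<^sub>R u x))"
        using u by simp
      show "AE x in Q. integrable N (\<lambda>y. case (x, y) of (x, y) \<Rightarrow> v y *\<^sub>R u x)"
        using v by simp
    qed simp
    show "(LINT p|?P. (case p of (x, y) \<Rightarrow> v y *\<^sub>R u x)) = (LINT y|N. v y) *\<^sub>R (LINT x|Q. u x)"
      using P.integral_fst[OF *] v by simp
  qed
  have intW: "integrable ?P (\<lambda>(x, y). w y)" and valW: "(LINT p|?P. (case p of (x, y) \<Rightarrow> w y)) = (LINT y|N. w y)"
    if w: "integrable N w" for w :: "'b \<Rightarrow> 'c::{banach, second_countable_topology}"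
  proof -
    have [measurable]: "w \<in> borel_measurable N" using w by auto
    show *: "integrable ?P (\<lambda>(x, y). w y)"
    proof (rule P.Fubini_integrable)
      show "AE x in Q. integrable N (\<lambda>y. case (x, y) of (x, y) \<Rightarrow> w y)"
        using w by simp
    qed simp_all
    show "(LINT p|?P. (case p of (x, y) \<Rightarrow> w y)) = (LINT y|N. w y)"
      using P.integral_fst[OF *] by (simp add: Q.prob_space)
  qed
  have eQ: "integrable Q (\<lambda>z. iexp (\<theta> * U z))" if "U \<in> borel_measurable Q" for U \<theta>
    using that by (intro Q.integrable_const_bound[where B=1]) auto
  have fQ: "integrable Q (\<lambda>z. f (U z))" if "U \<in> borel_measurable Q" for U
    using that fb by (intro Q.integrable_const_bound[where B=C]) auto
  have eN: "integrable N (\<lambda>z. complex_of_real (h z) * iexp (\<theta> * W z))" for \<theta>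
    by (rule Bochner_Integration.integrable_bound[OF h]) (auto simp: norm_mult)
  have fN: "integrable N (\<lambda>z. h z * f (W z))"
  proof (rule Bochner_Integration.integrable_bound[OF integrable_mult_left[OF h]])
    show "AE x in N. norm (h x * f (W x)) \<le> norm (h x * C)"
      by (auto intro!: AE_I2 mult_left_mono order_trans[OF fb] abs_ge_self simp: abs_mult)
  qed auto
  \<comment> \<open>the terms are numbered \<open>0, 1, 2\<close>, with signs such that their sum has to vanish\<close>
  define hh where "hh i = (\<lambda>(x :: 'a, y). if i = 0 then g y else if i = 1 then - g y else - h y)" for i :: nat
  define XX where "XX i = (\<lambda>(x, y). if i = 0 then X x else if i = 1 then Y x else W y)" for i :: nat
  have "(\<Sum>i<3. LINT z|?P. hh i z * f (XX i z)) = 0"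
  proof (rule zero_sum_char_imp_zero_sum_integral[OF _ _ _ _ f fb])
    show "sigma_finite_measure ?P" ..
    fix i :: nat assume "i < 3"
    then have i3: "i = 0 \<or> i = 1 \<or> i = 2" by linarith
    then consider "i = 0" | "i = 1" | "i = 2" by blast
    then show "XX i \<in> borel_measurable ?P" by cases (auto simp: XX_def)
    have "integrable ?P (\<lambda>(x, y). g y *\<^sub>R (1::real))" by (rule int[OF g(1)]) simp
    then show "integrable ?P (hh i)"
      using i3 intW[OF h] by (auto simp: hh_def case_prod_beta')
  next
    fix \<theta> :: real
    show "(\<Sum>i<3. LINT z|?P. complex_of_real (hh i z) * iexp (\<theta> * XX i z)) = 0"
      using val[OF g(1) eQ[OF X, of \<theta>]] val[OF g(1) eQ[OF Y, of \<theta>]] valW[OF eN[of \<theta>]] ch[of \<theta>]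
      by (simp add: numeral_3_eq_3 hh_def XX_def case_prod_beta' g(2) scaleR_conv_of_real)
  qed
  then show ?thesis
    using val[OF g(1) fQ[OF X]] val[OF g(1) fQ[OF Y]] valW[OF fN]
    by (simp add: numeral_3_eq_3 hh_def XX_def case_prod_beta' g(2))
qed

section \<open>Chain rules along indefinite integrals\<close>

lemma set_integrable_bounded_Icc:
  fixes f :: "real \<Rightarrow> 'a::{banach, second_countable_topology}"
  assumes [measurable]: "f \<in> borel_measurable borel" and b: "\<And>s. s \<in> {u..t} \<Longrightarrow> norm (f s) \<le> C"
  shows "set_integrable lborel {u..t} f"
proof (rule set_integrable_bound)
  show "set_integrable lborel {u..t} (\<lambda>_. max C 0)"
    by (auto simp: set_integrable_def emeasure_lborel_Icc_eq intro!: integrable_real_indicator)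
  show "AE x in lborel. x \<in> {u..t} \<longrightarrow> norm (f x) \<le> norm (max C 0)"
    using b by (auto intro!: AE_I2 order_trans[OF b])
qed (simp add: set_borel_measurable_def)

lemma indefinite_integral_increment:
  fixes f :: "real \<Rightarrow> 'a::{banach, second_countable_topology}"
  assumes f: "set_integrable lborel {0..t} f" and s: "0 \<le> s" "s \<le> t"
  shows "(LINT r:{0..t}|lborel. f r) - (LINT r:{0..s}|lborel. f r) = (LINT r:{s..t}|lborel. f r)"
proof -
  have "{0..t} = {0..s} \<union> {s..t}" using s by auto
  then have "(LINT r:{0..t}|lborel. f r) = (LINT r:{0..s} \<union> {s..t}|lborel. f r)" by simp
  also have "\<dots> = (LINT r:{0..s}|lborel. f r) + (LINT r:{s..t}|lborel. f r)"
  proof (rule set_integral_Un_AE)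
    show "AE x in lborel. \<not> (x \<in> {0..s} \<and> x \<in> {s..t})"
      using AE_lborel_singleton[of s] by eventually_elim auto
  qed (use s in \<open>auto intro: set_integrable_subset[OF f]\<close>)
  finally show ?thesis by simp
qed

lemma measurable_indefinite_integral_joint:
  fixes f :: "real \<Rightarrow> 'w \<Rightarrow> 'a::{banach, second_countable_topology}"
  assumes f: "(\<lambda>(t, w). f t w) \<in> borel_measurable (borel \<Otimes>\<^sub>M N)"
  shows "(\<lambda>(t, w). LINT s:{0..t}|lborel. f s w) \<in> borel_measurable (borel \<Otimes>\<^sub>M N)"
proof -
  have "(\<lambda>p. (snd p, snd (fst p))) \<in> ((borel \<Otimes>\<^sub>M N) \<Otimes>\<^sub>M lborel) \<rightarrow>\<^sub>M (borel \<Otimes>\<^sub>M N)"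
    by measurable
  from measurable_compose[OF this f]
  have fm[measurable]: "(\<lambda>p. f (snd p) (snd (fst p))) \<in> borel_measurable (((borel::real measure) \<Otimes>\<^sub>M N) \<Otimes>\<^sub>M lborel)"
    by simp
  have "(\<lambda>p. LINT s|lborel. (if 0 \<le> s \<and> s \<le> fst p then f s (snd p) else 0)) \<in> borel_measurable ((borel::real measure) \<Otimes>\<^sub>M N)"
  proof (rule lborel.borel_measurable_lebesgue_integral)
    have "(\<lambda>p. if 0 \<le> snd p \<and> snd p \<le> fst (fst p) then f (snd p) (snd (fst p)) else 0) \<in> borel_measurable (((borel::real measure) \<Otimes>\<^sub>M N) \<Otimes>\<^sub>M lborel)"
      by measurable
    then show "(\<lambda>(p, s). if 0 \<le> s \<and> s \<le> fst p then f s (snd p) else 0) \<in> borel_measurable (((borel::real measure) \<Otimes>\<^sub>M N) \<Otimes>\<^sub>M lborel)"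
      by (simp add: case_prod_beta')
  qed
  also have "(\<lambda>p. LINT s|lborel. (if 0 \<le> s \<and> s \<le> fst p then f s (snd p) else 0)) = (\<lambda>(t, w). LINT s:{0..t}|lborel. f s w)"
    by (auto simp: fun_eq_iff set_lebesgue_integral_def intro!: Bochner_Integration.integral_cong split: split_indicator)
  finally show ?thesis .
qed

lemma measurable_indefinite_integral[measurable]:
  fixes f :: "real \<Rightarrow> 'a::{banach, second_countable_topology}"
  assumes [measurable]: "f \<in> borel_measurable borel"
  shows "(\<lambda>t. y + (LINT s:{0..t}|lborel. f s)) \<in> borel_measurable borel"
proof -
  have "(\<lambda>(t, w). LINT s:{0..t}|lborel. f s) \<in> borel_measurable ((borel::real measure) \<Otimes>\<^sub>M (borel::real measure))"
    by (rule measurable_indefinite_integral_joint) measurable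
  from measurable_compose[OF _ this, of "\<lambda>t. (t, 0)" borel]
  have [measurable]: "(\<lambda>t. LINT s:{0..t}|lborel. f s) \<in> borel_measurable borel" by simp
  show ?thesis by measurable
qed

lemma norm_set_integral_Icc_le:
  fixes f :: "real \<Rightarrow> 'a::{banach, second_countable_topology}"
  assumes f: "set_integrable lborel {s..t} f" and b: "\<And>r. r \<in> {s..t} \<Longrightarrow> norm (f r) \<le> C" and st: "s \<le> t"
  shows "norm (LINT r:{s..t}|lborel. f r) \<le> C * (t - s)"
proof -
  have "norm (LINT r:{s..t}|lborel. f r) \<le> (LINT r:{s..t}|lborel. norm (f r))"
    by (rule set_integral_norm_bound[OF f])
  also have "\<dots> \<le> (LINT r:{s..t}|lborel. C)"
  proof (rule set_integral_mono)
    show "set_integrable lborel {s..t} (\<lambda>_. C)"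
      by (rule set_integrable_bounded_Icc[where C="\<bar>C\<bar>"]) auto
  qed (use f b set_integrable_norm[OF f] in auto)
  also have "\<dots> = C * (t - s)" using st by (simp add: set_lebesgue_integral_def)
  finally show ?thesis .
qed

lemma set_integral_lborel_singleton:
  fixes f :: "real \<Rightarrow> 'a::{banach, second_countable_topology}"
  shows "(LINT s:{u}|lborel. f s) = 0"
  unfolding set_lebesgue_integral_def
  by (rule integral_eq_zero_AE) (use AE_lborel_singleton[of u] in \<open>eventually_elim, auto\<close>)

lemma quadratic_increments_imp_constant:
  fixes H :: "real \<Rightarrow> 'a::real_normed_vector"
  assumes H: "\<And>s t. 0 \<le> s \<Longrightarrow> s \<le> t \<Longrightarrow> norm (H t - H s) \<le> C * (t - s)\<^sup>2" and t: "t \<ge> 0"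
  shows "H t = H 0"
proof -
  have H': "norm (H y - H x) \<le> C * \<bar>y - x\<bar>\<^sup>2" if "0 \<le> x" "0 \<le> y" for x y
    using H[of x y] H[of y x] that by (cases "x \<le> y") (auto simp: norm_minus_commute power2_commute)
  have "\<exists>c. \<forall>x\<in>{0..}. H x = c"
  proof (rule has_derivative_zero_constant)
    fix x :: real assume x: "x \<in> {0..}"
    show "(H has_derivative (\<lambda>h. 0)) (at x within {0..})"
    proof (rule has_derivativeI_sandwich[where e=1 and H="\<lambda>y. C * \<bar>y - x\<bar>"])
      fix y assume y: "y \<in> {0..}" "y \<noteq> x"
      have "norm (H y - H x) \<le> (C * \<bar>y - x\<bar>) * \<bar>y - x\<bar>"
        using H'[of x y] x y by (simp add: power2_eq_square mult.assoc)
      then show "norm (H y - H x - 0) / norm (y - x) \<le> C * \<bar>y - x\<bar>"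
        using y by (simp add: pos_divide_le_eq)
    next
      show "((\<lambda>y. C * \<bar>y - x\<bar>) \<longlongrightarrow> 0) (at x within {0..})"
        by (rule tendsto_eq_intros | simp)+
    qed auto
  qed auto
  then show ?thesis using t by auto
qed

text \<open>
  The drift \<open>b\<close> is only measurable, so \<open>A\<close> need not be differentiable at a given time. But \<open>A\<close> is
  Lipschitz, so over \<open>{u..v}\<close> both sides change by \<open>(A v - A u) * \<phi>'(A u)\<close> up to an error of order
  \<open>(v - u)\<^sup>2\<close>, and a function with quadratically small increments is constant.
\<close>

lemma chain_rule_indefinite_integral:
  fixes \<phi> \<phi>' :: "real \<Rightarrow> 'a::{banach, second_countable_topology}" and b A :: "real \<Rightarrow> real"
  assumes bm[measurable]: "b \<in> borel_measurable borel" and bb: "\<And>s. \<bar>b s\<bar> \<le> B"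
    and A: "\<And>t. A t = y + (LINT s:{0..t}|lborel. b s)"
    and T: "\<And>u v. norm (\<phi> v - \<phi> u - (v - u) *\<^sub>R \<phi>' u) \<le> K * (v - u)\<^sup>2"
    and L: "\<And>u v. norm (\<phi>' v - \<phi>' u) \<le> K * \<bar>v - u\<bar>"
    and t: "t \<ge> 0"
  shows "\<phi> (A t) = \<phi> y + (LINT s:{0..t}|lborel. b s *\<^sub>R \<phi>' (A s))"
proof -
  have B0: "B \<ge> 0" using bb[of 0] by linarith
  have K0: "K \<ge> 0" using order_trans[OF norm_ge_zero L[of 1 0]] by simp
  have bi: "set_integrable lborel {u..v} b" for u v
    by (rule set_integrable_bounded_Icc[where C=B]) (use bb in auto)
  have Ainc: "A v - A u = (LINT s:{u..v}|lborel. b s)" if "0 \<le> u" "u \<le> v" for u v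
    using indefinite_integral_increment[OF bi that] by (simp add: A)
  have Alip: "\<bar>A v - A u\<bar> \<le> B * (v - u)" if "0 \<le> u" "u \<le> v" for u v
    using norm_set_integral_Icc_le[OF bi[of u v], of B] bb that by (simp add: Ainc)
  have Am[measurable]: "A \<in> borel_measurable borel"
    unfolding A by measurable
  have "continuous_on UNIV \<phi>'"
  proof (rule lipschitz_on_continuous_on)
    show "K-lipschitz_on UNIV \<phi>'" using L K0 by (auto intro!: lipschitz_onI simp: dist_norm)
  qed
  then have pm[measurable]: "\<phi>' \<in> borel_measurable borel" by (rule borel_measurable_continuous_onI)
  have Ab: "\<bar>A s - A 0\<bar> \<le> B * v" if "s \<in> {0..v}" for s v
    using Alip[of 0 s] mult_left_mono[of s v B] B0 that by auto
  have fi: "set_integrable lborel {u..v} (\<lambda>s. b s *\<^sub>R \<phi>' (A s))" if "0 \<le> u" for u v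
  proof (rule set_integrable_bounded_Icc[where C="B * (norm (\<phi>' (A 0)) + K * (B * v))"])
    fix s assume s: "s \<in> {u..v}"
    have "norm (\<phi>' (A s)) \<le> norm (\<phi>' (A 0)) + norm (\<phi>' (A s) - \<phi>' (A 0))"
      by (rule norm_triangle_sub)
    also have "\<dots> \<le> norm (\<phi>' (A 0)) + K * (B * v)"
      using L[of "A s" "A 0"] mult_left_mono[OF Ab[of s v] K0] s that by simp
    finally show "norm (b s *\<^sub>R \<phi>' (A s)) \<le> B * (norm (\<phi>' (A 0)) + K * (B * v))"
      using bb[of s] B0 by (simp add: mult_mono)
  qed simp
  \<comment> \<open>the difference of the two sides, shown to be constant\<close>
  define H where "H v = \<phi> (A v) - (LINT s:{0..v}|lborel. b s *\<^sub>R \<phi>' (A s))" for v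
  have "H t = H 0"
  proof (rule quadratic_increments_imp_constant[OF _ t, where C="2 * K * B\<^sup>2"])
    fix u v :: real assume uv: "0 \<le> u" "u \<le> v"
    have c: "(LINT s:{u..v}|lborel. b s *\<^sub>R \<phi>' (A u)) = (A v - A u) *\<^sub>R \<phi>' (A u)"
      using Ainc[OF uv] bi[of u v] by (simp add: set_lebesgue_integral_def set_integrable_def)
    have ci: "set_integrable lborel {u..v} (\<lambda>s. b s *\<^sub>R \<phi>' (A u))"
      using bi[of u v] by (simp add: set_integrable_def)
    have "H v - H u = (\<phi> (A v) - \<phi> (A u)) - (LINT s:{u..v}|lborel. b s *\<^sub>R \<phi>' (A s))"
      using indefinite_integral_increment[OF fi[of 0 v] uv] by (simp add: H_def algebra_simps)
    also have "\<dots> = (\<phi> (A v) - \<phi> (A u) - (A v - A u) *\<^sub>R \<phi>' (A u))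
        - (LINT s:{u..v}|lborel. b s *\<^sub>R \<phi>' (A s) - b s *\<^sub>R \<phi>' (A u))"
      using set_integral_diff(2)[OF fi[OF uv(1), of v] ci] c by simp
    also have "norm \<dots> \<le> K * (A v - A u)\<^sup>2 + (B * (K * (B * (v - u)))) * (v - u)"
    proof (rule order_trans[OF norm_triangle_ineq4], rule add_mono[OF T])
      show "norm (LINT s:{u..v}|lborel. b s *\<^sub>R \<phi>' (A s) - b s *\<^sub>R \<phi>' (A u)) \<le> (B * (K * (B * (v - u)))) * (v - u)"
      proof (rule norm_set_integral_Icc_le)
        show "set_integrable lborel {u..v} (\<lambda>s. b s *\<^sub>R \<phi>' (A s) - b s *\<^sub>R \<phi>' (A u))"
          using set_integral_diff(1)[OF fi[OF uv(1), of v] ci] .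
        fix r assume r: "r \<in> {u..v}"
        have "norm (b r *\<^sub>R \<phi>' (A r) - b r *\<^sub>R \<phi>' (A u)) = \<bar>b r\<bar> * norm (\<phi>' (A r) - \<phi>' (A u))"
          by (simp flip: scaleR_diff_right)
        also have "\<dots> \<le> B * (K * (B * (v - u)))"
        proof (intro mult_mono bb B0 norm_ge_zero order_trans[OF L] mult_left_mono K0)
          show "\<bar>A r - A u\<bar> \<le> B * (v - u)"
            using Alip[of u r] r uv B0 mult_left_mono[of "r - u" "v - u" B] by auto
        qed auto
        finally show "norm (b r *\<^sub>R \<phi>' (A r) - b r *\<^sub>R \<phi>' (A u)) \<le> B * (K * (B * (v - u)))" .
      qed (use uv in auto)
    qed
    also have "K * (A v - A u)\<^sup>2 \<le> K * (B * (v - u))\<^sup>2"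
      using Alip[OF uv] K0 by (intro mult_left_mono) (auto simp: abs_le_square_iff[symmetric])
    finally show "norm (H v - H u) \<le> 2 * K * B\<^sup>2 * (v - u)\<^sup>2"
      by (simp add: power2_eq_square algebra_simps)
  qed
  then show ?thesis by (simp add: H_def A set_integral_lborel_singleton algebra_simps)
qed

lemma iexp_indefinite_integral:
  fixes b A :: "real \<Rightarrow> real"
  assumes bm: "b \<in> borel_measurable borel" and bb: "\<And>s. \<bar>b s\<bar> \<le> B"
    and A: "\<And>t. A t = y + (LINT s:{0..t}|lborel. b s)" and t: "t \<ge> 0"
  shows "iexp (\<theta> * A t) = iexp (\<theta> * y) + (LINT s:{0..t}|lborel. b s *\<^sub>R (\<i> * \<theta> * iexp (\<theta> * A s)))"
proof (rule chain_rule_indefinite_integral[OF bm bb A _ _ t, where K="\<theta>\<^sup>2"])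
  fix u v :: real
  have e: "iexp (\<theta> * v) = iexp (\<theta> * u) * iexp (\<theta> * (v - u))"
    by (simp add: exp_add[symmetric] algebra_simps)
  have 1: "norm (iexp (\<theta> * (v - u)) - 1 - \<i> * (\<theta> * (v - u))) \<le> \<bar>\<theta> * (v - u)\<bar>\<^sup>2 / 2"
    using iexp_approx1[of "\<theta> * (v - u)" 1] by (simp add: power2_eq_square algebra_simps)
  have "iexp (\<theta> * v) - iexp (\<theta> * u) - (v - u) *\<^sub>R (\<i> * \<theta> * iexp (\<theta> * u))
     = iexp (\<theta> * u) * (iexp (\<theta> * (v - u)) - 1 - \<i> * (\<theta> * (v - u)))"
    unfolding e by (simp add: algebra_simps scaleR_conv_of_real)
  then have "norm (iexp (\<theta> * v) - iexp (\<theta> * u) - (v - u) *\<^sub>R (\<i> * \<theta> * iexp (\<theta> * u))) \<le> \<bar>\<theta> * (v - u)\<bar>\<^sup>2 / 2"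
    using 1 by (simp add: norm_mult)
  also have "\<dots> \<le> \<theta>\<^sup>2 * (v - u)\<^sup>2" by (simp add: power_mult_distrib)
  finally show "norm (iexp (\<theta> * v) - iexp (\<theta> * u) - (v - u) *\<^sub>R (\<i> * \<theta> * iexp (\<theta> * u))) \<le> \<theta>\<^sup>2 * (v - u)\<^sup>2" .
  have 2: "norm (iexp (\<theta> * (v - u)) - 1) \<le> \<bar>\<theta> * (v - u)\<bar>"
    using iexp_approx1[of "\<theta> * (v - u)" 0] by simp
  have "\<i> * \<theta> * iexp (\<theta> * v) - \<i> * \<theta> * iexp (\<theta> * u) = \<i> * \<theta> * (iexp (\<theta> * u) * (iexp (\<theta> * (v - u)) - 1))"
    unfolding e by (simp add: algebra_simps)
  then have "norm (\<i> * \<theta> * iexp (\<theta> * v) - \<i> * \<theta> * iexp (\<theta> * u)) = \<bar>\<theta>\<bar> * norm (iexp (\<theta> * (v - u)) - 1)"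
    by (simp add: norm_mult)
  also have "\<dots> \<le> \<bar>\<theta>\<bar> * \<bar>\<theta> * (v - u)\<bar>" by (intro mult_left_mono 2) auto
  also have "\<dots> = \<theta>\<^sup>2 * \<bar>v - u\<bar>" by (simp add: abs_mult power2_eq_square flip: mult.assoc)
  finally show "norm (\<i> * \<theta> * iexp (\<theta> * v) - \<i> * \<theta> * iexp (\<theta> * u)) \<le> \<theta>\<^sup>2 * \<bar>v - u\<bar>" .
qed

text \<open>
  The chain rule for \<open>sqrt (\<epsilon>\<^sup>2 + u\<^sup>2)\<close>, with \<open>\<epsilon> \<rightarrow> 0\<close>. The derivatives converge to \<open>sgn\<close>
  pointwise, including the value \<open>0\<close> at \<open>0\<close>.
\<close>

lemma abs_indefinite_integral:
  fixes b A :: "real \<Rightarrow> real"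
  assumes bm[measurable]: "b \<in> borel_measurable borel" and bb: "\<And>s. \<bar>b s\<bar> \<le> B"
    and A: "\<And>t. A t = y + (LINT s:{0..t}|lborel. b s)" and t: "t \<ge> 0"
  shows "\<bar>A t\<bar> = \<bar>y\<bar> + (LINT s:{0..t}|lborel. b s * sgn (A s))"
proof -
  have Am[measurable]: "A \<in> borel_measurable borel"
    unfolding A by measurable
  define e where "e n = 1 / real (Suc n)" for n
  have e0: "e n > 0" for n by (simp add: e_def)
  have elim: "e \<longlonglongrightarrow> 0" unfolding e_def by (rule LIMSEQ_Suc[OF lim_1_over_n])
  define p where "p n u = sqrt ((e n)\<^sup>2 + u\<^sup>2)" for n u
  have p0: "p n u > 0" for n u unfolding p_def using e0[of n] by (simp add: add_pos_nonneg)
  have pu: "\<bar>u\<bar> \<le> p n u" for n u unfolding p_def by (metis abs_le_square_iff le_add_same_cancel2 real_sqrt_abs real_sqrt_le_mono zero_le_power2 add.commute)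
  have pe: "e n \<le> p n u" for n u using e0[of n] by (simp add: p_def real_le_rsqrt)
  have p2: "(p n u)\<^sup>2 = (e n)\<^sup>2 + u\<^sup>2" for n u by (simp add: p_def)
  have dp: "(p n has_real_derivative u / p n u) (at u)" for n u
  proof -
    have "0 < (e n)\<^sup>2 + u\<^sup>2" using e0[of n] by (simp add: add_pos_nonneg)
    then have "((\<lambda>u. sqrt ((e n)\<^sup>2 + u\<^sup>2)) has_real_derivative (inverse (sqrt ((e n)\<^sup>2 + u\<^sup>2)) / 2) * (2 * u)) (at u)"
      by (intro DERIV_chain2[OF DERIV_real_sqrt]) (auto intro!: derivative_eq_intros)
    then have "(p n has_real_derivative (inverse (p n u) / 2 * (2 * u))) (at u)"
      by (simp only: p_def[abs_def])
    then show ?thesis by (rule DERIV_cong) (simp add: field_simps)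
  qed
  have dq: "((\<lambda>u. u / p n u) has_real_derivative (p n u - u * (u / p n u)) / (p n u * p n u)) (at u)" for n u
    using p0[of n u] by (intro DERIV_cong[OF DERIV_divide[OF DERIV_ident dp]]) auto
  have dqb: "\<bar>(p n u - u * (u / p n u)) / (p n u * p n u)\<bar> \<le> 1 / e n" for n u
  proof -
    have "(p n u - u * (u / p n u)) = (e n)\<^sup>2 / p n u"
      using p0[of n u] p2[of n u] by (simp add: field_simps power2_eq_square)
    then have "\<bar>(p n u - u * (u / p n u)) / (p n u * p n u)\<bar> = ((e n)\<^sup>2 / (p n u * p n u)) * (1 / p n u)"
      using p0[of n u] by (simp add: abs_divide abs_mult)
    also have "\<dots> \<le> 1 * (1 / e n)"
    proof (rule mult_mono)
      show "(e n)\<^sup>2 / (p n u * p n u) \<le> 1"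
        using mult_pos_pos[OF p0[of n u] p0[of n u]] p2[of n u]
        by (subst divide_le_eq_1_pos) (simp_all add: power2_eq_square)
      show "1 / p n u \<le> 1 / e n" using pe[of n u] e0[of n] by (simp add: frac_le)
    qed (use p0[of n u] in auto)
    finally show ?thesis by simp
  qed
  have L: "norm (v / p n v - u / p n u) \<le> (1 / e n) * \<bar>v - u\<bar>" for n u v
    using field_differentiable_bound[of UNIV "\<lambda>u. u / p n u" "\<lambda>u. (p n u - u * (u / p n u)) / (p n u * p n u)" "1 / e n" v u]
      dq dqb by auto
  have T: "norm (p n v - p n u - (v - u) *\<^sub>R (u / p n u)) \<le> (1 / e n) * (v - u)\<^sup>2" for n u v
  proof (cases "u = v")
    case False
    then obtain z where z: "\<bar>z - u\<bar> \<le> \<bar>v - u\<bar>" "p n v - p n u = (v - u) * (z / p n z)"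
    proof (cases "u < v")
      case True
      then obtain z where "u < z" "z < v" "p n v - p n u = (v - u) * (z / p n z)"
        using MVT2[of u v "p n" "\<lambda>u. u / p n u"] dp by auto
      then show ?thesis using that[of z] by auto
    next
      case F: False
      then have "v < u" using False by simp
      then obtain z where z: "v < z" "z < u" "p n u - p n v = (u - v) * (z / p n z)"
        using MVT2[of v u "p n" "\<lambda>u. u / p n u"] dp by auto
      have "p n v - p n u = - (p n u - p n v)" by simp
      also have "\<dots> = (v - u) * (z / p n z)" unfolding z(3) by (metis minus_diff_eq mult_minus_left)
      finally show ?thesis using that[of z] z by auto
    qed
    have "norm (p n v - p n u - (v - u) *\<^sub>R (u / p n u)) = \<bar>v - u\<bar> * norm (z / p n z - u / p n u)"
      unfolding z(2) real_scaleR_def by (simp only: right_diff_distrib[symmetric] abs_mult real_norm_def)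
    also have "\<dots> \<le> \<bar>v - u\<bar> * ((1 / e n) * \<bar>v - u\<bar>)"
      using L[of z n u] z(1) e0[of n]
      by (intro mult_left_mono order_trans[OF L]) auto
    also have "\<dots> = (1 / e n) * \<bar>v - u\<bar>\<^sup>2"
      by (simp only: power2_eq_square mult.left_commute)
    finally show ?thesis by (simp only: power2_abs)
  qed simp
  have eq: "p n (A t) = p n y + (LINT s:{0..t}|lborel. b s *\<^sub>R (A s / p n (A s)))" for n
    by (rule chain_rule_indefinite_integral[OF bm bb A T L t])
  have plim: "(\<lambda>n. p n u) \<longlonglongrightarrow> \<bar>u\<bar>" for u
  proof -
    have "(\<lambda>n. sqrt ((e n)\<^sup>2 + u\<^sup>2)) \<longlonglongrightarrow> sqrt (0\<^sup>2 + u\<^sup>2)"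
      by (intro tendsto_intros elim)
    then show ?thesis by (simp add: p_def)
  qed
  have "(\<lambda>n. LINT s:{0..t}|lborel. b s *\<^sub>R (A s / p n (A s))) \<longlonglongrightarrow> (LINT s:{0..t}|lborel. b s * sgn (A s))"
    unfolding set_lebesgue_integral_def
  proof (rule integral_dominated_convergence[where w="\<lambda>s. indicator {0..t} s *\<^sub>R B"])
    show "AE s in lborel. (\<lambda>n. indicat_real {0..t} s *\<^sub>R b s *\<^sub>R (A s / p n (A s))) \<longlonglongrightarrow> indicat_real {0..t} s *\<^sub>R (b s * sgn (A s))"
    proof (rule AE_I2)
      fix s
      have "(\<lambda>n. A s / p n (A s)) \<longlonglongrightarrow> sgn (A s)"
      proof (cases "A s = 0")
        case False
        then have "(\<lambda>n. A s / p n (A s)) \<longlonglongrightarrow> A s / \<bar>A s\<bar>" by (intro tendsto_divide tendsto_const plim) auto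
        then show ?thesis using False by (simp add: sgn_if abs_if split: if_splits)
      qed simp
      then show "(\<lambda>n. indicat_real {0..t} s *\<^sub>R b s *\<^sub>R (A s / p n (A s))) \<longlonglongrightarrow> indicat_real {0..t} s *\<^sub>R (b s * sgn (A s))"
        unfolding real_scaleR_def by (intro tendsto_intros)
    qed
    show "AE s in lborel. norm (indicat_real {0..t} s *\<^sub>R b s *\<^sub>R (A s / p n (A s))) \<le> indicat_real {0..t} s *\<^sub>R B" for n
    proof (rule AE_I2)
      fix s
      have "\<bar>A s / p n (A s)\<bar> \<le> 1" using pu[of "A s" n] p0[of n "A s"] by (simp add: abs_divide)
      then have "\<bar>b s\<bar> * \<bar>A s / p n (A s)\<bar> \<le> B * 1" using bb[of s] by (intro mult_mono) auto
      then show "norm (indicat_real {0..t} s *\<^sub>R b s *\<^sub>R (A s / p n (A s))) \<le> indicat_real {0..t} s *\<^sub>R B"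
        by (simp add: abs_mult split: split_indicator)
    qed
  qed (auto simp: p_def emeasure_lborel_Icc_eq intro!: integrable_real_indicator)
  then have "(\<lambda>n. p n y + (LINT s:{0..t}|lborel. b s *\<^sub>R (A s / p n (A s)))) \<longlonglongrightarrow> \<bar>y\<bar> + (LINT s:{0..t}|lborel. b s * sgn (A s))"
    by (intro tendsto_add plim)
  then show ?thesis using LIMSEQ_unique[OF plim[of "A t"]] by (simp add: eq)
qed

section \<open>The noise and paths with an adapted drift\<close>

text \<open>
  Sample the process at the next point of a grid to the right; right continuity gives convergence
  as the grid is refined.
\<close>

lemma right_continuous_jointly_measurable:
  fixes X :: "real \<Rightarrow> 'w \<Rightarrow> real"
  assumes m: "\<And>t. X t \<in> borel_measurable N"
    and rc: "\<And>\<omega> t. \<omega> \<in> space N \<Longrightarrow> ((\<lambda>s. X s \<omega>) \<longlongrightarrow> X t \<omega>) (at_right t)"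
  shows "(\<lambda>(t, \<omega>). X t \<omega>) \<in> borel_measurable (borel \<Otimes>\<^sub>M N)"
proof -
  \<comment> \<open>strictly to the right of \<open>t\<close>, as required by the one-sided limit\<close>
  define g where "g n t = (of_int (\<lfloor>t * real (Suc n)\<rfloor> + 1) / real (Suc n) :: real)" for n t
  have gt: "t < g n t" "g n t \<le> t + 1 / real (Suc n)" for n t
  proof -
    have "t * real (Suc n) < of_int (\<lfloor>t * real (Suc n)\<rfloor> + 1)" by (simp add: floor_less_cancel)
    then show "t < g n t" unfolding g_def by (subst pos_less_divide_eq) auto
    have "of_int (\<lfloor>t * real (Suc n)\<rfloor> + 1) \<le> t * real (Suc n) + 1" by simp
    then have "g n t \<le> (t * real (Suc n) + 1) / real (Suc n)"
      unfolding g_def by (intro divide_right_mono) auto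
    also have "\<dots> = t + 1 / real (Suc n)" by (simp add: add_divide_distrib)
    finally show "g n t \<le> t + 1 / real (Suc n)" .
  qed
  have "(\<lambda>p. X (g n (fst p)) (snd p)) \<in> borel_measurable (borel \<Otimes>\<^sub>M N)" for n
  proof -
    have "(\<lambda>p. X (of_int (i + 1) / real (Suc n)) (snd p)) \<in> borel_measurable ((borel :: real measure) \<Otimes>\<^sub>M N)" for i :: int
      by (rule measurable_compose[OF measurable_snd m])
    moreover have "(\<lambda>p. \<lfloor>fst p * real (Suc n)\<rfloor>) \<in> ((borel :: real measure) \<Otimes>\<^sub>M N) \<rightarrow>\<^sub>M count_space UNIV"
      by measurable
    ultimately show ?thesis
      unfolding g_def by (rule measurable_compose_countable)
  qed
  moreover have "(\<lambda>n. X (g n (fst p)) (snd p)) \<longlonglongrightarrow> (case p of (t, \<omega>) \<Rightarrow> X t \<omega>)" if "p \<in> space (borel \<Otimes>\<^sub>M N)" for p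
  proof -
    obtain t \<omega> where p: "p = (t, \<omega>)" by (cases p)
    then have w: "\<omega> \<in> space N" using that by (auto simp: space_pair_measure)
    have "(\<lambda>n. g n t) \<longlonglongrightarrow> t"
    proof (rule tendsto_sandwich[OF _ _ tendsto_const])
      show "\<forall>\<^sub>F n in sequentially. t \<le> g n t" using gt(1) by (auto intro: always_eventually less_imp_le)
      show "\<forall>\<^sub>F n in sequentially. g n t \<le> t + 1 / real (Suc n)" using gt(2) by (auto intro: always_eventually)
      have "(\<lambda>n. t + 1 / real (Suc n)) \<longlonglongrightarrow> t + 0"
        by (intro tendsto_add tendsto_const LIMSEQ_Suc[OF lim_1_over_n])
      then show "(\<lambda>n. t + 1 / real (Suc n)) \<longlonglongrightarrow> t" by simp
    qed
    then have "filterlim (\<lambda>n. g n t) (at_right t) sequentially"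
      unfolding filterlim_at using gt(1) by (auto intro!: always_eventually simp: less_imp_neq[symmetric])
    from filterlim_compose[OF rc[OF w] this] show ?thesis by (simp add: p)
  qed
  ultimately show ?thesis by (rule borel_measurable_LIMSEQ_real[rotated])
qed

lemma (in prob_space) indep_set_imp_indep_var:
  assumes i: "indep_set (sets N1) (sets N2)" and s: "space N1 = space M" "space N2 = space M"
    and W: "W \<in> N1 \<rightarrow>\<^sub>M T" and U: "U \<in> N2 \<rightarrow>\<^sub>M T"
  shows "indep_var T W T U"
proof -
  have sub: "sets N1 \<subseteq> sets M" "sets N2 \<subseteq> sets M" using indep_setD_ev1[OF i] indep_setD_ev2[OF i] by auto
  have gen: "sigma_sets (space M) {V -` A \<inter> space M |A. A \<in> sets T} \<subseteq> sets N"
    if "V \<in> N \<rightarrow>\<^sub>M T" "space N = space M" for V and N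
  proof -
    have "{V -` A \<inter> space M |A. A \<in> sets T} \<subseteq> sets N"
      using measurable_sets[OF that(1)] that(2) by auto
    then have "sigma_sets (space N) {V -` A \<inter> space M |A. A \<in> sets T} \<subseteq> sets N"
      by (rule sets.sigma_sets_subset)
    then show ?thesis using that(2) by simp
  qed
  show ?thesis
    unfolding indep_var_eq
  proof (intro conjI)
    show "random_variable T W"
      by (rule measurable_from_subalg[OF _ W]) (simp add: subalgebra_def s sub)
    show "random_variable T U"
      by (rule measurable_from_subalg[OF _ U]) (simp add: subalgebra_def s sub)
    show "indep_set (sigma_sets (space M) {W -` A \<inter> space M |A. A \<in> sets T}) (sigma_sets (space M) {U -` A \<inter> space M |A. A \<in> sets T})"
      using i gen[OF W s(1)] gen[OF U s(2)] unfolding indep_set_def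
      by (elim indep_sets_mono_sets) (auto split: bool.split)
  qed
qed

text \<open>
  The constant \<open>c\<close> of the characteristic exponent is a parameter, as all kernels depend on it.
\<close>

locale stable_noise = prob_space M for M :: "'w measure" +
  fixes F :: "real \<Rightarrow> 'w measure" and Z :: "real \<Rightarrow> 'w \<Rightarrow> real" and \<alpha> c :: real
  assumes filt: "filtered_prob_space M F" and \<alpha>: "1 < \<alpha>" "\<alpha> < 2"
    and stab: "symmetric_stable_process M F \<alpha> Z" and c: "c > 0"
    and chr: "\<And>t \<theta>. t \<ge> 0 \<Longrightarrow> char (distr M borel (Z t)) \<theta> = exp (complex_of_real (- (c * t * \<bar>\<theta>\<bar> powr \<alpha>)))"
begin

lemma F_space: "t \<ge> 0 \<Longrightarrow> space (F t) = space M" and F_sets: "t \<ge> 0 \<Longrightarrow> sets (F t) \<subseteq> sets M"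
  using filt by (auto simp: filtered_prob_space_def subalgebra_def)

lemma F_imp_M: "t \<ge> 0 \<Longrightarrow> X \<in> F t \<rightarrow>\<^sub>M N \<Longrightarrow> X \<in> M \<rightarrow>\<^sub>M N"
  using filt by (auto simp: filtered_prob_space_def intro: measurable_from_subalg)

lemma F_mono:
  assumes "0 \<le> s" "s \<le> t"
  shows "sets (F s) \<subseteq> sets (F t)"
proof -
  have "filtration (space M) (\<lambda>t. F (max 0 t))" using filt by (simp add: filtered_prob_space_def)
  then have "sets (F (max 0 s)) \<subseteq> sets (F (max 0 t))" using assms(2) by (rule filtration.sets_F_mono)
  then show ?thesis using assms by simp
qed

lemma F_measurable_mono:
  assumes "0 \<le> s" "s \<le> t" "X \<in> F s \<rightarrow>\<^sub>M N"
  shows "X \<in> F t \<rightarrow>\<^sub>M N"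
  by (rule measurable_from_subalg[OF _ assms(3)])
     (use F_mono[OF assms(1,2)] assms F_space[of s] F_space[of t] in \<open>simp add: subalgebra_def\<close>)

lemma Z_F: "t \<ge> 0 \<Longrightarrow> Z t \<in> borel_measurable (F t)"
  using stab by (auto simp: symmetric_stable_process_def adapted_def)

lemma Z_M[measurable]: "Z (max 0 t) \<in> borel_measurable M"
  by (rule F_imp_M[OF _ Z_F]) auto

lemma Z_M': "t \<ge> 0 \<Longrightarrow> Z t \<in> borel_measurable M"
  by (rule F_imp_M[OF _ Z_F]) auto

lemma Z_0: "\<omega> \<in> space M \<Longrightarrow> Z 0 \<omega> = 0"
  using stab by (auto simp: symmetric_stable_process_def)

lemma Z_cadlag: "\<omega> \<in> space M \<Longrightarrow> cadlag (\<lambda>t. Z t \<omega>)"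
  using stab by (auto simp: symmetric_stable_process_def)

lemma right_continuous_clamp:
  fixes f :: "real \<Rightarrow> real"
  assumes "\<And>t. t \<ge> 0 \<Longrightarrow> (f \<longlongrightarrow> f t) (at_right t)"
  shows "((\<lambda>s. f (max 0 s)) \<longlongrightarrow> f (max 0 t)) (at_right t)"
proof (cases "t \<ge> 0")
  case True
  have "eventually (\<lambda>s. f s = f (max 0 s)) (at_right t)"
    using True by (auto simp: eventually_at_right_field intro!: exI[of _ "t + 1"])
  from tendsto_cong[OF this] assms[OF True] show ?thesis using True by simp
next
  case False
  have "eventually (\<lambda>s. f 0 = f (max 0 s)) (at_right t)"
    using False by (auto simp: eventually_at_right_field intro!: exI[of _ 0])
  from Lim_transform_eventually[OF tendsto_const this] show ?thesis using False by simp
qed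

lemma Z_joint[measurable]: "(\<lambda>(t, \<omega>). Z (max 0 t) \<omega>) \<in> borel_measurable (borel \<Otimes>\<^sub>M M)"
proof (rule right_continuous_jointly_measurable)
  fix \<omega> t assume "\<omega> \<in> space M"
  then show "((\<lambda>s. Z (max 0 s) \<omega>) \<longlongrightarrow> Z (max 0 t) \<omega>) (at_right t)"
    using right_continuous_clamp[of "\<lambda>s. Z s \<omega>"] Z_cadlag by (auto simp: cadlag_def)
qed (rule Z_M)

text \<open>
  Solutions satisfy their equation only almost surely, and the filtration need not be complete, so
  measurability at time \<open>t\<close> is asked for up to a null set. Independence of the future increments of
  \<open>Z\<close> is not affected by this.
\<close>

definition known_at :: "real \<Rightarrow> ('w \<Rightarrow> real) \<Rightarrow> bool" where
  "known_at t X \<longleftrightarrow> (\<exists>Y\<in>borel_measurable (F t). AE \<omega> in M. X \<omega> = Y \<omega>)"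

lemma known_at_measurable: "X \<in> borel_measurable (F t) \<Longrightarrow> known_at t X"
  unfolding known_at_def by auto

lemma known_at_compose:
  assumes "known_at t X" "known_at t Y" and g: "(\<lambda>(x, y). g x y) \<in> borel_measurable (borel \<Otimes>\<^sub>M borel)"
  shows "known_at t (\<lambda>\<omega>. g (X \<omega>) (Y \<omega>))"
proof -
  obtain X' where [measurable]: "X' \<in> borel_measurable (F t)" and X': "AE \<omega> in M. X \<omega> = X' \<omega>"
    using assms(1) unfolding known_at_def by blast
  obtain Y' where [measurable]: "Y' \<in> borel_measurable (F t)" and Y': "AE \<omega> in M. Y \<omega> = Y' \<omega>"
    using assms(2) unfolding known_at_def by blast
  from X' Y' have "AE \<omega> in M. g (X \<omega>) (Y \<omega>) = g (X' \<omega>) (Y' \<omega>)" by eventually_elim simp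
  moreover have "(\<lambda>\<omega>. (X' \<omega>, Y' \<omega>)) \<in> F t \<rightarrow>\<^sub>M borel \<Otimes>\<^sub>M borel" by measurable
  from measurable_compose[OF this g] have "(\<lambda>\<omega>. g (X' \<omega>) (Y' \<omega>)) \<in> borel_measurable (F t)" by simp
  ultimately show ?thesis
    unfolding known_at_def by (intro bexI[where x="\<lambda>\<omega>. g (X' \<omega>) (Y' \<omega>)"])
qed

text \<open>
  The increment of the noise after time \<open>s\<close> is independent of \<open>F s\<close>, and stationarity gives its
  characteristic function.
\<close>

lemma integral_iexp_increment:
  assumes s: "0 \<le> s" "s \<le> t" and X: "known_at s X" and b: "known_at s b"
    and [measurable]: "X \<in> borel_measurable M" "b \<in> borel_measurable M" and bB: "\<And>\<omega>. \<bar>b \<omega>\<bar> \<le> B"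
  shows "(LINT \<omega>|M. complex_of_real (b \<omega>) * iexp (\<theta> * X \<omega>) * iexp (\<theta> * (Z t \<omega> - Z s \<omega>)))
    = complex_of_real (exp (- (c * (t - s) * \<bar>\<theta>\<bar> powr \<alpha>))) * (LINT \<omega>|M. complex_of_real (b \<omega>) * iexp (\<theta> * X \<omega>))"
proof -
  obtain X' where XF[measurable]: "X' \<in> borel_measurable (F s)" and ae1: "AE \<omega> in M. X \<omega> = X' \<omega>"
    using X unfolding known_at_def by blast
  obtain b' where bF[measurable]: "b' \<in> borel_measurable (F s)" and ae2: "AE \<omega> in M. b \<omega> = b' \<omega>"
    using b unfolding known_at_def by blast
  note ae = ae1 ae2
  have [measurable]: "X' \<in> borel_measurable M" "b' \<in> borel_measurable M"
    by (rule F_imp_M[OF s(1) XF]) (rule F_imp_M[OF s(1) bF])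
  have [measurable]: "Z t \<in> borel_measurable M" "Z s \<in> borel_measurable M" using s by (auto intro: Z_M')
  define U where "U \<omega> = complex_of_real (b' \<omega>) * iexp (\<theta> * X' \<omega>)" for \<omega>
  define I where "I \<omega> = Z (s + (t - s)) \<omega> - Z s \<omega>" for \<omega>
  define W where "W \<omega> = iexp (\<theta> * I \<omega>)" for \<omega>
  have Um[measurable]: "U \<in> borel_measurable (F s)" unfolding U_def by measurable
  have UM[measurable]: "U \<in> borel_measurable M" using F_imp_M[OF s(1) Um] .
  have [measurable]: "I \<in> borel_measurable M" unfolding I_def by simp
  have WM[measurable]: "W \<in> borel_measurable M" unfolding W_def by measurable
  have "indep_set (sets (vimage_algebra (space M) I borel)) (sets (F s))"
  proof -
    have "\<And>t s. 0 \<le> t \<Longrightarrow> 0 \<le> s \<Longrightarrow> indep_set (sets (vimage_algebra (space M) (\<lambda>\<omega>. Z (t + s) \<omega> - Z t \<omega>) borel)) (sets (F t))"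
      using stab unfolding symmetric_stable_process_def by blast
    from this[of s "t - s"] show ?thesis using s unfolding I_def[abs_def] by simp
  qed
  then have iv: "indep_var borel W borel U"
  proof (rule indep_set_imp_indep_var)
    have "I \<in> vimage_algebra (space M) I borel \<rightarrow>\<^sub>M borel" by (rule measurable_vimage_algebra1) auto
    then show "W \<in> vimage_algebra (space M) I borel \<rightarrow>\<^sub>M borel"
      unfolding W_def by measurable
  qed (use s F_space in auto)
  have Wi: "integrable M W" by (rule integrable_const_bound[where B=1]) (auto simp: W_def)
  have Ui: "integrable M U"
  proof (rule integrable_const_bound[where B=B])
    show "AE \<omega> in M. norm (U \<omega>) \<le> B" 
      using ae(2)
    proof eventually_elim
      case (elim \<omega>)
      then show ?case using bB[of \<omega>] by (simp add: U_def norm_mult)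
    qed
  qed simp
  have EW: "(LINT \<omega>|M. W \<omega>) = complex_of_real (exp (- (c * (t - s) * \<bar>\<theta>\<bar> powr \<alpha>)))"
  proof -
    have "(LINT \<omega>|M. W \<omega>) = char (distr M borel I) \<theta>"
      unfolding char_def W_def by (subst integral_distr) auto
    also have "distr M borel I = distr M borel (\<lambda>\<omega>. Z (t - s) \<omega> - Z 0 \<omega>)"
    proof -
      have "\<And>t s. 0 \<le> t \<Longrightarrow> 0 \<le> s \<Longrightarrow> distr M borel (\<lambda>\<omega>. Z (t + s) \<omega> - Z t \<omega>) = distr M borel (\<lambda>\<omega>. Z s \<omega> - Z 0 \<omega>)"
        using stab unfolding symmetric_stable_process_def stationary_increments_def by blast
      from this[of s "t - s"] show ?thesis using s unfolding I_def[abs_def] by simp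
    qed
    also have "\<dots> = distr M borel (Z (t - s))" by (rule distr_cong) (auto simp: Z_0)
    finally show ?thesis using chr[of "t - s" \<theta>] s by (simp only: exp_of_real)
  qed
  have "(LINT \<omega>|M. complex_of_real (b \<omega>) * iexp (\<theta> * X \<omega>) * iexp (\<theta> * (Z t \<omega> - Z s \<omega>))) = (LINT \<omega>|M. W \<omega> * U \<omega>)"
  proof (rule integral_cong_AE)
    show "AE \<omega> in M. complex_of_real (b \<omega>) * iexp (\<theta> * X \<omega>) * iexp (\<theta> * (Z t \<omega> - Z s \<omega>)) = W \<omega> * U \<omega>"
      using ae by eventually_elim (simp add: W_def U_def I_def)
  qed measurable
  also have "\<dots> = (LINT \<omega>|M. W \<omega>) * (LINT \<omega>|M. U \<omega>)"
    by (rule indep_var_lebesgue_integral[OF iv Wi Ui])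
  also have "(LINT \<omega>|M. U \<omega>) = (LINT \<omega>|M. complex_of_real (b \<omega>) * iexp (\<theta> * X \<omega>))"
  proof (rule integral_cong_AE)
    show "AE \<omega> in M. U \<omega> = complex_of_real (b \<omega>) * iexp (\<theta> * X \<omega>)"
      using ae by eventually_elim (simp add: U_def)
  qed measurable
  finally show ?thesis by (simp add: EW)
qed

text \<open>
  The noise is read at \<open>max 0 t\<close> since \<open>Z\<close> is unconstrained at negative times.
\<close>

definition path :: "real \<Rightarrow> (real \<Rightarrow> 'w \<Rightarrow> real) \<Rightarrow> real \<Rightarrow> 'w \<Rightarrow> real" where
  "path x \<beta> t \<omega> = x + (LINT s:{0..t}|lborel. \<beta> s \<omega>) + Z (max 0 t) \<omega>"

text \<open>
  The drift is an arbitrary bounded process and not a function of the path. This generality is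
  needed for approximate solutions and for the maximum of two solutions.
\<close>

definition drifted :: "real \<Rightarrow> real \<Rightarrow> (real \<Rightarrow> 'w \<Rightarrow> real) \<Rightarrow> bool" where
  "drifted B x \<beta> \<longleftrightarrow> (\<lambda>(t, \<omega>). \<beta> t \<omega>) \<in> borel_measurable (borel \<Otimes>\<^sub>M M) \<and>
     (\<forall>t \<omega>. \<bar>\<beta> t \<omega>\<bar> \<le> B) \<and> (\<forall>t\<ge>0. known_at t (\<beta> t) \<and> known_at t (path x \<beta> t))"

lemma path_joint:
  assumes "(\<lambda>(t, \<omega>). \<beta> t \<omega>) \<in> borel_measurable (borel \<Otimes>\<^sub>M M)"
  shows "(\<lambda>(t, \<omega>). path x \<beta> t \<omega>) \<in> borel_measurable (borel \<Otimes>\<^sub>M M)"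
  using measurable_indefinite_integral_joint[OF assms] Z_joint
  unfolding path_def by (simp add: case_prod_beta')

lemma joint_section:
  assumes "(\<lambda>(t, \<omega>). u t \<omega>) \<in> borel_measurable (borel \<Otimes>\<^sub>M M)"
  shows "u t \<in> borel_measurable M" and "\<omega> \<in> space M \<Longrightarrow> (\<lambda>t. u t \<omega>) \<in> borel_measurable borel"
  using measurable_compose[OF measurable_Pair1' assms, of t] measurable_compose[OF measurable_Pair2' assms, of \<omega>]
  by auto

text \<open>
  The variation of constants formula for \<open>E (iexp (\<theta> * \<xi> t))\<close>. The chain rule is applied to the
  absolutely continuous part \<open>A\<close> of the path \<open>\<xi> = A + Z\<close>, at the fixed final value \<open>Z t\<close> of the
  noise; then \<open>Z t\<close> is split into \<open>Z s\<close> and the increment after \<open>s\<close>, which is averaged out.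
\<close>

lemma char_duhamel:
  fixes \<theta> :: real
  assumes d: "drifted B x \<beta>" and t: "t \<ge> 0"
  defines "\<psi> \<equiv> c * \<bar>\<theta>\<bar> powr \<alpha>"
  shows "(LINT \<omega>|M. iexp (\<theta> * path x \<beta> t \<omega>)) = iexp (\<theta> * x) * complex_of_real (exp (- (t * \<psi>)))
    + \<i> * \<theta> * (LINT s:{0..t}|lborel. complex_of_real (exp (- ((t - s) * \<psi>))) * (LINT \<omega>|M. complex_of_real (\<beta> s \<omega>) * iexp (\<theta> * path x \<beta> s \<omega>)))"
proof -
  have bj[measurable]: "(\<lambda>(t, \<omega>). \<beta> t \<omega>) \<in> borel_measurable (borel \<Otimes>\<^sub>M M)" and bb: "\<And>t \<omega>. \<bar>\<beta> t \<omega>\<bar> \<le> B"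
    and bk: "\<And>t. t \<ge> 0 \<Longrightarrow> known_at t (\<beta> t)" and pk: "\<And>t. t \<ge> 0 \<Longrightarrow> known_at t (path x \<beta> t)"
    using d by (auto simp: drifted_def)
  interpret P: pair_sigma_finite lborel M ..
  have B0: "B \<ge> 0" using bb[of 0 undefined] by linarith
  define A where "A s \<omega> = x + (LINT r:{0..s}|lborel. \<beta> r \<omega>)" for s \<omega>
  have Aj[measurable]: "(\<lambda>(t, \<omega>). A t \<omega>) \<in> borel_measurable (borel \<Otimes>\<^sub>M M)"
    using measurable_indefinite_integral_joint[OF bj] unfolding A_def by (simp add: case_prod_beta')
  have [measurable]: "(\<lambda>(t, \<omega>). path x \<beta> t \<omega>) \<in> borel_measurable (borel \<Otimes>\<^sub>M M)" by (rule path_joint[OF bj])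
  have [measurable]: "Z t \<in> borel_measurable M" using t by (rule Z_M')
  have [measurable]: "A t \<in> borel_measurable M" by (rule joint_section(1)[OF Aj])
  have pA: "path x \<beta> s \<omega> = A s \<omega> + Z s \<omega>" if "s \<ge> 0" for s \<omega> using that by (simp add: path_def A_def)
  let ?f = "\<lambda>s \<omega>. indicator {0..t} s *\<^sub>R (\<beta> s \<omega> *\<^sub>R (\<i> * \<theta> * iexp (\<theta> * A s \<omega>))) * iexp (\<theta> * Z t \<omega>)"
  have fi: "integrable (lborel \<Otimes>\<^sub>M M) (\<lambda>(s, \<omega>). ?f s \<omega>)"
  proof (rule Bochner_Integration.integrable_bound)
    have "integrable lborel (\<lambda>s. indicator {0..t} s * (B * \<bar>\<theta>\<bar>))"
      using set_integrable_bounded_Icc[of "\<lambda>_. B * \<bar>\<theta>\<bar>" 0 t "\<bar>B * \<bar>\<theta>\<bar>\<bar>"] by (simp add: set_integrable_def)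
    then show "integrable (lborel \<Otimes>\<^sub>M M) (\<lambda>(s, \<omega>). indicator {0..t} s * (B * \<bar>\<theta>\<bar>))"
      by (intro P.Fubini_integrable) (auto simp: prob_space abs_mult)
    show "AE p in lborel \<Otimes>\<^sub>M M. norm (case p of (s, \<omega>) \<Rightarrow> ?f s \<omega>) \<le> norm (case p of (s, \<omega>) \<Rightarrow> indicator {0..t} s * (B * \<bar>\<theta>\<bar>))"
      using bb B0 by (auto simp: norm_mult split: split_indicator intro!: AE_I2 mult_right_mono)
    have "(\<lambda>(s, \<omega>). ?f s \<omega>) \<in> borel_measurable (borel \<Otimes>\<^sub>M M)" by measurable
    then show "(\<lambda>(s, \<omega>). ?f s \<omega>) \<in> borel_measurable (lborel \<Otimes>\<^sub>M M)" by simp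
  qed
  have e1: "iexp (\<theta> * path x \<beta> t \<omega>) = iexp (\<theta> * x) * iexp (\<theta> * Z t \<omega>) + (LINT s|lborel. ?f s \<omega>)"
    if w: "\<omega> \<in> space M" for \<omega>
  proof -
    have "iexp (\<theta> * path x \<beta> t \<omega>) = iexp (\<theta> * A t \<omega>) * iexp (\<theta> * Z t \<omega>)"
      using t by (simp add: pA distrib_left exp_add)
    also have "iexp (\<theta> * A t \<omega>) = iexp (\<theta> * x) + (LINT s:{0..t}|lborel. \<beta> s \<omega> *\<^sub>R (\<i> * \<theta> * iexp (\<theta> * A s \<omega>)))"
      by (rule iexp_indefinite_integral[where b="\<lambda>s. \<beta> s \<omega>" and B=B]) (use joint_section(2)[OF bj w] bb t in \<open>auto simp: A_def\<close>)
    finally show ?thesis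
      by (simp only: set_lebesgue_integral_def distrib_right integral_mult_left_zero)
  qed
  have i1: "integrable M (\<lambda>\<omega>. iexp (\<theta> * x) * iexp (\<theta> * Z t \<omega>))"
    by (rule integrable_const_bound[where B=1]) (auto simp: norm_mult)
  have i2: "integrable M (\<lambda>\<omega>. LINT s|lborel. ?f s \<omega>)" by (rule P.integrable_snd[OF fi])
  have "(LINT \<omega>|M. iexp (\<theta> * path x \<beta> t \<omega>)) = (LINT \<omega>|M. iexp (\<theta> * x) * iexp (\<theta> * Z t \<omega>) + (LINT s|lborel. ?f s \<omega>))"
    by (rule Bochner_Integration.integral_cong[OF refl e1])
  also have "\<dots> = (LINT \<omega>|M. iexp (\<theta> * x) * iexp (\<theta> * Z t \<omega>)) + (LINT \<omega>|M. LINT s|lborel. ?f s \<omega>)"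
    by (rule Bochner_Integration.integral_add[OF i1 i2])
  also have "(LINT \<omega>|M. iexp (\<theta> * x) * iexp (\<theta> * Z t \<omega>)) = iexp (\<theta> * x) * char (distr M borel (Z t)) \<theta>"
    unfolding char_def by (subst integral_distr) auto
  also have "char (distr M borel (Z t)) \<theta> = complex_of_real (exp (- (t * \<psi>)))"
  proof -
    have "c * t * \<bar>\<theta>\<bar> powr \<alpha> = t * \<psi>" by (simp add: \<psi>_def)
    then show ?thesis by (simp only: chr[OF t] exp_of_real)
  qed
  also have "(LINT \<omega>|M. LINT s|lborel. ?f s \<omega>) = (LINT s|lborel. LINT \<omega>|M. ?f s \<omega>)"
    by (rule P.Fubini_integral[OF fi])
  also have "\<dots> = (LINT s|lborel. \<i> * \<theta> * (indicator {0..t} s *\<^sub>R (complex_of_real (exp (- ((t - s) * \<psi>))) * (LINT \<omega>|M. complex_of_real (\<beta> s \<omega>) * iexp (\<theta> * path x \<beta> s \<omega>)))))"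
  proof (intro Bochner_Integration.integral_cong refl)
    fix s :: real
    show "(LINT \<omega>|M. ?f s \<omega>) = \<i> * \<theta> * (indicator {0..t} s *\<^sub>R (complex_of_real (exp (- ((t - s) * \<psi>))) * (LINT \<omega>|M. complex_of_real (\<beta> s \<omega>) * iexp (\<theta> * path x \<beta> s \<omega>))))"
    proof (cases "s \<in> {0..t}")
      case True
      have "(LINT \<omega>|M. ?f s \<omega>) = (LINT \<omega>|M. \<i> * \<theta> * (complex_of_real (\<beta> s \<omega>) * iexp (\<theta> * path x \<beta> s \<omega>) * iexp (\<theta> * (Z t \<omega> - Z s \<omega>))))"
      proof (intro Bochner_Integration.integral_cong refl)
        fix \<omega>
        have "iexp (\<theta> * A s \<omega>) * iexp (\<theta> * Z t \<omega>) = iexp (\<theta> * path x \<beta> s \<omega>) * iexp (\<theta> * (Z t \<omega> - Z s \<omega>))"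
          using True by (simp add: pA exp_add[symmetric] algebra_simps)
        then have "\<i> * \<theta> * complex_of_real (\<beta> s \<omega>) * (iexp (\<theta> * A s \<omega>) * iexp (\<theta> * Z t \<omega>))
           = \<i> * \<theta> * complex_of_real (\<beta> s \<omega>) * (iexp (\<theta> * path x \<beta> s \<omega>) * iexp (\<theta> * (Z t \<omega> - Z s \<omega>)))" by simp
        then show "?f s \<omega> = \<i> * \<theta> * (complex_of_real (\<beta> s \<omega>) * iexp (\<theta> * path x \<beta> s \<omega>) * iexp (\<theta> * (Z t \<omega> - Z s \<omega>)))"
          using True by (simp only: scaleR_conv_of_real indicator_simps of_real_1 mult_1_left) (simp add: mult_ac)
      qed
      also have "\<dots> = \<i> * \<theta> * (LINT \<omega>|M. complex_of_real (\<beta> s \<omega>) * iexp (\<theta> * path x \<beta> s \<omega>) * iexp (\<theta> * (Z t \<omega> - Z s \<omega>)))"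
        by (rule integral_mult_right_zero)
      also have "(LINT \<omega>|M. complex_of_real (\<beta> s \<omega>) * iexp (\<theta> * path x \<beta> s \<omega>) * iexp (\<theta> * (Z t \<omega> - Z s \<omega>)))
        = complex_of_real (exp (- (c * (t - s) * \<bar>\<theta>\<bar> powr \<alpha>))) * (LINT \<omega>|M. complex_of_real (\<beta> s \<omega>) * iexp (\<theta> * path x \<beta> s \<omega>))"
        using True joint_section(1)[OF bj] joint_section(1)[OF path_joint[OF bj]]
        by (intro integral_iexp_increment[where B=B] pk bk bb) auto
      also have "c * (t - s) * \<bar>\<theta>\<bar> powr \<alpha> = (t - s) * \<psi>" by (simp add: \<psi>_def)
      finally show ?thesis using True by simp
    qed simp
  qed
  also have "\<dots> = \<i> * \<theta> * (LINT s:{0..t}|lborel. complex_of_real (exp (- ((t - s) * \<psi>))) * (LINT \<omega>|M. complex_of_real (\<beta> s \<omega>) * iexp (\<theta> * path x \<beta> s \<omega>)))"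
    unfolding set_lebesgue_integral_def by (rule integral_mult_right_zero)
  finally show ?thesis .
qed

end

text \<open>
  \<open>T\<close> is the law of an exponential time of rate \<open>l\<close>, and \<open>Q\<close> the joint law of this time and an
  independent noise. The kernel \<open>k\<close> is minus the derivative of the resolvent density, so \<open>l * D f\<close> is
  the derivative of the function \<open>y \<mapsto> E\<^sub>Q f(y + Z)\<close>.
\<close>

locale killed_noise = stable_noise M F Z \<alpha> c
  for M :: "'w measure" and F :: "real \<Rightarrow> 'w measure" and Z :: "real \<Rightarrow> 'w \<Rightarrow> real" and \<alpha> c :: real +
  fixes l :: real and k :: "real \<Rightarrow> real"
  assumes l: "l > 0" and k: "integrable lborel k"
    and k_fourier: "\<And>\<theta>. (LINT w|lborel. complex_of_real (k w) * iexp (\<theta> * w)) = \<i> * \<theta> / complex_of_real (l + c * \<bar>\<theta>\<bar> powr \<alpha>)"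
begin

definition T :: "real measure" where "T = density lborel (exponential_density l)"
definition Q :: "(real \<times> 'w) measure" where "Q = T \<Otimes>\<^sub>M M"
definition D :: "(real \<Rightarrow> real) \<Rightarrow> real \<Rightarrow> real" where "D f y = (LINT w|lborel. k w * f (y + w))"
definition kappa :: real where "kappa = (LINT w|lborel. \<bar>k w\<bar>)"

lemma T_sets[measurable_cong, simp]: "sets T = sets borel" and T_space[simp]: "space T = UNIV"
  by (simp_all add: T_def)

sublocale T: prob_space T
  unfolding T_def by (rule prob_space_exponential_density[OF l])

sublocale TM: pair_prob_space T M ..

lemma Q_sets[measurable_cong, simp]: "sets Q = sets (borel \<Otimes>\<^sub>M M)"
  unfolding Q_def by (rule sets_pair_measure_cong) auto

lemma Q_space: "space Q = UNIV \<times> space M"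
  by (simp add: Q_def space_pair_measure)

sublocale Q: prob_space Q
  unfolding Q_def by (rule TM.prob_space_axioms)

lemma k_measurable[measurable]: "k \<in> borel_measurable borel"
  using k by simp

lemma integral_T:
  fixes f :: "real \<Rightarrow> 'a::{banach, second_countable_topology}"
  assumes [measurable]: "f \<in> borel_measurable borel"
  shows "(LINT t|T. f t) = (LINT t|lborel. exponential_density l t *\<^sub>R f t)"
  unfolding T_def by (rule integral_density) (auto simp: exponential_density_nonneg[OF l])

lemma AE_T_nonneg: "AE t in T. t \<ge> 0"
  unfolding T_def by (subst AE_density) (auto simp: exponential_density_def)

lemma AE_Q_nonneg: "AE z in Q. fst z \<ge> 0"
  unfolding Q_def
proof (rule TM.AE_pair_measure)
  show "{z \<in> space (T \<Otimes>\<^sub>M M). fst z \<ge> 0} \<in> sets (T \<Otimes>\<^sub>M M)" by measurable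
  show "AE t in T. AE \<omega> in M. fst (t, \<omega>) \<ge> 0" using AE_T_nonneg by simp
qed

lemma joint_Q:
  assumes "(\<lambda>(t, \<omega>). u t \<omega>) \<in> borel_measurable (borel \<Otimes>\<^sub>M M)"
  shows "(\<lambda>z. u (fst z) (snd z)) \<in> borel_measurable Q"
  using assms by (simp add: case_prod_beta' cong: measurable_cong_sets)

lemma integrable_Q_bounded:
  fixes u :: "real \<Rightarrow> 'w \<Rightarrow> 'a::{banach, second_countable_topology}"
  assumes "(\<lambda>(t, \<omega>). u t \<omega>) \<in> borel_measurable (borel \<Otimes>\<^sub>M M)" "\<And>t \<omega>. norm (u t \<omega>) \<le> C"
  shows "integrable Q (\<lambda>z. u (fst z) (snd z))"
  by (rule Q.integrable_const_bound[where B=C]) (use assms joint_Q in auto)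

lemma integral_Q_iterated:
  fixes u :: "real \<Rightarrow> 'w \<Rightarrow> 'a::{banach, second_countable_topology}"
  assumes "(\<lambda>(t, \<omega>). u t \<omega>) \<in> borel_measurable (borel \<Otimes>\<^sub>M M)" "\<And>t \<omega>. norm (u t \<omega>) \<le> C"
  shows "(LINT z|Q. u (fst z) (snd z)) = (LINT t|T. LINT \<omega>|M. u t \<omega>)"
  using TM.integral_fst[of u] integrable_Q_bounded[OF assms] by (simp add: Q_def case_prod_beta')

lemma integral_T_exp:
  assumes "\<psi> \<ge> 0"
  shows "(LINT t|T. exp (- (t * \<psi>))) = l / (l + \<psi>)"
proof -
  have "(LINT t|T. exp (- (t * \<psi>))) = (LINT t|lborel. exponential_density l t *\<^sub>R exp (- (t * \<psi>)))"
    by (rule integral_T) simp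
  also have "\<dots> = (LINT t|lborel. l * (indicator {0<..} t *\<^sub>R exp (- ((l + \<psi>) * t))))"
  proof (rule integral_cong_AE)
    show "AE t in lborel. exponential_density l t *\<^sub>R exp (- (t * \<psi>)) = l * (indicator {0<..} t *\<^sub>R exp (- ((l + \<psi>) * t)))"
      using AE_lborel_singleton[of 0]
      by eventually_elim (auto simp: exponential_density_def exp_add[symmetric] algebra_simps split: split_indicator)
  qed auto
  also have "\<dots> = l * (1 / (l + \<psi>))"
    using set_integral_exp_decay[of "l + \<psi>"] l assms by (simp add: set_lebesgue_integral_def)
  finally show ?thesis by simp
qed

text \<open>
  Fubini: an exponential time restarted at \<open>s\<close> is again exponential, so the inner integral over
  \<open>t \<ge> s\<close> is the Laplace transform of \<open>exp (- u \<psi>)\<close>.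
\<close>

lemma integral_T_convolution:
  fixes h :: "real \<Rightarrow> complex"
  assumes hm[measurable]: "h \<in> borel_measurable borel" and hb: "\<And>s. norm (h s) \<le> C" and \<psi>: "\<psi> \<ge> 0"
  shows "integrable T (\<lambda>t. LINT s:{0..t}|lborel. complex_of_real (exp (- ((t - s) * \<psi>))) * h s)"
    and "(LINT t|T. (LINT s:{0..t}|lborel. complex_of_real (exp (- ((t - s) * \<psi>))) * h s)) = (LINT s|T. h s) / complex_of_real (l + \<psi>)"
proof -
  \<comment> \<open>the exponential density at \<open>t\<close> is the one at \<open>s\<close> times \<open>exp (- l (t - s))\<close>; with the kernel this gives \<open>G (t - s)\<close>\<close>
  define G where "G u = indicator {0<..} u *\<^sub>R exp (- ((l + \<psi>) * u))" for u :: real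
  have Gm[measurable]: "G \<in> borel_measurable borel" unfolding G_def by measurable
  have Gi: "integrable lborel G"
    using set_integrable_exp_decay[of "l + \<psi>"] l \<psi> unfolding G_def set_integrable_def by simp
  have Gv: "(LINT u|lborel. G u) = 1 / (l + \<psi>)"
    using set_integral_exp_decay[of "l + \<psi>"] l \<psi> unfolding G_def set_lebesgue_integral_def by simp
  have G0: "G u \<ge> 0" for u by (simp add: G_def)
  have Gs: "integrable lborel (\<lambda>t. G (- s + 1 * t))" for s by (rule lborel_integrable_real_affine[OF Gi]) simp
  have Gsv: "(LINT t|lborel. G (- s + 1 * t)) = 1 / (l + \<psi>)" for s
    using lborel_integral_real_affine[of 1 G "- s"] Gv by simp
  let ?e = "exponential_density l"
  let ?f = "\<lambda>s t. G (- s + 1 * t) *\<^sub>R (?e s *\<^sub>R h s)"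
  have ehi: "integrable lborel (\<lambda>s. ?e s *\<^sub>R h s)"
  proof -
    have "integrable T h" by (rule T.integrable_const_bound[where B=C]) (use hb in auto)
    then show ?thesis unfolding T_def by (subst (asm) integrable_density) (auto simp: exponential_density_nonneg[OF l])
  qed
  have fi: "integrable (lborel \<Otimes>\<^sub>M lborel) (\<lambda>(s, t). ?f s t)"
  proof (rule lborel_pair.Fubini_integrable)
    have "(\<lambda>s. LINT t|lborel. norm (?f s t)) = (\<lambda>s. norm (?e s *\<^sub>R h s) * (1 / (l + \<psi>)))"
    proof
      fix s
      have "(LINT t|lborel. norm (?f s t)) = (LINT t|lborel. G (- s + 1 * t) * norm (?e s *\<^sub>R h s))"
        by (intro Bochner_Integration.integral_cong) (simp_all add: abs_mult G0)
      also have "\<dots> = (LINT t|lborel. G (- s + 1 * t)) * norm (?e s *\<^sub>R h s)" by (rule integral_mult_left_zero)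
      finally show "(LINT t|lborel. norm (?f s t)) = norm (?e s *\<^sub>R h s) * (1 / (l + \<psi>))"
        unfolding Gsv by (simp only: mult.commute)
    qed
    then show "integrable lborel (\<lambda>s. LINT t|lborel. norm (case (s, t) of (s, t) \<Rightarrow> ?f s t))"
      using integrable_mult_left[OF integrable_norm[OF ehi], of "1 / (l + \<psi>)"] by simp
    show "AE s in lborel. integrable lborel (\<lambda>t. case (s, t) of (s, t) \<Rightarrow> ?f s t)"
      using Gs by (intro AE_I2) (simp add: integrable_scaleR_left)
  qed measurable
  let ?c = "\<lambda>t. LINT s:{0..t}|lborel. complex_of_real (exp (- ((t - s) * \<psi>))) * h s"
  have cm[measurable]: "?c \<in> borel_measurable borel"
  proof -
    have "(\<lambda>t. complex_of_real (exp (- (t * \<psi>))) * (0 + (LINT s:{0..t}|lborel. complex_of_real (exp (s * \<psi>)) * h s))) \<in> borel_measurable borel"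
      by measurable
    also have "(\<lambda>t. complex_of_real (exp (- (t * \<psi>))) * (0 + (LINT s:{0..t}|lborel. complex_of_real (exp (s * \<psi>)) * h s)))
       = (\<lambda>t. LINT s:{0..t}|lborel. complex_of_real (exp (- ((t - s) * \<psi>))) * h s)"
    proof
      fix t
      have "complex_of_real (exp (- (t * \<psi>))) * (LINT s:{0..t}|lborel. complex_of_real (exp (s * \<psi>)) * h s)
        = (LINT s:{0..t}|lborel. complex_of_real (exp (- (t * \<psi>))) * (complex_of_real (exp (s * \<psi>)) * h s))"
        by (rule set_integral_mult_right[symmetric])
      also have "\<dots> = (LINT s:{0..t}|lborel. complex_of_real (exp (- ((t - s) * \<psi>))) * h s)"
      proof -
        have "exp (- (t * \<psi>)) * exp (s * \<psi>) = exp (- ((t - s) * \<psi>))" for s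
          by (simp add: exp_add[symmetric] algebra_simps)
        then show ?thesis by (simp only: mult.assoc[symmetric] of_real_mult[symmetric])
      qed
      finally show "complex_of_real (exp (- (t * \<psi>))) * (0 + (LINT s:{0..t}|lborel. complex_of_real (exp (s * \<psi>)) * h s)) = (LINT s:{0..t}|lborel. complex_of_real (exp (- ((t - s) * \<psi>))) * h s)" by simp
    qed
    finally show ?thesis .
  qed
  have ceq: "?e t *\<^sub>R ?c t = (LINT s|lborel. ?f s t)" for t :: real
  proof -
    have "?e t *\<^sub>R (LINT s:{0..t}|lborel. complex_of_real (exp (- ((t - s) * \<psi>))) * h s)
       = (LINT s|lborel. ?e t *\<^sub>R (indicator {0..t} s *\<^sub>R (complex_of_real (exp (- ((t - s) * \<psi>))) * h s)))"
      unfolding set_lebesgue_integral_def by (rule integral_scaleR_right[symmetric])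
    also have "\<dots> = (LINT s|lborel. ?f s t)"
    proof (rule integral_cong_AE)
      show "AE s in lborel. ?e t *\<^sub>R (indicator {0..t} s *\<^sub>R (complex_of_real (exp (- ((t - s) * \<psi>))) * h s)) = ?f s t"
        using AE_lborel_singleton[of t]
      proof eventually_elim
        case (elim s)
        show ?case
        proof (cases "0 \<le> s \<and> s < t")
          case True
          have "l * exp (- t * l) * exp (- ((t - s) * \<psi>)) = exp (- ((l + \<psi>) * (- s + 1 * t))) * (l * exp (- s * l))"
            by (simp add: exp_add[symmetric] algebra_simps)
          then have "complex_of_real (l * exp (- t * l) * exp (- ((t - s) * \<psi>))) = complex_of_real (exp (- ((l + \<psi>) * (- s + 1 * t))) * (l * exp (- s * l)))" by (rule arg_cong)
          then show ?thesis using True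
            by (simp add: G_def exponential_density_def scaleR_conv_of_real flip: mult.assoc)
        next
          case False
          then show ?thesis using elim by (auto simp: G_def exponential_density_def split: split_indicator)
        qed
      qed
    qed measurable
    finally show ?thesis .
  qed
  show "integrable T ?c"
  proof -
    have "integrable lborel (\<lambda>t. ?e t *\<^sub>R ?c t)"
      unfolding ceq by (rule lborel_pair.integrable_snd[OF fi])
    then show ?thesis
      unfolding T_def by (subst integrable_density) (auto simp: exponential_density_nonneg[OF l])
  qed
  have "(LINT t|T. ?c t) = (LINT t|lborel. LINT s|lborel. ?f s t)"
    by (simp only: integral_T[OF cm] ceq)
  also have "\<dots> = (LINT s|lborel. LINT t|lborel. ?f s t)"
    by (rule lborel_pair.Fubini_integral[OF fi])
  also have "\<dots> = (LINT s|lborel. (1 / (l + \<psi>)) *\<^sub>R (?e s *\<^sub>R h s))"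
    by (intro Bochner_Integration.integral_cong refl) (simp only: integral_scaleR_left[OF Gs] Gsv)
  also have "\<dots> = (LINT s|T. h s) / complex_of_real (l + \<psi>)"
    by (simp only: integral_scaleR_right integral_T[OF hm]) (simp add: scaleR_conv_of_real)
  finally show "(LINT t|T. ?c t) = (LINT s|T. h s) / complex_of_real (l + \<psi>)" .
qed

lemma char_path_Q:
  fixes \<theta> :: real
  assumes d: "drifted B x \<beta>"
  defines "\<psi> \<equiv> c * \<bar>\<theta>\<bar> powr \<alpha>"
  shows "(LINT z|Q. iexp (\<theta> * path x \<beta> (fst z) (snd z))) = iexp (\<theta> * x) * complex_of_real (l / (l + \<psi>))
    + \<i> * \<theta> / complex_of_real (l + \<psi>) * (LINT z|Q. complex_of_real (\<beta> (fst z) (snd z)) * iexp (\<theta> * path x \<beta> (fst z) (snd z)))"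
proof -
  have bj[measurable]: "(\<lambda>(t, \<omega>). \<beta> t \<omega>) \<in> borel_measurable (borel \<Otimes>\<^sub>M M)" and bb: "\<And>t \<omega>. \<bar>\<beta> t \<omega>\<bar> \<le> B"
    using d by (auto simp: drifted_def)
  have pj[measurable]: "(\<lambda>(t, \<omega>). path x \<beta> t \<omega>) \<in> borel_measurable (borel \<Otimes>\<^sub>M M)" by (rule path_joint[OF bj])
  have \<psi>: "\<psi> \<ge> 0" using c by (simp add: \<psi>_def)
  have m1: "(\<lambda>(t, \<omega>). iexp (\<theta> * path x \<beta> t \<omega>)) \<in> borel_measurable (borel \<Otimes>\<^sub>M M)" by measurable
  have m2: "(\<lambda>(t, \<omega>). complex_of_real (\<beta> t \<omega>) * iexp (\<theta> * path x \<beta> t \<omega>)) \<in> borel_measurable (borel \<Otimes>\<^sub>M M)" by measurable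
  define h where "h s = (LINT \<omega>|M. complex_of_real (\<beta> s \<omega>) * iexp (\<theta> * path x \<beta> s \<omega>))" for s
  have hm[measurable]: "h \<in> borel_measurable borel"
    unfolding h_def by (rule borel_measurable_lebesgue_integral[OF m2])
  have hb: "norm (h s) \<le> B" for s
  proof -
    have "norm (h s) \<le> (LINT \<omega>|M. norm (complex_of_real (\<beta> s \<omega>) * iexp (\<theta> * path x \<beta> s \<omega>)))"
      unfolding h_def by (rule integral_norm_bound)
    also have "\<dots> \<le> (LINT \<omega>|M. B)"
    proof (rule integral_mono)
      show "integrable M (\<lambda>\<omega>. norm (complex_of_real (\<beta> s \<omega>) * iexp (\<theta> * path x \<beta> s \<omega>)))"
        by (rule integrable_norm, rule integrable_const_bound[where B=B])
           (use bb joint_section(1)[OF m2] in \<open>auto simp: norm_mult\<close>)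
    qed (use bb in \<open>auto simp: norm_mult\<close>)
    finally show ?thesis by (simp add: prob_space)
  qed
  let ?c = "\<lambda>t. LINT s:{0..t}|lborel. complex_of_real (exp (- ((t - s) * \<psi>))) * h s"
  note conv = integral_T_convolution[OF hm hb \<psi>]
  have [measurable]: "?c \<in> borel_measurable T" using conv(1) by (rule borel_measurable_integrable)
  have ei: "integrable T (\<lambda>t. complex_of_real (exp (- (t * \<psi>))))"
    by (rule T.integrable_const_bound[where B=1]) (use AE_T_nonneg \<psi> in \<open>auto elim!: eventually_mono\<close>)
  have "(LINT z|Q. iexp (\<theta> * path x \<beta> (fst z) (snd z))) = (LINT t|T. LINT \<omega>|M. iexp (\<theta> * path x \<beta> t \<omega>))"
    by (rule integral_Q_iterated[OF m1, of 1]) simp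
  also have "\<dots> = (LINT t|T. iexp (\<theta> * x) * complex_of_real (exp (- (t * \<psi>))) + \<i> * \<theta> * ?c t)"
  proof (rule integral_cong_AE)
    show "AE t in T. (LINT \<omega>|M. iexp (\<theta> * path x \<beta> t \<omega>)) = iexp (\<theta> * x) * complex_of_real (exp (- (t * \<psi>))) + \<i> * \<theta> * ?c t"
      using AE_T_nonneg by eventually_elim (use char_duhamel[OF d] in \<open>simp add: \<psi>_def h_def\<close>)
    show "(\<lambda>t. LINT \<omega>|M. iexp (\<theta> * path x \<beta> t \<omega>)) \<in> borel_measurable T"
      using borel_measurable_lebesgue_integral[OF m1] by simp
    show "(\<lambda>t. iexp (\<theta> * x) * complex_of_real (exp (- (t * \<psi>))) + \<i> * \<theta> * ?c t) \<in> borel_measurable T"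
      by measurable
  qed
  also have "\<dots> = iexp (\<theta> * x) * complex_of_real (l / (l + \<psi>)) + \<i> * \<theta> * ((LINT s|T. h s) / complex_of_real (l + \<psi>))"
    using conv(1) ei
    by (subst Bochner_Integration.integral_add)
       (simp_all only: integrable_mult_right integral_mult_right_zero conv(2) integral_complex_of_real integral_T_exp[OF \<psi>])
  also have "(LINT s|T. h s) = (LINT z|Q. complex_of_real (\<beta> (fst z) (snd z)) * iexp (\<theta> * path x \<beta> (fst z) (snd z)))"
    unfolding h_def by (rule integral_Q_iterated[OF m2, symmetric, of B]) (use bb in \<open>auto simp: norm_mult\<close>)
  finally show ?thesis by simp
qed

end

section \<open>The resolvent identity\<close>

lemma nn_integral_le_of_emeasure_le:
  assumes s: "sets N = sets L" and le: "\<And>A. A \<in> sets L \<Longrightarrow> emeasure N A \<le> C * emeasure L A"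
    and f: "f \<in> borel_measurable L"
  shows "(\<integral>\<^sup>+ x. f x \<partial>N) \<le> C * (\<integral>\<^sup>+ x. f x \<partial>L)"
proof -
  have "N \<le> scale_measure C L"
    using s le by (simp add: le_measure)
  then have "(\<integral>\<^sup>+ x. f x \<partial>N) \<le> (\<integral>\<^sup>+ x. f x \<partial>scale_measure C L)"
    using s by (intro nn_integral_mono_measure) auto
  also have "\<dots> = C * (\<integral>\<^sup>+ x. f x \<partial>L)"
    by (rule nn_integral_scale_measure[OF f])
  finally show ?thesis .
qed

context killed_noise
begin

abbreviation noise :: "real \<Rightarrow> real \<times> 'w \<Rightarrow> real" where
  "noise x z \<equiv> x + Z (max 0 (fst z)) (snd z)"

lemma noise_Q[measurable]: "(\<lambda>z. noise x z) \<in> borel_measurable Q"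
  using joint_Q[OF Z_joint] by measurable

lemma drifted_zero: "drifted 0 x (\<lambda>_ _. 0)" and path_zero: "path x (\<lambda>_ _. 0) t \<omega> = x + Z (max 0 t) \<omega>"
proof -
  show p: "path x (\<lambda>_ _. 0) t \<omega> = x + Z (max 0 t) \<omega>" for t \<omega>
    by (simp add: path_def set_lebesgue_integral_def)
  have "known_at t (path x (\<lambda>_ _. 0) t)" if "t \<ge> 0" for t
  proof (rule known_at_measurable)
    have "(\<lambda>\<omega>. x + Z t \<omega>) \<in> borel_measurable (F t)" using Z_F[OF that] by measurable
    then show "path x (\<lambda>_ _. 0) t \<in> borel_measurable (F t)" using that by (simp add: p[abs_def])
  qed
  then show "drifted 0 x (\<lambda>_ _. 0)" by (auto simp: drifted_def intro: known_at_measurable)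
qed

lemma kappa_nonneg: "kappa \<ge> 0"
  unfolding kappa_def by (intro integral_nonneg_AE) simp

lemma nn_integral_k: "(\<integral>\<^sup>+ w. ennreal \<bar>k w\<bar> \<partial>lborel) = ennreal kappa"
  unfolding kappa_def using k by (intro nn_integral_eq_integral) auto

lemma D_measurable[measurable]:
  assumes [measurable]: "f \<in> borel_measurable borel"
  shows "D f \<in> borel_measurable borel"
  unfolding D_def by measurable

lemma D_le_nn_integral: "ennreal \<bar>D f y\<bar> \<le> (\<integral>\<^sup>+ w. ennreal \<bar>k w\<bar> * ennreal \<bar>f (y + w)\<bar> \<partial>lborel)"
  using integral_norm_bound_ennreal[of lborel "\<lambda>w. k w * f (y + w)"]
  by (cases "integrable lborel (\<lambda>w. k w * f (y + w))")
     (simp_all add: D_def abs_mult ennreal_mult not_integrable_integral_eq)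

lemma D_bound:
  assumes f[measurable]: "f \<in> borel_measurable borel" and fb: "\<And>y. \<bar>f y\<bar> \<le> C"
  shows "\<bar>D f y\<bar> \<le> kappa * C"
proof -
  have C: "C \<ge> 0" using fb[of 0] by linarith
  have "ennreal \<bar>D f y\<bar> \<le> (\<integral>\<^sup>+ w. ennreal \<bar>k w\<bar> * ennreal C \<partial>lborel)"
    by (rule order_trans[OF D_le_nn_integral]) (intro nn_integral_mono mult_left_mono ennreal_leI fb zero_le)
  also have "\<dots> = ennreal (kappa * C)"
    using C kappa_nonneg by (subst nn_integral_multc) (auto simp: nn_integral_k ennreal_mult)
  finally show ?thesis using C kappa_nonneg by (simp add: ennreal_le_iff)
qed

lemma D_L1:
  assumes f[measurable]: "f \<in> borel_measurable borel"
  shows "(\<integral>\<^sup>+ y. ennreal \<bar>D f y\<bar> \<partial>lborel) \<le> ennreal kappa * (\<integral>\<^sup>+ y. ennreal \<bar>f y\<bar> \<partial>lborel)"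
proof -
  have "(\<integral>\<^sup>+ y. ennreal \<bar>D f y\<bar> \<partial>lborel) \<le> (\<integral>\<^sup>+ y. (\<integral>\<^sup>+ w. ennreal \<bar>k w\<bar> * ennreal \<bar>f (y + w)\<bar> \<partial>lborel) \<partial>lborel)"
    by (intro nn_integral_mono D_le_nn_integral)
  also have "\<dots> = (\<integral>\<^sup>+ w. (\<integral>\<^sup>+ y. ennreal \<bar>k w\<bar> * ennreal \<bar>f (y + w)\<bar> \<partial>lborel) \<partial>lborel)"
    by (rule lborel_pair.Fubini') simp
  also have "\<dots> = (\<integral>\<^sup>+ w. ennreal \<bar>k w\<bar> * (\<integral>\<^sup>+ y. ennreal \<bar>f y\<bar> \<partial>lborel) \<partial>lborel)"
  proof (intro nn_integral_cong)
    fix w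
    have "(\<integral>\<^sup>+ y. ennreal \<bar>f (y + w)\<bar> \<partial>lborel) = (\<integral>\<^sup>+ y. ennreal \<bar>f y\<bar> \<partial>lborel)"
      using nn_integral_real_affine[of "\<lambda>y. ennreal \<bar>f y\<bar>" 1 w] by (simp add: add.commute)
    then show "(\<integral>\<^sup>+ y. ennreal \<bar>k w\<bar> * ennreal \<bar>f (y + w)\<bar> \<partial>lborel) = ennreal \<bar>k w\<bar> * (\<integral>\<^sup>+ y. ennreal \<bar>f y\<bar> \<partial>lborel)"
      by (subst nn_integral_cmult) auto
  qed
  also have "\<dots> = ennreal kappa * (\<integral>\<^sup>+ y. ennreal \<bar>f y\<bar> \<partial>lborel)"
    by (subst nn_integral_multc) (auto simp: nn_integral_k)
  finally show ?thesis .
qed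

lemma char_noise:
  fixes \<theta> :: real
  shows "(LINT z|Q. iexp (\<theta> * noise x z)) = iexp (\<theta> * x) * complex_of_real (l / (l + c * \<bar>\<theta>\<bar> powr \<alpha>))"
  using char_path_Q[OF drifted_zero, where \<theta>=\<theta> and x=x] by (simp only: path_zero) simp

lemma integrable_std_normal: "integrable lborel std_normal_density"
  and integral_std_normal: "(LINT w|lborel. std_normal_density w) = 1"
  by (auto intro: integrable_normal_density integral_normal_density)

text \<open>
  For characters \<open>f\<close> this is \<open>char_path_Q\<close>, because \<open>D\<close> multiplies the character \<open>iexp (\<theta> * \<cdot>)\<close> by
  the Fourier transform of \<open>k\<close> at \<open>\<theta>\<close>. It extends to bounded Borel functions by uniqueness of
  signed measures, the last term being an integral over \<open>Q\<close> times Lebesgue measure with the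
  signed weight \<open>\<beta> * k(w)\<close>.
\<close>

lemma path_resolvent_identity:
  assumes d: "drifted B x \<beta>" and f[measurable]: "f \<in> borel_measurable borel" and fb: "\<And>y. \<bar>f y\<bar> \<le> C"
  shows "(LINT z|Q. f (path x \<beta> (fst z) (snd z))) = (LINT z|Q. f (noise x z))
    + (LINT z|Q. \<beta> (fst z) (snd z) * D f (path x \<beta> (fst z) (snd z)))"
proof -
  have bj: "(\<lambda>(t, \<omega>). \<beta> t \<omega>) \<in> borel_measurable (borel \<Otimes>\<^sub>M M)" and bb: "\<And>t \<omega>. \<bar>\<beta> t \<omega>\<bar> \<le> B"
    using d by (auto simp: drifted_def)
  define b where "b z = \<beta> (fst z) (snd z)" for z
  define X where "X z = path x \<beta> (fst z) (snd z)" for z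
  have [measurable]: "b \<in> borel_measurable Q" unfolding b_def by (rule joint_Q[OF bj])
  have [measurable]: "X \<in> borel_measurable Q" unfolding X_def by (rule joint_Q[OF path_joint[OF bj]])
  have bB: "\<bar>b z\<bar> \<le> B" for z by (simp add: b_def bb)
  interpret QL: pair_sigma_finite Q lborel ..
  let ?N = "Q \<Otimes>\<^sub>M lborel"
  have int: "integrable (Q \<Otimes>\<^sub>M lborel) (\<lambda>(z, w). (u z * complex_of_real (v w)) * e z w)"
    if [measurable]: "u \<in> borel_measurable Q" "(\<lambda>(z, w). e z w) \<in> borel_measurable (Q \<Otimes>\<^sub>M borel)"
      and v: "integrable lborel v" and ub: "\<And>z. norm (u z) \<le> U" and eb: "\<And>z w. norm (e z w) \<le> E"
    for u :: "_ \<Rightarrow> complex" and v :: "real \<Rightarrow> real" and e U E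
  proof (rule Bochner_Integration.integrable_bound)
    have [measurable]: "v \<in> borel_measurable borel" using v by simp
    have U0: "U \<ge> 0" and E0: "E \<ge> 0" using order_trans[OF norm_ge_zero ub] order_trans[OF norm_ge_zero eb] by auto
    show "integrable (Q \<Otimes>\<^sub>M lborel) (\<lambda>(z, w). v w * (U * E))"
      using v by (intro QL.Fubini_integrable) (auto simp: abs_mult)
    show "AE p in Q \<Otimes>\<^sub>M lborel. norm (case p of (z, w) \<Rightarrow> (u z * complex_of_real (v w)) * e z w) \<le> norm (case p of (z, w) \<Rightarrow> v w * (U * E))"
    proof (intro AE_I2, clarify)
      fix z w
      have "norm (u z) * norm (e z w) \<le> U * E" using ub eb U0 by (intro mult_mono) auto
      then have "\<bar>v w\<bar> * (norm (u z) * norm (e z w)) \<le> \<bar>v w\<bar> * (U * E)" by (intro mult_left_mono) auto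
      then show "norm ((u z * complex_of_real (v w)) * e z w) \<le> norm (v w * (U * E))"
        using U0 E0 by (simp add: norm_mult abs_mult mult_ac)
    qed
  qed (use v in measurable)
  let ?h = "\<lambda>(z, w). b z * k w"
  have hi: "integrable (Q \<Otimes>\<^sub>M lborel) ?h"
    using int[of "\<lambda>z. complex_of_real (b z)" "\<lambda>_ _. 1" k B 1, THEN integrable_Re] k bB by (simp add: case_prod_beta')
  \<comment> \<open>the auxiliary weight of mass \<open>1\<close> on the additional Lebesgue factor\<close>
  have gi: "integrable (Q \<Otimes>\<^sub>M lborel) (\<lambda>(z, w). std_normal_density w)"
    using int[of "\<lambda>z. 1" "\<lambda>_ _. 1" std_normal_density 1 1, THEN integrable_Re] integrable_std_normal by (simp add: case_prod_beta')
  have "(LINT z|Q. f (X z)) = (LINT z|Q. f (noise x z)) + (LINT p|?N. ?h p * f (case p of (z, w) \<Rightarrow> X z + w))"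
  proof (rule signed_char_uniqueness[OF _ _ _ _ _ hi gi _ _ f fb])
    show "prob_space Q" by (rule Q.prob_space_axioms)
    show "sigma_finite_measure (Q \<Otimes>\<^sub>M lborel)" ..
    show "(LINT p|?N. (case p of (z, w) \<Rightarrow> std_normal_density w)) = 1"
      using QL.integral_fst[OF gi] by (simp add: integral_std_normal Q.prob_space)
    fix \<theta> :: real
    define \<psi> where "\<psi> = c * \<bar>\<theta>\<bar> powr \<alpha>"
    have "(LINT p|?N. complex_of_real (?h p) * iexp (\<theta> * (case p of (z, w) \<Rightarrow> X z + w)))
      = (LINT p|?N. (case p of (z, w) \<Rightarrow> (complex_of_real (b z) * complex_of_real (k w)) * iexp (\<theta> * (X z + w))))"
      by (simp add: case_prod_beta')
    also have "\<dots> = (LINT z|Q. LINT w|lborel. (complex_of_real (b z) * complex_of_real (k w)) * iexp (\<theta> * (X z + w)))"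
      by (rule QL.integral_fst[symmetric], rule int[of "\<lambda>z. complex_of_real (b z)" "\<lambda>z w. iexp (\<theta> * (X z + w))" k B 1]) (use k bB in auto)
    also have "\<dots> = (LINT z|Q. (complex_of_real (b z) * iexp (\<theta> * X z)) * (\<i> * \<theta> / complex_of_real (l + \<psi>)))"
    proof (intro Bochner_Integration.integral_cong refl)
      fix z
      have "(LINT w|lborel. (complex_of_real (b z) * complex_of_real (k w)) * iexp (\<theta> * (X z + w)))
        = (LINT w|lborel. (complex_of_real (b z) * iexp (\<theta> * X z)) * (complex_of_real (k w) * iexp (\<theta> * w)))"
        by (intro Bochner_Integration.integral_cong refl) (simp add: distrib_left exp_add)
      also have "\<dots> = (complex_of_real (b z) * iexp (\<theta> * X z)) * (LINT w|lborel. complex_of_real (k w) * iexp (\<theta> * w))"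
        by (rule integral_mult_right_zero)
      finally show "(LINT w|lborel. (complex_of_real (b z) * complex_of_real (k w)) * iexp (\<theta> * (X z + w)))
        = (complex_of_real (b z) * iexp (\<theta> * X z)) * (\<i> * \<theta> / complex_of_real (l + \<psi>))"
        by (simp only: k_fourier \<psi>_def)
    qed
    also have "\<dots> = (LINT z|Q. complex_of_real (b z) * iexp (\<theta> * X z)) * (\<i> * \<theta> / complex_of_real (l + \<psi>))"
      by (rule integral_mult_left_zero)
    finally show "(LINT z|Q. iexp (\<theta> * X z)) = (LINT z|Q. iexp (\<theta> * noise x z))
      + (LINT p|?N. complex_of_real (?h p) * iexp (\<theta> * (case p of (z, w) \<Rightarrow> X z + w)))"
      using char_path_Q[OF d, of \<theta>] char_noise[of \<theta> x] by (simp only: X_def b_def \<psi>_def mult.commute)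
  qed measurable
  also have "(LINT p|?N. ?h p * f (case p of (z, w) \<Rightarrow> X z + w)) = (LINT p|?N. (case p of (z, w) \<Rightarrow> b z * k w * f (X z + w)))"
    by (simp add: case_prod_beta')
  also have "\<dots> = (LINT z|Q. LINT w|lborel. b z * k w * f (X z + w))"
    by (rule QL.integral_fst[symmetric])
       (use int[of "\<lambda>z. complex_of_real (b z)" "\<lambda>z w. complex_of_real (f (X z + w))" k B C, THEN integrable_Re] k bB fb in \<open>simp add: case_prod_beta'\<close>)
  also have "\<dots> = (LINT z|Q. b z * D f (X z))"
    by (simp add: D_def mult.assoc)
  finally show ?thesis by (simp only: X_def b_def)
qed

end

section \<open>Occupation densities\<close>

lemma iexp_integral_Icc:
  fixes \<theta> h :: real
  assumes h: "h \<ge> 0"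
  shows "\<i> * \<theta> * (LINT s:{0..h}|lborel. iexp (\<theta> * s)) = iexp (\<theta> * h) - 1"
proof -
  have A: "s = 0 + (LINT r:{0..s}|lborel. indicator {0..} r)" if "s \<ge> 0" for s :: real
  proof -
    have "(LINT r:{0..s}|lborel. indicat_real {0..} r) = (LINT r:{0..s}|lborel. 1)"
      by (intro set_lebesgue_integral_cong) auto
    then show ?thesis using that by (simp add: set_lebesgue_integral_def)
  qed
  define A where "A s = 0 + (LINT r:{0..s}|lborel. indicat_real {0..} r)" for s :: real
  have "iexp (\<theta> * A h) = iexp (\<theta> * 0) + (LINT s:{0..h}|lborel. indicat_real {0..} s *\<^sub>R (\<i> * \<theta> * iexp (\<theta> * A s)))"
    by (rule iexp_indefinite_integral[where B=1]) (auto simp: A_def h split: split_indicator)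
  also have "(LINT s:{0..h}|lborel. indicat_real {0..} s *\<^sub>R (\<i> * \<theta> * iexp (\<theta> * A s))) = (LINT s:{0..h}|lborel. \<i> * \<theta> * iexp (\<theta> * s))"
  proof (rule set_lebesgue_integral_cong; (intro allI impI)?)
    fix s :: real assume "s \<in> {0..h}"
    then have "A s = s" "indicat_real {0..} s = 1" using A[of s] by (auto simp: A_def)
    then show "indicat_real {0..} s *\<^sub>R (\<i> * \<theta> * iexp (\<theta> * A s)) = \<i> * \<theta> * iexp (\<theta> * s)" by simp
  qed simp
  also have "\<dots> = \<i> * \<theta> * (LINT s:{0..h}|lborel. iexp (\<theta> * s))"
    by (rule set_integral_mult_right)
  also have "A h = h" using A[OF h] by (simp add: A_def)
  finally show ?thesis by (simp add: algebra_simps)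
qed

context killed_noise
begin

text \<open>
  This makes precise that \<open>l * D f\<close> is the derivative of the expectation in the starting point. Again
  it suffices to check characters.
\<close>

lemma noise_translate:
  assumes f[measurable]: "f \<in> borel_measurable borel" and fb: "\<And>y. \<bar>f y\<bar> \<le> C" and h: "h \<ge> 0"
  shows "(LINT z|Q. f (noise (y + h) z)) = (LINT z|Q. f (noise y z)) + (LINT s:{0..h}|lborel. l * D f (y + s))"
proof -
  let ?N = "lborel \<Otimes>\<^sub>M (lborel :: real measure)"
  have int: "integrable ?N (\<lambda>(s, w). complex_of_real (u s * v w) * e s w)"
    if u: "integrable lborel u" and v: "integrable lborel v" and [measurable]: "(\<lambda>(s, w). e s w) \<in> borel_measurable (borel \<Otimes>\<^sub>M borel)"
      and eb: "\<And>s w. norm (e s w) \<le> E"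
    for u v :: "real \<Rightarrow> real" and e E
  proof (rule Bochner_Integration.integrable_bound)
    have [measurable]: "u \<in> borel_measurable borel" "v \<in> borel_measurable borel" using u v by auto
    show "integrable ?N (\<lambda>(s, w). u s * v w * E)"
      using u v by (intro lborel_pair.Fubini_integrable) (auto simp: abs_mult)
    show "AE p in ?N. norm (case p of (s, w) \<Rightarrow> complex_of_real (u s * v w) * e s w) \<le> norm (case p of (s, w) \<Rightarrow> u s * v w * E)"
      using eb by (auto simp: norm_mult abs_mult intro!: AE_I2 mult_left_mono order_trans[OF eb] abs_ge_self)
    show "(\<lambda>(s, w). complex_of_real (u s * v w) * e s w) \<in> borel_measurable ?N" by measurable
  qed
  define I where "I s = l * indicator {0..h} s" for s :: real
  have Ii: "integrable lborel I"
    unfolding I_def by (auto simp: emeasure_lborel_Icc_eq intro!: integrable_real_indicator)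
  have [measurable]: "I \<in> borel_measurable borel" unfolding I_def by measurable
  let ?h = "\<lambda>(s, w). I s * k w"
  have hi: "integrable ?N ?h"
    using int[OF Ii k, of "\<lambda>_ _. 1" 1, THEN integrable_Re] by (simp add: case_prod_beta')
  have gi: "integrable ?N (\<lambda>(s, w). std_normal_density s * std_normal_density w)"
    using int[OF integrable_std_normal integrable_std_normal, of "\<lambda>_ _. 1" 1, THEN integrable_Re] by (simp add: case_prod_beta')
  have "(LINT z|Q. f (noise (y + h) z)) = (LINT z|Q. f (noise y z)) + (LINT p|?N. ?h p * f (case p of (s, w) \<Rightarrow> y + s + w))"
  proof (rule signed_char_uniqueness[OF _ _ _ _ _ hi gi _ _ f fb])
    show "prob_space Q" by (rule Q.prob_space_axioms)
    show "sigma_finite_measure ?N" ..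
    show "(LINT p|?N. (case p of (s, w) \<Rightarrow> std_normal_density s * std_normal_density w)) = 1"
      using lborel_pair.integral_fst[OF gi] by (simp add: integral_std_normal)
    fix \<theta> :: real
    define \<psi> where "\<psi> = c * \<bar>\<theta>\<bar> powr \<alpha>"
    have "(LINT p|?N. complex_of_real (?h p) * iexp (\<theta> * (case p of (s, w) \<Rightarrow> y + s + w)))
      = (LINT p|?N. (case p of (s, w) \<Rightarrow> complex_of_real (I s * k w) * iexp (\<theta> * (y + s + w))))"
      by (simp add: case_prod_beta')
    also have "\<dots> = (LINT s|lborel. LINT w|lborel. complex_of_real (I s * k w) * iexp (\<theta> * (y + s + w)))"
      by (rule lborel_pair.integral_fst[symmetric], rule int[OF Ii k, of "\<lambda>s w. iexp (\<theta> * (y + s + w))" 1]) auto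
    also have "\<dots> = (LINT s|lborel. (iexp (\<theta> * y) * (\<i> * \<theta> / complex_of_real (l + \<psi>)) * l) * (indicator {0..h} s *\<^sub>R iexp (\<theta> * s)))"
    proof (intro Bochner_Integration.integral_cong refl)
      fix s
      have "(LINT w|lborel. complex_of_real (I s * k w) * iexp (\<theta> * (y + s + w)))
        = (LINT w|lborel. (complex_of_real (I s) * iexp (\<theta> * y) * iexp (\<theta> * s)) * (complex_of_real (k w) * iexp (\<theta> * w)))"
        by (intro Bochner_Integration.integral_cong refl) (simp add: distrib_left exp_add)
      also have "\<dots> = (complex_of_real (I s) * iexp (\<theta> * y) * iexp (\<theta> * s)) * (LINT w|lborel. complex_of_real (k w) * iexp (\<theta> * w))"
        by (rule integral_mult_right_zero)
      also have "\<dots> = (iexp (\<theta> * y) * (\<i> * \<theta> / complex_of_real (l + \<psi>)) * l) * (indicator {0..h} s *\<^sub>R iexp (\<theta> * s))"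
        unfolding k_fourier \<psi>_def[symmetric] by (simp add: I_def split: split_indicator)
      finally show "(LINT w|lborel. complex_of_real (I s * k w) * iexp (\<theta> * (y + s + w)))
        = (iexp (\<theta> * y) * (\<i> * \<theta> / complex_of_real (l + \<psi>)) * l) * (indicator {0..h} s *\<^sub>R iexp (\<theta> * s))" .
    qed
    also have "\<dots> = (iexp (\<theta> * y) * (\<i> * \<theta> / complex_of_real (l + \<psi>)) * l) * (LINT s:{0..h}|lborel. iexp (\<theta> * s))"
      unfolding set_lebesgue_integral_def by (rule integral_mult_right_zero)
    also have "\<dots> = iexp (\<theta> * y) * complex_of_real (l / (l + \<psi>)) * (\<i> * \<theta> * (LINT s:{0..h}|lborel. iexp (\<theta> * s)))"
      by simp
    also have "\<dots> = iexp (\<theta> * y) * complex_of_real (l / (l + \<psi>)) * (iexp (\<theta> * h) - 1)"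
      by (simp only: iexp_integral_Icc[OF h])
    finally have e: "(LINT p|?N. complex_of_real (?h p) * iexp (\<theta> * (case p of (s, w) \<Rightarrow> y + s + w)))
      = iexp (\<theta> * y) * complex_of_real (l / (l + \<psi>)) * (iexp (\<theta> * h) - 1)" .
    have s: "iexp (\<theta> * (y + h)) = iexp (\<theta> * y) * iexp (\<theta> * h)" by (simp add: distrib_left exp_add)
    show "(LINT z|Q. iexp (\<theta> * noise (y + h) z)) = (LINT z|Q. iexp (\<theta> * noise y z))
      + (LINT p|?N. complex_of_real (?h p) * iexp (\<theta> * (case p of (s, w) \<Rightarrow> y + s + w)))"
    proof -
      have "E * H * L = E * L + E * L * (H - 1)" for E H L :: complex by (simp add: algebra_simps)
      then show ?thesis unfolding e char_noise s \<psi>_def[symmetric] .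
    qed
  qed measurable
  also have "(LINT p|?N. ?h p * f (case p of (s, w) \<Rightarrow> y + s + w)) = (LINT p|?N. (case p of (s, w) \<Rightarrow> I s * k w * f (y + s + w)))"
    by (simp add: case_prod_beta')
  also have "\<dots> = (LINT s|lborel. LINT w|lborel. I s * k w * f (y + s + w))"
    by (rule lborel_pair.integral_fst[symmetric])
       (use int[OF Ii k, of "\<lambda>s w. complex_of_real (f (y + s + w))" C, THEN integrable_Re] fb in \<open>simp add: case_prod_beta'\<close>)
  also have "\<dots> = (LINT s:{0..h}|lborel. l * D f (y + s))"
    unfolding set_lebesgue_integral_def
    by (intro Bochner_Integration.integral_cong refl) (auto simp: I_def D_def mult.assoc split: split_indicator)
  finally show ?thesis .
qed

lemma D_set_integral_le:
  assumes f[measurable]: "f \<in> borel_measurable borel" and fb: "\<And>y. \<bar>f y\<bar> \<le> C"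
  shows "ennreal \<bar>LINT s:{0..h}|lborel. l * D f (y + s)\<bar> \<le> ennreal (l * kappa) * (\<integral>\<^sup>+ y. ennreal \<bar>f y\<bar> \<partial>lborel)"
proof -
  have i: "set_integrable lborel {0..h} (\<lambda>s. l * D f (y + s))"
    by (rule set_integrable_bounded_Icc[where C="l * (kappa * C)"]) (use D_bound[OF f fb] l in \<open>auto simp: abs_mult\<close>)
  have "ennreal \<bar>LINT s:{0..h}|lborel. l * D f (y + s)\<bar> \<le> (\<integral>\<^sup>+ s. ennreal (norm (indicator {0..h} s *\<^sub>R (l * D f (y + s)))) \<partial>lborel)"
    unfolding set_lebesgue_integral_def
    using integral_norm_bound_ennreal[OF i[unfolded set_integrable_def]] by simp
  also have "\<dots> \<le> (\<integral>\<^sup>+ s. ennreal l * ennreal \<bar>D f (y + 1 * s)\<bar> \<partial>lborel)"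
    using l by (intro nn_integral_mono) (auto simp: abs_mult ennreal_mult split: split_indicator)
  also have "\<dots> = ennreal l * (\<integral>\<^sup>+ s. ennreal \<bar>D f (y + 1 * s)\<bar> \<partial>lborel)"
    by (rule nn_integral_cmult) measurable
  also have "(\<integral>\<^sup>+ s. ennreal \<bar>D f (y + 1 * s)\<bar> \<partial>lborel) = (\<integral>\<^sup>+ s. ennreal \<bar>D f s\<bar> \<partial>lborel)"
    using nn_integral_real_affine[of "\<lambda>s. ennreal \<bar>D f s\<bar>" 1 y] by simp
  also have "ennreal l * \<dots> \<le> ennreal l * (ennreal kappa * (\<integral>\<^sup>+ y. ennreal \<bar>f y\<bar> \<partial>lborel))"
    by (intro mult_left_mono D_L1) auto
  also have "\<dots> = ennreal (l * kappa) * (\<integral>\<^sup>+ y. ennreal \<bar>f y\<bar> \<partial>lborel)"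
    using l kappa_nonneg by (simp add: ennreal_mult mult.assoc)
  finally show ?thesis .
qed

lemma noise_lipschitz:
  assumes f: "f \<in> borel_measurable borel" and fb: "\<And>y. \<bar>f y\<bar> \<le> C"
  shows "\<bar>(LINT z|Q. f (noise x z)) - (LINT z|Q. f (noise y z))\<bar> \<le> l * kappa * C * \<bar>x - y\<bar>"
proof -
  have main: "\<bar>(LINT z|Q. f (noise (u + h) z)) - (LINT z|Q. f (noise u z))\<bar> \<le> l * kappa * C * h" if h: "h \<ge> 0" for u h
  proof -
    have b: "norm (l * D f (u + r)) \<le> l * kappa * C" for r
      using D_bound[OF f fb, of "u + r"] l by (simp add: abs_mult mult.assoc)
    have "norm (LINT s:{0..h}|lborel. l * D f (u + s)) \<le> l * kappa * C * (h - 0)"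
      by (rule norm_set_integral_Icc_le[OF set_integrable_bounded_Icc]) (use b h f in auto)
    then show ?thesis using noise_translate[OF f fb h, of u] by simp
  qed
  show ?thesis
  proof (cases "y \<le> x")
    case True
    then show ?thesis using main[of "x - y" y] by simp
  next
    case False
    then show ?thesis using main[of "y - x" x] by (simp add: abs_minus_commute)
  qed
qed

text \<open>
  Move the starting point from \<open>- \<infinity>\<close>, where a bounded set has probability \<open>0\<close>, to \<open>x\<close>. By
  \<open>noise_translate\<close> the probability of \<open>A\<close> grows by at most \<open>l\<close> times the \<open>L1\<close> norm of
  \<open>D (indicator A)\<close>, which is at most \<open>kappa\<close> times the measure of \<open>A\<close>.
\<close>

lemma noise_density_bound:
  assumes A[measurable]: "A \<in> sets borel"
  shows "emeasure (distr Q borel (noise x)) A \<le> ennreal (l * kappa) * emeasure lborel A"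
proof -
  interpret N: prob_space "distr Q borel (noise x)" by (rule Q.prob_space_distr) simp
  \<comment> \<open>bounded pieces of \<open>A\<close>, which are left when the starting point escapes to \<open>- \<infinity>\<close>\<close>
  define A' where "A' n = A \<inter> {- real n..real n}" for n
  have [measurable]: "A' n \<in> sets borel" for n unfolding A'_def by simp
  have "emeasure (distr Q borel (noise x)) (A' n) \<le> ennreal (l * kappa) * emeasure lborel A" for n
  proof -
    define f where "f y = indicat_real (A' n) y" for y
    have f[measurable]: "f \<in> borel_measurable borel" unfolding f_def by measurable
    have fb: "\<bar>f y\<bar> \<le> 1" for y by (simp add: f_def)
    have L: "(\<integral>\<^sup>+ y. ennreal \<bar>f y\<bar> \<partial>lborel) \<le> emeasure lborel A"
    proof -
      have "(\<integral>\<^sup>+ y. ennreal \<bar>f y\<bar> \<partial>lborel) = (\<integral>\<^sup>+ y. indicator (A' n) y \<partial>lborel)"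
        by (intro nn_integral_cong) (auto simp: f_def split: split_indicator)
      also have "\<dots> \<le> emeasure lborel A" by (simp add: A'_def emeasure_mono)
      finally show ?thesis .
    qed
    have le: "ennreal ((LINT z|Q. f (noise x z)) - (LINT z|Q. f (noise (x - real m) z))) \<le> ennreal (l * kappa) * emeasure lborel A" for m
    proof -
      have "(LINT z|Q. f (noise x z)) - (LINT z|Q. f (noise (x - real m) z)) = (LINT s:{0..real m}|lborel. l * D f (x - real m + s))"
        using noise_translate[OF f fb, of "real m" "x - real m"] by simp
      then have "ennreal ((LINT z|Q. f (noise x z)) - (LINT z|Q. f (noise (x - real m) z))) \<le> ennreal \<bar>LINT s:{0..real m}|lborel. l * D f (x - real m + s)\<bar>"
        by (simp add: ennreal_leI)
      also have "\<dots> \<le> ennreal (l * kappa) * (\<integral>\<^sup>+ y. ennreal \<bar>f y\<bar> \<partial>lborel)" by (rule D_set_integral_le[OF f fb])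
      also have "\<dots> \<le> ennreal (l * kappa) * emeasure lborel A" by (intro mult_left_mono L) simp
      finally show ?thesis .
    qed
    have "(\<lambda>m. LINT z|Q. f (noise (x - real m) z)) \<longlonglongrightarrow> (LINT z|Q. 0)"
    proof (rule integral_dominated_convergence[where w="\<lambda>_. 1"])
      show "AE z in Q. (\<lambda>m. f (noise (x - real m) z)) \<longlonglongrightarrow> 0"
      proof (intro AE_I2 tendsto_eventually)
        fix z
        obtain m0 :: nat where m0: "noise x z + real n < real m0" using reals_Archimedean2 by blast
        have "f (noise (x - real m) z) = 0" if "m \<ge> m0" for m
          using m0 that by (auto simp: f_def A'_def split: split_indicator)
        then show "\<forall>\<^sub>F m in sequentially. f (noise (x - real m) z) = 0"
          unfolding eventually_sequentially by blast
      qed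
    qed (use fb in auto)
    then have "(\<lambda>m. ennreal ((LINT z|Q. f (noise x z)) - (LINT z|Q. f (noise (x - real m) z)))) \<longlonglongrightarrow> ennreal ((LINT z|Q. f (noise x z)) - 0)"
      by (intro tendsto_ennrealI tendsto_diff tendsto_const) simp
    then have "ennreal ((LINT z|Q. f (noise x z)) - 0) \<le> ennreal (l * kappa) * emeasure lborel A"
      by (rule LIMSEQ_le_const2) (use le in auto)
    moreover have "emeasure (distr Q borel (noise x)) (A' n) = ennreal (LINT z|Q. f (noise x z))"
    proof -
      have "(LINT z|Q. f (noise x z)) = (LINT y|(distr Q borel (noise x)). f y)"
        by (rule integral_distr[symmetric]) auto
      also have "\<dots> = measure (distr Q borel (noise x)) (A' n)" by (simp add: f_def[abs_def])
      finally show ?thesis by (simp add: N.emeasure_eq_measure)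
    qed
    ultimately show ?thesis by simp
  qed
  moreover have "(\<lambda>n. emeasure (distr Q borel (noise x)) (A' n)) \<longlonglongrightarrow> emeasure (distr Q borel (noise x)) (\<Union>n. A' n)"
    by (rule Lim_emeasure_incseq) (auto simp: A'_def incseq_def)
  moreover have "(\<Union>n. A' n) = A"
  proof -
    have "\<exists>n::nat. - real n \<le> y \<and> y \<le> real n" for y
    proof -
      obtain n :: nat where "\<bar>y\<bar> \<le> real n" using real_arch_simple by blast
      then have "- real n \<le> y \<and> y \<le> real n" by linarith
      then show ?thesis ..
    qed
    then show ?thesis by (auto simp: A'_def)
  qed
  ultimately show ?thesis by (auto intro: LIMSEQ_le_const2)
qed

text \<open>
  In the resolvent identity the first term is controlled by the density of the noise. The second one
  is at most \<open>B * E \<bar>D f\<bar>(\<xi>)\<close>, where \<open>\<bar>D f\<bar>\<close> has both its supremum and its integral smaller than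
  those of \<open>f\<close> by the factor \<open>kappa\<close>. As \<open>B * kappa \<le> 1 / 2\<close>, the crude bound \<open>m\<close> is halved at
  every step while the coefficient \<open>2 * l * kappa\<close> reproduces itself.
\<close>

lemma krylov_iterate:
  assumes d: "drifted B x \<beta>" and small: "B * kappa \<le> 1 / 2"
    and "f \<in> borel_measurable borel" and "\<And>y. 0 \<le> f y" and "\<And>y. f y \<le> m"
  shows "(\<integral>\<^sup>+ z. ennreal (f (path x \<beta> (fst z) (snd z))) \<partial>Q) \<le> ennreal (2 * l * kappa) * (\<integral>\<^sup>+ y. ennreal (f y) \<partial>lborel) + ennreal (m / 2 ^ n)"
  using assms(3-5)
proof (induction n arbitrary: f m)
  case 0
  have "(\<integral>\<^sup>+ z. ennreal (f (path x \<beta> (fst z) (snd z))) \<partial>Q) \<le> (\<integral>\<^sup>+ z. ennreal m \<partial>Q)"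
    using 0 by (intro nn_integral_mono ennreal_leI) auto
  then show ?case by (simp add: Q.emeasure_space_1 add_increasing)
next
  case (Suc n)
  note f[measurable] = Suc.prems(1)
  have bj: "(\<lambda>(t, \<omega>). \<beta> t \<omega>) \<in> borel_measurable (borel \<Otimes>\<^sub>M M)" and bb: "\<And>t \<omega>. \<bar>\<beta> t \<omega>\<bar> \<le> B"
    using d by (auto simp: drifted_def)
  define b where "b z = \<beta> (fst z) (snd z)" for z
  define X where "X z = path x \<beta> (fst z) (snd z)" for z
  have bm[measurable]: "b \<in> borel_measurable Q" unfolding b_def by (rule joint_Q[OF bj])
  have Xm[measurable]: "X \<in> borel_measurable Q" unfolding X_def by (rule joint_Q[OF path_joint[OF bj]])
  have bB: "\<bar>b z\<bar> \<le> B" for z by (simp add: b_def bb)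
  have B0: "B \<ge> 0" using bB[of undefined] by linarith
  have m0: "m \<ge> 0" using Suc.prems(2,3)[of 0] by linarith
  have fb: "\<bar>f y\<bar> \<le> m" for y using Suc.prems(2,3)[of y] by simp
  have fi: "integrable Q (\<lambda>z. f (X z))" "integrable Q (\<lambda>z. f (noise x z))"
    by (auto intro!: Q.integrable_const_bound[where B=m] simp: fb)
  have n0: "0 \<le> (LINT z|Q. f (noise x z))" by (rule integral_nonneg_AE) (simp add: Suc.prems)
  let ?I = "\<integral>\<^sup>+ y. ennreal (f y) \<partial>lborel"
  have "(\<integral>\<^sup>+ z. ennreal (f (X z)) \<partial>Q) = ennreal (LINT z|Q. f (X z))"
    by (rule nn_integral_eq_integral[OF fi(1)]) (simp add: Suc.prems)
  also have "\<dots> = ennreal ((LINT z|Q. f (noise x z)) + (LINT z|Q. b z * D f (X z)))"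
    using path_resolvent_identity[OF d f fb] by (simp add: b_def X_def)
  also have "\<dots> \<le> ennreal (LINT z|Q. f (noise x z)) + ennreal \<bar>LINT z|Q. b z * D f (X z)\<bar>"
    using n0 by (simp add: ennreal_plus[symmetric] ennreal_leI del: ennreal_plus)
  also have "\<dots> \<le> ennreal (l * kappa) * ?I + ennreal B * (ennreal (2 * l * kappa) * (ennreal kappa * ?I) + ennreal (kappa * m / 2 ^ n))"
  proof (rule add_mono)
    have "ennreal (LINT z|Q. f (noise x z)) = (\<integral>\<^sup>+ z. ennreal (f (noise x z)) \<partial>Q)"
      by (rule nn_integral_eq_integral[OF fi(2), symmetric]) (simp add: Suc.prems)
    also have "\<dots> = (\<integral>\<^sup>+ y. ennreal (f y) \<partial>(distr Q borel (noise x)))"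
      by (rule nn_integral_distr[symmetric]) auto
    also have "\<dots> \<le> ennreal (l * kappa) * ?I"
      by (rule nn_integral_le_of_emeasure_le) (auto intro: noise_density_bound)
    finally show "ennreal (LINT z|Q. f (noise x z)) \<le> ennreal (l * kappa) * ?I" .
    have Db: "\<bar>D f y\<bar> \<le> kappa * m" for y by (rule D_bound[OF f fb])
    have "ennreal \<bar>LINT z|Q. b z * D f (X z)\<bar> \<le> (\<integral>\<^sup>+ z. ennreal (norm (b z * D f (X z))) \<partial>Q)"
    proof -
      have "integrable Q (\<lambda>z. b z * D f (X z))"
        by (rule Q.integrable_const_bound[where B="B * (kappa * m)"]) (use bB Db B0 in \<open>auto simp: abs_mult intro!: mult_mono\<close>)
      from integral_norm_bound_ennreal[OF this] show ?thesis by simp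
    qed
    also have "\<dots> \<le> (\<integral>\<^sup>+ z. ennreal B * ennreal \<bar>D f (X z)\<bar> \<partial>Q)"
      using bB B0 by (intro nn_integral_mono) (auto simp: abs_mult ennreal_mult'[symmetric] intro!: ennreal_leI mult_right_mono)
    also have "\<dots> = ennreal B * (\<integral>\<^sup>+ z. ennreal \<bar>D f (X z)\<bar> \<partial>Q)"
      by (rule nn_integral_cmult) measurable
    also have "(\<integral>\<^sup>+ z. ennreal \<bar>D f (X z)\<bar> \<partial>Q) \<le> ennreal (2 * l * kappa) * (\<integral>\<^sup>+ y. ennreal \<bar>D f y\<bar> \<partial>lborel) + ennreal (kappa * m / 2 ^ n)"
      unfolding X_def by (rule Suc.IH) (use Db in auto)
    also have "(\<integral>\<^sup>+ y. ennreal \<bar>D f y\<bar> \<partial>lborel) \<le> ennreal kappa * ?I"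
      using D_L1[OF f] Suc.prems(2) by simp
    finally show "ennreal \<bar>LINT z|Q. b z * D f (X z)\<bar> \<le> ennreal B * (ennreal (2 * l * kappa) * (ennreal kappa * ?I) + ennreal (kappa * m / 2 ^ n))"
      by (simp add: mult_left_mono add_right_mono)
  qed
  also have "\<dots> = (ennreal (l * kappa) * ?I + ennreal ((B * kappa) * (2 * l * kappa)) * ?I) + ennreal ((B * kappa) * (m / 2 ^ n))"
    using B0 kappa_nonneg l m0 by (simp add: distrib_left ennreal_mult'[symmetric] ennreal_mult''[symmetric] mult.assoc[symmetric] add.assoc) (simp add: ac_simps)
  also have "\<dots> \<le> (ennreal (l * kappa) * ?I + ennreal (l * kappa) * ?I) + ennreal (m / 2 ^ Suc n)"
  proof (intro add_mono order_refl mult_right_mono ennreal_leI)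
    show "B * kappa * (2 * l * kappa) \<le> l * kappa"
      using mult_right_mono[OF small, of "2 * l * kappa"] l kappa_nonneg by simp
    show "B * kappa * (m / 2 ^ n) \<le> m / 2 ^ Suc n"
      using mult_right_mono[OF small, of "m / 2 ^ n"] m0 by simp
  qed simp
  also have "ennreal (l * kappa) * ?I + ennreal (l * kappa) * ?I = ennreal (2 * l * kappa) * ?I"
    using l kappa_nonneg by (simp add: distrib_right[symmetric] ennreal_plus[symmetric] del: ennreal_plus)
  finally show ?case unfolding X_def by simp
qed

lemma krylov:
  assumes d: "drifted B x \<beta>" and small: "B * kappa \<le> 1 / 2" and A[measurable]: "A \<in> sets borel"
  shows "emeasure (distr Q borel (\<lambda>z. path x \<beta> (fst z) (snd z))) A \<le> ennreal (2 * l * kappa) * emeasure lborel A"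
proof -
  have bj: "(\<lambda>(t, \<omega>). \<beta> t \<omega>) \<in> borel_measurable (borel \<Otimes>\<^sub>M M)" using d by (auto simp: drifted_def)
  have [measurable]: "(\<lambda>z. path x \<beta> (fst z) (snd z)) \<in> borel_measurable Q" by (rule joint_Q[OF path_joint[OF bj]])
  have "emeasure (distr Q borel (\<lambda>z. path x \<beta> (fst z) (snd z))) A = (\<integral>\<^sup>+ y. indicator A y \<partial>(distr Q borel (\<lambda>z. path x \<beta> (fst z) (snd z))))"
    by simp
  also have "\<dots> = (\<integral>\<^sup>+ z. ennreal (indicat_real A (path x \<beta> (fst z) (snd z))) \<partial>Q)"
    by (subst nn_integral_distr) (auto simp: ennreal_indicator)
  finally have e: "emeasure (distr Q borel (\<lambda>z. path x \<beta> (fst z) (snd z))) A = (\<integral>\<^sup>+ z. ennreal (indicat_real A (path x \<beta> (fst z) (snd z))) \<partial>Q)" .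
  have le: "emeasure (distr Q borel (\<lambda>z. path x \<beta> (fst z) (snd z))) A \<le> ennreal (2 * l * kappa) * emeasure lborel A + ennreal (1 / 2 ^ n)" for n
    unfolding e using krylov_iterate[OF d small, of "indicat_real A" 1 n] by (simp add: ennreal_indicator)
  have "(\<lambda>n. ennreal (2 * l * kappa) * emeasure lborel A + ennreal ((1 / 2) ^ n)) \<longlonglongrightarrow> ennreal (2 * l * kappa) * emeasure lborel A + ennreal 0"
    by (intro tendsto_add tendsto_const tendsto_ennrealI LIMSEQ_power_zero) simp
  then show ?thesis
    by (rule LIMSEQ_le_const[THEN order_trans]) (use le in \<open>auto simp: power_one_over\<close>)
qed

end

section \<open>Comparison of laws\<close>

lemma abs_integral_le:
  fixes f g :: "'a \<Rightarrow> real"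
  assumes f: "integrable N f" and g: "integrable N g" and le: "\<And>x. \<bar>f x\<bar> \<le> g x"
  shows "\<bar>LINT x|N. f x\<bar> \<le> (LINT x|N. g x)"
proof -
  have "\<bar>LINT x|N. f x\<bar> \<le> (LINT x|N. \<bar>f x\<bar>)"
    using integral_norm_bound[of N f] by simp
  also have "\<dots> \<le> (LINT x|N. g x)" using f g le by (intro integral_mono) auto
  finally show ?thesis .
qed

text \<open>
  The rate \<open>l\<close> is so large, and hence the kernel \<open>k\<close> so small, that \<open>f \<mapsto> a * D f\<close> at least halves the
  supremum norm for every function \<open>a\<close> bounded by \<open>B\<close>.
\<close>

locale damped_noise = killed_noise M F Z \<alpha> c l k
  for M :: "'w measure" and F :: "real \<Rightarrow> 'w measure" and Z :: "real \<Rightarrow> 'w \<Rightarrow> real" and \<alpha> c l :: real and k :: "real \<Rightarrow> real" +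
  fixes B :: real
  assumes B0: "B \<ge> 0" and small: "B * kappa \<le> 1 / 2"
begin

abbreviation flow :: "real \<Rightarrow> (real \<Rightarrow> 'w \<Rightarrow> real) \<Rightarrow> real \<times> 'w \<Rightarrow> real" where
  "flow x \<beta> z \<equiv> path x \<beta> (fst z) (snd z)"

text \<open>
  How far \<open>path x \<beta>\<close> is from solving the equation with drift \<open>a\<close>.
\<close>

definition drift_error :: "(real \<Rightarrow> real) \<Rightarrow> real \<Rightarrow> (real \<Rightarrow> 'w \<Rightarrow> real) \<Rightarrow> real" where
  "drift_error a x \<beta> = (LINT z|Q. \<bar>\<beta> (fst z) (snd z) - a (flow x \<beta> z)\<bar>)"

lemma driftedD:
  assumes "drifted B x \<beta>"
  shows "(\<lambda>(t, \<omega>). \<beta> t \<omega>) \<in> borel_measurable (borel \<Otimes>\<^sub>M M)" "\<bar>\<beta> t \<omega>\<bar> \<le> B"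
    "t \<ge> 0 \<Longrightarrow> known_at t (\<beta> t)" "t \<ge> 0 \<Longrightarrow> known_at t (path x \<beta> t)"
    "(\<lambda>z. \<beta> (fst z) (snd z)) \<in> borel_measurable Q" "flow x \<beta> \<in> borel_measurable Q"
proof -
  show j: "(\<lambda>(t, \<omega>). \<beta> t \<omega>) \<in> borel_measurable (borel \<Otimes>\<^sub>M M)"
    using assms unfolding drifted_def by blast
  show "\<bar>\<beta> t \<omega>\<bar> \<le> B" using assms unfolding drifted_def by blast
  show "t \<ge> 0 \<Longrightarrow> known_at t (\<beta> t)" "t \<ge> 0 \<Longrightarrow> known_at t (path x \<beta> t)"
    using assms unfolding drifted_def by blast+
  show "(\<lambda>z. \<beta> (fst z) (snd z)) \<in> borel_measurable Q" by (rule joint_Q[OF j])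
  show "flow x \<beta> \<in> borel_measurable Q" by (rule joint_Q[OF path_joint[OF j]])
qed

lemma drift_integrable:
  assumes "drifted B x \<beta>" "\<omega> \<in> space M"
  shows "set_integrable lborel {u..t} (\<lambda>s. \<beta> s \<omega>)"
  by (rule set_integrable_bounded_Icc[where C=B])
     (use joint_section(2)[OF driftedD(1)[OF assms(1)] assms(2)] driftedD(2)[OF assms(1)] in auto)

lemma drift_error_integrable:
  assumes d: "drifted B x \<beta>" and [measurable]: "a \<in> borel_measurable borel" and ab: "\<And>y. \<bar>a y\<bar> \<le> B"
  shows "integrable Q (\<lambda>z. \<bar>\<beta> (fst z) (snd z) - a (flow x \<beta> z)\<bar>)"
proof (rule Q.integrable_const_bound[where B="2 * B"])
  note [measurable] = driftedD(5,6)[OF d]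
  show "(\<lambda>z. \<bar>\<beta> (fst z) (snd z) - a (flow x \<beta> z)\<bar>) \<in> borel_measurable Q" by measurable
  have "\<bar>\<beta> t \<omega> - a y\<bar> \<le> 2 * B" for t \<omega> y
    using driftedD(2)[OF d, of t \<omega>] ab[of y] by linarith
  then show "AE z in Q. norm \<bar>\<beta> (fst z) (snd z) - a (flow x \<beta> z)\<bar> \<le> 2 * B" by simp
qed

lemma drift_error_nonneg: "drift_error a x \<beta> \<ge> 0"
  unfolding drift_error_def by (intro integral_nonneg_AE) simp

text \<open>
  With \<open>K f = a * D f\<close>, the resolvent identity reads \<open>E f(\<xi>) = E f(x + Z) + E (K f)(\<xi>)\<close> up to the
  drift error. Subtracting the identity for the second path leaves the difference of the noise terms,
  which is Lipschitz in the starting points, and the same problem for \<open>K f\<close>, whose supremum norm is at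
  most half of that of \<open>f\<close>.
\<close>

lemma law_comparison_iterate:
  assumes d1: "drifted B x \<beta>" and d2: "drifted B y \<gamma>"
    and a[measurable]: "a \<in> borel_measurable borel" and ab: "\<And>y. \<bar>a y\<bar> \<le> B"
    and "f \<in> borel_measurable borel" and "\<And>y. \<bar>f y\<bar> \<le> C"
  shows "\<bar>(LINT z|Q. f (flow x \<beta> z)) - (LINT z|Q. f (flow y \<gamma> z))\<bar>
    \<le> 2 * kappa * C * (l * \<bar>x - y\<bar> + drift_error a x \<beta> + drift_error a y \<gamma>) + 2 * C / 2 ^ n"
  using assms(5,6)
proof (induction n arbitrary: f C)
  case 0
  have C: "C \<ge> 0" using 0(2)[of 0] by linarith
  have b: "\<bar>LINT z|Q. f (flow u \<delta> z)\<bar> \<le> C" if d: "drifted B u \<delta>" for u \<delta>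
  proof -
    note [measurable] = driftedD(6)[OF d] 0(1)
    have i: "integrable Q (\<lambda>z. f (flow u \<delta> z))"
      by (rule Q.integrable_const_bound[where B=C]) (use 0(2) in auto)
    have "\<bar>LINT z|Q. f (flow u \<delta> z)\<bar> \<le> (LINT z|Q. C)"
      by (rule abs_integral_le[OF i]) (use 0(2) in auto)
    then show ?thesis by (simp add: Q.prob_space)
  qed
  have nn: "0 \<le> 2 * kappa * C * (l * \<bar>x - y\<bar> + drift_error a x \<beta> + drift_error a y \<gamma>)"
    using C kappa_nonneg l drift_error_nonneg by (intro mult_nonneg_nonneg add_nonneg_nonneg) auto
  have "\<bar>(LINT z|Q. f (flow x \<beta> z)) - (LINT z|Q. f (flow y \<gamma> z))\<bar> \<le> 2 * C"
    using b[OF d1] b[OF d2] by linarith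
  from add_increasing[OF nn this] show ?case by simp
next
  case (Suc n)
  note f[measurable] = Suc.prems(1) and fb = Suc.prems(2)
  have C: "C \<ge> 0" using fb[of 0] by linarith
  define Kf where "Kf y = a y * D f y" for y
  have Kfm[measurable]: "Kf \<in> borel_measurable borel" unfolding Kf_def by measurable
  have Db: "\<bar>D f y\<bar> \<le> kappa * C" for y by (rule D_bound[OF f fb])
  have Kb: "\<bar>Kf y\<bar> \<le> C / 2" for y
  proof -
    have "\<bar>Kf y\<bar> \<le> B * (kappa * C)" unfolding Kf_def abs_mult using ab Db B0 by (intro mult_mono) auto
    also have "\<dots> \<le> C / 2" using mult_right_mono[OF small C] by simp
    finally show ?thesis .
  qed
  have step: "\<bar>(LINT z|Q. f (flow u \<delta> z)) - (LINT z|Q. f (noise u z)) - (LINT z|Q. Kf (flow u \<delta> z))\<bar> \<le> kappa * C * drift_error a u \<delta>"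
    if d: "drifted B u \<delta>" for u \<delta>
  proof -
    note [measurable] = driftedD(5,6)[OF d]
    let ?b = "\<lambda>z. \<delta> (fst z) (snd z)"
    have i1: "integrable Q (\<lambda>z. ?b z * D f (flow u \<delta> z))"
      by (rule Q.integrable_const_bound[where B="B * (kappa * C)"])
         (use driftedD(2)[OF d] Db B0 in \<open>auto simp: abs_mult intro!: AE_I2 mult_mono\<close>)
    have i2: "integrable Q (\<lambda>z. Kf (flow u \<delta> z))"
      by (rule Q.integrable_const_bound[where B="C / 2"]) (use Kb in auto)
    have e: "(LINT z|Q. f (flow u \<delta> z)) - (LINT z|Q. f (noise u z)) - (LINT z|Q. Kf (flow u \<delta> z))
      = (LINT z|Q. ?b z * D f (flow u \<delta> z) - Kf (flow u \<delta> z))"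
      using path_resolvent_identity[OF d f fb] i1 i2 by simp
    have "\<bar>LINT z|Q. ?b z * D f (flow u \<delta> z) - Kf (flow u \<delta> z)\<bar> \<le> (LINT z|Q. kappa * C * \<bar>?b z - a (flow u \<delta> z)\<bar>)"
    proof (rule abs_integral_le)
      show "integrable Q (\<lambda>z. ?b z * D f (flow u \<delta> z) - Kf (flow u \<delta> z))" using i1 i2 by simp
      show "integrable Q (\<lambda>z. kappa * C * \<bar>?b z - a (flow u \<delta> z)\<bar>)"
        using drift_error_integrable[OF d a ab] by simp
      fix z
      have "?b z * D f (flow u \<delta> z) - Kf (flow u \<delta> z) = D f (flow u \<delta> z) * (?b z - a (flow u \<delta> z))"
        by (simp add: Kf_def algebra_simps)
      then show "\<bar>?b z * D f (flow u \<delta> z) - Kf (flow u \<delta> z)\<bar> \<le> kappa * C * \<bar>?b z - a (flow u \<delta> z)\<bar>"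
        using Db[of "flow u \<delta> z"] by (simp add: abs_mult mult_right_mono)
    qed
    also have "\<dots> = kappa * C * drift_error a u \<delta>"
      unfolding drift_error_def by (rule integral_mult_right_zero)
    finally show ?thesis unfolding e .
  qed
  let ?S = "l * \<bar>x - y\<bar> + drift_error a x \<beta> + drift_error a y \<gamma>"
  have "\<bar>(LINT z|Q. f (flow x \<beta> z)) - (LINT z|Q. f (flow y \<gamma> z))\<bar>
    \<le> \<bar>(LINT z|Q. f (noise x z)) - (LINT z|Q. f (noise y z))\<bar>
      + \<bar>(LINT z|Q. Kf (flow x \<beta> z)) - (LINT z|Q. Kf (flow y \<gamma> z))\<bar>
      + kappa * C * drift_error a x \<beta> + kappa * C * drift_error a y \<gamma>"
  proof -
    have "\<bar>F1 - F2\<bar> \<le> \<bar>N1 - N2\<bar> + \<bar>K1 - K2\<bar> + e1 + e2"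
      if "\<bar>F1 - N1 - K1\<bar> \<le> e1" "\<bar>F2 - N2 - K2\<bar> \<le> e2" for F1 F2 N1 N2 K1 K2 e1 e2 :: real
      using that by linarith
    from this[OF step[OF d1] step[OF d2]] show ?thesis .
  qed
  also have "\<dots> \<le> l * kappa * C * \<bar>x - y\<bar> + (2 * kappa * (C / 2) * ?S + 2 * (C / 2) / 2 ^ n)
      + kappa * C * drift_error a x \<beta> + kappa * C * drift_error a y \<gamma>"
    by (intro add_mono order_refl noise_lipschitz[OF f fb] Suc.IH[OF Kfm Kb])
  also have "\<dots> = 2 * kappa * C * ?S + 2 * C / 2 ^ Suc n"
    by (simp add: algebra_simps)
  finally show ?case .
qed

lemma law_comparison:
  assumes "drifted B x \<beta>" and "drifted B y \<gamma>" and "a \<in> borel_measurable borel" and "\<And>y. \<bar>a y\<bar> \<le> B"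
    and "f \<in> borel_measurable borel" and "\<And>y. \<bar>f y\<bar> \<le> C"
  shows "\<bar>(LINT z|Q. f (flow x \<beta> z)) - (LINT z|Q. f (flow y \<gamma> z))\<bar>
    \<le> 2 * kappa * C * (l * \<bar>x - y\<bar> + drift_error a x \<beta> + drift_error a y \<gamma>)" (is "?L \<le> ?R")
proof -
  have "(\<lambda>n. ?R + 2 * C * (1 / 2) ^ n) \<longlonglongrightarrow> ?R + 2 * C * 0"
    by (intro tendsto_intros LIMSEQ_power_zero) simp
  moreover have "?L \<le> ?R + 2 * C * (1 / 2) ^ n" for n
    using law_comparison_iterate[OF assms, of n] by (simp add: power_one_over)
  ultimately show ?thesis using LIMSEQ_le_const[of _ "?R + 2 * C * 0" ?L] by auto
qed

lemma known_at_cong: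
  assumes "known_at t X" "\<And>\<omega>. \<omega> \<in> space M \<Longrightarrow> Y \<omega> = X \<omega>"
  shows "known_at t Y"
proof -
  obtain X' where "X' \<in> borel_measurable (F t)" "AE \<omega> in M. X \<omega> = X' \<omega>"
    using assms(1) unfolding known_at_def by blast
  moreover have "AE \<omega> in M. Y \<omega> = X \<omega>" using assms(2) by (rule AE_I2)
  ultimately have "AE \<omega> in M. Y \<omega> = X' \<omega>" by (auto elim: eventually_elim2)
  then show ?thesis using \<open>X' \<in> _\<close> unfolding known_at_def by blast
qed

text \<open>
  The drift of the upper path; at times when the two paths meet it is the mean of the two drifts.
\<close>

definition max_drift :: "real \<Rightarrow> (real \<Rightarrow> 'w \<Rightarrow> real) \<Rightarrow> real \<Rightarrow> (real \<Rightarrow> 'w \<Rightarrow> real) \<Rightarrow> real \<Rightarrow> 'w \<Rightarrow> real" where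
  "max_drift x \<beta> y \<gamma> t \<omega> =
     (\<beta> t \<omega> + \<gamma> t \<omega> + sgn (path x \<beta> t \<omega> - path y \<gamma> t \<omega>) * (\<beta> t \<omega> - \<gamma> t \<omega>)) / 2"

lemma max_drift_cases:
  "path x \<beta> t \<omega> > path y \<gamma> t \<omega> \<Longrightarrow> max_drift x \<beta> y \<gamma> t \<omega> = \<beta> t \<omega>"
  "path x \<beta> t \<omega> < path y \<gamma> t \<omega> \<Longrightarrow> max_drift x \<beta> y \<gamma> t \<omega> = \<gamma> t \<omega>"
  "path x \<beta> t \<omega> = path y \<gamma> t \<omega> \<Longrightarrow> max_drift x \<beta> y \<gamma> t \<omega> = (\<beta> t \<omega> + \<gamma> t \<omega>) / 2"
  by (auto simp: max_drift_def sgn_if)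

lemma max_drift_joint:
  assumes d1: "drifted B x \<beta>" and d2: "drifted B y \<gamma>"
  shows "(\<lambda>(t, \<omega>). max_drift x \<beta> y \<gamma> t \<omega>) \<in> borel_measurable (borel \<Otimes>\<^sub>M M)"
proof -
  note [measurable] = driftedD(1)[OF d1] driftedD(1)[OF d2] path_joint[OF driftedD(1)[OF d1]] path_joint[OF driftedD(1)[OF d2]]
  show ?thesis unfolding max_drift_def by measurable
qed

text \<open>
  \<open>max u v = (u + v + \<bar>u - v\<bar>) / 2\<close>, and the noise cancels in the difference of the two paths, to
  which the chain rule for the absolute value applies.
\<close>

lemma path_max:
  assumes d1: "drifted B x \<beta>" and d2: "drifted B y \<gamma>" and t: "t \<ge> 0" and w: "\<omega> \<in> space M"
  shows "path (max x y) (max_drift x \<beta> y \<gamma>) t \<omega> = max (path x \<beta> t \<omega>) (path y \<gamma> t \<omega>)"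
proof -
  note i1 = drift_integrable[OF d1 w] and i2 = drift_integrable[OF d2 w]
  define A where "A s = path x \<beta> s \<omega> - path y \<gamma> s \<omega>" for s
  have bm: "(\<lambda>s. \<beta> s \<omega> - \<gamma> s \<omega>) \<in> borel_measurable borel"
    using joint_section(2)[OF driftedD(1)[OF d1] w] joint_section(2)[OF driftedD(1)[OF d2] w] by measurable
  have bb: "\<bar>\<beta> s \<omega> - \<gamma> s \<omega>\<bar> \<le> 2 * B" for s
    using driftedD(2)[OF d1, of s \<omega>] driftedD(2)[OF d2, of s \<omega>] by linarith
  have A: "A s = (x - y) + (LINT r:{0..s}|lborel. \<beta> r \<omega> - \<gamma> r \<omega>)" for s
    using set_integral_diff(2)[OF i1 i2, of 0 s] by (simp add: A_def path_def)
  have abs: "\<bar>A t\<bar> = \<bar>x - y\<bar> + (LINT s:{0..t}|lborel. (\<beta> s \<omega> - \<gamma> s \<omega>) * sgn (A s))"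
    by (rule abs_indefinite_integral[OF bm bb A t])
  have i3: "set_integrable lborel {0..t} (\<lambda>s. (\<beta> s \<omega> - \<gamma> s \<omega>) * sgn (A s))"
  proof (rule set_integrable_bounded_Icc[where C="2 * B"])
    have [measurable]: "(\<lambda>s. \<beta> s \<omega> - \<gamma> s \<omega>) \<in> borel_measurable borel" by (rule bm)
    have [measurable]: "A \<in> borel_measurable borel" unfolding A by measurable
    show "(\<lambda>s. (\<beta> s \<omega> - \<gamma> s \<omega>) * sgn (A s)) \<in> borel_measurable borel" by measurable
    show "norm ((\<beta> s \<omega> - \<gamma> s \<omega>) * sgn (A s)) \<le> 2 * B" for s
      using bb[of s] B0 by (auto simp: sgn_if)
  qed
  have "(LINT s:{0..t}|lborel. max_drift x \<beta> y \<gamma> s \<omega>)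
     = (LINT s:{0..t}|lborel. ((\<beta> s \<omega> + \<gamma> s \<omega>) + (\<beta> s \<omega> - \<gamma> s \<omega>) * sgn (A s)) / 2)"
    by (intro set_lebesgue_integral_cong) (auto simp: max_drift_def A_def mult.commute)
  also have "\<dots> = (LINT s:{0..t}|lborel. (\<beta> s \<omega> + \<gamma> s \<omega>) + (\<beta> s \<omega> - \<gamma> s \<omega>) * sgn (A s)) / 2"
    by (rule set_integral_divide_zero)
  also have "(LINT s:{0..t}|lborel. (\<beta> s \<omega> + \<gamma> s \<omega>) + (\<beta> s \<omega> - \<gamma> s \<omega>) * sgn (A s))
     = (LINT s:{0..t}|lborel. \<beta> s \<omega> + \<gamma> s \<omega>) + (LINT s:{0..t}|lborel. (\<beta> s \<omega> - \<gamma> s \<omega>) * sgn (A s))"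
    by (rule set_integral_add(2)[OF set_integral_add(1)[OF i1 i2] i3])
  also have "(LINT s:{0..t}|lborel. \<beta> s \<omega> + \<gamma> s \<omega>) = (LINT s:{0..t}|lborel. \<beta> s \<omega>) + (LINT s:{0..t}|lborel. \<gamma> s \<omega>)"
    by (rule set_integral_add(2)[OF i1 i2])
  finally have e: "2 * (LINT s:{0..t}|lborel. max_drift x \<beta> y \<gamma> s \<omega>)
      = (LINT s:{0..t}|lborel. \<beta> s \<omega>) + (LINT s:{0..t}|lborel. \<gamma> s \<omega>) + (\<bar>A t\<bar> - \<bar>x - y\<bar>)"
    using abs by simp
  have m: "max u v = (u + v + \<bar>u - v\<bar>) / 2" for u v :: real by (simp add: max_def)
  have "max (path x \<beta> t \<omega>) (path y \<gamma> t \<omega>) = (path x \<beta> t \<omega> + path y \<gamma> t \<omega> + \<bar>A t\<bar>) / 2"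
    by (simp only: m A_def)
  note facts = this e m[of x y] path_def[of x \<beta> t \<omega>] path_def[of y \<gamma> t \<omega>] path_def[of "max x y" "max_drift x \<beta> y \<gamma>" t \<omega>]
  have "P = mm" if "mm = (p + q + u) / 2" "2 * J = b + g + (u - v)" "mx = (x + y + v) / 2"
      "p = x + b + zz" "q = y + g + zz" "P = mx + J + zz" for P mm p q u J b g v mx zz :: real
    using that by argo
  from this[OF facts] show ?thesis .
qed

lemma drifted_max:
  assumes d1: "drifted B x \<beta>" and d2: "drifted B y \<gamma>"
  shows "drifted B (max x y) (max_drift x \<beta> y \<gamma>)"
  unfolding drifted_def
proof (intro conjI allI impI)
  show "(\<lambda>(t, \<omega>). max_drift x \<beta> y \<gamma> t \<omega>) \<in> borel_measurable (borel \<Otimes>\<^sub>M M)" by (rule max_drift_joint[OF d1 d2])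
  show "\<bar>max_drift x \<beta> y \<gamma> t \<omega>\<bar> \<le> B" for t \<omega>
    using driftedD(2)[OF d1, of t \<omega>] driftedD(2)[OF d2, of t \<omega>] max_drift_cases[where x=x and \<beta>=\<beta> and y=y and \<gamma>=\<gamma> and t=t and \<omega>=\<omega>]
    by (cases "path x \<beta> t \<omega>" "path y \<gamma> t \<omega>" rule: linorder_cases) auto
  fix t :: real assume t: "t \<ge> 0"
  note kb = driftedD(3)[OF d1 t] driftedD(3)[OF d2 t] and kp = driftedD(4)[OF d1 t] driftedD(4)[OF d2 t]
  have s: "known_at t (\<lambda>\<omega>. sgn (path x \<beta> t \<omega> - path y \<gamma> t \<omega>))"
    by (rule known_at_compose[OF kp]) measurable
  have "known_at t (\<lambda>\<omega>. \<beta> t \<omega> - \<gamma> t \<omega>)" by (rule known_at_compose[OF kb]) measurable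
  from known_at_compose[OF s this, of "\<lambda>u v. u * v"]
  have p: "known_at t (\<lambda>\<omega>. sgn (path x \<beta> t \<omega> - path y \<gamma> t \<omega>) * (\<beta> t \<omega> - \<gamma> t \<omega>))" by simp
  have "known_at t (\<lambda>\<omega>. \<beta> t \<omega> + \<gamma> t \<omega>)" by (rule known_at_compose[OF kb]) measurable
  from known_at_compose[OF this p, of "\<lambda>u v. (u + v) / 2"]
  show "known_at t (max_drift x \<beta> y \<gamma> t)" by (simp add: max_drift_def[abs_def])
  have "known_at t (\<lambda>\<omega>. max (path x \<beta> t \<omega>) (path y \<gamma> t \<omega>))" by (rule known_at_compose[OF kp]) measurable
  then show "known_at t (path (max x y) (max_drift x \<beta> y \<gamma>) t)"
    by (rule known_at_cong) (rule path_max[OF d1 d2 t])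
qed

lemma AE_Q_nonneg_space: "AE z in Q. fst z \<ge> 0 \<and> snd z \<in> space M"
  using AE_Q_nonneg AE_space[of Q] by eventually_elim (auto simp: Q_space)

lemma drift_error_max:
  assumes d1: "drifted B x \<beta>" and d2: "drifted B y \<gamma>" and a[measurable]: "a \<in> borel_measurable borel" and ab: "\<And>y. \<bar>a y\<bar> \<le> B"
  shows "drift_error a (max x y) (max_drift x \<beta> y \<gamma>) \<le> drift_error a x \<beta> + drift_error a y \<gamma>"
proof -
  note d3 = drifted_max[OF d1 d2]
  note i1 = drift_error_integrable[OF d1 a ab] and i2 = drift_error_integrable[OF d2 a ab]
  have "drift_error a (max x y) (max_drift x \<beta> y \<gamma>) \<le> (LINT z|Q. \<bar>\<beta> (fst z) (snd z) - a (flow x \<beta> z)\<bar> + \<bar>\<gamma> (fst z) (snd z) - a (flow y \<gamma> z)\<bar>)"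
    unfolding drift_error_def
  proof (rule integral_mono_AE[OF drift_error_integrable[OF d3 a ab] Bochner_Integration.integrable_add[OF i1 i2]])
    show "AE z in Q. \<bar>max_drift x \<beta> y \<gamma> (fst z) (snd z) - a (flow (max x y) (max_drift x \<beta> y \<gamma>) z)\<bar>
       \<le> \<bar>\<beta> (fst z) (snd z) - a (flow x \<beta> z)\<bar> + \<bar>\<gamma> (fst z) (snd z) - a (flow y \<gamma> z)\<bar>"
      using AE_Q_nonneg_space
    proof eventually_elim
      case (elim z)
      then have "flow (max x y) (max_drift x \<beta> y \<gamma>) z = max (flow x \<beta> z) (flow y \<gamma> z)"
        by (intro path_max[OF d1 d2]) auto
      then show ?case
        using max_drift_cases[where x=x and \<beta>=\<beta> and y=y and \<gamma>=\<gamma> and t="fst z" and \<omega>="snd z"]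
        by (cases "flow x \<beta> z" "flow y \<gamma> z" rule: linorder_cases) (auto simp: abs_if field_simps)
    qed
  qed
  also have "\<dots> = drift_error a x \<beta> + drift_error a y \<gamma>"
    unfolding drift_error_def by (rule Bochner_Integration.integral_add[OF i1 i2])
  finally show ?thesis .
qed

text \<open>
  For monotone \<open>f\<close> the distance \<open>\<bar>f \<xi> - f \<eta>\<bar>\<close> is \<open>(f (max \<xi> \<eta>) - f \<xi>) + (f (max \<xi> \<eta>) - f \<eta>)\<close>. Its
  expectation depends only on the laws of \<open>\<xi>\<close>, \<open>\<eta>\<close> and \<open>max \<xi> \<eta>\<close>, and these are close by
  \<open>law_comparison\<close>.
\<close>

lemma clamped_comparison:
  assumes d1: "drifted B x \<beta>" and d2: "drifted B y \<gamma>" and a[measurable]: "a \<in> borel_measurable borel" and ab: "\<And>y. \<bar>a y\<bar> \<le> B"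
    and f[measurable]: "f \<in> borel_measurable borel" and fb: "\<And>y. \<bar>f y\<bar> \<le> R" and mono: "mono f"
  shows "(LINT z|Q. \<bar>f (flow x \<beta> z) - f (flow y \<gamma> z)\<bar>) \<le> 4 * kappa * R * (l * \<bar>x - y\<bar> + 2 * (drift_error a x \<beta> + drift_error a y \<gamma>))"
proof -
  note d3 = drifted_max[OF d1 d2]
  let ?\<delta> = "max_drift x \<beta> y \<gamma>"
  have R: "R \<ge> 0" using fb[of 0] by linarith
  have i: "integrable Q (\<lambda>z. f (flow u \<delta> z))" if d: "drifted B u \<delta>" for u \<delta>
  proof -
    note [measurable] = driftedD(6)[OF d]
    show ?thesis by (rule Q.integrable_const_bound[where B=R]) (use fb in auto)
  qed
  have "(LINT z|Q. \<bar>f (flow x \<beta> z) - f (flow y \<gamma> z)\<bar>)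
      = (LINT z|Q. (f (flow (max x y) ?\<delta> z) - f (flow x \<beta> z)) + (f (flow (max x y) ?\<delta> z) - f (flow y \<gamma> z)))"
  proof (rule integral_cong_AE)
    show "AE z in Q. \<bar>f (flow x \<beta> z) - f (flow y \<gamma> z)\<bar> = (f (flow (max x y) ?\<delta> z) - f (flow x \<beta> z)) + (f (flow (max x y) ?\<delta> z) - f (flow y \<gamma> z))"
      using AE_Q_nonneg_space
    proof eventually_elim
      case (elim z)
      then have "flow (max x y) ?\<delta> z = max (flow x \<beta> z) (flow y \<gamma> z)"
        by (intro path_max[OF d1 d2]) auto
      then show ?case using monoD[OF mono, of "flow x \<beta> z" "flow y \<gamma> z"] monoD[OF mono, of "flow y \<gamma> z" "flow x \<beta> z"]
        by (auto simp: max_def)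
    qed
  qed (use driftedD(6)[OF d1] driftedD(6)[OF d2] driftedD(6)[OF d3] in measurable)
  also have "\<dots> = ((LINT z|Q. f (flow (max x y) ?\<delta> z)) - (LINT z|Q. f (flow x \<beta> z))) + ((LINT z|Q. f (flow (max x y) ?\<delta> z)) - (LINT z|Q. f (flow y \<gamma> z)))"
    using i[OF d1] i[OF d2] i[OF d3] by simp
  also have "\<dots> \<le> 2 * kappa * R * (l * \<bar>max x y - x\<bar> + drift_error a (max x y) ?\<delta> + drift_error a x \<beta>)
       + 2 * kappa * R * (l * \<bar>max x y - y\<bar> + drift_error a (max x y) ?\<delta> + drift_error a y \<gamma>)"
    by (intro add_mono order_trans[OF abs_ge_self law_comparison] d1 d2 d3 a ab f fb)
  also have "\<dots> = 2 * kappa * R * (l * (\<bar>max x y - x\<bar> + \<bar>max x y - y\<bar>) + 2 * drift_error a (max x y) ?\<delta> + (drift_error a x \<beta> + drift_error a y \<gamma>))"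
    by (simp add: algebra_simps)
  also have "\<dots> \<le> 2 * kappa * R * (l * (2 * \<bar>x - y\<bar>) + 4 * (drift_error a x \<beta> + drift_error a y \<gamma>))"
  proof (rule mult_left_mono)
    have "l * (\<bar>max x y - x\<bar> + \<bar>max x y - y\<bar>) \<le> l * (2 * \<bar>x - y\<bar>)"
      using l by (intro mult_left_mono) (auto simp: max_def)
    moreover have "p + 2 * e + (u + v) \<le> q + 4 * (u + v)" if "p \<le> q" "e \<le> u + v" "0 \<le> u" "0 \<le> v" for p q e u v :: real
      using that by argo
    ultimately show "l * (\<bar>max x y - x\<bar> + \<bar>max x y - y\<bar>) + 2 * drift_error a (max x y) ?\<delta> + (drift_error a x \<beta> + drift_error a y \<gamma>)
      \<le> l * (2 * \<bar>x - y\<bar>) + 4 * (drift_error a x \<beta> + drift_error a y \<gamma>)"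
      using drift_error_max[OF d1 d2 a ab] drift_error_nonneg[of a x \<beta>] drift_error_nonneg[of a y \<gamma>] by blast
  qed (use kappa_nonneg R in simp)
  finally show ?thesis by (simp add: algebra_simps)
qed

end

section \<open>The distance of two drifted paths\<close>

lemma finite_weight_measure:
  assumes "\<alpha> > (1 :: real)"
  shows "finite_measure (weight_measure \<alpha>)"
proof
  have i: "integrable lborel (\<lambda>x::real. 2 * inverse (1 + x\<^sup>2) :: real)"
    using integrable_inverse_1_plus_square by (simp add: set_integrable_def einterval_def)
  have "emeasure (weight_measure \<alpha>) (space (weight_measure \<alpha>)) = (\<integral>\<^sup>+ x. ennreal ((1 + \<bar>x\<bar>) powr (- (\<alpha> + 1))) \<partial>lborel)"
    unfolding weight_measure_def by (subst emeasure_density) (auto intro!: nn_integral_cong)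
  also have "\<dots> \<le> (\<integral>\<^sup>+ x. ennreal (2 * inverse (1 + x\<^sup>2)) \<partial>lborel)"
  proof (intro nn_integral_mono ennreal_leI)
    fix x :: real
    have "(1 + \<bar>x\<bar>) powr (- (\<alpha> + 1)) \<le> (1 + \<bar>x\<bar>) powr (- 2)"
      using assms by (intro powr_mono) auto
    also have "\<dots> = inverse ((1 + \<bar>x\<bar>)\<^sup>2)" by (simp add: powr_minus powr_numeral)
    also have "\<dots> \<le> inverse (1 + x\<^sup>2)"
    proof (rule le_imp_inverse_le)
      have "(1 + \<bar>x\<bar>)\<^sup>2 = 1 + 2 * \<bar>x\<bar> + x\<^sup>2" by (simp add: power2_sum)
      then show "1 + x\<^sup>2 \<le> (1 + \<bar>x\<bar>)\<^sup>2" by simp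
    qed (simp add: add_pos_nonneg)
    also have "\<dots> \<le> 2 * inverse (1 + x\<^sup>2)" by simp
    finally show "(1 + \<bar>x\<bar>) powr (- (\<alpha> + 1)) \<le> 2 * inverse (1 + x\<^sup>2)" .
  qed
  also have "\<dots> < \<infinity>" using i unfolding integrable_iff_bounded by simp
  finally show "emeasure (weight_measure \<alpha>) (space (weight_measure \<alpha>)) \<noteq> \<infinity>" by simp
qed

lemma sets_weight_measure[measurable_cong, simp]: "sets (weight_measure \<alpha>) = sets borel"
  and space_weight_measure[simp]: "space (weight_measure \<alpha>) = UNIV"
  by (simp_all add: weight_measure_def)

context damped_noise
begin

text \<open>
  A common bound for all drifted paths that start in \<open>{- X0..X0}\<close>.
\<close>

definition envelope :: "real \<Rightarrow> real \<times> 'w \<Rightarrow> real" where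
  "envelope X0 z = X0 + B * \<bar>fst z\<bar> + \<bar>Z (max 0 (fst z)) (snd z)\<bar>"

text \<open>
  The integrand dominates both \<open>1\<close> and the distance of any two drifted paths that start in
  \<open>{- X0..X0}\<close>, on the event that one of them can leave \<open>{- R..R}\<close>.
\<close>

definition tail :: "real \<Rightarrow> real \<Rightarrow> real" where
  "tail X0 R = (LINT z|Q. (if envelope X0 z > R then 1 + 2 * X0 + 2 * B * \<bar>fst z\<bar> else 0))"

lemma envelope_measurable[measurable]: "envelope X0 \<in> borel_measurable Q"
  using joint_Q[OF Z_joint] unfolding envelope_def[abs_def] by measurable

text \<open>
  The exponential density leaves room for \<open>exp (l / 2 * t)\<close>, which dominates \<open>t\<close>.
\<close>

lemma integrable_time: "integrable Q (\<lambda>z. \<bar>fst z\<bar>)"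
proof -
  have "integrable T (\<lambda>t. \<bar>t\<bar>)"
  proof (rule Bochner_Integration.integrable_bound)
    \<comment> \<open>\<open>l exp (- l t) * 2 / l * exp (l t / 2) = 2 exp (- l t / 2)\<close> for \<open>t \<ge> 0\<close>\<close>
    have "integrable lborel (\<lambda>t. 2 * exp (- (l / 2 * \<bar>t\<bar>)))"
      using integrable_exp_abs_decay[of "l / 2"] l by simp
    then have "integrable lborel (\<lambda>t. exponential_density l t *\<^sub>R (2 / l * exp (l / 2 * \<bar>t\<bar>)))"
    proof (rule Bochner_Integration.integrable_bound)
      show "AE t in lborel. norm (exponential_density l t *\<^sub>R (2 / l * exp (l / 2 * \<bar>t\<bar>))) \<le> norm (2 * exp (- (l / 2 * \<bar>t\<bar>)))"
      proof (rule AE_I2)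
        fix t :: real
        have "exp (- (t * l)) * exp (l * t / 2) = exp (- (l * t / 2))" by (simp add: exp_add[symmetric])
        then show "norm (exponential_density l t *\<^sub>R (2 / l * exp (l / 2 * \<bar>t\<bar>))) \<le> norm (2 * exp (- (l / 2 * \<bar>t\<bar>)))"
          using l by (auto simp: exponential_density_def)
      qed
    qed measurable
    then show "integrable T (\<lambda>t. 2 / l * exp (l / 2 * \<bar>t\<bar>))"
      unfolding T_def by (subst integrable_density) (auto simp: exponential_density_nonneg[OF l])
    show "AE t in T. norm \<bar>t\<bar> \<le> norm (2 / l * exp (l / 2 * \<bar>t\<bar>))"
    proof (rule AE_I2)
      fix t :: real
      have "l / 2 * \<bar>t\<bar> \<le> exp (l / 2 * \<bar>t\<bar>)" using exp_ge_add_one_self[of "l / 2 * \<bar>t\<bar>"] by linarith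
      then have "2 / l * (l / 2 * \<bar>t\<bar>) \<le> 2 / l * exp (l / 2 * \<bar>t\<bar>)" using l by (intro mult_left_mono) auto
      then show "norm \<bar>t\<bar> \<le> norm (2 / l * exp (l / 2 * \<bar>t\<bar>))" using l by simp
    qed
  qed simp
  then have "integrable (T \<Otimes>\<^sub>M M) (\<lambda>(t, \<omega>). \<bar>t\<bar>)"
    by (intro TM.Fubini_integrable) (auto simp: prob_space)
  then show ?thesis by (simp add: Q_def case_prod_beta')
qed

lemma integrable_linear: "integrable Q (\<lambda>z. p + q * \<bar>fst z\<bar>)"
  using integrable_time by simp

lemma tail_integrable: "integrable Q (\<lambda>z. if envelope X0 z > R then 1 + 2 * X0 + 2 * B * \<bar>fst z\<bar> else 0)"
proof (rule Bochner_Integration.integrable_bound[OF integrable_linear[of "1 + 2 * X0" "2 * B"]])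
  show "(\<lambda>z. if envelope X0 z > R then 1 + 2 * X0 + 2 * B * \<bar>fst z\<bar> else 0) \<in> borel_measurable Q" by measurable
qed auto

lemma tail_tendsto: "(\<lambda>n. tail X0 (real n)) \<longlonglongrightarrow> 0"
proof -
  have "(\<lambda>n. tail X0 (real n)) \<longlonglongrightarrow> (LINT z|Q. (0::real))"
    unfolding tail_def
  proof (rule integral_dominated_convergence[where w="\<lambda>z. \<bar>1 + 2 * X0 + 2 * B * \<bar>fst z\<bar>\<bar>"])
    show "integrable Q (\<lambda>z. \<bar>1 + 2 * X0 + 2 * B * \<bar>fst z\<bar>\<bar>)"
      by (rule integrable_abs[OF integrable_linear])
    show "AE z in Q. (\<lambda>n. if real n < envelope X0 z then 1 + 2 * X0 + 2 * B * \<bar>fst z\<bar> else 0) \<longlonglongrightarrow> 0"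
    proof (intro AE_I2 tendsto_eventually)
      fix z
      obtain n0 :: nat where "envelope X0 z \<le> real n0" using real_arch_simple by blast
      then have "(if real n < envelope X0 z then 1 + 2 * X0 + 2 * B * \<bar>fst z\<bar> else 0) = 0" if "n \<ge> n0" for n
        using that by auto
      then show "\<forall>\<^sub>F n in sequentially. (if real n < envelope X0 z then 1 + 2 * X0 + 2 * B * \<bar>fst z\<bar> else 0) = 0"
        unfolding eventually_sequentially by blast
    qed
    show "(\<lambda>z. if real n < envelope X0 z then 1 + 2 * X0 + 2 * B * \<bar>fst z\<bar> else 0) \<in> borel_measurable Q" for n by measurable
  qed auto
  then show ?thesis by simp
qed

lemma drift_integral_bound:
  assumes d: "drifted B x \<beta>" and w: "\<omega> \<in> space M" and st: "0 \<le> s" "s \<le> t"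
  shows "\<bar>(LINT r:{0..t}|lborel. \<beta> r \<omega>) - (LINT r:{0..s}|lborel. \<beta> r \<omega>)\<bar> \<le> B * (t - s)"
  using norm_set_integral_Icc_le[OF drift_integrable[OF d w, of s t], of B] driftedD(2)[OF d] st
    indefinite_integral_increment[OF drift_integrable[OF d w] st] by simp

lemma path_diff_bound:
  assumes d1: "drifted B x \<beta>" and d2: "drifted B y \<gamma>" and w: "\<omega> \<in> space M" and t: "t \<ge> 0"
  shows "\<bar>path x \<beta> t \<omega> - path y \<gamma> t \<omega>\<bar> \<le> \<bar>x - y\<bar> + 2 * B * t"
  using drift_integral_bound[OF d1 w order_refl t] drift_integral_bound[OF d2 w order_refl t]
  by (simp add: path_def set_integral_lborel_singleton)

lemma flow_envelope:
  assumes d: "drifted B x \<beta>" and x: "\<bar>x\<bar> \<le> X0"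
  shows "AE z in Q. \<bar>flow x \<beta> z\<bar> \<le> envelope X0 z"
  using AE_Q_nonneg_space
proof eventually_elim
  case (elim z)
  then show ?case
    using drift_integral_bound[OF d, of "snd z" 0 "fst z"] x
    by (simp add: path_def envelope_def set_integral_lborel_singleton)
qed

lemma flow_distance_integrable:
  assumes d1: "drifted B x \<beta>" and d2: "drifted B y \<gamma>"
  shows "integrable Q (\<lambda>z. \<bar>flow x \<beta> z - flow y \<gamma> z\<bar>)"
proof (rule Bochner_Integration.integrable_bound[OF integrable_linear[of "\<bar>x - y\<bar>" "2 * B"]])
  note [measurable] = driftedD(6)[OF d1] driftedD(6)[OF d2]
  show "(\<lambda>z. \<bar>flow x \<beta> z - flow y \<gamma> z\<bar>) \<in> borel_measurable Q" by measurable
  show "AE z in Q. norm \<bar>flow x \<beta> z - flow y \<gamma> z\<bar> \<le> norm (\<bar>x - y\<bar> + 2 * B * \<bar>fst z\<bar>)"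
    using AE_Q_nonneg_space
  proof eventually_elim
    case (elim z)
    then show ?case using path_diff_bound[OF d1 d2, of "snd z" "fst z"] by simp
  qed
qed

text \<open>
  \<open>clamped_comparison\<close> for truncation to \<open>{- R..R}\<close>; where the truncation acts, the distance is
  covered by \<open>tail\<close>. The noise cancels in the distance, which therefore grows at most linearly in
  time and is integrable.
\<close>

lemma flow_distance:
  assumes d1: "drifted B x \<beta>" and d2: "drifted B y \<gamma>" and a: "a \<in> borel_measurable borel" and ab: "\<And>y. \<bar>a y\<bar> \<le> B"
    and x: "\<bar>x\<bar> \<le> X0" and y: "\<bar>y\<bar> \<le> X0" and R: "R \<ge> 0"
  shows "(LINT z|Q. \<bar>flow x \<beta> z - flow y \<gamma> z\<bar>) \<le> 4 * kappa * R * (l * \<bar>x - y\<bar> + 2 * (drift_error a x \<beta> + drift_error a y \<gamma>)) + tail X0 R"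
proof -
  define f where "f u = max (- R) (min R u)" for u :: real
  have fm[measurable]: "f \<in> borel_measurable borel" unfolding f_def by measurable
  have fb: "\<bar>f u\<bar> \<le> R" for u using R by (auto simp: f_def)
  have fmono: "mono f" by (auto simp: f_def mono_def)
  note [measurable] = driftedD(6)[OF d1] driftedD(6)[OF d2]
  let ?t = "\<lambda>z. if envelope X0 z > R then 1 + 2 * X0 + 2 * B * \<bar>fst z\<bar> else 0"
  have fi: "integrable Q (\<lambda>z. \<bar>f (flow x \<beta> z) - f (flow y \<gamma> z)\<bar>)"
  proof (rule Q.integrable_const_bound[where B="2 * R"])
    have "\<bar>f u - f v\<bar> \<le> 2 * R" for u v using fb[of u] fb[of v] by linarith
    then show "AE z in Q. norm \<bar>f (flow x \<beta> z) - f (flow y \<gamma> z)\<bar> \<le> 2 * R" by simp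
  qed measurable
  have "(LINT z|Q. \<bar>flow x \<beta> z - flow y \<gamma> z\<bar>) \<le> (LINT z|Q. \<bar>f (flow x \<beta> z) - f (flow y \<gamma> z)\<bar> + ?t z)"
  proof (rule integral_mono_AE[OF flow_distance_integrable[OF d1 d2] Bochner_Integration.integrable_add[OF fi tail_integrable]])
    show "AE z in Q. \<bar>flow x \<beta> z - flow y \<gamma> z\<bar> \<le> \<bar>f (flow x \<beta> z) - f (flow y \<gamma> z)\<bar> + ?t z"
      using AE_Q_nonneg_space flow_envelope[OF d1 x] flow_envelope[OF d2 y]
    proof eventually_elim
      case (elim z)
      show ?case
      proof (cases "envelope X0 z > R")
        case True
        then show ?thesis using path_diff_bound[OF d1 d2, of "snd z" "fst z"] elim x y by simp
      next
        case False
        then have "f (flow x \<beta> z) = flow x \<beta> z" "f (flow y \<gamma> z) = flow y \<gamma> z"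
          using elim by (auto simp: f_def)
        then show ?thesis using False by simp
      qed
    qed
  qed
  also have "\<dots> = (LINT z|Q. \<bar>f (flow x \<beta> z) - f (flow y \<gamma> z)\<bar>) + tail X0 R"
    unfolding tail_def by (rule Bochner_Integration.integral_add[OF fi tail_integrable])
  finally show ?thesis
    using clamped_comparison[OF d1 d2 a ab fm fb fmono] by linarith
qed

text \<open>
  The two properties of drifted paths that are used to integrate functions along them. In contrast
  to being a drifted path, they pass to limits.
\<close>

definition regular_occupation :: "real \<Rightarrow> (real \<times> 'w \<Rightarrow> real) \<Rightarrow> bool" where
  "regular_occupation X0 Y \<longleftrightarrow> Y \<in> borel_measurable Q \<and> (AE z in Q. \<bar>Y z\<bar> \<le> envelope X0 z) \<and>
     (\<forall>A\<in>sets borel. emeasure (distr Q borel Y) A \<le> ennreal (2 * l * kappa) * emeasure lborel A)"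

lemma regular_occupation_flow:
  assumes "drifted B x \<beta>" "\<bar>x\<bar> \<le> X0"
  shows "regular_occupation X0 (flow x \<beta>)"
  unfolding regular_occupation_def
  using flow_envelope[OF assms] driftedD(6)[OF assms(1)] krylov[OF assms(1) small] by auto

text \<open>
  On \<open>{- R..R}\<close> Lebesgue measure is at most \<open>(1 + R) powr (\<alpha> + 1)\<close> times the weight measure, and
  outside the envelope exceeds \<open>R\<close>.
\<close>

lemma occupation_bound:
  assumes Y: "regular_occupation X0 Y" and g[measurable]: "g \<in> borel_measurable borel"
    and g0: "\<And>y. 0 \<le> g y" and gm: "\<And>y. g y \<le> m" and R: "R \<ge> 0" and X0: "X0 \<ge> 0"
  shows "(LINT z|Q. g (Y z)) \<le> 2 * l * kappa * (1 + R) powr (\<alpha> + 1) * (LINT y|weight_measure \<alpha>. g y) + m * tail X0 R"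
proof -
  interpret W: finite_measure "weight_measure \<alpha>" by (rule finite_weight_measure[OF \<alpha>(1)])
  have Ym[measurable]: "Y \<in> borel_measurable Q" and env: "AE z in Q. \<bar>Y z\<bar> \<le> envelope X0 z"
    and occ: "\<And>A. A \<in> sets borel \<Longrightarrow> emeasure (distr Q borel Y) A \<le> ennreal (2 * l * kappa) * emeasure lborel A"
    using Y by (auto simp: regular_occupation_def)
  have m0: "m \<ge> 0" using g0[of 0] gm[of 0] by linarith
  let ?w = "\<lambda>y. (1 + \<bar>y\<bar>) powr (- (\<alpha> + 1))"
  let ?C = "(1 + R) powr (\<alpha> + 1)"
  \<comment> \<open>the part of \<open>g\<close> where the weight is bounded below\<close>
  define g1 where "g1 y = g y * indicator {- R..R} y" for y
  have g1m[measurable]: "g1 \<in> borel_measurable borel" unfolding g1_def by measurable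
  have g1b: "0 \<le> g1 y" "g1 y \<le> m" for y using g0[of y] gm[of y] m0 by (auto simp: g1_def split: split_indicator)
  have Wi: "integrable (weight_measure \<alpha>) g"
    by (rule W.integrable_const_bound[where B=m]) (use g0 gm in auto)
  have g1w: "g1 y \<le> ?C * (?w y * g y)" for y
  proof (cases "\<bar>y\<bar> \<le> R")
    case True
    have "1 = (1 + \<bar>y\<bar>) powr (\<alpha> + 1) * ?w y"
      using powr_add[of "1 + \<bar>y\<bar>" "\<alpha> + 1" "- (\<alpha> + 1)"] add_pos_nonneg[OF zero_less_one abs_ge_zero[of y]]
      by simp
    also have "\<dots> \<le> ?C * ?w y" using True \<alpha> by (intro mult_right_mono powr_mono2) auto
    finally have "1 * g y \<le> ?C * ?w y * g y" using g0[of y] by (rule mult_right_mono)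
    then show ?thesis using True by (simp add: g1_def abs_le_iff mult.assoc)
  next
    case False
    then show ?thesis using g0[of y] by (auto simp: g1_def indicator_def abs_le_iff)
  qed
  have i1: "integrable Q (\<lambda>z. g1 (Y z))"
    by (rule Q.integrable_const_bound[where B=m]) (use g1b in auto)
  have i0: "integrable Q (\<lambda>z. g (Y z))"
    by (rule Q.integrable_const_bound[where B=m]) (use g0 gm in auto)
  have "ennreal (LINT z|Q. g1 (Y z)) = (\<integral>\<^sup>+ z. ennreal (g1 (Y z)) \<partial>Q)"
    by (rule nn_integral_eq_integral[OF i1, symmetric]) (use g1b in simp)
  also have "\<dots> = (\<integral>\<^sup>+ y. ennreal (g1 y) \<partial>(distr Q borel Y))"
    by (rule nn_integral_distr[symmetric]) auto
  also have "\<dots> \<le> ennreal (2 * l * kappa) * (\<integral>\<^sup>+ y. ennreal (g1 y) \<partial>lborel)"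
    by (rule nn_integral_le_of_emeasure_le) (use occ in auto)
  also have "\<dots> \<le> ennreal (2 * l * kappa) * (\<integral>\<^sup>+ y. ennreal ?C * (ennreal (?w y) * ennreal (g y)) \<partial>lborel)"
    using g1w g0 by (intro mult_left_mono nn_integral_mono) (auto simp: ennreal_mult[symmetric] intro!: ennreal_leI)
  also have "(\<integral>\<^sup>+ y. ennreal ?C * (ennreal (?w y) * ennreal (g y)) \<partial>lborel) = ennreal ?C * (\<integral>\<^sup>+ y. ennreal (g y) \<partial>weight_measure \<alpha>)"
    unfolding weight_measure_def by (subst nn_integral_density) (auto simp: nn_integral_cmult)
  also have "(\<integral>\<^sup>+ y. ennreal (g y) \<partial>weight_measure \<alpha>) = ennreal (LINT y|weight_measure \<alpha>. g y)"
    by (rule nn_integral_eq_integral[OF Wi]) (use g0 in simp)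
  also have "ennreal (2 * l * kappa) * (ennreal ?C * ennreal (LINT y|weight_measure \<alpha>. g y)) = ennreal (2 * l * kappa * ?C * (LINT y|weight_measure \<alpha>. g y))"
    using l kappa_nonneg by (simp add: ennreal_mult'[symmetric] mult.assoc)
  finally have main: "(LINT z|Q. g1 (Y z)) \<le> 2 * l * kappa * ?C * (LINT y|weight_measure \<alpha>. g y)"
    using l kappa_nonneg by (subst (asm) ennreal_le_iff) (auto intro!: mult_nonneg_nonneg integral_nonneg_AE simp: g0)
  let ?t = "\<lambda>z. if envelope X0 z > R then 1 + 2 * X0 + 2 * B * \<bar>fst z\<bar> else 0"
  have it: "integrable Q (\<lambda>z. g1 (Y z) + m * ?t z)" using i1 tail_integrable[of R X0] by simp
  have "(LINT z|Q. g (Y z)) \<le> (LINT z|Q. g1 (Y z) + m * ?t z)"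
  proof (rule integral_mono_AE[OF i0 it])
    show "AE z in Q. g (Y z) \<le> g1 (Y z) + m * ?t z"
      using env
    proof eventually_elim
      case (elim z)
      show ?case
      proof (cases "envelope X0 z > R")
        case True
        have "m * 1 \<le> m * (1 + 2 * X0 + 2 * B * \<bar>fst z\<bar>)"
          using m0 X0 B0 by (intro mult_left_mono) auto
        then show ?thesis using True gm[of "Y z"] g1b(1)[of "Y z"] by simp
      next
        case False
        then show ?thesis using elim by (simp add: g1_def indicator_def abs_le_iff)
      qed
    qed
  qed
  also have "\<dots> = (LINT z|Q. g1 (Y z)) + m * tail X0 R"
    unfolding tail_def using i1 tail_integrable[of R X0] by simp
  finally show ?thesis using main by linarith
qed

end

section \<open>Approximate solutions\<close>

lemma weight_integral_tendsto_0:
  assumes \<alpha>: "\<alpha> > (1 :: real)" and g[measurable]: "\<And>n. g n \<in> borel_measurable borel" and b: "\<And>n y. \<bar>g n y\<bar> \<le> (m :: real)"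
    and lim: "AE y in lborel. (\<lambda>n. g n y) \<longlonglongrightarrow> 0"
  shows "(\<lambda>n. LINT y|weight_measure \<alpha>. g n y) \<longlonglongrightarrow> 0"
proof -
  interpret W: finite_measure "weight_measure \<alpha>" by (rule finite_weight_measure[OF \<alpha>])
  have "AE y in weight_measure \<alpha>. (\<lambda>n. g n y) \<longlonglongrightarrow> 0"
    unfolding weight_measure_def by (subst AE_density) (use lim in \<open>auto elim: eventually_mono\<close>)
  then have "(\<lambda>n. LINT y|weight_measure \<alpha>. g n y) \<longlonglongrightarrow> (LINT y|weight_measure \<alpha>. 0)"
    by (intro integral_dominated_convergence[where w="\<lambda>_. m"]) (use b in auto)
  then show ?thesis by simp
qed

lemma right_continuous_stop:
  fixes f :: "real \<Rightarrow> real"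
  assumes "\<And>s. (f \<longlongrightarrow> f s) (at_right s)"
  shows "((\<lambda>s. f (min u s)) \<longlongrightarrow> f (min u s)) (at_right s)"
proof (cases "s < u")
  case True
  have "eventually (\<lambda>r. f r = f (min u r)) (at_right s)"
    using True by (auto simp: eventually_at_right_field intro!: exI[of _ u])
  from Lim_transform_eventually[OF assms this] show ?thesis using True by simp
next
  case False
  have "eventually (\<lambda>r. f u = f (min u r)) (at_right s)"
    using False by (auto simp: eventually_at_right_field intro!: exI[of _ "s + 1"])
  from Lim_transform_eventually[OF tendsto_const this] show ?thesis using False by simp
qed

text \<open>
  The averages over intervals of length \<open>1 / Suc n\<close>, which converge by Lebesgue's differentiation
  theorem.
\<close>

lemma lipschitz_averages:
  fixes a :: "real \<Rightarrow> real"
  assumes a[measurable]: "a \<in> borel_measurable borel" and ab: "\<And>y. \<bar>a y\<bar> \<le> B"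
  obtains g :: "nat \<Rightarrow> real \<Rightarrow> real" where "\<And>n. g n \<in> borel_measurable borel" "\<And>n y. \<bar>g n y\<bar> \<le> B"
    "\<And>n u v. \<bar>g n u - g n v\<bar> \<le> 2 * B * real (Suc n) * \<bar>u - v\<bar>" "AE y in lborel. (\<lambda>n. g n y) \<longlonglongrightarrow> a y"
proof -
  have B0: "B \<ge> 0" using ab[of 0] by linarith
  have ai: "set_integrable lborel {u..v} a" for u v
    by (rule set_integrable_bounded_Icc[where C=B]) (use ab in auto)
  define h where "h n = 1 / real (Suc n)" for n
  have h: "h n > 0" for n by (simp add: h_def)
  define g where "g n y = (LINT s:{y..y + h n}|lborel. a s) / h n" for n y
  have gb: "\<bar>g n y\<bar> \<le> B" for n y
  proof -
    have "\<bar>LINT s:{y..y + h n}|lborel. a s\<bar> \<le> B * (y + h n - y)"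
      using norm_set_integral_Icc_le[OF ai, of y "y + h n" B] ab h[of n] by simp
    then show ?thesis using h[of n] by (simp add: g_def abs_divide pos_divide_le_eq)
  qed
  have glip': "\<bar>g n v - g n u\<bar> \<le> 2 * B * real (Suc n) * (v - u)" if uv: "u \<le> v" for n u v
  proof -
    let ?I = "\<lambda>y s. indicat_real {y..y + h n} s"
    have i: "integrable lborel (\<lambda>s. ?I y s * a s)" for y
      using ai[of y "y + h n"] by (simp add: set_integrable_def)
    have "(LINT s:{v..v + h n}|lborel. a s) - (LINT s:{u..u + h n}|lborel. a s) = (LINT s|lborel. ?I v s * a s - ?I u s * a s)"
      unfolding set_lebesgue_integral_def using Bochner_Integration.integral_diff[OF i[of v] i[of u]] by simp
    also have "\<bar>\<dots>\<bar> \<le> (LINT s|lborel. B * (indicat_real {u..v} s + indicat_real {u + h n..v + h n} s))"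
    proof (rule abs_integral_le)
      show "integrable lborel (\<lambda>s. ?I v s * a s - ?I u s * a s)" using i by simp
      show "integrable lborel (\<lambda>s. B * (indicat_real {u..v} s + indicat_real {u + h n..v + h n} s))"
        by (auto simp: emeasure_lborel_Icc_eq intro!: integrable_real_indicator)
      fix s
      have "?I v s * a s - ?I u s * a s = (?I v s - ?I u s) * a s" by (simp add: algebra_simps)
      moreover have "\<bar>?I v s - ?I u s\<bar> \<le> indicat_real {u..v} s + indicat_real {u + h n..v + h n} s"
        using uv h[of n] by (auto simp: indicator_def)
      ultimately show "\<bar>?I v s * a s - ?I u s * a s\<bar> \<le> B * (indicat_real {u..v} s + indicat_real {u + h n..v + h n} s)"
        using ab[of s] B0 by (simp only: abs_mult) (subst mult.commute, intro mult_mono, auto)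
    qed
    also have "\<dots> = 2 * B * (v - u)"
      using uv by (subst integral_mult_right_zero) (simp add: emeasure_lborel_Icc_eq integrable_real_indicator)
    finally have "\<bar>(LINT s:{v..v + h n}|lborel. a s) - (LINT s:{u..u + h n}|lborel. a s)\<bar> / h n \<le> 2 * B * (v - u) / h n"
      using h[of n] by (intro divide_right_mono) auto
    moreover have "g n v - g n u = ((LINT s:{v..v + h n}|lborel. a s) - (LINT s:{u..u + h n}|lborel. a s)) / h n"
      unfolding g_def by (rule diff_divide_distrib[symmetric])
    moreover have "2 * B * (v - u) / h n = 2 * B * real (Suc n) * (v - u)" by (simp add: h_def del: of_nat_Suc)
    ultimately show ?thesis using h[of n] by (simp add: abs_divide del: of_nat_Suc)
  qed
  have glip: "\<bar>g n u - g n v\<bar> \<le> 2 * B * real (Suc n) * \<bar>u - v\<bar>" for n u v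
    using glip'[of u v n] glip'[of v u n] by (cases "u \<le> v") (auto simp: abs_minus_commute)
  have "continuous_on UNIV (g n)" for n
    by (rule lipschitz_on_continuous_on[where L="2 * B * real (Suc n)"])
       (use glip B0 in \<open>auto intro!: lipschitz_onI simp: dist_real_def\<close>)
  then have gm: "g n \<in> borel_measurable borel" for n by (rule borel_measurable_continuous_onI)
  have "a integrable_on cbox u v" for u v
    using set_borel_integral_eq_integral(1)[OF ai[of u v]] by simp
  from integrable_ccontinuous_explicit[OF this] obtain N where N: "negligible N" and
    lim: "\<And>y e. y \<notin> N \<Longrightarrow> 0 < e \<Longrightarrow> \<exists>d>0. \<forall>h. 0 < h \<and> h < d \<longrightarrow> norm (integral (cbox y (y + h *\<^sub>R One)) a /\<^sub>R h ^ DIM(real) - a y) < e"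
    by blast
  have "(\<lambda>n. g n y) \<longlonglongrightarrow> a y" if "y \<notin> N" for y
  proof (rule LIMSEQ_I)
    fix e :: real assume "e > 0"
    from lim[OF that this] obtain d where d: "d > 0" "\<And>h. 0 < h \<Longrightarrow> h < d \<Longrightarrow> norm (integral {y..y + h} a / h - a y) < e"
      by (auto simp: divide_inverse mult.commute)
    obtain n0 where n0: "inverse (real (Suc n0)) < d" using reals_Archimedean[OF d(1)] by blast
    have "norm (g n y - a y) < e" if "n \<ge> n0" for n
    proof -
      have "h n \<le> inverse (real (Suc n0))" using that by (simp add: h_def divide_inverse)
      then have "norm (integral {y..y + h n} a / h n - a y) < e" using h[of n] n0 by (intro d(2)) auto
      then show ?thesis unfolding g_def by (subst set_borel_integral_eq_integral(2)[OF ai])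
    qed
    then show "\<exists>no. \<forall>n\<ge>no. norm (g n y - a y) < e" by blast
  qed
  then have "AE y in lebesgue. (\<lambda>n. g n y) \<longlonglongrightarrow> a y"
    using N by (auto simp: negligible_iff_null_sets intro: AE_I'[of N])
  then have "AE y in lborel. (\<lambda>n. g n y) \<longlonglongrightarrow> a y" by (simp add: AE_completion_iff)
  with gm gb glip show ?thesis using that by blast
qed

context damped_noise
begin

text \<open>
  The threshold \<open>J\<close> does not depend on the process, so functions tending to \<open>0\<close> in the weight
  measure may be composed with processes that vary with \<open>n\<close>.
\<close>

lemma occupation_uniform:
  fixes g :: "nat \<Rightarrow> real \<Rightarrow> real"
  assumes g: "\<And>n. g n \<in> borel_measurable borel" and g0: "\<And>n y. 0 \<le> g n y" and gm: "\<And>n y. g n y \<le> m"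
    and lim: "(\<lambda>n. LINT y|weight_measure \<alpha>. g n y) \<longlonglongrightarrow> 0" and e: "e > 0" and X0: "X0 \<ge> 0"
  shows "\<exists>J. \<forall>n\<ge>J. \<forall>Y. regular_occupation X0 Y \<longrightarrow> (LINT z|Q. g n (Y z)) < e"
proof -
  have "(\<lambda>r. m * tail X0 (real r)) \<longlonglongrightarrow> m * 0" by (intro tendsto_intros tail_tendsto)
  then have "eventually (\<lambda>r. m * tail X0 (real r) < e / 2) sequentially" using e by (intro order_tendstoD) auto
  then obtain r where r: "m * tail X0 (real r) < e / 2" by (auto simp: eventually_sequentially)
  let ?C = "2 * l * kappa * (1 + real r) powr (\<alpha> + 1)"
  have "(\<lambda>n. ?C * (LINT y|weight_measure \<alpha>. g n y)) \<longlonglongrightarrow> ?C * 0" by (intro tendsto_intros lim)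
  then have "eventually (\<lambda>n. ?C * (LINT y|weight_measure \<alpha>. g n y) < e / 2) sequentially" using e by (intro order_tendstoD) auto
  then obtain J where J: "\<And>n. n \<ge> J \<Longrightarrow> ?C * (LINT y|weight_measure \<alpha>. g n y) < e / 2" by (auto simp: eventually_sequentially)
  show ?thesis
  proof (intro exI allI impI)
    fix n Y assume n: "n \<ge> J" and Y: "regular_occupation X0 Y"
    have "(LINT z|Q. g n (Y z)) \<le> ?C * (LINT y|weight_measure \<alpha>. g n y) + m * tail X0 (real r)"
      by (rule occupation_bound[OF Y g g0 gm]) (use X0 in auto)
    then show "(LINT z|Q. g n (Y z)) < e" using J[OF n] r by linarith
  qed
qed

text \<open>
  The paths are measurable at each time without exceptional null sets, so that a limit of them is
  adapted to a filtration that need not be complete.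
\<close>

definition approximable :: "(real \<Rightarrow> real) \<Rightarrow> real \<Rightarrow> bool" where
  "approximable a x \<longleftrightarrow> (\<forall>e>0. \<exists>\<beta>. drifted B x \<beta> \<and> (\<forall>t\<ge>0. path x \<beta> t \<in> borel_measurable (F t)) \<and> drift_error a x \<beta> < e)"

lemma drift_error_triangle:
  assumes d: "drifted B x \<beta>" and a[measurable]: "a \<in> borel_measurable borel" and ab: "\<And>y. \<bar>a y\<bar> \<le> B"
    and a'[measurable]: "a' \<in> borel_measurable borel" and ab': "\<And>y. \<bar>a' y\<bar> \<le> B"
  shows "drift_error a x \<beta> \<le> drift_error a' x \<beta> + (LINT z|Q. \<bar>a' (flow x \<beta> z) - a (flow x \<beta> z)\<bar>)"
proof -
  note [measurable] = driftedD(5,6)[OF d]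
  have b2: "\<bar>\<bar>a' y - a y\<bar>\<bar> \<le> 2 * B" for y using ab[of y] ab'[of y] by linarith
  have i: "integrable Q (\<lambda>z. \<bar>a' (flow x \<beta> z) - a (flow x \<beta> z)\<bar>)"
    by (rule Q.integrable_const_bound[where B="2 * B"]) (use b2 in auto)
  have "drift_error a x \<beta> \<le> (LINT z|Q. \<bar>\<beta> (fst z) (snd z) - a' (flow x \<beta> z)\<bar> + \<bar>a' (flow x \<beta> z) - a (flow x \<beta> z)\<bar>)"
    unfolding drift_error_def
    by (intro integral_mono drift_error_integrable[OF d a ab] Bochner_Integration.integrable_add drift_error_integrable[OF d a' ab'] i) linarith
  also have "\<dots> = drift_error a' x \<beta> + (LINT z|Q. \<bar>a' (flow x \<beta> z) - a (flow x \<beta> z)\<bar>)"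
    unfolding drift_error_def by (rule Bochner_Integration.integral_add[OF drift_error_integrable[OF d a' ab'] i])
  finally show ?thesis .
qed

text \<open>
  Replacing \<open>g n\<close> by \<open>a\<close> costs \<open>E \<bar>g n - a\<bar>(\<xi>)\<close>, which is small uniformly over all drifted paths \<open>\<xi>\<close>,
  including the approximate solution that is chosen only after \<open>n\<close>.
\<close>

lemma approximable_limit:
  assumes g: "\<And>n. g n \<in> borel_measurable borel" and gb: "\<And>n y. \<bar>g n y\<bar> \<le> B"
    and a: "a \<in> borel_measurable borel" and ab: "\<And>y. \<bar>a y\<bar> \<le> B"
    and lim: "AE y in lborel. (\<lambda>n. g n y) \<longlonglongrightarrow> a y" and ap: "\<And>n. approximable (g n) x"
  shows "approximable a x"
  unfolding approximable_def
proof (intro allI impI)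
  fix e :: real assume e: "e > 0"
  have gm[measurable]: "g n \<in> borel_measurable borel" "a \<in> borel_measurable borel" for n using g a by auto
  have b2: "\<bar>\<bar>g n y - a y\<bar>\<bar> \<le> 2 * B" for n y using ab[of y] gb[of n y] by linarith
  have "AE y in lborel. (\<lambda>n. \<bar>g n y - a y\<bar>) \<longlonglongrightarrow> 0"
    using lim by eventually_elim (simp add: tendsto_rabs_zero LIM_zero)
  then have "(\<lambda>n. LINT y|weight_measure \<alpha>. \<bar>g n y - a y\<bar>) \<longlonglongrightarrow> 0"
    by (intro weight_integral_tendsto_0[OF \<alpha>(1) _ b2]) auto
  then have "\<exists>J. \<forall>n\<ge>J. \<forall>Y. regular_occupation \<bar>x\<bar> Y \<longrightarrow> (LINT z|Q. \<bar>g n (Y z) - a (Y z)\<bar>) < e / 2"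
    by (intro occupation_uniform[where m="2 * B"]) (use b2 e in auto)
  then obtain J where
    J: "\<And>Y. regular_occupation \<bar>x\<bar> Y \<Longrightarrow> (LINT z|Q. \<bar>g J (Y z) - a (Y z)\<bar>) < e / 2"
    by blast
  obtain \<beta> where d: "drifted B x \<beta>" "\<And>t. t \<ge> 0 \<Longrightarrow> path x \<beta> t \<in> borel_measurable (F t)" "drift_error (g J) x \<beta> < e / 2"
    using ap[of J] e unfolding approximable_def by (metis half_gt_zero)
  have "drift_error a x \<beta> < e"
    using drift_error_triangle[OF d(1) gm(2) ab gm(1) gb, of J] J[OF regular_occupation_flow[OF d(1) order_refl]] d(3) by linarith
  then show "\<exists>\<beta>. drifted B x \<beta> \<and> (\<forall>t\<ge>0. path x \<beta> t \<in> borel_measurable (F t)) \<and> drift_error a x \<beta> < e"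
    using d by blast
qed

lemma path_right_continuous:
  assumes d: "drifted B x \<beta>" and w: "\<omega> \<in> space M"
  shows "((\<lambda>s. path x \<beta> (max 0 s) \<omega>) \<longlongrightarrow> path x \<beta> (max 0 t) \<omega>) (at_right t)"
proof (rule right_continuous_clamp)
  fix t :: real assume t: "t \<ge> 0"
  have "((\<lambda>s. LINT r:{0..s}|lborel. \<beta> r \<omega>) \<longlongrightarrow> (LINT r:{0..t}|lborel. \<beta> r \<omega>)) (at_right t)"
  proof (rule LIM_zero_cancel, rule Lim_null_comparison)
    show "\<forall>\<^sub>F s in at_right t. norm ((LINT r:{0..s}|lborel. \<beta> r \<omega>) - (LINT r:{0..t}|lborel. \<beta> r \<omega>)) \<le> B * (s - t)"
      using drift_integral_bound[OF d w t] by (auto simp: eventually_at_right_field intro!: exI[of _ "t + 1"])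
    show "((\<lambda>s. B * (s - t)) \<longlongrightarrow> 0) (at_right t)"
      by (auto intro!: tendsto_eq_intros)
  qed
  moreover have "((\<lambda>s. Z (max 0 s) \<omega>) \<longlongrightarrow> Z (max 0 t) \<omega>) (at_right t)"
    by (rule right_continuous_clamp) (use Z_cadlag[OF w] in \<open>auto simp: cadlag_def\<close>)
  ultimately show "((\<lambda>s. path x \<beta> s \<omega>) \<longlongrightarrow> path x \<beta> t \<omega>) (at_right t)"
    unfolding path_def by (intro tendsto_intros)
qed

lemma picard_adapted:
  assumes d: "drifted B x \<beta>" and ad: "\<And>t. t \<ge> 0 \<Longrightarrow> path x \<beta> t \<in> borel_measurable (F t)"
    and a[measurable]: "a \<in> borel_measurable borel" and ab: "\<And>y. \<bar>a y\<bar> \<le> B"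
  defines "\<gamma> \<equiv> (\<lambda>t \<omega>. a (path x \<beta> (max 0 t) \<omega>))"
  shows "drifted B x \<gamma>" and "\<And>t. t \<ge> 0 \<Longrightarrow> path x \<gamma> t \<in> borel_measurable (F t)"
proof -
  show pm: "path x \<gamma> t \<in> borel_measurable (F t)" if t: "t \<ge> 0" for t
  proof -
    \<comment> \<open>the path stopped at \<open>t\<close> is measurable at time \<open>t\<close> jointly in \<open>(s, \<omega>)\<close>\<close>
    define X where "X s = path x \<beta> (max 0 (min t s))" for s
    have Xm: "X s \<in> borel_measurable (F t)" for s
      unfolding X_def by (rule F_measurable_mono[OF _ _ ad]) (use t in auto)
    have "(\<lambda>(s, \<omega>). X s \<omega>) \<in> borel_measurable (borel \<Otimes>\<^sub>M F t)"
    proof (rule right_continuous_jointly_measurable[OF Xm])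
      fix \<omega> s assume "\<omega> \<in> space (F t)"
      then have "\<omega> \<in> space M" using F_space[OF t] by simp
      from right_continuous_stop[of "\<lambda>s. path x \<beta> (max 0 s) \<omega>" t s, OF path_right_continuous[OF d this]]
      show "((\<lambda>s. X s \<omega>) \<longlongrightarrow> X s \<omega>) (at_right s)" unfolding X_def .
    qed
    from measurable_compose[OF this a] have j: "(\<lambda>(s, \<omega>). a (X s \<omega>)) \<in> borel_measurable (borel \<Otimes>\<^sub>M F t)"
      by (simp add: case_prod_beta')
    from measurable_compose[OF measurable_Pair1' measurable_indefinite_integral_joint[OF j], of t]
    have [measurable]: "(\<lambda>\<omega>. LINT s:{0..t}|lborel. a (X s \<omega>)) \<in> borel_measurable (F t)" by simp
    have [measurable]: "Z (max 0 t) \<in> borel_measurable (F t)" using Z_F[OF t] t by simp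
    have "(\<lambda>\<omega>. x + (LINT s:{0..t}|lborel. a (X s \<omega>)) + Z (max 0 t) \<omega>) \<in> borel_measurable (F t)" by measurable
    also have "(\<lambda>\<omega>. x + (LINT s:{0..t}|lborel. a (X s \<omega>)) + Z (max 0 t) \<omega>) = path x \<gamma> t"
      unfolding path_def[abs_def] fun_eq_iff
      by (intro allI arg_cong2[where f="(+)"] refl set_lebesgue_integral_cong) (auto simp: \<gamma>_def X_def min_def max_def path_def)
    finally show ?thesis .
  qed
  have pj: "(\<lambda>(t, \<omega>). path x \<beta> t \<omega>) \<in> borel_measurable (borel \<Otimes>\<^sub>M M)" by (rule path_joint[OF driftedD(1)[OF d]])
  have "(\<lambda>p. (max 0 (fst p), snd p)) \<in> ((borel :: real measure) \<Otimes>\<^sub>M M) \<rightarrow>\<^sub>M ((borel :: real measure) \<Otimes>\<^sub>M M)" by measurable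
  from measurable_compose[OF measurable_compose[OF this pj] a]
  have gj: "(\<lambda>(t, \<omega>). \<gamma> t \<omega>) \<in> borel_measurable (borel \<Otimes>\<^sub>M M)" by (simp add: \<gamma>_def case_prod_beta')
  have "\<gamma> t \<in> borel_measurable (F t)" if "t \<ge> 0" for t
    unfolding \<gamma>_def using measurable_compose[OF ad[OF that] a] that by simp
  then show "drifted B x \<gamma>"
    unfolding drifted_def using gj pm ab by (auto simp: \<gamma>_def intro: known_at_measurable)
qed

fun picard :: "(real \<Rightarrow> real) \<Rightarrow> real \<Rightarrow> nat \<Rightarrow> real \<Rightarrow> 'w \<Rightarrow> real" where
  "picard a x 0 = (\<lambda>_ _. 0)"
| "picard a x (Suc n) = (\<lambda>t \<omega>. a (path x (picard a x n) (max 0 t) \<omega>))"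

text \<open>
  Picard iterates converge with a factorial rate at each time, and the drift error of an iterate is
  at most \<open>L\<close> times its distance to the preceding one.
\<close>

lemma approximable_lipschitz:
  assumes a[measurable]: "a \<in> borel_measurable borel" and ab: "\<And>y. \<bar>a y\<bar> \<le> B"
    and L: "\<And>u v. \<bar>a u - a v\<bar> \<le> L * \<bar>u - v\<bar>"
  shows "approximable a x"
proof -
  have L0: "L \<ge> 0" using order_trans[OF abs_ge_zero L[of 1 0]] by simp
  have pic: "drifted B x (picard a x n) \<and> (\<forall>t\<ge>0. path x (picard a x n) t \<in> borel_measurable (F t))" for n
  proof (induction n)
    case 0
    have "drifted B x (picard a x 0)"
      using drifted_zero[of x] B0 unfolding drifted_def by auto
    moreover have "path x (picard a x 0) t \<in> borel_measurable (F t)" if "t \<ge> 0" for t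
    proof -
      have [measurable]: "Z t \<in> borel_measurable (F t)" by (rule Z_F[OF that])
      have "(\<lambda>\<omega>. x + Z t \<omega>) \<in> borel_measurable (F t)" by measurable
      also have "(\<lambda>\<omega>. x + Z t \<omega>) = path x (picard a x 0) t"
        using that by (simp add: fun_eq_iff path_zero)
      finally show ?thesis .
    qed
    ultimately show ?case by blast
  next
    case (Suc n)
    then show ?case using picard_adapted[OF _ _ a ab, of x "picard a x n"] by auto
  qed
  note pd = pic[THEN conjunct1]
  have diff: "\<bar>path x (picard a x (Suc n)) t \<omega> - path x (picard a x n) t \<omega>\<bar> \<le> B * L ^ n * t ^ Suc n / fact (Suc n)"
    if t: "t \<ge> 0" and w: "\<omega> \<in> space M" for n t \<omega>
    using t
  proof (induction n arbitrary: t)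
    case 0
    have e: "path x (picard a x (Suc 0)) t \<omega> - path x (picard a x 0) t \<omega> = (LINT s:{0..t}|lborel. picard a x (Suc 0) s \<omega>)"
      by (simp add: path_def set_lebesgue_integral_def)
    have "\<bar>LINT s:{0..t}|lborel. picard a x (Suc 0) s \<omega>\<bar> \<le> B * t"
      using drift_integral_bound[OF pd[of "Suc 0"] w order_refl 0] by (simp add: set_integral_lborel_singleton)
    then show ?case unfolding e by simp
  next
    case (Suc n)
    let ?b = "\<lambda>n s. picard a x n s \<omega>"
    have i: "set_integrable lborel {0..t} (?b j)" for j by (rule drift_integrable[OF pd w])
    have e: "path x (picard a x (Suc (Suc n))) t \<omega> - path x (picard a x (Suc n)) t \<omega> = (LINT s:{0..t}|lborel. ?b (Suc (Suc n)) s - ?b (Suc n) s)"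
      using set_integral_diff(2)[OF i[of "Suc (Suc n)"] i[of "Suc n"]] by (simp add: path_def)
    have "\<bar>LINT s:{0..t}|lborel. ?b (Suc (Suc n)) s - ?b (Suc n) s\<bar> \<le> (LINT s|lborel. (L * (B * L ^ n / fact (Suc n))) * (s ^ Suc n * indicator {0..t} s))"
      unfolding set_lebesgue_integral_def
    proof (rule abs_integral_le)
      show "integrable lborel (\<lambda>s. indicat_real {0..t} s *\<^sub>R (?b (Suc (Suc n)) s - ?b (Suc n) s))"
        using set_integral_diff(1)[OF i[of "Suc (Suc n)"] i[of "Suc n"]] by (simp add: set_integrable_def)
      have "set_integrable lborel {0..t} (\<lambda>s. s ^ Suc n)"
        by (intro borel_integrable_atLeastAtMost' continuous_intros)
      then show "integrable lborel (\<lambda>s. (L * (B * L ^ n / fact (Suc n))) * (s ^ Suc n * indicator {0..t} s))"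
        by (intro integrable_mult_right) (simp add: set_integrable_def mult.commute)
      fix s
      show "\<bar>indicat_real {0..t} s *\<^sub>R (?b (Suc (Suc n)) s - ?b (Suc n) s)\<bar> \<le> (L * (B * L ^ n / fact (Suc n))) * (s ^ Suc n * indicator {0..t} s)"
      proof (cases "s \<in> {0..t}")
        case True
        then have "\<bar>?b (Suc (Suc n)) s - ?b (Suc n) s\<bar> \<le> L * \<bar>path x (picard a x (Suc n)) s \<omega> - path x (picard a x n) s \<omega>\<bar>"
          using L by simp
        also have "\<dots> \<le> L * (B * L ^ n * s ^ Suc n / fact (Suc n))"
          using True L0 by (intro mult_left_mono Suc.IH) auto
        finally show ?thesis using True by simp
      qed simp
    qed
    also have "\<dots> = (L * (B * L ^ n / fact (Suc n))) * (t ^ Suc (Suc n) / real (Suc (Suc n)))"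
      using Suc.prems by (subst integral_mult_right_zero) (simp only: integral_power, simp)
    also have "\<dots> = B * L ^ Suc n * t ^ Suc (Suc n) / fact (Suc (Suc n))"
      by (simp add: field_simps)
    finally show ?case unfolding e .
  qed
  have "(\<lambda>n. drift_error a x (picard a x (Suc n))) \<longlonglongrightarrow> (LINT z|Q. 0)"
    unfolding drift_error_def
  proof (rule integral_dominated_convergence[where w="\<lambda>_. 2 * B"])
    show "AE z in Q. (\<lambda>n. \<bar>picard a x (Suc n) (fst z) (snd z) - a (flow x (picard a x (Suc n)) z)\<bar>) \<longlonglongrightarrow> 0"
      using AE_Q_nonneg_space
    proof eventually_elim
      case (elim z)
      let ?t = "fst z"
      show ?case
      proof (rule Lim_null_comparison)
        show "\<forall>\<^sub>F n in sequentially. norm \<bar>picard a x (Suc n) (fst z) (snd z) - a (flow x (picard a x (Suc n)) z)\<bar>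
            \<le> B * (inverse (fact (Suc n)) * (L * ?t) ^ Suc n)"
        proof (rule always_eventually, rule allI)
          fix n
          have "\<bar>picard a x (Suc n) (fst z) (snd z) - a (flow x (picard a x (Suc n)) z)\<bar>
            \<le> L * \<bar>path x (picard a x (Suc n)) ?t (snd z) - path x (picard a x n) ?t (snd z)\<bar>"
            using L[of "path x (picard a x n) ?t (snd z)" "flow x (picard a x (Suc n)) z"] elim by (simp add: abs_minus_commute)
          also have "\<dots> \<le> L * (B * L ^ n * ?t ^ Suc n / fact (Suc n))"
            using elim L0 by (intro mult_left_mono diff) auto
          also have "\<dots> = B * (inverse (fact (Suc n)) * (L * ?t) ^ Suc n)"
            by (simp add: power_mult_distrib divide_inverse)
          finally show "norm \<bar>picard a x (Suc n) (fst z) (snd z) - a (flow x (picard a x (Suc n)) z)\<bar>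
            \<le> B * (inverse (fact (Suc n)) * (L * ?t) ^ Suc n)" by simp
        qed
        have "(\<lambda>n. inverse (fact n) * (L * ?t) ^ n) \<longlonglongrightarrow> 0"
          using summable_LIMSEQ_zero[OF summable_exp[of "L * ?t"]] by simp
        then show "(\<lambda>n. B * (inverse (fact (Suc n)) * (L * ?t) ^ Suc n)) \<longlonglongrightarrow> 0"
          by (intro tendsto_mult_right_zero LIMSEQ_Suc)
      qed
    qed
    show "(\<lambda>z. \<bar>picard a x (Suc n) (fst z) (snd z) - a (flow x (picard a x (Suc n)) z)\<bar>) \<in> borel_measurable Q" for n
      by (rule borel_measurable_integrable[OF drift_error_integrable[OF pd a ab]])
    show "AE z in Q. norm \<bar>picard a x (Suc n) (fst z) (snd z) - a (flow x (picard a x (Suc n)) z)\<bar> \<le> 2 * B" for n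
    proof (rule AE_I2)
      fix z
      show "norm \<bar>picard a x (Suc n) (fst z) (snd z) - a (flow x (picard a x (Suc n)) z)\<bar> \<le> 2 * B"
        using driftedD(2)[OF pd[of "Suc n"], of "fst z" "snd z"] ab[of "flow x (picard a x (Suc n)) z"]
        unfolding real_norm_def by linarith
    qed
  qed auto
  then have "(\<lambda>n. drift_error a x (picard a x (Suc n))) \<longlonglongrightarrow> 0" by simp
  show ?thesis
    unfolding approximable_def
  proof (intro allI impI)
    fix e :: real assume "e > 0"
    then have "eventually (\<lambda>n. drift_error a x (picard a x (Suc n)) < e) sequentially"
      using \<open>(\<lambda>n. drift_error a x (picard a x (Suc n))) \<longlonglongrightarrow> 0\<close> by (intro order_tendstoD)
    then obtain n where "drift_error a x (picard a x (Suc n)) < e" by (auto simp: eventually_sequentially)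
    then show "\<exists>\<beta>. drifted B x \<beta> \<and> (\<forall>t\<ge>0. path x \<beta> t \<in> borel_measurable (F t)) \<and> drift_error a x \<beta> < e"
      using pic[of "Suc n"] by blast
  qed
qed

lemma approximable_measurable:
  assumes a: "a \<in> borel_measurable borel" and ab: "\<And>y. \<bar>a y\<bar> \<le> B"
  shows "approximable a x"
proof -
  obtain g :: "nat \<Rightarrow> real \<Rightarrow> real" where gm: "\<And>n. g n \<in> borel_measurable borel" and gb: "\<And>n y. \<bar>g n y\<bar> \<le> B"
    and gl: "\<And>n u v. \<bar>g n u - g n v\<bar> \<le> 2 * B * real (Suc n) * \<bar>u - v\<bar>" and lim: "AE y in lborel. (\<lambda>n. g n y) \<longlonglongrightarrow> a y"
    using lipschitz_averages[OF a ab] by blast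
  show ?thesis
    by (rule approximable_limit[OF gm gb a ab lim approximable_lipschitz[OF gm gb gl]])
qed

section \<open>Strong existence\<close>

lemma AE_T_lborel: "(AE t in T. P t) \<Longrightarrow> AE t in lborel. t > 0 \<longrightarrow> P t"
  unfolding T_def by (subst (asm) AE_density) (use l in \<open>auto simp: exponential_density_def elim!: eventually_mono\<close>)

lemma AE_T_dense:
  assumes P: "AE t in T. P t" and t: "t \<ge> 0" and e: "e > 0"
  obtains s where "t < s" "s < t + e" "P s"
proof (rule ccontr)
  assume *: "\<not> thesis"
  have "AE s in lborel. s \<notin> {t<..<t + e}"
    using AE_T_lborel[OF P] by eventually_elim (use * that t in auto)
  then have "emeasure lborel {s \<in> space lborel. s \<in> {t<..<t + e}} = 0" by (rule emeasure_eq_0_AE)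
  also have "{s \<in> space lborel. s \<in> {t<..<t + e}} = {t<..<t + e}" by auto
  finally show False using e by simp
qed

lemma AE_Q_swap:
  assumes P: "AE z in Q. P (fst z) (snd z)" and m: "{z \<in> space Q. P (fst z) (snd z)} \<in> sets Q"
  shows "AE \<omega> in M. AE t in T. P t \<omega>"
proof -
  have "AE t in T. AE \<omega> in M. P t \<omega>"
    using TM.AE_pair[OF P[unfolded Q_def]] by simp
  moreover have "{z \<in> space (T \<Otimes>\<^sub>M M). P (fst z) (snd z)} \<in> sets (T \<Otimes>\<^sub>M M)"
    using m unfolding Q_def .
  ultimately show ?thesis by (simp add: TM.AE_commute)
qed

lemma flow_close:
  assumes a: "a \<in> borel_measurable borel" and ab: "\<And>y. \<bar>a y\<bar> \<le> B" and e: "e > 0"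
  obtains d where "d > 0" "\<And>\<beta> \<gamma>. drifted B x \<beta> \<Longrightarrow> drifted B x \<gamma> \<Longrightarrow> drift_error a x \<beta> < d \<Longrightarrow> drift_error a x \<gamma> < d \<Longrightarrow>
    (LINT z|Q. \<bar>flow x \<beta> z - flow x \<gamma> z\<bar>) < e"
proof -
  have "eventually (\<lambda>r. tail \<bar>x\<bar> (real r) < e / 2) sequentially"
    using tail_tendsto e by (intro order_tendstoD) auto
  then obtain r where r: "tail \<bar>x\<bar> (real r) < e / 2" by (auto simp: eventually_sequentially)
  \<comment> \<open>the coefficient of the errors in \<open>flow_distance\<close> with truncation level \<open>r\<close>\<close>
  define K where "K = 8 * kappa * real r"
  have K0: "K \<ge> 0" using kappa_nonneg by (simp add: K_def)
  define d where "d = e / (4 * (K + 1))"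
  show ?thesis
  proof (rule that)
    show "d > 0" using e K0 by (simp add: d_def)
    fix \<beta> \<gamma> assume d1: "drifted B x \<beta>" and d2: "drifted B x \<gamma>" and er: "drift_error a x \<beta> < d" "drift_error a x \<gamma> < d"
    have "K * (drift_error a x \<beta> + drift_error a x \<gamma>) \<le> K * (2 * d)" using er K0 by (intro mult_left_mono) auto
    also have "\<dots> \<le> (K + 1) * (2 * d)" using \<open>d > 0\<close> by (intro mult_right_mono) auto
    also have "\<dots> = e / 2"
    proof -
      have "b * (2 * (e / (4 * b))) = e / 2" if "b > 0" for b :: real using that by simp
      from this[of "K + 1"] show ?thesis unfolding d_def using K0 by linarith
    qed
    finally have "K * (drift_error a x \<beta> + drift_error a x \<gamma>) \<le> e / 2" .
    moreover have "(LINT z|Q. \<bar>flow x \<beta> z - flow x \<gamma> z\<bar>) \<le> K * (drift_error a x \<beta> + drift_error a x \<gamma>) + tail \<bar>x\<bar> (real r)"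
      using flow_distance[OF d1 d2 a ab order_refl order_refl, of "real r"] by (simp add: K_def mult_ac)
    ultimately show "(LINT z|Q. \<bar>flow x \<beta> z - flow x \<gamma> z\<bar>) < e" using r by linarith
  qed
qed

text \<open>
  All drift integrals share a Lipschitz constant, so convergence at nearby times suffices.
\<close>

lemma path_Cauchy_extend:
  assumes d: "\<And>n. drifted B x (\<beta> n)" and w: "\<omega> \<in> space M"
    and C: "AE t in T. Cauchy (\<lambda>n. path x (\<beta> n) t \<omega>)" and t: "t \<ge> 0"
  shows "Cauchy (\<lambda>n. path x (\<beta> n) t \<omega>)"
proof (rule metric_CauchyI)
  fix e :: real assume e: "e > 0"
  define h where "h = e / (4 * (B + 1))"
  have h: "h > 0" using e B0 by (simp add: h_def)
  obtain s where s: "t < s" "s < t + h" "Cauchy (\<lambda>n. path x (\<beta> n) s \<omega>)" using AE_T_dense[OF C t h] by blast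
  have "e / 2 > 0" using e by simp
  from metric_CauchyD[OF s(3) this] obtain N where N: "\<And>m n. m \<ge> N \<Longrightarrow> n \<ge> N \<Longrightarrow> dist (path x (\<beta> m) s \<omega>) (path x (\<beta> n) s \<omega>) < e / 2" by blast
  have bs: "B * (s - t) \<le> e / 4"
  proof -
    have "B * (s - t) \<le> (B + 1) * h" using s B0 by (intro mult_mono) auto
    also have "\<dots> = e / 4"
    proof -
      have "b * (e / (4 * b)) = e / 4" if "b > 0" for b :: real using that by simp
      from this[of "B + 1"] show ?thesis unfolding h_def using B0 by linarith
    qed
    finally show ?thesis .
  qed
  have "dist (path x (\<beta> m) t \<omega>) (path x (\<beta> n) t \<omega>) < e" if "m \<ge> N" "n \<ge> N" for m n
  proof -
    let ?A = "\<lambda>n t. LINT r:{0..t}|lborel. \<beta> n r \<omega>"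
    have "\<bar>?A m s - ?A n s\<bar> < e / 2" using N[OF that] by (simp add: dist_real_def path_def)
    moreover have "\<bar>?A j s - ?A j t\<bar> \<le> e / 4" for j
      using drift_integral_bound[OF d w t less_imp_le[OF s(1)], of j] bs by linarith
    from this[of m] this[of n] have "\<bar>?A m s - ?A m t\<bar> \<le> e / 4" "\<bar>?A n s - ?A n t\<bar> \<le> e / 4" by auto
    ultimately have "\<bar>?A m t - ?A n t\<bar> < e" by linarith
    then show ?thesis by (simp add: dist_real_def path_def)
  qed
  then show "\<exists>N. \<forall>m\<ge>N. \<forall>n\<ge>N. dist (path x (\<beta> m) t \<omega>) (path x (\<beta> n) t \<omega>) < e" by blast
qed

text \<open>
  For open sets the density bound is preserved by Fatou's lemma, and outer regularity of Lebesgue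
  measure extends it to Borel sets.
\<close>

lemma regular_occupation_limit:
  assumes Y: "\<And>n. regular_occupation X0 (Y n)" and X[measurable]: "X \<in> borel_measurable Q"
    and lim: "AE z in Q. (\<lambda>n. Y n z) \<longlonglongrightarrow> X z"
  shows "regular_occupation X0 X"
  unfolding regular_occupation_def
proof (intro conjI ballI)
  show "X \<in> borel_measurable Q" by fact
  have [measurable]: "Y n \<in> borel_measurable Q" for n using Y by (simp add: regular_occupation_def)
  have "AE z in Q. \<forall>n. \<bar>Y n z\<bar> \<le> envelope X0 z"
    using Y by (simp add: regular_occupation_def AE_all_countable)
  with lim show "AE z in Q. \<bar>X z\<bar> \<le> envelope X0 z"
    by eventually_elim (rule LIMSEQ_le_const2[OF tendsto_rabs], auto)
  let ?C = "ennreal (2 * l * kappa)"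
  have op: "emeasure (distr Q borel X) U \<le> ?C * emeasure lborel U" if U: "open U" for U
  proof -
    have [measurable]: "U \<in> sets borel" using U by simp
    have occ: "emeasure (distr Q borel V) U = (\<integral>\<^sup>+ z. indicator U (V z) \<partial>Q)" if [measurable]: "V \<in> borel_measurable Q" for V
    proof -
      have "(\<integral>\<^sup>+ y. indicator U y \<partial>(distr Q borel V)) = (\<integral>\<^sup>+ z. indicator U (V z) \<partial>Q)"
        by (rule nn_integral_distr) measurable
      then show ?thesis by simp
    qed
    have "emeasure (distr Q borel X) U = (\<integral>\<^sup>+ z. indicator U (X z) \<partial>Q)"
      by (rule occ[OF X])
    also have "\<dots> \<le> (\<integral>\<^sup>+ z. liminf (\<lambda>n. indicator U (Y n z)) \<partial>Q)"
    proof (rule nn_integral_mono_AE)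
      show "AE z in Q. indicator U (X z) \<le> liminf (\<lambda>n. indicator U (Y n z) :: ennreal)"
        using lim
      proof eventually_elim
        case (elim z)
        show ?case
        proof (cases "X z \<in> U")
          case True
          have "eventually (\<lambda>n. Y n z \<in> U) sequentially" by (rule topological_tendstoD[OF elim U True])
          then have "eventually (\<lambda>n. 1 \<le> (indicator U (Y n z) :: ennreal)) sequentially" by eventually_elim simp
          then show ?thesis using True by (simp add: Liminf_bounded)
        qed simp
      qed
    qed
    also have "\<dots> \<le> liminf (\<lambda>n. \<integral>\<^sup>+ z. indicator U (Y n z) \<partial>Q)"
      by (rule nn_integral_liminf) measurable
    also have "\<dots> \<le> liminf (\<lambda>n::nat. ?C * emeasure lborel U)"
    proof (rule Liminf_mono, rule always_eventually, rule allI)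
      fix n
      have "(\<integral>\<^sup>+ z. indicator U (Y n z) \<partial>Q) = emeasure (distr Q borel (Y n)) U"
        by (rule occ[symmetric]) simp
      then show "(\<integral>\<^sup>+ z. indicator U (Y n z) \<partial>Q) \<le> ?C * emeasure lborel U"
        using Y[of n] by (simp add: regular_occupation_def)
    qed
    also have "\<dots> = ?C * emeasure lborel U" by (simp add: Liminf_const)
    finally show ?thesis .
  qed
  fix A :: "real set" assume A[measurable]: "A \<in> sets borel"
  have le: "emeasure (distr Q borel X) A \<le> ?C * emeasure lborel A + ?C * ennreal (1 / real (Suc n))" for n
  proof -
    obtain U where U: "open U" "A \<subseteq> U" "emeasure lborel (U - A) < ennreal (1 / real (Suc n))"
      using outer_regular_lborel[OF A, of "1 / real (Suc n)"] by auto
    have [measurable]: "U \<in> sets borel" using U by simp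
    have "emeasure (distr Q borel X) A \<le> emeasure (distr Q borel X) U" using U by (intro emeasure_mono) auto
    also have "\<dots> \<le> ?C * emeasure lborel U" by (rule op[OF U(1)])
    also have "U = A \<union> (U - A)" using U by auto
    also have "emeasure lborel (A \<union> (U - A)) = emeasure lborel A + emeasure lborel (U - A)"
      by (rule plus_emeasure[symmetric]) auto
    also have "?C * \<dots> \<le> ?C * (emeasure lborel A + ennreal (1 / real (Suc n)))"
      using U by (intro mult_left_mono add_left_mono) auto
    finally show ?thesis by (simp add: distrib_left)
  qed
  have "(\<lambda>n. ?C * emeasure lborel A + ennreal (2 * l * kappa * (1 / real (Suc n)))) \<longlonglongrightarrow> ?C * emeasure lborel A + ennreal (2 * l * kappa * 0)"
    by (intro tendsto_add tendsto_const tendsto_ennrealI tendsto_mult LIMSEQ_Suc[OF lim_1_over_n])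
  moreover have "?C * ennreal (1 / real (Suc n)) = ennreal (2 * l * kappa * (1 / real (Suc n)))" for n
    using l kappa_nonneg by (subst ennreal_mult) auto
  ultimately have lim0: "(\<lambda>n. ?C * emeasure lborel A + ?C * ennreal (1 / real (Suc n))) \<longlonglongrightarrow> ?C * emeasure lborel A"
    by simp
  show "emeasure (distr Q borel X) A \<le> ?C * emeasure lborel A"
    by (rule LIMSEQ_le_const[OF lim0]) (use le in blast)
qed

text \<open>
  Although \<open>a\<close> is only measurable, it may be replaced by a Lipschitz function: the error is small
  along all \<open>Y n\<close> and along \<open>X\<close> at the same time by the occupation density bound.
\<close>

lemma composed_drift_converges:
  assumes a: "a \<in> borel_measurable borel" and ab: "\<And>y. \<bar>a y\<bar> \<le> B" and X0: "X0 \<ge> 0"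
    and Y: "\<And>n. regular_occupation X0 (Y n)" and X: "regular_occupation X0 X"
    and lim: "AE z in Q. (\<lambda>n. Y n z) \<longlonglongrightarrow> X z"
  shows "(\<lambda>n. LINT z|Q. \<bar>a (Y n z) - a (X z)\<bar>) \<longlonglongrightarrow> 0"
proof (rule LIMSEQ_I)
  fix e :: real assume e: "e > 0"
  note [measurable] = a
  have Ym[measurable]: "Y n \<in> borel_measurable Q" "X \<in> borel_measurable Q" for n
    using Y X by (auto simp: regular_occupation_def)
  \<comment> \<open>three-epsilon argument through one Lipschitz average \<open>g J\<close>\<close>
  obtain g :: "nat \<Rightarrow> real \<Rightarrow> real" where gm[measurable]: "\<And>n. g n \<in> borel_measurable borel" and gb: "\<And>n y. \<bar>g n y\<bar> \<le> B"
    and gl: "\<And>n u v. \<bar>g n u - g n v\<bar> \<le> 2 * B * real (Suc n) * \<bar>u - v\<bar>" and gl2: "AE y in lborel. (\<lambda>n. g n y) \<longlonglongrightarrow> a y"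
    using lipschitz_averages[OF a ab] by blast
  have b2: "\<bar>g n u - a v\<bar> \<le> 2 * B" "\<bar>g n u - g n v\<bar> \<le> 2 * B" "\<bar>a u - a v\<bar> \<le> 2 * B" for n u v
    using ab[of v] gb[of n u] gb[of n v] ab[of u] by linarith+
  have "AE y in lborel. (\<lambda>n. \<bar>g n y - a y\<bar>) \<longlonglongrightarrow> 0"
    using gl2 by eventually_elim (simp add: tendsto_rabs_zero LIM_zero)
  then have "(\<lambda>n. LINT y|weight_measure \<alpha>. \<bar>g n y - a y\<bar>) \<longlonglongrightarrow> 0"
    by (intro weight_integral_tendsto_0[OF \<alpha>(1), where m="2 * B"]) (use b2 in auto)
  then have "\<exists>J. \<forall>n\<ge>J. \<forall>Y. regular_occupation X0 Y \<longrightarrow> (LINT z|Q. \<bar>g n (Y z) - a (Y z)\<bar>) < e / 3"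
    by (intro occupation_uniform[where m="2 * B"]) (use b2 e X0 in auto)
  then obtain J where J: "\<And>Y. regular_occupation X0 Y \<Longrightarrow> (LINT z|Q. \<bar>g J (Y z) - a (Y z)\<bar>) < e / 3" by blast
  have "(\<lambda>n. LINT z|Q. \<bar>g J (Y n z) - g J (X z)\<bar>) \<longlonglongrightarrow> (LINT z|Q. 0)"
  proof (rule integral_dominated_convergence[where w="\<lambda>_. 2 * B"])
    show "AE z in Q. (\<lambda>n. \<bar>g J (Y n z) - g J (X z)\<bar>) \<longlonglongrightarrow> 0"
      using lim
    proof eventually_elim
      case (elim z)
      have "(\<lambda>n. 2 * B * real (Suc J) * \<bar>Y n z - X z\<bar>) \<longlonglongrightarrow> 2 * B * real (Suc J) * 0"
        using elim by (intro tendsto_mult tendsto_const tendsto_rabs_zero) (simp add: LIM_zero)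
      then have lim0: "(\<lambda>n. 2 * B * real (Suc J) * \<bar>Y n z - X z\<bar>) \<longlonglongrightarrow> 0" by simp
      show ?case by (rule Lim_null_comparison[OF _ lim0]) (use gl[of J] in \<open>auto simp del: of_nat_Suc\<close>)
    qed
  qed (use b2 in auto)
  then have "(\<lambda>n. LINT z|Q. \<bar>g J (Y n z) - g J (X z)\<bar>) \<longlonglongrightarrow> 0" by simp
  then have "eventually (\<lambda>n. (LINT z|Q. \<bar>g J (Y n z) - g J (X z)\<bar>) < e / 3) sequentially"
    using e by (intro order_tendstoD) auto
  then obtain N where N: "\<And>n. n \<ge> N \<Longrightarrow> (LINT z|Q. \<bar>g J (Y n z) - g J (X z)\<bar>) < e / 3" by (auto simp: eventually_sequentially)
  have ib: "integrable Q (\<lambda>z. \<bar>u z\<bar>)" if "u \<in> borel_measurable Q" "\<And>z. \<bar>u z\<bar> \<le> 2 * B" for u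
    by (rule Q.integrable_const_bound[where B="2 * B"]) (use that in auto)
  have "norm ((LINT z|Q. \<bar>a (Y n z) - a (X z)\<bar>) - 0) < e" if "n \<ge> N" for n
  proof -
    have i1: "integrable Q (\<lambda>z. \<bar>g J (Y n z) - a (Y n z)\<bar>)" by (rule ib) (use b2 in auto)
    have i2: "integrable Q (\<lambda>z. \<bar>g J (Y n z) - g J (X z)\<bar>)" by (rule ib) (use b2 in auto)
    have i3: "integrable Q (\<lambda>z. \<bar>g J (X z) - a (X z)\<bar>)" by (rule ib) (use b2 in auto)
    have i4: "integrable Q (\<lambda>z. \<bar>a (Y n z) - a (X z)\<bar>)" by (rule ib) (use b2 in auto)
    have "(LINT z|Q. \<bar>a (Y n z) - a (X z)\<bar>) \<le> (LINT z|Q. \<bar>g J (Y n z) - a (Y n z)\<bar> + \<bar>g J (Y n z) - g J (X z)\<bar> + \<bar>g J (X z) - a (X z)\<bar>)"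
      by (intro integral_mono i4 Bochner_Integration.integrable_add i1 i2 i3) linarith
    also have "\<dots> = (LINT z|Q. \<bar>g J (Y n z) - a (Y n z)\<bar>) + (LINT z|Q. \<bar>g J (Y n z) - g J (X z)\<bar>) + (LINT z|Q. \<bar>g J (X z) - a (X z)\<bar>)"
      using i1 i2 i3 by simp
    also have "\<dots> < e" using J[OF Y[of n]] J[OF X] N[OF that] by linarith
    finally show ?thesis using integral_nonneg_AE[of "\<lambda>z. \<bar>a (Y n z) - a (X z)\<bar>" Q] by simp
  qed
  then show "\<exists>no. \<forall>n\<ge>no. norm ((LINT z|Q. \<bar>a (Y n z) - a (X z)\<bar>) - 0) < e" by blast
qed

text \<open>
  Take approximate solutions with errors so small that, by \<open>flow_distance\<close>, consecutive paths have
  summable distances in \<open>L1(Q)\<close>. They converge almost surely, and the limit inherits the occupation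
  density bound, so \<open>a(\<xi> n)\<close> converges to \<open>a(\<xi>)\<close> in \<open>L1(Q)\<close>. A subsequence of the drifts then
  converges almost everywhere, which passes to the limit in the equation.
\<close>

lemma strong_existence:
  assumes a[measurable]: "a \<in> borel_measurable borel" and ab: "\<And>y. \<bar>a y\<bar> \<le> B"
  obtains \<xi> where "\<And>t. t \<ge> 0 \<Longrightarrow> \<xi> t \<in> borel_measurable (F t)"
    "\<And>\<omega>. \<omega> \<in> space M \<Longrightarrow> (\<lambda>t. \<xi> t \<omega>) \<in> borel_measurable borel"
    "AE \<omega> in M. \<forall>t\<ge>0. \<xi> t \<omega> = x + (LINT s:{0..t}|lborel. a (\<xi> s \<omega>)) + Z t \<omega>"
proof -
  define X0 where "X0 = \<bar>x\<bar>"
  have X0: "X0 \<ge> 0" "\<bar>x\<bar> \<le> X0" by (auto simp: X0_def)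
  define close_at where "close_at n d \<longleftrightarrow> d > 0 \<and> (\<forall>\<beta> \<gamma>. drifted B x \<beta> \<longrightarrow> drifted B x \<gamma> \<longrightarrow>
      drift_error a x \<beta> < d \<longrightarrow> drift_error a x \<gamma> < d \<longrightarrow> (LINT z|Q. \<bar>flow x \<beta> z - flow x \<gamma> z\<bar>) < (1 / 2) ^ n)"
    for n :: nat and d
  have "\<exists>d. close_at n d" for n
  proof (rule flow_close[OF a ab, of "(1 / 2) ^ n" x])
    fix d :: real assume d: "d > 0" "\<And>\<beta> \<gamma>. drifted B x \<beta> \<Longrightarrow> drifted B x \<gamma> \<Longrightarrow> drift_error a x \<beta> < d \<Longrightarrow> drift_error a x \<gamma> < d \<Longrightarrow>
      (LINT z|Q. \<bar>flow x \<beta> z - flow x \<gamma> z\<bar>) < (1 / 2) ^ n"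
    show ?thesis unfolding close_at_def by (rule exI[of _ d]) (intro conjI allI impI d; assumption)
  qed simp
  then have "\<forall>n. \<exists>d. close_at n d" by blast
  from choice[OF this] obtain \<delta> where "\<And>n. close_at n (\<delta> n)" by blast
  then have \<delta>: "\<And>n. \<delta> n > 0" and close: "\<And>n \<beta> \<gamma>. drifted B x \<beta> \<Longrightarrow> drifted B x \<gamma> \<Longrightarrow>
      drift_error a x \<beta> < \<delta> n \<Longrightarrow> drift_error a x \<gamma> < \<delta> n \<Longrightarrow> (LINT z|Q. \<bar>flow x \<beta> z - flow x \<gamma> z\<bar>) < (1 / 2) ^ n"
    unfolding close_at_def by blast+
  \<comment> \<open>below every \<open>\<delta> m\<close> with \<open>m \<le> n\<close>, so that the two consecutive paths \<open>n\<close> and \<open>Suc n\<close> are both within \<open>\<delta> n\<close>\<close>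
  define \<eta> where "\<eta> n = min (Min (\<delta> ` {..n})) (1 / real (Suc n))" for n
  have \<eta>0: "\<eta> n > 0" for n using \<delta> by (auto simp: \<eta>_def)
  have \<eta>\<delta>: "\<eta> m \<le> \<delta> n" if "n \<le> m" for n m
    unfolding \<eta>_def using that by (intro min.coboundedI1 Min_le) auto
  have "\<forall>n. \<exists>\<beta>. drifted B x \<beta> \<and> (\<forall>t\<ge>0. path x \<beta> t \<in> borel_measurable (F t)) \<and> drift_error a x \<beta> < \<eta> n"
    using approximable_measurable[OF a ab, of x] \<eta>0 unfolding approximable_def by blast
  from choice[OF this] obtain \<beta> where d: "\<And>n. drifted B x (\<beta> n)" and ad: "\<And>n t. t \<ge> 0 \<Longrightarrow> path x (\<beta> n) t \<in> borel_measurable (F t)"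
    and er: "\<And>n. drift_error a x (\<beta> n) < \<eta> n" by blast
  have fm[measurable]: "flow x (\<beta> n) \<in> borel_measurable Q" "(\<lambda>z. \<beta> n (fst z) (snd z)) \<in> borel_measurable Q" for n
    by (rule driftedD(6)[OF d], rule driftedD(5)[OF d])
  define f where "f n z = \<bar>flow x (\<beta> n) z - flow x (\<beta> (Suc n)) z\<bar>" for n z
  have fq[measurable]: "f n \<in> borel_measurable Q" for n unfolding f_def by measurable
  have fi: "integrable Q (f n)" for n unfolding f_def by (rule flow_distance_integrable[OF d d])
  have fle: "(LINT z|Q. f n z) \<le> (1 / 2) ^ n" for n
    unfolding f_def
    by (rule less_imp_le, rule close[OF d d]; rule less_le_trans[OF er \<eta>\<delta>]; simp)
  have "(\<integral>\<^sup>+ z. (\<Sum>n. ennreal (f n z)) \<partial>Q) = (\<Sum>n. \<integral>\<^sup>+ z. ennreal (f n z) \<partial>Q)"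
    by (rule nn_integral_suminf) measurable
  also have "\<dots> \<le> (\<Sum>n. ennreal ((1 / 2) ^ n))"
  proof (intro suminf_le)
    fix n
    have "(\<integral>\<^sup>+ z. ennreal (f n z) \<partial>Q) = ennreal (LINT z|Q. f n z)"
      by (rule nn_integral_eq_integral[OF fi]) (simp add: f_def)
    then show "(\<integral>\<^sup>+ z. ennreal (f n z) \<partial>Q) \<le> ennreal ((1 / 2) ^ n)" using fle[of n] by (simp add: ennreal_leI)
  qed auto
  also have "\<dots> = ennreal (\<Sum>n. (1 / 2) ^ n)" by (rule suminf_ennreal2) (auto intro: summable_geometric)
  finally have "(\<integral>\<^sup>+ z. (\<Sum>n. ennreal (f n z)) \<partial>Q) \<noteq> \<infinity>" by (auto simp: top_unique)
  then have "AE z in Q. (\<Sum>n. ennreal (f n z)) \<noteq> \<infinity>"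
    by (rule nn_integral_noteq_infinite[rotated]) measurable
  then have cauchyQ: "AE z in Q. Cauchy (\<lambda>n. path x (\<beta> n) (fst z) (snd z))"
  proof eventually_elim
    case (elim z)
    then have "summable (\<lambda>n. f n z)" by (intro summable_suminf_not_top) (auto simp: f_def)
    then have "summable (\<lambda>n. \<bar>flow x (\<beta> (Suc n)) z - flow x (\<beta> n) z\<bar>)" by (simp add: f_def abs_minus_commute)
    then have "summable (\<lambda>n. flow x (\<beta> (Suc n)) z - flow x (\<beta> n) z)" by (rule summable_rabs_cancel)
    then have "(\<lambda>m. \<Sum>n<m. flow x (\<beta> (Suc n)) z - flow x (\<beta> n) z) \<longlonglongrightarrow> (\<Sum>n. flow x (\<beta> (Suc n)) z - flow x (\<beta> n) z)"
      by (rule summable_LIMSEQ)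
    then have "(\<lambda>m. flow x (\<beta> m) z - flow x (\<beta> 0) z) \<longlonglongrightarrow> (\<Sum>n. flow x (\<beta> (Suc n)) z - flow x (\<beta> n) z)"
      unfolding sum_lessThan_telescope[of "\<lambda>n. flow x (\<beta> n) z"] .
    from tendsto_add[OF this tendsto_const[of "flow x (\<beta> 0) z"]] show ?case
      by (intro LIMSEQ_imp_Cauchy) simp
  qed
  have "AE \<omega> in M. AE t in T. Cauchy (\<lambda>n. path x (\<beta> n) t \<omega>)"
    by (rule AE_Q_swap[OF cauchyQ], rule sets_Collect_Cauchy) (rule fm)
  then have good: "AE \<omega> in M. \<omega> \<in> space M \<and> (\<forall>t\<ge>0. Cauchy (\<lambda>n. path x (\<beta> n) t \<omega>))"
    using AE_space
  proof eventually_elim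
    case (elim \<omega>)
    then show ?case using path_Cauchy_extend[OF d elim(2) elim(1)] by blast
  qed
  define \<xi> where "\<xi> t \<omega> = lim (\<lambda>n. path x (\<beta> n) t \<omega>)" for t \<omega>
  have \<xi>F: "\<xi> t \<in> borel_measurable (F t)" if "t \<ge> 0" for t
    unfolding \<xi>_def by (rule borel_measurable_lim_metric) (rule ad[OF that])
  have \<xi>j: "(\<lambda>(t, \<omega>). \<xi> t \<omega>) \<in> borel_measurable (borel \<Otimes>\<^sub>M M)"
  proof -
    have "(\<lambda>p. lim (\<lambda>n. (case p of (t, \<omega>) \<Rightarrow> path x (\<beta> n) t \<omega>))) \<in> borel_measurable (borel \<Otimes>\<^sub>M M)"
      by (rule borel_measurable_lim_metric) (rule path_joint[OF driftedD(1)[OF d]])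
    then show ?thesis by (simp add: \<xi>_def case_prod_beta')
  qed
  define X where "X z = \<xi> (fst z) (snd z)" for z
  have Xm[measurable]: "X \<in> borel_measurable Q" unfolding X_def by (rule joint_Q[OF \<xi>j])
  have limQ: "AE z in Q. (\<lambda>n. flow x (\<beta> n) z) \<longlonglongrightarrow> X z"
    using cauchyQ by eventually_elim (simp add: X_def \<xi>_def Cauchy_convergent_iff convergent_LIMSEQ_iff)
  have occ: "regular_occupation X0 (flow x (\<beta> n))" for n by (rule regular_occupation_flow[OF d X0(2)])
  have occX: "regular_occupation X0 X" by (rule regular_occupation_limit[OF occ Xm limQ])
  have comp: "(\<lambda>n. LINT z|Q. \<bar>a (flow x (\<beta> n) z) - a (X z)\<bar>) \<longlonglongrightarrow> 0"
    by (rule composed_drift_converges[OF a ab X0(1) occ occX limQ])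
  have err: "(\<lambda>n. drift_error a x (\<beta> n)) \<longlonglongrightarrow> 0"
  proof (rule tendsto_sandwich[OF _ _ tendsto_const])
    show "\<forall>\<^sub>F n in sequentially. 0 \<le> drift_error a x (\<beta> n)" by (simp add: drift_error_nonneg)
    show "\<forall>\<^sub>F n in sequentially. drift_error a x (\<beta> n) \<le> 1 / real (Suc n)"
    proof (rule always_eventually, rule allI)
      fix n show "drift_error a x (\<beta> n) \<le> 1 / real (Suc n)"
        using er[of n] unfolding \<eta>_def by (simp del: of_nat_Suc)
    qed
    show "(\<lambda>n. 1 / real (Suc n)) \<longlonglongrightarrow> 0" by (rule LIMSEQ_Suc[OF lim_1_over_n])
  qed
  have b2: "\<bar>\<beta> n t \<omega> - a y\<bar> \<le> 2 * B" "\<bar>a u - a y\<bar> \<le> 2 * B" for n t \<omega> u y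
    using driftedD(2)[OF d, of n t \<omega>] ab[of y] ab[of u] by linarith+
  let ?u = "\<lambda>n z. \<beta> n (fst z) (snd z) - a (X z)"
  have ui: "integrable Q (?u n)" for n
    by (rule Q.integrable_const_bound[where B="2 * B"]) (use b2 in auto)
  have "(\<lambda>n. LINT z|Q. norm (?u n z)) \<longlonglongrightarrow> 0"
  proof (rule Lim_null_comparison[OF always_eventually])
    show "(\<lambda>n. drift_error a x (\<beta> n) + (LINT z|Q. \<bar>a (flow x (\<beta> n) z) - a (X z)\<bar>)) \<longlonglongrightarrow> 0"
      using tendsto_add[OF err comp] by simp
    show "\<forall>n. norm (LINT z|Q. norm (?u n z)) \<le> drift_error a x (\<beta> n) + (LINT z|Q. \<bar>a (flow x (\<beta> n) z) - a (X z)\<bar>)"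
    proof
      fix n
      have i2: "integrable Q (\<lambda>z. \<bar>a (flow x (\<beta> n) z) - a (X z)\<bar>)"
        by (rule Q.integrable_const_bound[where B="2 * B"]) (use b2 in auto)
      note i1 = drift_error_integrable[OF d[of n] a ab]
      have "(LINT z|Q. norm (?u n z)) \<le> (LINT z|Q. \<bar>\<beta> n (fst z) (snd z) - a (flow x (\<beta> n) z)\<bar> + \<bar>a (flow x (\<beta> n) z) - a (X z)\<bar>)"
      proof (rule integral_mono[OF integrable_norm[OF ui] Bochner_Integration.integrable_add[OF i1 i2]])
        fix z
        show "norm (?u n z) \<le> \<bar>\<beta> n (fst z) (snd z) - a (flow x (\<beta> n) z)\<bar> + \<bar>a (flow x (\<beta> n) z) - a (X z)\<bar>"
          using abs_triangle_ineq[of "\<beta> n (fst z) (snd z) - a (flow x (\<beta> n) z)" "a (flow x (\<beta> n) z) - a (X z)"] by simp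
      qed
      also have "\<dots> = drift_error a x (\<beta> n) + (LINT z|Q. \<bar>a (flow x (\<beta> n) z) - a (X z)\<bar>)"
        unfolding drift_error_def by (rule Bochner_Integration.integral_add[OF i1 i2])
      finally show "norm (LINT z|Q. norm (?u n z)) \<le> drift_error a x (\<beta> n) + (LINT z|Q. \<bar>a (flow x (\<beta> n) z) - a (X z)\<bar>)"
        by (simp add: integral_nonneg_AE)
    qed
  qed
  from tendsto_L1_AE_subseq[OF ui this] obtain r :: "nat \<Rightarrow> nat" where r: "strict_mono r"
    and rl: "AE z in Q. (\<lambda>n. ?u (r n) z) \<longlonglongrightarrow> 0" by blast
  have "AE \<omega> in M. AE t in T. (\<lambda>n. \<beta> (r n) t \<omega> - a (\<xi> t \<omega>)) \<longlonglongrightarrow> 0"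
  proof (rule AE_Q_swap)
    show "AE z in Q. (\<lambda>n. \<beta> (r n) (fst z) (snd z) - a (\<xi> (fst z) (snd z))) \<longlonglongrightarrow> 0" using rl unfolding X_def .
    have "{z \<in> space Q. (\<lambda>n. ?u (r n) z) \<longlonglongrightarrow> 0} \<in> sets Q" by measurable
    then show "{z \<in> space Q. (\<lambda>n. \<beta> (r n) (fst z) (snd z) - a (\<xi> (fst z) (snd z))) \<longlonglongrightarrow> 0} \<in> sets Q" unfolding X_def .
  qed
  with good have "AE \<omega> in M. \<forall>t\<ge>0. \<xi> t \<omega> = x + (LINT s:{0..t}|lborel. a (\<xi> s \<omega>)) + Z t \<omega>"
  proof eventually_elim
    case (elim \<omega>)
    then have w: "\<omega> \<in> space M" and C: "\<And>t. t \<ge> 0 \<Longrightarrow> Cauchy (\<lambda>n. path x (\<beta> n) t \<omega>)"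
      and L: "AE t in T. (\<lambda>n. \<beta> (r n) t \<omega> - a (\<xi> t \<omega>)) \<longlonglongrightarrow> 0" by auto
    have [measurable]: "(\<lambda>s. \<xi> s \<omega>) \<in> borel_measurable borel" "(\<lambda>s. \<beta> n s \<omega>) \<in> borel_measurable borel" for n
      by (rule joint_section(2)[OF \<xi>j w], rule joint_section(2)[OF driftedD(1)[OF d] w])
    show ?case
    proof (intro allI impI)
      fix t :: real assume t: "t \<ge> 0"
      have p: "(\<lambda>n. path x (\<beta> n) t \<omega>) \<longlonglongrightarrow> \<xi> t \<omega>"
        using C[OF t] by (simp add: \<xi>_def Cauchy_convergent_iff convergent_LIMSEQ_iff)
      have "(\<lambda>n. LINT s:{0..t}|lborel. \<beta> (r n) s \<omega>) \<longlonglongrightarrow> (LINT s:{0..t}|lborel. a (\<xi> s \<omega>))"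
        unfolding set_lebesgue_integral_def
      proof (rule integral_dominated_convergence[where w="\<lambda>s. indicator {0..t} s *\<^sub>R B"])
        show "AE s in lborel. (\<lambda>n. indicat_real {0..t} s *\<^sub>R \<beta> (r n) s \<omega>) \<longlonglongrightarrow> indicat_real {0..t} s *\<^sub>R a (\<xi> s \<omega>)"
          using AE_T_lborel[OF L] AE_lborel_singleton[of 0]
        proof eventually_elim
          case (elim s)
          show ?case
          proof (cases "s \<in> {0..t}")
            case True
            then have "(\<lambda>n. \<beta> (r n) s \<omega> - a (\<xi> s \<omega>)) \<longlonglongrightarrow> 0" using elim by auto
            then show ?thesis by (intro tendsto_intros) (rule LIM_zero_cancel)
          qed simp
        qed
        show "integrable lborel (\<lambda>s. indicator {0..t} s *\<^sub>R B)"
          by (auto simp: emeasure_lborel_Icc_eq intro!: integrable_real_indicator)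
        show "AE s in lborel. norm (indicat_real {0..t} s *\<^sub>R \<beta> (r n) s \<omega>) \<le> indicator {0..t} s *\<^sub>R B" for n
          using driftedD(2)[OF d] by (auto split: split_indicator)
      qed measurable
      then have "(\<lambda>n. path x (\<beta> (r n)) t \<omega>) \<longlonglongrightarrow> x + (LINT s:{0..t}|lborel. a (\<xi> s \<omega>)) + Z (max 0 t) \<omega>"
        unfolding path_def by (intro tendsto_intros)
      moreover have "(\<lambda>n. path x (\<beta> (r n)) t \<omega>) \<longlonglongrightarrow> \<xi> t \<omega>"
        using LIMSEQ_subseq_LIMSEQ[OF p r] by (simp add: comp_def)
      ultimately show "\<xi> t \<omega> = x + (LINT s:{0..t}|lborel. a (\<xi> s \<omega>)) + Z t \<omega>"
        using t LIMSEQ_unique by fastforce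
    qed
  qed
  then show ?thesis using that \<xi>F joint_section(2)[OF \<xi>j] by blast
qed

section \<open>Pathwise uniqueness\<close>

text \<open>
  On the null set where the equation fails the drift is set to \<open>0\<close>. Elsewhere the equation makes the
  path right continuous, which supplies the joint measurability in time and \<open>\<omega>\<close>.
\<close>

lemma solution_imp_drifted:
  assumes sol: "solution M F Z a x \<xi>" and a[measurable]: "a \<in> borel_measurable borel" and ab: "\<And>y. \<bar>a y\<bar> \<le> B"
  obtains \<beta> where "drifted B x \<beta>" "AE \<omega> in M. \<forall>t\<ge>0. \<xi> t \<omega> = path x \<beta> t \<omega>"
    "AE z in Q. \<beta> (fst z) (snd z) = a (flow x \<beta> z)"
proof -
  have ad: "\<xi> t \<in> borel_measurable (F t)" if "t \<ge> 0" for t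
    using sol that by (simp add: solution_def adapted_def)
  have "AE \<omega> in M. (\<forall>T>0. set_integrable lborel {0..T} (\<lambda>s. a (\<xi> s \<omega>))) \<and>
      (\<forall>t\<ge>0. \<xi> t \<omega> = x + (LINT s:{0..t}|lborel. a (\<xi> s \<omega>)) + Z t \<omega>)"
    using sol by (simp add: solution_def)
  from AE_E3[OF this] obtain N where N: "N \<in> null_sets M" and
    si: "\<And>\<omega> T. \<omega> \<in> space M - N \<Longrightarrow> T > 0 \<Longrightarrow> set_integrable lborel {0..T} (\<lambda>s. a (\<xi> s \<omega>))" and
    eq: "\<And>\<omega> t. \<omega> \<in> space M - N \<Longrightarrow> t \<ge> 0 \<Longrightarrow> \<xi> t \<omega> = x + (LINT s:{0..t}|lborel. a (\<xi> s \<omega>)) + Z t \<omega>"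
    by metis
  define G where "G = space M - N"
  have Gm[measurable]: "G \<in> sets M" using N by (auto simp: G_def)
  have GM: "AE \<omega> in M. \<omega> \<in> G" using AE_not_in[OF N] AE_space by eventually_elim (simp add: G_def)
  define X where "X t \<omega> = (if \<omega> \<in> G then \<xi> (max 0 t) \<omega> else 0)" for t \<omega>
  have Xm: "X t \<in> borel_measurable M" for t
  proof -
    have [measurable]: "\<xi> (max 0 t) \<in> borel_measurable M" by (rule F_imp_M[OF _ ad]) auto
    show ?thesis unfolding X_def by measurable
  qed
  have Xj[measurable]: "(\<lambda>(t, \<omega>). X t \<omega>) \<in> borel_measurable (borel \<Otimes>\<^sub>M M)"
  proof (rule right_continuous_jointly_measurable[OF Xm])
    fix \<omega> t assume w: "\<omega> \<in> space M"
    show "((\<lambda>s. X s \<omega>) \<longlongrightarrow> X t \<omega>) (at_right t)"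
    proof (cases "\<omega> \<in> G")
      case True
      have "((\<lambda>s. \<xi> (max 0 s) \<omega>) \<longlongrightarrow> \<xi> (max 0 t) \<omega>) (at_right t)"
      proof (rule right_continuous_clamp)
        fix t :: real assume t: "t \<ge> 0"
        let ?I = "\<lambda>s. LINT r:{0..s}|lborel. a (\<xi> r \<omega>)"
        have Zr: "(Z' \<longlongrightarrow> Z' t) (at_right t)" if "Z' = (\<lambda>s. Z s \<omega>)" for Z'
          using Z_cadlag[OF w] t that by (auto simp: cadlag_def)
        have "(?I \<longlongrightarrow> ?I t) (at_right t)"
        proof (rule LIM_zero_cancel, rule Lim_null_comparison)
          show "\<forall>\<^sub>F s in at_right t. norm (?I s - ?I t) \<le> B * (s - t)"
            unfolding eventually_at_right_field
          proof (intro exI[of _ "t + 1"] conjI allI impI)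
            fix s assume s: "t < s" "s < t + 1"
            have i: "set_integrable lborel {0..s} (\<lambda>r. a (\<xi> r \<omega>))" using si[of \<omega> s] True s t by (simp add: G_def)
            have i': "set_integrable lborel {t..s} (\<lambda>r. a (\<xi> r \<omega>))" by (rule set_integrable_subset[OF i]) (use t in auto)
            show "norm (?I s - ?I t) \<le> B * (s - t)"
              using norm_set_integral_Icc_le[OF i', of B] ab s indefinite_integral_increment[OF i t] by simp
          qed simp
          show "((\<lambda>s. B * (s - t)) \<longlongrightarrow> 0) (at_right t)" by (auto intro!: tendsto_eq_intros)
        qed
        then have lim: "((\<lambda>s. x + ?I s + Z s \<omega>) \<longlongrightarrow> x + ?I t + Z t \<omega>) (at_right t)"
          by (intro tendsto_intros Zr[OF refl])
        have "eventually (\<lambda>s. x + ?I s + Z s \<omega> = \<xi> s \<omega>) (at_right t)"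
          unfolding eventually_at_right_field using eq[of \<omega>] True t by (intro exI[of _ "t + 1"]) (auto simp: G_def)
        from Lim_transform_eventually[OF lim this] show "((\<lambda>s. \<xi> s \<omega>) \<longlongrightarrow> \<xi> t \<omega>) (at_right t)"
          using eq[of \<omega> t] True t by (simp add: G_def)
      qed
      then show ?thesis using True by (simp add: X_def)
    qed (simp add: X_def)
  qed
  define \<beta> where "\<beta> t \<omega> = (if \<omega> \<in> G then a (X t \<omega>) else 0)" for t \<omega>
  have aXj: "(\<lambda>p. a (X (fst p) (snd p))) \<in> borel_measurable (borel \<Otimes>\<^sub>M M)"
    using measurable_compose[OF Xj a] by (simp add: case_prod_beta')
  have bj: "(\<lambda>(t, \<omega>). \<beta> t \<omega>) \<in> borel_measurable (borel \<Otimes>\<^sub>M M)"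
  proof -
    have "(\<lambda>p. if snd p \<in> G then a (X (fst p) (snd p)) else 0) \<in> borel_measurable (borel \<Otimes>\<^sub>M M)"
      using aXj by measurable
    then show ?thesis by (simp add: \<beta>_def case_prod_beta')
  qed
  have pe: "path x \<beta> t \<omega> = \<xi> t \<omega>" if "\<omega> \<in> G" "t \<ge> 0" for t \<omega>
  proof -
    have "(LINT s:{0..t}|lborel. \<beta> s \<omega>) = (LINT s:{0..t}|lborel. a (\<xi> s \<omega>))"
      by (rule set_lebesgue_integral_cong) (use that in \<open>auto simp: \<beta>_def X_def\<close>)
    then show ?thesis using eq[of \<omega> t] that by (simp add: path_def G_def)
  qed
  have known: "known_at t V" if "V' \<in> borel_measurable (F t)" "\<And>\<omega>. \<omega> \<in> G \<Longrightarrow> V \<omega> = V' \<omega>" for t V V'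
    unfolding known_at_def by (rule bexI[OF _ that(1)]) (use GM that(2) in \<open>auto elim: eventually_mono\<close>)
  show ?thesis
  proof (rule that)
    show "drifted B x \<beta>"
      unfolding drifted_def
    proof (intro conjI allI impI bj)
      show "\<bar>\<beta> t \<omega>\<bar> \<le> B" for t \<omega> using ab B0 by (simp add: \<beta>_def)
      fix t :: real assume t: "t \<ge> 0"
      show "known_at t (\<beta> t)"
        by (rule known[OF measurable_compose[OF ad[OF t] a]]) (use t in \<open>simp add: \<beta>_def X_def\<close>)
      show "known_at t (path x \<beta> t)"
        by (rule known[OF ad[OF t]]) (rule pe[OF _ t])
    qed
    show "AE \<omega> in M. \<forall>t\<ge>0. \<xi> t \<omega> = path x \<beta> t \<omega>" using GM by eventually_elim (simp add: pe)
    have "AE z in Q. snd z \<in> G"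
      unfolding Q_def
    proof (rule TM.AE_pair_measure)
      show "{z \<in> space (T \<Otimes>\<^sub>M M). snd z \<in> G} \<in> sets (T \<Otimes>\<^sub>M M)" by measurable
      show "AE t in T. AE \<omega> in M. snd (t, \<omega>) \<in> G" using GM by simp
    qed
    then show "AE z in Q. \<beta> (fst z) (snd z) = a (flow x \<beta> z)"
      using AE_Q_nonneg by eventually_elim (simp add: pe, simp add: \<beta>_def X_def)
  qed
qed

lemma drift_error_of_solution:
  assumes "AE z in Q. \<beta> (fst z) (snd z) = b (flow x \<beta> z)" and "drifted B x \<beta>"
    and [measurable]: "a \<in> borel_measurable borel" "b \<in> borel_measurable borel"
  shows "drift_error a x \<beta> = (LINT z|Q. \<bar>b (flow x \<beta> z) - a (flow x \<beta> z)\<bar>)"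
  unfolding drift_error_def
proof (rule integral_cong_AE)
  note [measurable] = driftedD(5,6)[OF assms(2)]
  show "(\<lambda>z. \<bar>\<beta> (fst z) (snd z) - a (flow x \<beta> z)\<bar>) \<in> borel_measurable Q" by measurable
  show "(\<lambda>z. \<bar>b (flow x \<beta> z) - a (flow x \<beta> z)\<bar>) \<in> borel_measurable Q" by measurable
  show "AE z in Q. \<bar>\<beta> (fst z) (snd z) - a (flow x \<beta> z)\<bar> = \<bar>b (flow x \<beta> z) - a (flow x \<beta> z)\<bar>"
    using assms(1) by eventually_elim simp
qed

lemma path_difference_lipschitz:
  assumes d1: "drifted B x \<beta>" and d2: "drifted B y \<gamma>" and w: "\<omega> \<in> space M" and s: "0 \<le> s" "s \<le> t"
  shows "\<bar>(path x \<beta> t \<omega> - path y \<gamma> t \<omega>) - (path x \<beta> s \<omega> - path y \<gamma> s \<omega>)\<bar> \<le> 2 * B * (t - s)"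
  using drift_integral_bound[OF d1 w s] drift_integral_bound[OF d2 w s]
  by (simp add: path_def)

text \<open>
  For two solutions both drift errors vanish, so \<open>flow_distance\<close> bounds their distance by
  \<open>tail \<bar>x\<bar> R\<close> for every \<open>R\<close>. Equality at almost every time extends to all times by the Lipschitz
  continuity of the difference.
\<close>

lemma pathwise_uniqueness:
  assumes a[measurable]: "a \<in> borel_measurable borel" and ab: "\<And>y. \<bar>a y\<bar> \<le> B"
  shows "pathwise_unique M F Z a x"
  unfolding pathwise_unique_def
proof (intro allI impI, elim conjE)
  fix \<xi> \<eta> assume "solution M F Z a x \<xi>" "solution M F Z a x \<eta>"
  obtain \<beta> where d1: "drifted B x \<beta>" and e1: "AE \<omega> in M. \<forall>t\<ge>0. \<xi> t \<omega> = path x \<beta> t \<omega>"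
    and b1: "AE z in Q. \<beta> (fst z) (snd z) = a (flow x \<beta> z)"
    using solution_imp_drifted[OF \<open>solution M F Z a x \<xi>\<close> a ab] by blast
  obtain \<gamma> where d2: "drifted B x \<gamma>" and e2: "AE \<omega> in M. \<forall>t\<ge>0. \<eta> t \<omega> = path x \<gamma> t \<omega>"
    and b2: "AE z in Q. \<gamma> (fst z) (snd z) = a (flow x \<gamma> z)"
    using solution_imp_drifted[OF \<open>solution M F Z a x \<eta>\<close> a ab] by blast
  note [measurable] = driftedD(6)[OF d1] driftedD(6)[OF d2]
  let ?I = "LINT z|Q. \<bar>flow x \<beta> z - flow x \<gamma> z\<bar>"
  have "drift_error a x \<beta> = 0" "drift_error a x \<gamma> = 0"
    using drift_error_of_solution[OF b1 d1 a a] drift_error_of_solution[OF b2 d2 a a] by auto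
  then have "?I \<le> tail \<bar>x\<bar> (real r)" for r
    using flow_distance[OF d1 d2 a ab order_refl order_refl, of "real r"] by simp
  then have "?I \<le> 0" by (intro LIMSEQ_le_const[OF tail_tendsto]) auto
  moreover have "?I \<ge> 0" by (intro integral_nonneg_AE) simp
  ultimately have "?I = 0" by simp
  then have "AE z in Q. \<bar>flow x \<beta> z - flow x \<gamma> z\<bar> = 0"
    by (subst (asm) integral_nonneg_eq_0_iff_AE[OF flow_distance_integrable[OF d1 d2]]) auto
  then have z: "AE z in Q. path x \<beta> (fst z) (snd z) = path x \<gamma> (fst z) (snd z)" by simp
  have "AE \<omega> in M. AE t in T. path x \<beta> t \<omega> = path x \<gamma> t \<omega>"
    by (rule AE_Q_swap[OF z]) measurable
  with e1 e2 AE_space show "AE \<omega> in M. \<forall>t\<ge>0. \<xi> t \<omega> = \<eta> t \<omega>"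
  proof eventually_elim
    case (elim \<omega>)
    have "path x \<beta> t \<omega> = path x \<gamma> t \<omega>" if t: "t \<ge> 0" for t
    proof (rule ccontr)
      assume "path x \<beta> t \<omega> \<noteq> path x \<gamma> t \<omega>"
      then have p: "\<bar>path x \<beta> t \<omega> - path x \<gamma> t \<omega>\<bar> > 0" (is "?p > 0") by simp
      define h where "h = ?p / (2 * B + 1)"
      have h: "h > 0" using p B0 by (simp add: h_def)
      obtain s where s: "t < s" "s < t + h" "path x \<beta> s \<omega> = path x \<gamma> s \<omega>" using AE_T_dense[OF elim(4) t h] by blast
      have "?p \<le> 2 * B * (s - t)"
        using path_difference_lipschitz[OF d1 d2 elim(3) t less_imp_le[OF s(1)]] s(3) by (simp add: abs_minus_commute)
      also have "\<dots> \<le> 2 * B * h" using s B0 by (intro mult_left_mono) auto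
      also have "\<dots> < (2 * B + 1) * h" using h by (simp add: algebra_simps)
      also have "\<dots> = ?p" using B0 by (simp add: h_def)
      finally show False by simp
    qed
    then show ?case using elim by simp
  qed
qed

section \<open>Convergence in probability, uniformly in time\<close>

text \<open>
  The difference is Lipschitz with constant \<open>2 * B\<close>, so once it exceeds \<open>e\<close> it stays above \<open>e / 2\<close>
  for a time \<open>h\<close> that depends only on \<open>e\<close> and \<open>B\<close>; the exponential density is bounded below on
  \<open>{0..T0 + h}\<close>.
\<close>

lemma large_difference_occupies_time:
  assumes T0: "T0 > 0" and e: "e > 0"
  obtains C where "C > 0" "\<And>x \<beta> y \<gamma> \<omega> t. drifted B x \<beta> \<Longrightarrow> drifted B y \<gamma> \<Longrightarrow> \<omega> \<in> space M \<Longrightarrow> t \<in> {0..T0} \<Longrightarrow>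
    e < \<bar>path x \<beta> t \<omega> - path y \<gamma> t \<omega>\<bar> \<Longrightarrow> 1 \<le> ennreal C * (\<integral>\<^sup>+ s. ennreal \<bar>path x \<beta> s \<omega> - path y \<gamma> s \<omega>\<bar> \<partial>T)"
proof -
  \<comment> \<open>within time \<open>h\<close> the difference changes by at most \<open>2 * B * h < e / 2\<close>\<close>
  define h where "h = e / (2 * (2 * B + 1))"
  have h: "h > 0" using e B0 by (simp add: h_def)
  \<comment> \<open>below the exponential density on \<open>{0..T0 + h}\<close>\<close>
  define q where "q = l * exp (- (T0 + h) * l)"
  have q: "q > 0" using l by (simp add: q_def)
  show ?thesis
  proof (rule that)
    show "1 / (e / 2 * q * h) > 0" using e q h by simp
    fix x \<beta> y \<gamma> \<omega> t
    assume d1: "drifted B x \<beta>" and d2: "drifted B y \<gamma>" and w: "\<omega> \<in> space M" and t: "t \<in> {0..T0}"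
      and big: "e < \<bar>path x \<beta> t \<omega> - path y \<gamma> t \<omega>\<bar>"
    let ?D = "\<lambda>s. path x \<beta> s \<omega> - path y \<gamma> s \<omega>"
    have [measurable]: "(\<lambda>s. path x \<beta> s \<omega>) \<in> borel_measurable borel" "(\<lambda>s. path y \<gamma> s \<omega>) \<in> borel_measurable borel"
      by (rule joint_section(2)[OF path_joint[OF driftedD(1)[OF d1]] w], rule joint_section(2)[OF path_joint[OF driftedD(1)[OF d2]] w])
    have low: "e / 2 \<le> \<bar>?D s\<bar>" if "s \<in> {t..t + h}" for s
    proof -
      have "\<bar>?D s - ?D t\<bar> \<le> 2 * B * (s - t)"
        by (rule path_difference_lipschitz[OF d1 d2 w]) (use t that in auto)
      also have "\<dots> \<le> 2 * B * h" using that B0 by (intro mult_left_mono) auto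
      also have "\<dots> \<le> (2 * B + 1) * h" using h by (simp add: algebra_simps)
      also have "\<dots> = e / 2"
      proof -
        have "b * (e / (2 * b)) = e / 2" if "b > 0" for b :: real using that by simp
        from this[of "2 * B + 1"] show ?thesis unfolding h_def using B0 by linarith
      qed
      finally show ?thesis using big by linarith
    qed
    have "ennreal (e / 2 * q * h) = ennreal (e / 2 * q) * ennreal h"
      by (rule ennreal_mult) (use e q h in auto)
    also have "\<dots> = (\<integral>\<^sup>+ s. ennreal (e / 2 * q) * indicator {t..t + h} s \<partial>lborel)"
      using h by (subst nn_integral_cmult_indicator) auto
    also have "\<dots> \<le> (\<integral>\<^sup>+ s. ennreal (exponential_density l s) * ennreal \<bar>?D s\<bar> \<partial>lborel)"
    proof (intro nn_integral_mono)
      fix s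
      show "ennreal (e / 2 * q) * indicator {t..t + h} s \<le> ennreal (exponential_density l s) * ennreal \<bar>?D s\<bar>"
      proof (cases "s \<in> {t..t + h}")
        case True
        have "s * l \<le> (T0 + h) * l" using True t l by (intro mult_right_mono) auto
        then have "q \<le> exponential_density l s"
          using True t l by (auto simp: q_def exponential_density_def algebra_simps)
        then have "q * (e / 2) \<le> exponential_density l s * \<bar>?D s\<bar>"
          using low[OF True] q e by (intro mult_mono) auto
        then show ?thesis using True exponential_density_nonneg[OF l, of s]
          by (simp add: ennreal_mult[symmetric] mult.commute ennreal_leI)
      qed simp
    qed
    also have "\<dots> = (\<integral>\<^sup>+ s. ennreal \<bar>?D s\<bar> \<partial>T)"
      unfolding T_def by (subst nn_integral_density) auto
    finally have "ennreal (1 / (e / 2 * q * h)) * ennreal (e / 2 * q * h) \<le> ennreal (1 / (e / 2 * q * h)) * (\<integral>\<^sup>+ s. ennreal \<bar>?D s\<bar> \<partial>T)"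
      by (rule mult_left_mono) simp
    moreover have "ennreal (1 / (e / 2 * q * h)) * ennreal (e / 2 * q * h) = 1"
      using e q h by (simp add: ennreal_mult[symmetric] del: ennreal_1)
    ultimately show "1 \<le> ennreal (1 / (e / 2 * q * h)) * (\<integral>\<^sup>+ s. ennreal \<bar>?D s\<bar> \<partial>T)" by simp
  qed
qed

lemma flow_convergence:
  assumes d: "\<And>n. drifted B (x n) (\<beta> n)" and a: "a \<in> borel_measurable borel" and ab: "\<And>y. \<bar>a y\<bar> \<le> B"
    and x: "x \<longlonglongrightarrow> x 0" and X0: "\<And>n. \<bar>x n\<bar> \<le> X0"
    and e: "(\<lambda>n. drift_error a (x n) (\<beta> n)) \<longlonglongrightarrow> 0" and e0: "drift_error a (x 0) (\<beta> 0) = 0"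
  shows "(\<lambda>n. LINT z|Q. \<bar>flow (x n) (\<beta> n) z - flow (x 0) (\<beta> 0) z\<bar>) \<longlonglongrightarrow> 0"
proof (rule LIMSEQ_I)
  fix \<epsilon> :: real assume \<epsilon>: "\<epsilon> > 0"
  have "eventually (\<lambda>r. tail X0 (real r) < \<epsilon> / 2) sequentially"
    using tail_tendsto \<epsilon> by (intro order_tendstoD) auto
  then obtain r where r: "tail X0 (real r) < \<epsilon> / 2" by (auto simp: eventually_sequentially)
  have "(\<lambda>n. 4 * kappa * real r * (l * \<bar>x n - x 0\<bar> + 2 * (drift_error a (x n) (\<beta> n) + 0))) \<longlonglongrightarrow> 4 * kappa * real r * (l * 0 + 2 * (0 + 0))"
    using x by (intro tendsto_intros e tendsto_rabs_zero LIM_zero)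
  then have "eventually (\<lambda>n. 4 * kappa * real r * (l * \<bar>x n - x 0\<bar> + 2 * (drift_error a (x n) (\<beta> n) + 0)) < \<epsilon> / 2) sequentially"
    using \<epsilon> by (intro order_tendstoD) auto
  then obtain N where N: "\<And>n. n \<ge> N \<Longrightarrow> 4 * kappa * real r * (l * \<bar>x n - x 0\<bar> + 2 * (drift_error a (x n) (\<beta> n) + 0)) < \<epsilon> / 2"
    by (auto simp: eventually_sequentially)
  have "norm ((LINT z|Q. \<bar>flow (x n) (\<beta> n) z - flow (x 0) (\<beta> 0) z\<bar>) - 0) < \<epsilon>" if "n \<ge> N" for n
  proof -
    have nn: "0 \<le> (LINT z|Q. \<bar>flow (x n) (\<beta> n) z - flow (x 0) (\<beta> 0) z\<bar>)" by (intro integral_nonneg_AE) simp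
    have "(LINT z|Q. \<bar>flow (x n) (\<beta> n) z - flow (x 0) (\<beta> 0) z\<bar>) \<le>
        4 * kappa * real r * (l * \<bar>x n - x 0\<bar> + 2 * (drift_error a (x n) (\<beta> n) + 0)) + tail X0 (real r)"
      using flow_distance[OF d[of n] d[of 0] a ab X0 X0, of "real r"] e0 by simp
    then show ?thesis using N[OF that] r nn by simp
  qed
  then show "\<exists>no. \<forall>n\<ge>no. norm ((LINT z|Q. \<bar>flow (x n) (\<beta> n) z - flow (x 0) (\<beta> 0) z\<bar>) - 0) < \<epsilon>" by blast
qed

end

lemma completion_measurable_AE_eq:
  fixes f g :: "'a \<Rightarrow> real"
  assumes f: "f \<in> borel_measurable M" and eq: "AE x in M. f x = g x"
  shows "g \<in> borel_measurable (completion M)"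
proof (rule borel_measurableI_greater)
  fix y
  obtain N where N: "\<And>x. x \<in> space M - N \<Longrightarrow> f x = g x" "N \<in> null_sets M" using AE_E3[OF eq] by blast
  have 1: "{x \<in> space M. g x > y} \<inter> N \<in> null_sets (completion M)"
    by (rule null_sets_completion_subset[OF _ null_sets_completionI[OF N(2)]]) auto
  have 2: "{x \<in> space M. f x > y} - N \<in> sets (completion M)"
    using f N(2) by (intro sets_completionI_sets) auto
  have 3: "{x \<in> space (completion M). g x > y} = ({x \<in> space M. f x > y} - N) \<union> ({x \<in> space M. g x > y} \<inter> N)"
    using N(1) by auto
  show "{x \<in> space (completion M). g x > y} \<in> sets (completion M)"
    unfolding 3 by (rule sets.Un[OF 2 null_setsD2[OF 1]])
qed

context damped_noise
begin

text \<open>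
  The clamped rationals form a countable set of times in \<open>{0..T0}\<close> that suffices for the supremum;
  this gives its measurability.
\<close>

lemma path_difference_rational:
  assumes d1: "drifted B x \<beta>" and d2: "drifted B y \<gamma>" and w: "\<omega> \<in> space M" and t: "t \<in> {0..T0}"
    and big: "e < \<bar>path x \<beta> t \<omega> - path y \<gamma> t \<omega>\<bar>"
  obtains r :: rat where "e < \<bar>path x \<beta> (min T0 (max 0 (of_rat r))) \<omega> - path y \<gamma> (min T0 (max 0 (of_rat r))) \<omega>\<bar>"
proof -
  let ?D = "\<lambda>s. path x \<beta> s \<omega> - path y \<gamma> s \<omega>"
  define h where "h = (\<bar>?D t\<bar> - e) / (2 * B + 1)"
  have h: "h > 0" using big B0 by (simp add: h_def)
  obtain r :: rat where r: "t - h < of_rat r" "of_rat r < t" using of_rat_dense[of "t - h" t] h by auto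
  define s where "s = min T0 (max 0 (of_rat r :: real))"
  have s: "0 \<le> s" "s \<le> t" "t - s < h" using r t h by (auto simp: s_def)
  have "\<bar>?D t - ?D s\<bar> \<le> 2 * B * (t - s)" by (rule path_difference_lipschitz[OF d1 d2 w s(1,2)])
  also have "\<dots> \<le> 2 * B * h" using s B0 by (intro mult_left_mono) auto
  also have "\<dots> < (2 * B + 1) * h" using h by (simp add: algebra_simps)
  also have "\<dots> = \<bar>?D t\<bar> - e" using B0 by (simp add: h_def)
  finally have "e < \<bar>?D s\<bar>" by linarith
  then show ?thesis using that by (simp add: s_def)
qed

lemma sup_path_difference:
  assumes d1: "drifted B x \<beta>" and d2: "drifted B y \<gamma>" and T0: "T0 > 0"
  shows "(\<lambda>\<omega>. SUP t\<in>{0..T0}. \<bar>path x \<beta> t \<omega> - path y \<gamma> t \<omega>\<bar>) \<in> borel_measurable M"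
    and "\<omega> \<in> space M \<Longrightarrow> e < (SUP t\<in>{0..T0}. \<bar>path x \<beta> t \<omega> - path y \<gamma> t \<omega>\<bar>) \<longleftrightarrow> (\<exists>t\<in>{0..T0}. e < \<bar>path x \<beta> t \<omega> - path y \<gamma> t \<omega>\<bar>)"
proof -
  let ?D = "\<lambda>t \<omega>. path x \<beta> t \<omega> - path y \<gamma> t \<omega>"
  have [measurable]: "path x \<beta> t \<in> borel_measurable M" "path y \<gamma> t \<in> borel_measurable M" for t
    by (rule joint_section(1)[OF path_joint[OF driftedD(1)[OF d1]]], rule joint_section(1)[OF path_joint[OF driftedD(1)[OF d2]]])
  show iff: "e < (SUP t\<in>{0..T0}. \<bar>?D t \<omega>\<bar>) \<longleftrightarrow> (\<exists>t\<in>{0..T0}. e < \<bar>?D t \<omega>\<bar>)" if w: "\<omega> \<in> space M" for \<omega> e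
  proof (rule less_cSUP_iff)
    show "bdd_above ((\<lambda>t. \<bar>?D t \<omega>\<bar>) ` {0..T0})"
    proof (rule bdd_aboveI2)
      fix t assume t: "t \<in> {0..T0}"
      then have "\<bar>?D t \<omega>\<bar> \<le> \<bar>x - y\<bar> + 2 * B * t" by (intro path_diff_bound[OF d1 d2 w]) auto
      also have "\<dots> \<le> \<bar>x - y\<bar> + 2 * B * T0" using t B0 by (intro add_left_mono mult_left_mono) auto
      finally show "\<bar>?D t \<omega>\<bar> \<le> \<bar>x - y\<bar> + 2 * B * T0" .
    qed
  qed (use T0 in auto)
  show "(\<lambda>\<omega>. SUP t\<in>{0..T0}. \<bar>?D t \<omega>\<bar>) \<in> borel_measurable M"
  proof (rule borel_measurableI_greater)
    fix e
    let ?s = "\<lambda>r::rat. min T0 (max 0 (of_rat r)) :: real"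
    have "{\<omega> \<in> space M. e < (SUP t\<in>{0..T0}. \<bar>?D t \<omega>\<bar>)} = (\<Union>r. {\<omega> \<in> space M. e < \<bar>?D (?s r) \<omega>\<bar>})"
    proof (intro equalityI subsetI)
      fix \<omega> assume "\<omega> \<in> {\<omega> \<in> space M. e < (SUP t\<in>{0..T0}. \<bar>?D t \<omega>\<bar>)}"
      then obtain t where t: "\<omega> \<in> space M" "t \<in> {0..T0}" "e < \<bar>?D t \<omega>\<bar>" using iff by auto
      obtain r where "e < \<bar>?D (?s r) \<omega>\<bar>" by (rule path_difference_rational[OF d1 d2 t])
      then show "\<omega> \<in> (\<Union>r. {\<omega> \<in> space M. e < \<bar>?D (?s r) \<omega>\<bar>})" using t by blast
    next
      fix \<omega> assume "\<omega> \<in> (\<Union>r. {\<omega> \<in> space M. e < \<bar>?D (?s r) \<omega>\<bar>})"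
      then obtain r where r: "\<omega> \<in> space M" "e < \<bar>?D (?s r) \<omega>\<bar>" by blast
      have "?s r \<in> {0..T0}" using T0 by auto
      then show "\<omega> \<in> {\<omega> \<in> space M. e < (SUP t\<in>{0..T0}. \<bar>?D t \<omega>\<bar>)}" using r iff by blast
    qed
    also have "\<dots> \<in> sets M" by measurable
    finally show "{\<omega> \<in> space M. e < (SUP t\<in>{0..T0}. \<bar>?D t \<omega>\<bar>)} \<in> sets M" .
  qed
qed

text \<open>
  Where the supremum exceeds \<open>e\<close>, the integral of the difference over the exponential time is bounded
  below by \<open>large_difference_occupies_time\<close>, so Markov's inequality applies. The suprema of the given
  processes and of the paths agree almost surely, whence the completion.
\<close>

lemma uniform_convergence_of_paths:
  assumes d: "\<And>n. drifted B (x n) (\<beta> n)" and eq: "\<And>n. AE \<omega> in M. \<forall>t\<ge>0. \<xi> n t \<omega> = path (x n) (\<beta> n) t \<omega>"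
    and lim: "(\<lambda>n. LINT z|Q. \<bar>flow (x n) (\<beta> n) z - flow (x 0) (\<beta> 0) z\<bar>) \<longlonglongrightarrow> 0" and T0: "T0 > 0"
  shows "uniformly_converges_in_probability M T0 \<xi> (\<xi> 0)"
  unfolding uniformly_converges_in_probability_def converges_in_measure_def
proof (intro conjI allI impI)
  let ?S = "\<lambda>n \<omega>. SUP t\<in>{0..T0}. \<bar>\<xi> n t \<omega> - \<xi> 0 t \<omega>\<bar>"
  let ?P = "\<lambda>n \<omega>. SUP t\<in>{0..T0}. \<bar>path (x n) (\<beta> n) t \<omega> - path (x 0) (\<beta> 0) t \<omega>\<bar>"
  have SP: "AE \<omega> in M. ?P n \<omega> = ?S n \<omega>" for n
    using eq[of n] eq[of 0] by eventually_elim (auto intro!: SUP_cong)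
  show "?S n \<in> borel_measurable (completion M)" for n
    by (rule completion_measurable_AE_eq[OF sup_path_difference(1)[OF d d T0] SP])
  show "(\<lambda>_. 0) \<in> borel_measurable (completion M)" by simp
  fix e :: real assume e: "e > 0"
  obtain C where C: "C > 0" and big: "\<And>x \<beta> y \<gamma> \<omega> t. drifted B x \<beta> \<Longrightarrow> drifted B y \<gamma> \<Longrightarrow> \<omega> \<in> space M \<Longrightarrow> t \<in> {0..T0} \<Longrightarrow>
    e < \<bar>path x \<beta> t \<omega> - path y \<gamma> t \<omega>\<bar> \<Longrightarrow> 1 \<le> ennreal C * (\<integral>\<^sup>+ s. ennreal \<bar>path x \<beta> s \<omega> - path y \<gamma> s \<omega>\<bar> \<partial>T)"
    using large_difference_occupies_time[OF T0 e] by blast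
  let ?I = "\<lambda>n. LINT z|Q. \<bar>flow (x n) (\<beta> n) z - flow (x 0) (\<beta> 0) z\<bar>"
  have le: "emeasure (completion M) {\<omega> \<in> space (completion M). e < \<bar>?S n \<omega> - 0\<bar>} \<le> ennreal (C * ?I n)" for n
  proof -
    let ?D = "\<lambda>s \<omega>. \<bar>path (x n) (\<beta> n) s \<omega> - path (x 0) (\<beta> 0) s \<omega>\<bar>"
    have pj[measurable]: "(\<lambda>(t, \<omega>). path (x n) (\<beta> n) t \<omega>) \<in> borel_measurable (borel \<Otimes>\<^sub>M M)" for n
      by (rule path_joint[OF driftedD(1)[OF d]])
    have Dj: "(\<lambda>(s, \<omega>). ennreal (?D s \<omega>)) \<in> borel_measurable (T \<Otimes>\<^sub>M M)" by measurable
    let ?u = "\<lambda>\<omega>. \<integral>\<^sup>+ s. ennreal (?D s \<omega>) \<partial>T"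
    have um[measurable]: "?u \<in> borel_measurable M"
      using T.borel_measurable_nn_integral_fst[OF measurable_pair_swap[OF Dj]] by simp
    let ?A = "{\<omega> \<in> space M. 1 \<le> ennreal C * ?u \<omega>}"
    have Am[measurable]: "?A \<in> sets M" by measurable
    have "emeasure (completion M) {\<omega> \<in> space (completion M). e < \<bar>?S n \<omega> - 0\<bar>} \<le> emeasure (completion M) ?A"
    proof (rule emeasure_mono_AE)
      have "AE \<omega> in M. \<omega> \<in> {\<omega> \<in> space (completion M). e < \<bar>?S n \<omega> - 0\<bar>} \<longrightarrow> \<omega> \<in> ?A"
        using SP[of n] AE_space
      proof eventually_elim
        case (elim \<omega>)
        show ?case
        proof
          assume "\<omega> \<in> {\<omega> \<in> space (completion M). e < \<bar>?S n \<omega> - 0\<bar>}"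
          then have "e < \<bar>?P n \<omega>\<bar>" using elim(1) by simp
          moreover have "0 \<le> ?P n \<omega>"
          proof -
            have "\<not> ?P n \<omega> < 0"
            proof
              assume neg: "?P n \<omega> < 0"
              have "?P n \<omega> / 2 < ?P n \<omega>"
                unfolding sup_path_difference(2)[OF d d T0 elim(2), of "?P n \<omega> / 2"]
                using T0 neg by (intro bexI[of _ 0]) (auto intro: less_le_trans)
              then show False using neg by simp
            qed
            then show ?thesis by simp
          qed
          ultimately have "e < ?P n \<omega>" by simp
          then obtain t where "t \<in> {0..T0}" "e < ?D t \<omega>"
            using sup_path_difference(2)[OF d d T0 elim(2)] by blast
          then show "\<omega> \<in> ?A" using big[OF d d elim(2)] elim(2) by blast
        qed
      qed
      then show "AE \<omega> in completion M. \<omega> \<in> {\<omega> \<in> space (completion M). e < \<bar>?S n \<omega> - 0\<bar>} \<longrightarrow> \<omega> \<in> ?A"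
        by (rule AE_completion)
    qed simp
    also have "\<dots> = emeasure M ?A" by (simp add: Am)
    also have "\<dots> \<le> ennreal C * (\<integral>\<^sup>+ \<omega>. ?u \<omega> * indicator (space M) \<omega> \<partial>M)"
      by (rule nn_integral_Markov_inequality) measurable
    also have "(\<integral>\<^sup>+ \<omega>. ?u \<omega> * indicator (space M) \<omega> \<partial>M) = (\<integral>\<^sup>+ \<omega>. ?u \<omega> \<partial>M)"
      by (intro nn_integral_cong) simp
    also have "\<dots> = (\<integral>\<^sup>+ z. ennreal \<bar>flow (x n) (\<beta> n) z - flow (x 0) (\<beta> 0) z\<bar> \<partial>Q)"
      using TM.nn_integral_snd[OF Dj] by (simp add: Q_def case_prod_beta')
    also have "\<dots> = ennreal (?I n)"
      by (rule nn_integral_eq_integral[OF flow_distance_integrable[OF d d]]) simp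
    also have "ennreal C * \<dots> = ennreal (C * ?I n)"
      using C by (simp add: ennreal_mult')
    finally show ?thesis .
  qed
  have "(\<lambda>n. ennreal (C * ?I n)) \<longlonglongrightarrow> ennreal (C * 0)" by (intro tendsto_ennrealI tendsto_mult tendsto_const lim)
  then have lim0: "(\<lambda>n. ennreal (C * ?I n)) \<longlonglongrightarrow> 0" by simp
  show "(\<lambda>n. emeasure (completion M) {\<omega> \<in> space (completion M). e < \<bar>?S n \<omega> - 0\<bar>}) \<longlonglongrightarrow> 0"
    by (rule tendsto_sandwich[OF _ _ tendsto_const lim0]) (use le in auto)
qed

end

lemma weight_integral_of_convergence_in_measure:
  assumes \<alpha>: "\<alpha> > 1" and c: "converges_in_measure (weight_measure \<alpha>) a b" and m: "\<And>n y. \<bar>a n y - b y\<bar> \<le> m"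
  shows "(\<lambda>n. LINT y|weight_measure \<alpha>. \<bar>a n y - b y\<bar>) \<longlonglongrightarrow> 0"
proof (rule LIMSEQ_I)
  interpret W: finite_measure "weight_measure \<alpha>" by (rule finite_weight_measure[OF \<alpha>])
  let ?W = "weight_measure \<alpha>"
  have [measurable]: "a n \<in> borel_measurable borel" "b \<in> borel_measurable borel" for n
    using c measurable_cong_sets[OF sets_weight_measure refl, of \<alpha> "borel :: real measure"]
    by (simp_all add: converges_in_measure_def)
  fix e :: real assume e: "e > 0"
  have m0: "m \<ge> 0" using order_trans[OF abs_ge_zero m] .
  define w where "w = measure ?W UNIV"
  have w: "w \<ge> 0" by (simp add: w_def)
  define \<epsilon> where "\<epsilon> = e / (2 * (w + 1))"
  have \<epsilon>: "\<epsilon> > 0" using e w by (simp add: \<epsilon>_def)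
  define A where "A n = {y. \<bar>a n y - b y\<bar> > \<epsilon>}" for n
  have [measurable]: "A n \<in> sets borel" for n unfolding A_def by measurable
  have "(\<lambda>n. emeasure ?W (A n)) \<longlonglongrightarrow> 0"
    using c \<epsilon> by (simp add: converges_in_measure_def A_def)
  then have "(\<lambda>n. measure ?W (A n)) \<longlonglongrightarrow> 0"
    using tendsto_ennreal_iff[of "\<lambda>n. measure ?W (A n)" sequentially 0] by (simp add: W.emeasure_eq_measure)
  then have "(\<lambda>n. m * measure ?W (A n)) \<longlonglongrightarrow> m * 0" by (intro tendsto_intros)
  then have "eventually (\<lambda>n. m * measure ?W (A n) < e / 2) sequentially" using e by (intro order_tendstoD) auto
  then obtain N where N: "\<And>n. n \<ge> N \<Longrightarrow> m * measure ?W (A n) < e / 2" by (auto simp: eventually_sequentially)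
  have "norm ((LINT y|?W. \<bar>a n y - b y\<bar>) - 0) < e" if "n \<ge> N" for n
  proof -
    have i: "integrable ?W (\<lambda>y. \<bar>a n y - b y\<bar>)" by (rule W.integrable_const_bound[where B=m]) (use m in auto)
    have i2: "integrable ?W (\<lambda>y. \<epsilon> + m * indicator (A n) y)"
      by (auto simp: W.emeasure_eq_measure intro!: integrable_real_indicator)
    have "(LINT y|?W. \<bar>a n y - b y\<bar>) \<le> (LINT y|?W. \<epsilon> + m * indicator (A n) y)"
      by (rule integral_mono[OF i i2]) (use m[of n] m0 \<epsilon> in \<open>auto simp: A_def indicator_def intro: add_increasing\<close>)
    also have "\<dots> = w * \<epsilon> + m * measure ?W (A n)"
      by (subst Bochner_Integration.integral_add) (auto simp: w_def W.emeasure_eq_measure intro!: integrable_real_indicator)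
    also have "w * \<epsilon> \<le> e / 2"
    proof -
      have "w * \<epsilon> \<le> (w + 1) * \<epsilon>" using \<epsilon> by (intro mult_right_mono) auto
      also have "\<dots> = e / 2"
      proof -
        have "v * (e / (2 * v)) = e / 2" if "v > 0" for v :: real using that by simp
        from this[of "w + 1"] show ?thesis unfolding \<epsilon>_def using w by linarith
      qed
      finally show ?thesis .
    qed
    finally have "(LINT y|?W. \<bar>a n y - b y\<bar>) < e" using N[OF that] by linarith
    moreover have "0 \<le> (LINT y|?W. \<bar>a n y - b y\<bar>)" by (intro integral_nonneg_AE) simp
    ultimately show ?thesis by simp
  qed
  then show "\<exists>no. \<forall>n\<ge>no. norm ((LINT y|?W. \<bar>a n y - b y\<bar>) - 0) < e" by blast
qed

context damped_noise
begin

text \<open>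
  Relative to the drift \<open>a 0\<close>, the path \<open>\<xi> n\<close> has the error \<open>E \<bar>a n - a 0\<bar>(\<xi> n)\<close>, which vanishes in
  the limit by the occupation density bound. \<open>flow_distance\<close> then compares \<open>\<xi> n\<close> with \<open>\<xi> 0\<close>.
\<close>

lemma solutions_converge:
  assumes a: "\<And>n. a n \<in> borel_measurable borel" and ab: "\<And>n y. \<bar>a n y\<bar> \<le> B" and x: "x \<longlonglongrightarrow> x 0"
    and c: "converges_in_measure (weight_measure \<alpha>) a (a 0)"
    and sol: "\<And>n. solution M F Z (a n) (x n) (\<xi> n)" and T0: "T0 > 0"
  shows "uniformly_converges_in_probability M T0 \<xi> (\<xi> 0)"
proof -
  note [measurable] = a
  have "\<exists>\<beta>. drifted B (x n) \<beta> \<and> (AE \<omega> in M. \<forall>t\<ge>0. \<xi> n t \<omega> = path (x n) \<beta> t \<omega>) \<and>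
      (AE z in Q. \<beta> (fst z) (snd z) = a n (flow (x n) \<beta> z))" for n
    using solution_imp_drifted[OF sol[of n] a ab] by blast
  then have "\<forall>n. \<exists>\<beta>. drifted B (x n) \<beta> \<and> (AE \<omega> in M. \<forall>t\<ge>0. \<xi> n t \<omega> = path (x n) \<beta> t \<omega>) \<and>
      (AE z in Q. \<beta> (fst z) (snd z) = a n (flow (x n) \<beta> z))" by blast
  from choice[OF this] obtain \<beta> where d: "\<And>n. drifted B (x n) (\<beta> n)" and eq: "\<And>n. AE \<omega> in M. \<forall>t\<ge>0. \<xi> n t \<omega> = path (x n) (\<beta> n) t \<omega>"
    and b: "\<And>n. AE z in Q. \<beta> n (fst z) (snd z) = a n (flow (x n) (\<beta> n) z)" by blast
  have err: "drift_error (a 0) (x n) (\<beta> n) = (LINT z|Q. \<bar>a n (flow (x n) (\<beta> n) z) - a 0 (flow (x n) (\<beta> n) z)\<bar>)" for n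
    by (rule drift_error_of_solution[OF b d a a])
  have "Bseq x" using x by (intro convergent_imp_Bseq) (auto simp: convergent_def)
  then obtain X0 where X0: "X0 > 0" "\<And>n. \<bar>x n\<bar> \<le> X0" by (auto simp: Bseq_def)
  have b2: "\<bar>\<bar>a n y - a 0 y\<bar>\<bar> \<le> 2 * B" "\<bar>a n y - a 0 y\<bar> \<le> 2 * B" for n y using ab[of n y] ab[of 0 y] by auto
  have w: "(\<lambda>n. LINT y|weight_measure \<alpha>. \<bar>a n y - a 0 y\<bar>) \<longlonglongrightarrow> 0"
    by (rule weight_integral_of_convergence_in_measure[OF \<alpha>(1) c b2(2)])
  have "(\<lambda>n. drift_error (a 0) (x n) (\<beta> n)) \<longlonglongrightarrow> 0"
  proof (rule LIMSEQ_I)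
    fix e :: real assume e: "e > 0"
    have "\<exists>J. \<forall>n\<ge>J. \<forall>Y. regular_occupation X0 Y \<longrightarrow> (LINT z|Q. \<bar>a n (Y z) - a 0 (Y z)\<bar>) < e"
      by (rule occupation_uniform[where m="2 * B", OF _ _ b2(2) w e]) (use X0 in auto)
    then obtain J where J: "\<And>n Y. n \<ge> J \<Longrightarrow> regular_occupation X0 Y \<Longrightarrow> (LINT z|Q. \<bar>a n (Y z) - a 0 (Y z)\<bar>) < e" by blast
    have "norm (drift_error (a 0) (x n) (\<beta> n) - 0) < e" if "n \<ge> J" for n
      using J[OF that regular_occupation_flow[OF d[of n] X0(2)]] drift_error_nonneg[of "a 0" "x n" "\<beta> n"] by (simp add: err)
    then show "\<exists>no. \<forall>n\<ge>no. norm (drift_error (a 0) (x n) (\<beta> n) - 0) < e" by blast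
  qed
  from flow_convergence[OF d a[of 0] ab x X0(2) this] err[of 0]
  have "(\<lambda>n. LINT z|Q. \<bar>flow (x n) (\<beta> n) z - flow (x 0) (\<beta> 0) z\<bar>) \<longlonglongrightarrow> 0" by simp
  from uniform_convergence_of_paths[OF d eq this T0] show ?thesis .
qed

end

section \<open>The filtration generated by the noise\<close>

text \<open>
  Contained both in every filtration to which \<open>Z\<close> is adapted and in the completed one: a solution
  adapted to this filtration is adapted to the given one and strong.
\<close>

definition natural_filtration :: "'w measure \<Rightarrow> (real \<Rightarrow> 'w \<Rightarrow> real) \<Rightarrow> real \<Rightarrow> 'w measure" where
  "natural_filtration M Z t = sigma (space M) (\<Union>s\<in>{0..t}. sets (vimage_algebra (space M) (Z s) borel))"

lemma natural_filtration_generator: "(\<Union>s\<in>{0..t}. sets (vimage_algebra (space M) (Z s) borel)) \<subseteq> Pow (space M)"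
  using sets.space_closed[of "vimage_algebra (space M) _ borel"] by auto

lemma space_natural_filtration[simp]: "space (natural_filtration M Z t) = space M"
  unfolding natural_filtration_def by (rule space_measure_of[OF natural_filtration_generator])

lemma sets_natural_filtration:
  "sets (natural_filtration M Z t) = sigma_sets (space M) (\<Union>s\<in>{0..t}. sets (vimage_algebra (space M) (Z s) borel))"
  unfolding natural_filtration_def by (rule sets_measure_of[OF natural_filtration_generator])

lemma space_completed_natural_filtration: "space (completed_natural_filtration M Z t) = space M"
  unfolding completed_natural_filtration_def by (rule space_measure_of_conv)

lemma natural_filtration_subset_completed:
  "sets (natural_filtration M Z t) \<subseteq> sets (completed_natural_filtration M Z t)"
proof -
  have "null_sets (completion M) \<subseteq> Pow (space M)" using sets.sets_into_space[of _ "completion M"] by auto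
  then have "sets (completed_natural_filtration M Z t) = sigma_sets (space M)
       ((\<Union>s\<in>{0..t}. sets (vimage_algebra (space M) (Z s) borel)) \<union> null_sets (completion M))"
    unfolding completed_natural_filtration_def using natural_filtration_generator[of M Z t] by (intro sets_measure_of) blast
  then show ?thesis unfolding sets_natural_filtration by (simp add: sigma_sets_mono')
qed

context stable_noise
begin

lemma natural_filtration_subset: "t \<ge> 0 \<Longrightarrow> sets (natural_filtration M Z t) \<subseteq> sets (F t)"
  unfolding sets_natural_filtration
proof -
  assume t: "t \<ge> 0"
  have "sets (vimage_algebra (space M) (Z s) borel) \<subseteq> sets (F t)" if "s \<in> {0..t}" for s
  proof -
    have "Z s \<in> borel_measurable (F t)" by (rule F_measurable_mono[OF _ _ Z_F]) (use that in auto)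
    then have "{Z s -` A \<inter> space M |A. A \<in> sets borel} \<subseteq> sets (F t)"
      using F_space[OF t] by (auto dest: measurable_sets)
    then show ?thesis
      using sets.sigma_sets_subset[of _ "F t"] F_space[OF t] by (simp add: sets_vimage_algebra)
  qed
  then have "(\<Union>s\<in>{0..t}. sets (vimage_algebra (space M) (Z s) borel)) \<subseteq> sets (F t)" by blast
  from sets.sigma_sets_subset[OF this] show "sigma_sets (space M) (\<Union>s\<in>{0..t}. sets (vimage_algebra (space M) (Z s) borel)) \<subseteq> sets (F t)"
    using F_space[OF t] by simp
qed

lemma stable_noise_natural_filtration: "stable_noise M (natural_filtration M Z) Z \<alpha> c"
proof
  show "filtered_prob_space M (natural_filtration M Z)"
    unfolding filtered_prob_space_def
  proof (intro conjI allI impI)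
    show "prob_space M" by (rule prob_space_axioms)
    show "filtration (space M) (\<lambda>t. natural_filtration M Z (max 0 t))"
    proof
      fix s t :: real assume "s \<le> t"
      then show "sets (natural_filtration M Z (max 0 s)) \<subseteq> sets (natural_filtration M Z (max 0 t))"
        unfolding sets_natural_filtration by (intro sigma_sets_mono' UN_mono) auto
    qed simp
    show "subalgebra M (natural_filtration M Z t)" if "t \<ge> 0" for t
      using natural_filtration_subset[OF that] F_sets[OF that] by (auto simp: subalgebra_def)
  qed
  show "symmetric_stable_process M (natural_filtration M Z) \<alpha> Z"
    unfolding symmetric_stable_process_def
  proof (intro conjI allI impI)
    show "adapted (natural_filtration M Z) Z"
      unfolding adapted_def
    proof (intro allI impI)
      fix t :: real assume t: "t \<ge> 0"
      show "Z t \<in> borel_measurable (natural_filtration M Z t)"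
      proof (rule measurableI)
        fix A :: "real set" assume "A \<in> sets borel"
        then have "Z t -` A \<inter> space M \<in> sets (vimage_algebra (space M) (Z t) borel)" by (rule in_vimage_algebra)
        then show "Z t -` A \<inter> space (natural_filtration M Z t) \<in> sets (natural_filtration M Z t)"
          unfolding sets_natural_filtration space_natural_filtration using t by (intro sigma_sets.Basic) auto
      qed simp
    qed
    show "\<forall>\<omega>\<in>space M. Z 0 \<omega> = 0 \<and> cadlag (\<lambda>t. Z t \<omega>)" "stationary_increments M Z" "independent_increments M Z"
      "\<exists>c>0. \<forall>t\<ge>0. \<forall>\<theta>. char (distr M borel (Z t)) \<theta> = exp (complex_of_real (- (c * t * \<bar>\<theta>\<bar> powr \<alpha>)))"
      using stab unfolding symmetric_stable_process_def by blast+
    fix t s :: real assume ts: "t \<ge> 0" "s \<ge> 0"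
    have "indep_set (sets (vimage_algebra (space M) (\<lambda>\<omega>. Z (t + s) \<omega> - Z t \<omega>) borel)) (sets (F t))"
      using stab ts unfolding symmetric_stable_process_def by blast
    then show "indep_set (sets (vimage_algebra (space M) (\<lambda>\<omega>. Z (t + s) \<omega> - Z t \<omega>) borel)) (sets (natural_filtration M Z t))"
      unfolding indep_set_def
      by (rule indep_sets_mono_sets) (use natural_filtration_subset[OF ts(1)] in \<open>auto split: bool.split\<close>)
  qed
qed (use \<alpha> c chr in auto)

end

theorem corollary2p1:
  fixes M :: "'w measure" and F :: "real \<Rightarrow> 'w measure"
    and Z :: "real \<Rightarrow> 'w \<Rightarrow> real" and \<alpha> :: real
    and x :: "nat \<Rightarrow> real" and a :: "nat \<Rightarrow> real \<Rightarrow> real"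
  assumes "filtered_prob_space M F"
    and "1 < \<alpha>" and "\<alpha> < 2"
    and "symmetric_stable_process M F \<alpha> Z"
    and "\<And>n. a n \<in> borel_measurable borel"
    and "x \<longlonglongrightarrow> x 0"
    and "(SUP n. SUP y. ereal \<bar>a n y\<bar>) < \<infinity>"
    and "converges_in_measure (weight_measure \<alpha>) a (a 0)"
  shows "(\<forall>n. (\<exists>\<xi>. strong_solution M F Z (a n) (x n) \<xi>) \<and> pathwise_unique M F Z (a n) (x n)) \<and>
    (\<forall>\<xi>. (\<forall>n. strong_solution M F Z (a n) (x n) (\<xi> n)) \<longrightarrow>
       (\<forall>T>0. uniformly_converges_in_probability M T \<xi> (\<xi> 0)))"
proof -
  obtain c where c: "c > 0" and chr: "\<And>t \<theta>. t \<ge> 0 \<Longrightarrow> char (distr M borel (Z t)) \<theta> = exp (complex_of_real (- (c * t * \<bar>\<theta>\<bar> powr \<alpha>)))"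
    using assms(4) unfolding symmetric_stable_process_def by blast
  obtain B where B0: "B \<ge> 0" and ab: "\<And>n y. \<bar>a n y\<bar> \<le> B"
  proof -
    let ?S = "SUP n. SUP y. ereal \<bar>a n y\<bar>"
    have le: "ereal \<bar>a n y\<bar> \<le> ?S" for n y
      by (rule SUP_upper2[of n], simp, rule SUP_upper, simp)
    have "?S \<noteq> \<infinity>" using assms(7) by simp
    moreover have "?S \<noteq> -\<infinity>" using le[of 0 0] by auto
    ultimately obtain r where r: "?S = ereal r" by (cases ?S) auto
    have "\<bar>a n y\<bar> \<le> r" for n y using le[of n y] unfolding r by simp
    then show ?thesis using that[of r] order_trans[OF abs_ge_zero, of "a 0 0" r] by blast
  qed
  have pos: "1 / (2 * (B + 1)) > 0" using B0 by simp
  \<comment> \<open>any norm bound \<open>\<epsilon>\<close> with \<open>B * \<epsilon> \<le> 1 / 2\<close> would do; \<open>B + 1\<close> avoids a case distinction for \<open>B = 0\<close>\<close>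
  obtain l :: real and k :: "real \<Rightarrow> real" where l: "l > 0" and k: "integrable lborel k"
    and kappa: "(LINT w|lborel. \<bar>k w\<bar>) \<le> 1 / (2 * (B + 1))"
    and kf: "\<And>\<theta>. (LINT w|lborel. complex_of_real (k w) * iexp (\<theta> * w)) = \<i> * \<theta> / complex_of_real (l + c * \<bar>\<theta>\<bar> powr \<alpha>)"
    by (rule stable_resolvent_kernel[OF c assms(2,3) pos], rule that, assumption, assumption, assumption, blast)
  have "B * (LINT w|lborel. \<bar>k w\<bar>) \<le> B * (1 / (2 * (B + 1)))" using kappa B0 by (rule mult_left_mono)
  also have "\<dots> \<le> 1 / 2" using B0 by (simp add: divide_le_eq)
  finally have small: "B * (LINT w|lborel. \<bar>k w\<bar>) \<le> 1 / 2" .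
  interpret S: stable_noise M F Z \<alpha> c
    using assms(1-4) c chr by (auto simp: stable_noise_def stable_noise_axioms_def filtered_prob_space_def)
  have damped: "damped_noise M F' Z \<alpha> c l k B" if "stable_noise M F' Z \<alpha> c" for F'
  proof -
    interpret K: killed_noise M F' Z \<alpha> c l k
      by (rule killed_noise.intro[OF that]) (unfold killed_noise_axioms_def, use l k kf in blast)
    show ?thesis by unfold_locales (use B0 small in \<open>auto simp: K.kappa_def\<close>)
  qed
  interpret S: damped_noise M F Z \<alpha> c l k B by (rule damped[OF S.stable_noise_axioms])
  interpret N: damped_noise M "natural_filtration M Z" Z \<alpha> c l k B
    by (rule damped[OF S.stable_noise_natural_filtration])
  have "\<exists>\<xi>. strong_solution M F Z (a n) (x n) \<xi>" for n
  proof -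
    obtain \<xi> where ad: "\<And>t. t \<ge> 0 \<Longrightarrow> \<xi> t \<in> borel_measurable (natural_filtration M Z t)"
      and m: "\<And>\<omega>. \<omega> \<in> space M \<Longrightarrow> (\<lambda>t. \<xi> t \<omega>) \<in> borel_measurable borel"
      and eq: "AE \<omega> in M. \<forall>t\<ge>0. \<xi> t \<omega> = x n + (LINT s:{0..t}|lborel. a n (\<xi> s \<omega>)) + Z t \<omega>"
      by (rule N.strong_existence[OF assms(5)[of n] ab[of n], of "x n"], rule that, blast, blast, assumption)
    have si: "set_integrable lborel {0..T} (\<lambda>s. a n (\<xi> s \<omega>))" if "\<omega> \<in> space M" for \<omega> T
      by (rule set_integrable_bounded_Icc[where C=B]) (use measurable_compose[OF m[OF that] assms(5)] ab in auto)
    have "adapted F \<xi>"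
      unfolding adapted_def
    proof (intro allI impI)
      fix t :: real assume t: "t \<ge> 0"
      show "\<xi> t \<in> borel_measurable (F t)"
        by (rule measurable_from_subalg[OF _ ad[OF t]])
           (use S.natural_filtration_subset[OF t] S.F_space[OF t] in \<open>simp add: subalgebra_def\<close>)
    qed
    moreover have "adapted (completed_natural_filtration M Z) \<xi>"
      unfolding adapted_def
    proof (intro allI impI)
      fix t :: real assume t: "t \<ge> 0"
      show "\<xi> t \<in> borel_measurable (completed_natural_filtration M Z t)"
        by (rule measurable_from_subalg[OF _ ad[OF t]])
           (use natural_filtration_subset_completed[of M Z t] in \<open>simp add: subalgebra_def space_completed_natural_filtration\<close>)
    qed
    moreover have "AE \<omega> in M. (\<forall>T>0. set_integrable lborel {0..T} (\<lambda>s. a n (\<xi> s \<omega>))) \<and>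
        (\<forall>t\<ge>0. \<xi> t \<omega> = x n + (LINT s:{0..t}|lborel. a n (\<xi> s \<omega>)) + Z t \<omega>)"
      using eq AE_space by eventually_elim (use si in blast)
    ultimately show ?thesis unfolding strong_solution_def solution_def by blast
  qed
  moreover have "pathwise_unique M F Z (a n) (x n)" for n
    by (rule S.pathwise_uniqueness[OF assms(5) ab])
  moreover have "uniformly_converges_in_probability M T \<xi> (\<xi> 0)"
    if "\<forall>n. strong_solution M F Z (a n) (x n) (\<xi> n)" "T > 0" for \<xi> T
    by (rule S.solutions_converge[OF assms(5) ab assms(6,8) _ that(2)]) (use that(1) in \<open>simp add: strong_solution_def\<close>)
  ultimately show ?thesis by blast
qed

end
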